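(* Let $F:\mathbb{R}^n\to\mathbb{R}^n$ be smooth (in particular $F\in C^2(\mathbb{R}^n;\mathbb{R}^n)$), let $U^0\in\mathbb{R}^n$ be a constant state, and let $U^1\in BV(\mathbb{R};\mathbb{R}^n)\cap L^1(\mathbb{R};\mathbb{R}^n)$. Assume that $\nabla F(U)$ is diagonalizable with real eigenvalues for every $U$, that each eigenvalue has constant multiplicity, and that each corresponding characteristic field is either genuinely nonlinear ($\nabla\lambda_j\cdot \mathbf{r}_j\equiv 1$) or linearly degenerate ($\nabla\lambda_j\cdot \mathbf{r}_j\equiv 0$). Let $U^{\varepsilon}(t,x)$ be the entropy solution of $$\partial_tU+\partial_xF(U)=0,\qquad U|_{t=0}=U^0+\varepsilon U^1(x),$$ given by the standard Riemann semigroup, i.e. $U^\varepsilon(t,\cdot)=S_t(U^0+\varepsilon U^1)$. Let $$U^{\varepsilon}_w(t,x)=U^0+\varepsilon\sum_{j=1}^n\sigma^{(j)}(\varepsilon t,\,x-\lambda_j(U^0)t)\,\mathbf{r}_j(U^0),$$ where $\sigma^{(j)}(\tau,y)$ is the entropy solution of $\partial_\tau\sigma^{(j)}+\frac12\partial_y(\sigma^{(j)})^2=0$ if the $j$-th field is genuinely nonlinear, and the solution of $\partial_\tau\sigma^{(j)}=0$ if the $j$-th field is linearly degenerate, in both cases with initial data $\sigma^{(j)}(0,y)=\mathbf{l}_j(U^0)\cdot U^1(y)$. Then for every fixed $T_0>0$, $$\sup_{0\le t\le T_0/\varepsilon}\|U^{\varepsilon}(t,\cdot)-U^{\varepsilon}_w(t,\cdot)\|_{L^1}=o(\varepsilon)\qquad\text{as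 }\varepsilon\to0^+ .$$
   Context: Eigenstructure: $\lambda_1(U)\le\dots\le\lambda_n(U)$ are the eigenvalues of $\nabla F(U)$ counted with multiplicity; constant multiplicity means that for each pair $j,k$ either $\lambda_j\equiv\lambda_k$ or $\lambda_j(U)\neq\lambda_k(U)$ for all $U$. The (smooth) left and right eigenvectors $\mathbf{l}_j(U)$, $\mathbf{r}_k(U)$ satisfy $\mathbf{l}_j\nabla F=\lambda_j\mathbf{l}_j$, $\nabla F\,\mathbf{r}_k=\lambda_k\mathbf{r}_k$, $\mathbf{l}_j\cdot\mathbf{r}_k=\delta_{jk}$. Standard Riemann semigroup (SRS): a map $S:\mathcal{D}\times[0,\infty)\to\mathcal{D}$ on a closed domain $\mathcal{D}$ of functions $\mathbb{R}\to\mathbb{R}^n$ (with difference from $U^0$ in $L^1$) containing all $\bar U$ with $\bar U-U^0\in L^1$ and total variation less than some $\delta_0>0$, such that: (i) $S_0\bar U=\bar U$ and $S_tS_s\bar U=S_{t+s}\bar U$; (ii) $\|S_t\bar U-S_s\bar V\|_{L^1}\le L_1\|\bar U-\bar V\|_{L^1}+L_2|t-s|$ for some constants $L_1,L_2$; (iii) for every piecewise constant $\bar U\in\mathcal{D}$ there is $\delta>0$ such that for $t\in[0,\delta]$, $S_t\bar U$ coincides with the solution of $\partial_tU+\partial_xF(U)=0$ obtained by piecing together the standard entropy solutions of the Riemann problems at the jumps of $\bar U$. For $\varepsilon$ small, $U^0+\varepsilon U^1\in\mathcal{D}$. *)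

theory Defs
  imports "HOL-Analysis.Analysis"
begin

section \<open>Smooth maps\<close>

text \<open>All directional derivatives of order at most \<open>k\<close> exist and are continuous; in finite
  dimension this is membership in \<open>C\<^sup>k\<close>.\<close>

fun C_k :: "nat \<Rightarrow> ('a::euclidean_space \<Rightarrow> 'b::real_normed_vector) \<Rightarrow> bool" where
  "C_k 0 f \<longleftrightarrow> continuous_on UNIV f"
| "C_k (Suc k) f \<longleftrightarrow>
     (\<forall>x. f differentiable (at x)) \<and> (\<forall>v. C_k k (\<lambda>x. frechet_derivative f (at x) v))"

definition smooth :: "('a::euclidean_space \<Rightarrow> 'b::real_normed_vector) \<Rightarrow> bool" where
  "smooth f \<longleftrightarrow> (\<forall>k. C_k k f)"


section \<open>\<open>L\<^sup>1\<close> distance and total variation\<close>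

definition L1_dist :: "(real \<Rightarrow> 'a::real_normed_vector) \<Rightarrow> (real \<Rightarrow> 'a) \<Rightarrow> ennreal" where
  "L1_dist u v = (\<integral>\<^sup>+ x. ennreal (norm (u x - v x)) \<partial>lborel)"

definition pointwise_variation :: "(real \<Rightarrow> 'a::real_normed_vector) \<Rightarrow> ennreal" where
  "pointwise_variation u =
     (SUP xs \<in> {xs. sorted xs}. \<Sum>i<length xs - 1. ennreal (norm (u (xs ! Suc i) - u (xs ! i))))"

text \<open>Functions in \<open>L\<^sup>1\<close> are only given up to null sets, so the total variation is that of the
  best representative.\<close>

definition total_variation :: "(real \<Rightarrow> 'a::real_normed_vector) \<Rightarrow> ennreal" where
  "total_variation u = (INF v \<in> {v. AE x in lborel. v x = u x}. pointwise_variation v)"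


section \<open>Eigenstructure\<close>

text \<open>Eigenvalues and eigenvectors are indexed by \<open>1, \<dots>, CARD('n)\<close>.\<close>

definition real_diagonalizable :: "real ^ 'n ^ 'n \<Rightarrow> bool" where
  "real_diagonalizable A \<longleftrightarrow>
     (\<exists>(P :: real ^ 'n ^ 'n) d. invertible P \<and>
        A = P ** (\<chi> i j. if i = j then d i else 0) ** matrix_inv P)"

definition ordered_eigenvalues :: "real ^ 'n ^ 'n \<Rightarrow> (nat \<Rightarrow> real) \<Rightarrow> bool" where
  "ordered_eigenvalues A \<mu> \<longleftrightarrow>
     (\<forall>j\<in>{1..CARD('n)}. \<forall>k\<in>{1..CARD('n)}. j \<le> k \<longrightarrow> \<mu> j \<le> \<mu> k) \<and>
     (\<forall>z. det (mat z - A) = (\<Prod>j\<in>{1..CARD('n)}. z - \<mu> j))"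

definition constant_multiplicity :: "(nat \<Rightarrow> real ^ 'n \<Rightarrow> real) \<Rightarrow> bool" where
  "constant_multiplicity lam \<longleftrightarrow>
     (\<forall>j\<in>{1..CARD('n)}. \<forall>k\<in>{1..CARD('n)}.
        (\<forall>U. lam j U = lam k U) \<or> (\<forall>U. lam j U \<noteq> lam k U))"

definition dual_eigenvectors ::
  "(real ^ 'n \<Rightarrow> real ^ 'n) \<Rightarrow> (nat \<Rightarrow> real ^ 'n \<Rightarrow> real)
    \<Rightarrow> (nat \<Rightarrow> real ^ 'n \<Rightarrow> real ^ 'n) \<Rightarrow> (nat \<Rightarrow> real ^ 'n \<Rightarrow> real ^ 'n) \<Rightarrow> bool" where
  "dual_eigenvectors F lam l r \<longleftrightarrow>
     (\<forall>j\<in>{1..CARD('n)}. smooth (l j) \<and> smooth (r j)) \<and>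
     (\<forall>U. \<forall>j\<in>{1..CARD('n)}.
        l j U v* jacobian F (at U) = lam j U *\<^sub>R l j U \<and>
        jacobian F (at U) *v r j U = lam j U *\<^sub>R r j U) \<and>
     (\<forall>U. \<forall>j\<in>{1..CARD('n)}. \<forall>k\<in>{1..CARD('n)}.
        l j U \<bullet> r k U = (if j = k then 1 else 0))"

definition genuinely_nonlinear ::
  "(nat \<Rightarrow> real ^ 'n \<Rightarrow> real) \<Rightarrow> (nat \<Rightarrow> real ^ 'n \<Rightarrow> real ^ 'n) \<Rightarrow> nat \<Rightarrow> bool" where
  "genuinely_nonlinear lam r j \<longleftrightarrow> (\<forall>U. \<exists>g. GDERIV (lam j) U :> g \<and> g \<bullet> r j U = 1)"

definition linearly_degenerate ::
  "(nat \<Rightarrow> real ^ 'n \<Rightarrow> real) \<Rightarrow> (nat \<Rightarrow> real ^ 'n \<Rightarrow> real ^ 'n) \<Rightarrow> nat \<Rightarrow> bool" where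
  "linearly_degenerate lam r j \<longleftrightarrow> (\<forall>U. \<exists>g. GDERIV (lam j) U :> g \<and> g \<bullet> r j U = 0)"


section \<open>Riemann problems\<close>

text \<open>An elementary wave of the \<open>j\<close>-th family joining the left state \<open>um\<close> to the right state
  \<open>up\<close> and occupying the speeds \<open>[a, b]\<close>: a centred rarefaction with profile \<open>\<phi>\<close>, a shock
  satisfying the Rankine-Hugoniot and Lax conditions, or a contact discontinuity.  In the
  rarefaction, \<open>\<nabla>\<lambda>\<^sub>j \<cdot> r\<^sub>j = 1\<close> forces \<open>\<lambda>\<^sub>j (\<phi> \<xi>) = \<xi>\<close>.  The trivial wave \<open>um = up\<close> is a rarefaction
  with \<open>a = b\<close>, or a contact discontinuity.  For an eigenvalue of multiplicity \<open>p > 1\<close>, a contact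
  discontinuity is split into \<open>p\<close> ones of the same speed.\<close>

definition elementary_wave ::
  "(real ^ 'n \<Rightarrow> real ^ 'n) \<Rightarrow> (nat \<Rightarrow> real ^ 'n \<Rightarrow> real) \<Rightarrow> (nat \<Rightarrow> real ^ 'n \<Rightarrow> real ^ 'n)
    \<Rightarrow> nat \<Rightarrow> real ^ 'n \<Rightarrow> real ^ 'n \<Rightarrow> real \<Rightarrow> real \<Rightarrow> (real \<Rightarrow> real ^ 'n) \<Rightarrow> bool" where
  "elementary_wave F lam r j um up a b \<phi> \<longleftrightarrow>
     (genuinely_nonlinear lam r j \<and> a = lam j um \<and> b = lam j up \<and> a \<le> b \<and>
        \<phi> a = um \<and> \<phi> b = up \<and>
        (\<forall>\<xi>\<in>{a..b}. (\<phi> has_vector_derivative r j (\<phi> \<xi>)) (at \<xi> within {a..b}))) \<or>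
     (genuinely_nonlinear lam r j \<and> a = b \<and> F up - F um = a *\<^sub>R (up - um) \<and>
        lam j up < a \<and> a < lam j um) \<or>
     (linearly_degenerate lam r j \<and> a = b \<and> F up - F um = a *\<^sub>R (up - um) \<and>
        lam j up = a \<and> a = lam j um)"

text \<open>The self-similar solution \<open>w (x / t)\<close> of the Riemann problem with states \<open>um\<close>, \<open>up\<close>, made of
  one elementary wave of each family, through the intermediate states \<open>\<omega> 1, \<dots>, \<omega> (n - 1)\<close>.
  The values of \<open>w\<close> at the finitely many endpoints of waves are irrelevant.\<close>

definition lax_solution ::
  "(real ^ 'n \<Rightarrow> real ^ 'n) \<Rightarrow> (nat \<Rightarrow> real ^ 'n \<Rightarrow> real) \<Rightarrow> (nat \<Rightarrow> real ^ 'n \<Rightarrow> real ^ 'n)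
    \<Rightarrow> real ^ 'n \<Rightarrow> real ^ 'n \<Rightarrow> (nat \<Rightarrow> real ^ 'n) \<Rightarrow> (real \<Rightarrow> real ^ 'n) \<Rightarrow> bool" where
  "lax_solution F lam r um up \<omega> w \<longleftrightarrow>
     \<omega> 0 = um \<and> \<omega> CARD('n) = up \<and>
     (\<exists>a b \<phi>.
        (\<forall>j\<in>{1..CARD('n)}.
           elementary_wave F lam r j (\<omega> (j - 1)) (\<omega> j) (a j) (b j) (\<phi> j)) \<and>
        (\<forall>j\<in>{1..<CARD('n)}. b j \<le> a (Suc j)) \<and>
        (\<forall>\<xi><a 1. w \<xi> = um) \<and> (\<forall>\<xi>>b CARD('n). w \<xi> = up) \<and>
        (\<forall>j\<in>{1..CARD('n)}. \<forall>\<xi>. a j < \<xi> \<and> \<xi> < b j \<longrightarrow> w \<xi> = \<phi> j \<xi>) \<and>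
        (\<forall>j\<in>{1..<CARD('n)}. \<forall>\<xi>. b j < \<xi> \<and> \<xi> < a (Suc j) \<longrightarrow> w \<xi> = \<omega> j))"

text \<open>The standard (Lax) solution of a Riemann problem with nearby states is the one with small
  waves: by Lax's theorem it exists for all states near \<open>U0\<close>, its intermediate states are within
  \<open>O(norm (up - um))\<close> of \<open>um\<close>, and it is the only one with intermediate states in a small
  neighbourhood of \<open>U0\<close>.  The local condition below rules out solutions that join two nearby
  states through large waves.\<close>

definition standard_riemann_solver ::
  "(real ^ 'n \<Rightarrow> real ^ 'n) \<Rightarrow> (nat \<Rightarrow> real ^ 'n \<Rightarrow> real) \<Rightarrow> (nat \<Rightarrow> real ^ 'n \<Rightarrow> real ^ 'n)
    \<Rightarrow> real ^ 'n \<Rightarrow> (real ^ 'n \<Rightarrow> real ^ 'n \<Rightarrow> real \<Rightarrow> real ^ 'n) \<Rightarrow> bool" where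
  "standard_riemann_solver F lam r U0 R \<longleftrightarrow>
     (\<exists>\<rho>>0. \<exists>C. \<forall>um\<in>ball U0 \<rho>. \<forall>up\<in>ball U0 \<rho>. \<exists>\<omega>.
        lax_solution F lam r um up \<omega> (R um up) \<and>
        (\<forall>j\<in>{1..CARD('n)}. norm (\<omega> j - um) \<le> C * norm (up - um)))"


section \<open>Standard Riemann semigroups\<close>

text \<open>\<open>u\<close> has jumps exactly at \<open>x 1 < \<dots> < x N\<close>, and is equal to \<open>v k\<close> between \<open>x k\<close> and
  \<open>x (k + 1)\<close>, where \<open>x 0 = -\<infinity>\<close> and \<open>x (N + 1) = \<infinity>\<close>.\<close>

definition piecewise_constant ::
  "nat \<Rightarrow> (nat \<Rightarrow> real) \<Rightarrow> (nat \<Rightarrow> 'a) \<Rightarrow> (real \<Rightarrow> 'a) \<Rightarrow> bool" where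
  "piecewise_constant N x v u \<longleftrightarrow>
     (\<forall>k\<in>{1..<N}. x k < x (Suc k)) \<and> (\<forall>k\<in>{1..N}. v (k - 1) \<noteq> v k) \<and>
     (\<forall>k\<le>N. \<forall>y. (k = 0 \<or> x k < y) \<and> (k = N \<or> y < x (Suc k)) \<longrightarrow> u y = v k)"

text \<open>Elements of the domain \<open>D\<close> are regarded as \<open>L\<^sup>1\<close> classes, hence the equalities almost
  everywhere.  In the last clause the solution pieced together from the Riemann solutions is
  \<open>R (v (k - 1)) (v k) ((y - x k) / t)\<close> at distance less than \<open>d\<close> from the jump \<open>x k\<close>, and is equal
  to \<open>u\<close> away from the jumps.\<close>

definition standard_riemann_semigroup ::
  "(real ^ 'n \<Rightarrow> real ^ 'n) \<Rightarrow> (nat \<Rightarrow> real ^ 'n \<Rightarrow> real) \<Rightarrow> (nat \<Rightarrow> real ^ 'n \<Rightarrow> real ^ 'n)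
    \<Rightarrow> real ^ 'n \<Rightarrow> (real \<Rightarrow> real ^ 'n) set
    \<Rightarrow> (real \<Rightarrow> (real \<Rightarrow> real ^ 'n) \<Rightarrow> (real \<Rightarrow> real ^ 'n)) \<Rightarrow> bool" where
  "standard_riemann_semigroup F lam r U0 D S \<longleftrightarrow>
     (\<forall>u\<in>D. integrable lborel (\<lambda>x. u x - U0)) \<and>
     (\<forall>u v. (\<forall>k::nat. u k \<in> D) \<and> integrable lborel (\<lambda>x. v x - U0) \<and>
        ((\<lambda>k. L1_dist (u k) v) \<longlonglongrightarrow> 0) \<longrightarrow> v \<in> D) \<and>
     (\<exists>\<delta>0>0. \<forall>u. integrable lborel (\<lambda>x. u x - U0) \<and> total_variation u < ennreal \<delta>0 \<longrightarrow> u \<in> D) \<and>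
     (\<forall>u\<in>D. \<forall>t\<ge>0. S t u \<in> D) \<and>
     (\<forall>u\<in>D. AE x in lborel. S 0 u x = u x) \<and>
     (\<forall>u\<in>D. \<forall>s\<ge>0. \<forall>t\<ge>0. AE x in lborel. S t (S s u) x = S (t + s) u x) \<and>
     (\<exists>L1\<ge>0. \<exists>L2\<ge>0. \<forall>u\<in>D. \<forall>v\<in>D. \<forall>s\<ge>0. \<forall>t\<ge>0.
        L1_dist (S t u) (S s v) \<le> ennreal L1 * L1_dist u v + ennreal (L2 * \<bar>t - s\<bar>)) \<and>
     (\<exists>R. standard_riemann_solver F lam r U0 R \<and>
        (\<forall>u\<in>D. \<forall>N x v. piecewise_constant N x v u \<longrightarrow>
           (\<forall>k\<in>{1..N}. \<exists>\<omega>. lax_solution F lam r (v (k - 1)) (v k) \<omega> (R (v (k - 1)) (v k))) \<and>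
           (\<exists>\<delta>>0. \<exists>d>0. (\<forall>k\<in>{1..<N}. x k + 2 * d \<le> x (Suc k)) \<and>
              (\<forall>t\<in>{0<..\<delta>}. AE y in lborel.
                 (\<forall>k\<in>{1..N}. \<bar>y - x k\<bar> < d \<longrightarrow>
                    S t u y = R (v (k - 1)) (v k) ((y - x k) / t)) \<and>
                 ((\<forall>k\<in>{1..N}. d \<le> \<bar>y - x k\<bar>) \<longrightarrow> S t u y = u y)))))"


section \<open>Scalar conservation laws\<close>

text \<open>\<open>\<sigma>\<close> is bounded, continuous in time with values in \<open>L\<^sup>1\<close>, and takes the initial data
  \<open>\<sigma>0\<close>; its values at negative times are irrelevant.\<close>

definition bounded_L1_evolution :: "(real \<Rightarrow> real) \<Rightarrow> (real \<Rightarrow> real \<Rightarrow> real) \<Rightarrow> bool" where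
  "bounded_L1_evolution \<sigma>0 \<sigma> \<longleftrightarrow>
     set_borel_measurable lborel ({0..} \<times> UNIV) (\<lambda>z. \<sigma> (fst z) (snd z)) \<and>
     (\<exists>M. \<forall>\<tau>\<ge>0. AE y in lborel. \<bar>\<sigma> \<tau> y\<bar> \<le> M) \<and>
     (\<forall>\<tau>\<ge>0. integrable lborel (\<sigma> \<tau>)) \<and>
     (\<forall>\<tau>\<^sub>0\<ge>0. ((\<lambda>\<tau>. L1_dist (\<sigma> \<tau>) (\<sigma> \<tau>\<^sub>0)) \<longlongrightarrow> 0) (at \<tau>\<^sub>0 within {0..})) \<and>
     (AE y in lborel. \<sigma> 0 y = \<sigma>0 y)"

definition test_function :: "(real \<times> real \<Rightarrow> real) \<Rightarrow> bool" where
  "test_function \<psi> \<longleftrightarrow>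
     smooth \<psi> \<and> (\<exists>K. compact K \<and> K \<subseteq> {0<..} \<times> UNIV \<and> (\<forall>z. z \<notin> K \<longrightarrow> \<psi> z = 0))"

abbreviation d_tau :: "(real \<times> real \<Rightarrow> real) \<Rightarrow> real \<times> real \<Rightarrow> real" where
  "d_tau \<psi> z \<equiv> frechet_derivative \<psi> (at z) (1, 0)"

abbreviation d_y :: "(real \<times> real \<Rightarrow> real) \<Rightarrow> real \<times> real \<Rightarrow> real" where
  "d_y \<psi> z \<equiv> frechet_derivative \<psi> (at z) (0, 1)"

definition weak_solution ::
  "(real \<Rightarrow> real) \<Rightarrow> (real \<Rightarrow> real) \<Rightarrow> (real \<Rightarrow> real \<Rightarrow> real) \<Rightarrow> bool" where
  "weak_solution f \<sigma>0 \<sigma> \<longleftrightarrow> bounded_L1_evolution \<sigma>0 \<sigma> \<and>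
     (\<forall>\<psi>. test_function \<psi> \<longrightarrow>
        (LINT z:{0..} \<times> UNIV|lborel.
           \<sigma> (fst z) (snd z) * d_tau \<psi> z + f (\<sigma> (fst z) (snd z)) * d_y \<psi> z) = 0)"

text \<open>Kruzhkov's entropy condition.\<close>

definition entropy_solution ::
  "(real \<Rightarrow> real) \<Rightarrow> (real \<Rightarrow> real) \<Rightarrow> (real \<Rightarrow> real \<Rightarrow> real) \<Rightarrow> bool" where
  "entropy_solution f \<sigma>0 \<sigma> \<longleftrightarrow> bounded_L1_evolution \<sigma>0 \<sigma> \<and>
     (\<forall>\<psi> c. test_function \<psi> \<and> (\<forall>z. 0 \<le> \<psi> z) \<longrightarrow>
        0 \<le> (LINT z:{0..} \<times> UNIV|lborel.
           \<bar>\<sigma> (fst z) (snd z) - c\<bar> * d_tau \<psi> z +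
           sgn (\<sigma> (fst z) (snd z) - c) * (f (\<sigma> (fst z) (snd z)) - f c) * d_y \<psi> z))"

definition U_w ::
  "(nat \<Rightarrow> real ^ 'n \<Rightarrow> real) \<Rightarrow> (nat \<Rightarrow> real ^ 'n \<Rightarrow> real ^ 'n) \<Rightarrow> real ^ 'n
    \<Rightarrow> (nat \<Rightarrow> real \<Rightarrow> real \<Rightarrow> real) \<Rightarrow> real \<Rightarrow> real \<Rightarrow> real \<Rightarrow> real ^ 'n" where
  "U_w lam r U0 \<sigma> \<epsilon> t x =
     U0 + \<epsilon> *\<^sub>R (\<Sum>j\<in>{1..CARD('n)}. \<sigma> j (\<epsilon> * t) (x - lam j U0 * t) *\<^sub>R r j U0)"

end

theory Submission
  imports Defs
begin

text \<open>
  Replace \<open>U\<^sup>1\<close> by a step function: the semigroup and the scalar equations are Lipschitz in \<open>L\<^sup>1\<close>, so the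
  error is a small multiple of \<open>\<epsilon>\<close>. For step data each \<open>\<sigma>\<^sup>(\<^sup>j\<^sup>)\<close> is tracked by finitely many fronts that do
  not depend on \<open>\<epsilon>\<close>, and every front is lifted to a wave of the system by a second-order ansatz, whose
  Riemann problems are solved almost exactly. The semigroup property turns the local Riemann errors
  into a bound by their time integral. While waves of different speeds overlap, up to a time independent
  of \<open>\<epsilon>\<close>, the crude quadratic error suffices; once the groups are separated only cubic errors remain, and
  they are harmless over a time of order \<open>1/\<epsilon>\<close>.
\<close>

text \<open>The obstacle is the time scale: a local error of rate \<epsilon>^2 kept up for a time of
  order 1/\<epsilon> costs O(\<epsilon>), exactly the size to be beaten. Hence the parameters are
  fixed in the order step data, \<eta>, \<epsilon>. The step data determine a variation bound
  \<open>V\<close> and a radius \<open>A\<close> containing all tracked profiles; both may be huge,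
  but neither depends on \<epsilon>. Upward jumps of genuinely nonlinear amplitudes, which replace
  rarefactions, are at most \<eta> and cost a constant times \<eta> \<epsilon> in total. Apart from
  the error of the step data, the rest is O(\<epsilon>^2) with constants depending on
  \<open>V\<close> and \<open>A\<close>. Groups separate because profiles have bounded support and
  distinct eigenvalues at \<open>U0\<close> differ by at least 1 / \<open>C\<close>, so a time just
  above 2 \<open>A\<close> \<open>C\<close> is enough. Families that share an eigenvalue never
  separate. They are kept together instead: a multiple eigenvalue is linearly degenerate and its
  eigenspaces are involutive, so superposing its families along an approximate integral manifold
  costs a cubic error only.\<close>

abbreviation (input) dist1 :: "(real => real) => (real => real) => real" where
 "dist1 f g \<equiv> (LBINT y. \<bar>f y - g y\<bar>)"

abbreviation (input) ndist1 :: "(real => 'b::{banach, second_countable_topology}) => (real => 'b) => real" where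
 "ndist1 f g \<equiv> (LBINT y. norm (f y - g y))"

section \<open>Closure properties of \<open>C_k\<close> maps\<close>

lemma C_k_mono_Suc: "C_k (Suc k) f ==> C_k k f"
proof (induction k arbitrary: f)
 case 0
 then show ?case by (auto intro!: continuous_at_imp_continuous_on differentiable_imp_continuous_within)
next
 case (Suc k)
 then show ?case by auto
qed

lemma C_k_le: "C_k n f ==> k <= n ==> C_k k f"
proof (induction n)
 case (Suc n)
 then show ?case using C_k_mono_Suc by (cases "k = Suc n") auto
qed simp

lemma C_k_SucI:
 assumes "!!x. (f has_derivative f' x) (at x)" "!!v. C_k k (%x. f' x v)"
 shows "C_k (Suc k) f"
proof -
 have "frechet_derivative f (at x) = f' x" for x using assms(1) frechet_derivative_at by metis
 then show ?thesis using assms by (auto simp: differentiable_def)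
qed

lemma C_k_SucD:
 assumes "C_k (Suc k) f"
 shows "(f has_derivative frechet_derivative f (at x)) (at x)" "C_k k (%x. frechet_derivative f (at x) v)"
 using assms by (auto simp: frechet_derivative_works)

lemma C_k_const [simp]: "C_k k (%x. c)"
proof (induction k arbitrary: c)
 case (Suc k)
 show ?case by (rule C_k_SucI[where f' = "%x v. 0"]) (use Suc in auto)
qed simp

lemma C_k_add: "C_k k f ==> C_k k g ==> C_k k (%x. f x + g x)"
proof (induction k arbitrary: f g)
 case (Suc k)
 show ?case by (rule C_k_SucI[OF has_derivative_add[OF C_k_SucD(1)[OF Suc.prems(1)] C_k_SucD(1)[OF Suc.prems(2)]]])
    (intro Suc.IH C_k_SucD(2)[OF Suc.prems(1)] C_k_SucD(2)[OF Suc.prems(2)])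
qed (auto intro: continuous_intros)

lemma C_k_sum: "(!!i. i \<in> I ==> C_k k (f i)) ==> C_k k (%x. \<Sum>i\<in>I. f i x)"
 by (induction I rule: infinite_finite_induct) (auto intro: C_k_add)

lemma C_k_bilinear:
 assumes "bounded_bilinear B"
 shows "C_k k f ==> C_k k g ==> C_k k (%x. B (f x) (g x))"
proof (induction k arbitrary: f g)
 case 0
 then show ?case using bounded_bilinear.continuous_on[OF assms] by auto
next
 case (Suc k)
 show ?case by (rule C_k_SucI[OF bounded_bilinear.FDERIV[OF assms C_k_SucD(1)[OF Suc.prems(1)] C_k_SucD(1)[OF Suc.prems(2)]]])
    (intro Suc.IH C_k_add C_k_SucD(2)[OF Suc.prems(1)] C_k_SucD(2)[OF Suc.prems(2)] C_k_mono_Suc[OF Suc.prems(1)] C_k_mono_Suc[OF Suc.prems(2)])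
qed

lemmas C_k_mult = C_k_bilinear[OF bounded_bilinear_mult]
lemmas C_k_inner = C_k_bilinear[OF bounded_bilinear_inner]
lemmas C_k_scaleR = C_k_bilinear[OF bounded_bilinear_scaleR]

lemma C_k_diff: "C_k k f ==> C_k k g ==> C_k k (%x. f x - g x)"
 using C_k_add[of k f "%x. (-1) *\<^sub>R g x"] C_k_scaleR[of k "%_. -1" g] by simp

text \<open>Every test function below is built from one-variable functions of affine arguments. The
  derivative is a multiple of another such composition, so the induction closes without a chain rule
  for general \<open>C_k\<close> maps.\<close>

lemma C_k_affine_real:
 fixes h :: "real => real" and T :: "'a::euclidean_space => real"
 assumes "bounded_linear T"
 shows "C_k k h ==> C_k k (%x. h (T x + b))"
proof (induction k arbitrary: h)
 case 0
 have "continuous_on UNIV (%x. T x + b)" by (intro continuous_intros bounded_linear.continuous_on[OF assms])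
 with 0 show ?case by (auto intro: continuous_on_compose2)
next
 case (Suc k)
 have 1: "((%x. T x + b) has_derivative T) (at x)" for x by (rule has_derivative_add_const) (rule bounded_linear_imp_has_derivative[OF assms])
 have 2: "frechet_derivative h (at y) u = u * frechet_derivative h (at y) 1" for y u
  using linear_scale[OF linear_frechet_derivative, of h "at y" u 1] Suc.prems by simp
 have 3: "((%x. h (T x + b)) has_derivative (%v. T v * frechet_derivative h (at (T x + b)) 1)) (at x)" for x
 proof -
  have "(%v. frechet_derivative h (at (T x + b)) (T v)) = (%v. T v * frechet_derivative h (at (T x + b)) 1)" by (rule ext) (rule 2)
  then show ?thesis using has_derivative_compose[OF 1[of x] C_k_SucD(1)[OF Suc.prems, of "T x + b"]] by simp
 qed
 show ?case by (rule C_k_SucI[OF 3]) (intro C_k_mult C_k_const Suc.IH C_k_SucD(2)[OF Suc.prems])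
qed

section \<open>A smooth step\<close>

text \<open>The polynomial parameter makes this class of functions closed under differentiation, so
  smoothness is an induction over all polynomials at once.\<close>

definition flat :: "real poly => real => real" where
 "flat p x = (if x > 0 then poly p (1/x) * exp (- (1/x)) else 0)"

lemma poly_exp_tendsto: "((%x. poly p x * exp (-x)) \<longlongrightarrow> 0) at_top" for p :: "real poly"
proof (induction p)
 case (pCons a p)
 have *: "((%x::real. x^n * exp (-x)) \<longlongrightarrow> 0) at_top" for n using tendsto_power_div_exp_0[of n] by (simp add: exp_minus field_simps)
 have "poly q x * exp (-x) = (\<Sum>i\<le>degree q. coeff q i * (x^i * exp(-x)))" for q :: "real poly" and x
  by (simp add: poly_altdef sum_distrib_right mult.assoc)
 moreover have "((%x. \<Sum>i\<le>degree q. coeff q i * (x^i * exp(-x))) \<longlongrightarrow> (\<Sum>i\<le>degree q. coeff q i * 0)) at_top" for q :: "real poly"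
  by (intro tendsto_intros *)
 ultimately have "((%x. poly q x * exp (-x)) \<longlongrightarrow> 0) at_top" for q :: "real poly" by simp
 then show ?case .
qed simp

lemma flat_tendsto: "((%x. poly p (1/x) * exp (- (1/x))) \<longlongrightarrow> 0) (at_right 0)" for p :: "real poly"
 using filterlim_compose[OF poly_exp_tendsto, of "%x. 1/x" "at_right 0"] filterlim_inverse_at_top_right by (simp add: inverse_eq_divide)

text \<open>With y = 1/x, differentiation multiplies by y^2 and replaces p by p - p'. At 0 the
  difference quotient is again of this kind, with polynomial y p, and tends to 0.\<close>

lemma flat_deriv: "(flat p has_real_derivative flat ([:0,0,1:] * (p - pderiv p)) x) (at x)"
proof -
 consider "x > 0" | "x < 0" | "x = 0" by linarith
 then show ?thesis
 proof cases
  case 1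
  have "((%x. poly p (1/x) * exp (- (1/x))) has_real_derivative flat ([:0,0,1:] * (p - pderiv p)) x) (at x)"
   using 1 by (auto intro!: derivative_eq_intros DERIV_chain2[OF poly_DERIV] simp: flat_def field_simps power2_eq_square)
  then show ?thesis by (rule has_field_derivative_transform_within_open[of _ _ _ "{0<..}"]) (use 1 in \<open>auto simp: flat_def\<close>)
 next
  case 2
  have "((%x. 0) has_real_derivative flat ([:0,0,1:] * (p - pderiv p)) x) (at x)" using 2 by (auto simp: flat_def)
  then show ?thesis by (rule has_field_derivative_transform_within_open[of _ _ _ "{..<0}"]) (use 2 in \<open>auto simp: flat_def\<close>)
 next
  case 3
  have r: "((%y. (flat p y - flat p 0) / (y - 0)) \<longlongrightarrow> 0) (at_right 0)" by (rule Lim_transform_eventually[OF flat_tendsto[of "[:0,1:] * p"]])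
    (auto simp: flat_def eventually_at_right_field field_simps intro!: exI[of _ 1])
  have l: "((%y. (flat p y - flat p 0) / (y - 0)) \<longlongrightarrow> 0) (at_left 0)" by (rule Lim_transform_eventually[OF tendsto_const[of 0]])
    (auto simp: flat_def eventually_at_left_field intro!: exI[of _ "-1"])
  show ?thesis unfolding 3 using filterlim_split_at[OF l r] by (simp add: has_field_derivative_iff flat_def)
 qed
qed

lemma C_k_real_SucI:
 fixes f :: "real => real"
 assumes "!!x. (f has_real_derivative f' x) (at x)" "C_k k f'"
 shows "C_k (Suc k) f" by (rule C_k_SucI[where f' = "%x v. f' x * v"]) (use assms in \<open>auto simp: has_field_derivative_def intro!: C_k_mult\<close>)

lemma C_k_flat: "C_k k (flat p)"
proof (induction k arbitrary: p)
 case 0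
 show ?case using flat_deriv[of p] by (auto intro!: continuous_at_imp_continuous_on DERIV_isCont)
next
 case (Suc k)
 show ?case by (rule C_k_real_SucI[OF flat_deriv Suc])
qed

definition bump :: "real => real" where "bump x = flat 1 x * flat 1 (1 - x)"

lemma C_k_bump: "C_k k bump"
proof -
 have "C_k k (%x::real. flat 1 ((- x) + 1))" by (rule C_k_affine_real[OF _ C_k_flat]) (simp add: bounded_linear_minus bounded_linear_ident)
 then have "C_k k (%x. flat 1 x * flat 1 (1 - x))" by (intro C_k_mult C_k_flat) (simp add: add.commute)
 then show ?thesis unfolding bump_def[abs_def] .
qed

lemma bump_nonneg: "0 <= bump x" by (simp add: bump_def flat_def)

lemma bump_eq_0: "x <= 0 \<or> 1 <= x ==> bump x = 0" by (auto simp: bump_def flat_def)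

lemma bump_pos: "0 < x ==> x < 1 ==> 0 < bump x" by (auto simp: bump_def flat_def)

lemma bump_cont: "continuous_on A bump"
 using C_k_bump[of 0] continuous_on_subset by auto

lemma bump_mass: "integral {0..1} bump > 0"
proof -
 have "integral {0..1} bump >= 0" by (rule integral_nonneg) (auto intro: integrable_continuous_interval bump_cont bump_nonneg)
 moreover have "integral {0..1} bump ~= 0"
 proof
  assume "integral {0..1} bump = 0"
  then have "(bump has_integral 0) (cbox 0 1)" using integrable_integral[OF integrable_continuous_interval[OF bump_cont[of "{0..1}"]]] by simp
  then have "bump (1/2) = 0" by (rule has_integral_0_cbox_imp_0[rotated 2]) (auto intro: bump_cont bump_nonneg)
  then show False using bump_pos[of "1/2"] by simp
 qed
 ultimately show ?thesis by simp
qed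

definition ramp' :: "real => real" where "ramp' x = bump x / integral {0..1} bump"
text \<open>A smooth monotone Heaviside function, constant outside [0, 1]. The test functions are
  products and differences of its rescalings.\<close>

definition ramp :: "real => real" where "ramp x = (if x <= 0 then 0 else integral {0..x} ramp')"

lemma ramp'_nonneg: "0 <= ramp' x" using bump_nonneg bump_mass by (simp add: ramp'_def less_imp_le)
lemma ramp'_eq_0: "x <= 0 \<or> 1 <= x ==> ramp' x = 0" using bump_eq_0 by (simp add: ramp'_def)
lemma C_k_ramp': "C_k k ramp'"
 using C_k_mult[OF C_k_const[of k "1 / integral {0..1} bump"] C_k_bump] by (simp add: ramp'_def[abs_def])
lemma ramp'_cont: "continuous_on A ramp'"
 using C_k_ramp'[of 0] continuous_on_subset by auto

text \<open>Moving the base point below both 0 and x makes x an interior point of the interval of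
  integration, so that the fundamental theorem yields a two-sided derivative, also at 0.\<close>

lemma ramp_eq_integral: "c <= 0 ==> c <= x ==> ramp x = integral {c..x} ramp'"
proof -
 assume c: "c <= 0" "c <= x"
 have z: "integral {c..y} ramp' = 0" if "y <= 0" for y
 proof -
  have "integral {c..y} ramp' = integral {c..y} (%x. 0)" by (rule integral_cong) (use that in \<open>auto intro: ramp'_eq_0\<close>)
  then show ?thesis by simp
 qed
 show ?thesis
 proof (cases "x <= 0")
  case False
  then have "integral {c..0} ramp' + integral {0..x} ramp' = integral {c..x} ramp'"
   by (intro Henstock_Kurzweil_Integration.integral_combine) (use c in \<open>auto intro: integrable_continuous_interval ramp'_cont\<close>)
  then show ?thesis using z[of 0] False by (simp add: ramp_def)
 qed (use z in \<open>auto simp: ramp_def\<close>)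
qed

lemma ramp_deriv: "(ramp has_real_derivative ramp' x) (at x)"
proof -
 define c where "c = min 0 x - 1"
 have "((%u. integral {c..u} ramp') has_real_derivative ramp' x) (at x within {c..x+1})"
  by (rule integral_has_real_derivative) (auto simp: c_def intro: ramp'_cont)
 then have "((%u. integral {c..u} ramp') has_real_derivative ramp' x) (at x)" by (subst (asm) at_within_interior) (auto simp: c_def)
 then show ?thesis by (rule has_field_derivative_transform_within_open[of _ _ _ "{c<..}"]) (auto simp: c_def intro!: ramp_eq_integral[symmetric])
qed

lemma C_k_ramp: "C_k k ramp"
 using C_k_real_SucI[OF ramp_deriv C_k_ramp'] C_k_mono_Suc by blast

lemma ramp_mono: "mono ramp"
 by (rule deriv_nonneg_imp_mono[of _ _ ramp ramp', THEN monoI]) (auto intro: ramp_deriv ramp'_nonneg)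

lemma ramp_eq_0: "x <= 0 ==> ramp x = 0" by (simp add: ramp_def)

lemma ramp_eq_1: "1 <= x ==> ramp x = 1"
proof -
 assume x: "1 <= x"
 have "integral {0..1} ramp' + integral {1..x} ramp' = integral {0..x} ramp'"
  by (intro Henstock_Kurzweil_Integration.integral_combine) (use x in \<open>auto intro: integrable_continuous_interval ramp'_cont\<close>)
 moreover have "integral {1..x} ramp' = integral {1..x} (%x. 0)" by (rule integral_cong) (auto intro: ramp'_eq_0)
 moreover have "integral {0..1} ramp' = 1" using bump_mass by (simp add: ramp'_def[abs_def])
 ultimately show ?thesis using x by (simp add: ramp_def)
qed

lemma ramp_nonneg: "0 <= ramp x" using monoD[OF ramp_mono, of "min x 0" x] ramp_eq_0[of "min x 0"] by simp
lemma ramp_le_1: "ramp x <= 1" using monoD[OF ramp_mono, of x "max x 1"] ramp_eq_1[of "max x 1"] by simp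

section \<open>Step functions\<close>

lemma L1_dist_eq:
 fixes u v :: "real => 'b::{banach, second_countable_topology}"
 assumes "integrable lborel (%x. u x - v x)"
 shows "L1_dist u v = ennreal (ndist1 u v)" unfolding L1_dist_def by (rule nn_integral_eq_integral) (use assms in auto)

lemma L1_dist_commute: "L1_dist u v = L1_dist v u"
 unfolding L1_dist_def by (simp add: norm_minus_commute)

lemma L1_dist_triangle:
 fixes u v w :: "real => 'a::{real_normed_vector, second_countable_topology}"
 assumes "(%x. u x - v x) \<in> borel_measurable lborel" "(%x. v x - w x) \<in> borel_measurable lborel"
 shows "L1_dist u w <= L1_dist u v + L1_dist v w"
proof -
 have "L1_dist u w <= (\<integral>\<^sup>+ x. ennreal (norm (u x - v x)) + ennreal (norm (v x - w x)) \<partial>lborel)" unfolding L1_dist_def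
  by (intro nn_integral_mono) (metis ennreal_leI ennreal_plus norm_ge_zero norm_triangle_sub diff_add_cancel add_diff_eq norm_triangle_ineq)
 also have "... = L1_dist u v + L1_dist v w" unfolding L1_dist_def by (rule nn_integral_add) (use assms in measurable)
 finally show ?thesis .
qed

lemma L1_dist_cong_AE:
 assumes "AE x in lborel. u x = u' x" "AE x in lborel. v x = v' x"
 shows "L1_dist u v = L1_dist u' v'" unfolding L1_dist_def by (rule nn_integral_cong_AE) (use assms in auto)

text \<open>Positions need neither be ordered nor distinct, so fronts may cross or coincide without
  being renumbered.\<close>

definition fronts :: "'i set => ('i => real) => ('i => 'b) => real => 'b::real_normed_vector" where
 "fronts K p d y = (\<Sum>k\<in>K. if p k <= y then d k else 0)"

lemma fronts_measurable [measurable]: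
 fixes d :: "'i => 'b::{banach, second_countable_topology}"
 shows "fronts K p d \<in> borel_measurable borel" unfolding fronts_def by measurable

lemma fronts_before: "(!!k. k \<in> K ==> y < p k) ==> fronts K p d y = 0"
 unfolding fronts_def by (rule sum.neutral) force

lemma fronts_after: "(!!k. k \<in> K ==> p k <= y) ==> fronts K p d y = sum d K"
 unfolding fronts_def by (rule sum.cong) auto

lemma fronts_norm_le: "norm (fronts K p d y) <= (\<Sum>k\<in>K. norm (d k))"
 unfolding fronts_def by (rule order_trans[OF norm_sum]) (auto intro!: sum_mono)

lemma integrable_bounded_support:
 fixes f :: "real => 'b::{banach, second_countable_topology}"
 assumes "f \<in> borel_measurable borel" "!!x. norm (f x) <= M" "!!x. x \<notin> {a..b} ==> f x = 0"
 shows "integrable lborel f"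
proof (rule Bochner_Integration.integrable_bound)
 show "integrable lborel (%x. M * indicator {a..b} x :: real)" by (cases "a <= b") auto
 show "f \<in> borel_measurable lborel" using assms by auto
 have "0 <= M" using assms(2)[of a] norm_ge_zero order_trans by blast
 then show "AE x in lborel. norm (f x) <= norm (M * indicator {a..b} x :: real)" using assms(2,3) by (auto simp: indicator_def)
qed

lemma fronts_outside:
 assumes "sum d K = 0" "!!k. k \<in> K ==> p k \<in> {a..b}" "y \<notin> {a..b}"
 shows "fronts K p d y = 0"
proof (cases "y < a")
 case True then show ?thesis using assms by (intro fronts_before) force
next
 case False then show ?thesis using assms by (subst fronts_after) force+
qed

lemma fronts_integrable:
 fixes d :: "'i => 'b::{banach, second_countable_topology}"
 assumes "finite K" "sum d K = 0"
 shows "integrable lborel (fronts K p d)"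
proof (rule integrable_bounded_support)
 fix x assume "x \<notin> {Min (p ` K)..Max (p ` K)}"
 then show "fronts K p d x = 0" by (rule fronts_outside[OF assms(2), rotated]) (use assms in auto)
qed (auto intro: fronts_norm_le)

lemma integral_indicator_diff_fronts:
 fixes a b :: real
 shows "integrable lborel (%y. \<bar>(if a <= y then 1 else 0) - (if b <= y then 1 else 0)\<bar> :: real)"
  and "(LBINT y. \<bar>(if a <= y then 1 else 0) - (if b <= y then 1 else 0)\<bar>) = \<bar>a - b\<bar>"
proof -
 have *: "(%y. \<bar>(if a <= y then 1 else 0) - (if b <= y then 1 else 0)\<bar>) = (indicator {min a b..<max a b} :: real => real)"
  by (auto simp: indicator_def fun_eq_iff)
 show "integrable lborel (%y. \<bar>(if a <= y then 1 else 0) - (if b <= y then 1 else 0)\<bar> :: real)"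
  "(LBINT y. \<bar>(if a <= y then 1 else 0) - (if b <= y then 1 else 0)\<bar>) = \<bar>a - b\<bar>" unfolding * by (auto simp: max_def min_def)
qed

text \<open>Shifting a jump d by a distance s changes the function by |d| on an interval of length
  s. The zero sum of the jumps makes both functions compactly supported.\<close>

lemma fronts_move:
 fixes d :: "'i => 'b::{banach, second_countable_topology}"
 assumes "finite K" "sum d K = 0"
 shows "(ndist1 (fronts K p d) (fronts K q d)) <= (\<Sum>k\<in>K. norm (d k) * \<bar>p k - q k\<bar>)"
proof -
 let ?I = "%k y. \<bar>(if p k <= y then 1 else 0) - (if q k <= y then 1 else 0)\<bar> :: real"
 have "(ndist1 (fronts K p d) (fronts K q d)) <= (LBINT y. (\<Sum>k\<in>K. norm (d k) * ?I k y))"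
 proof (rule integral_mono)
  show "integrable lborel (%y. norm (fronts K p d y - fronts K q d y))" using fronts_integrable[OF assms] by auto
  show "integrable lborel (%y. \<Sum>k\<in>K. norm (d k) * ?I k y)"
   by (intro Bochner_Integration.integrable_sum integrable_mult_right integral_indicator_diff_fronts)
  fix y
  show "norm (fronts K p d y - fronts K q d y) <= (\<Sum>k\<in>K. norm (d k) * ?I k y)" unfolding fronts_def sum_subtractf[symmetric]
   by (rule order_trans[OF norm_sum], rule sum_mono) auto
 qed
 also have "... = (\<Sum>k\<in>K. norm (d k) * \<bar>p k - q k\<bar>)" by (subst Bochner_Integration.integral_sum)
    (auto intro!: integrable_mult_right integral_indicator_diff_fronts simp: integral_indicator_diff_fronts)
 finally show ?thesis .
qed

section \<open>Density of step functions in \<open>L\<^sup>1\<close>\<close>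

text \<open>With lists, addition of step functions is concatenation and a linear map acts
  entrywise.\<close>

definition lfronts :: "(real \<times> 'b) list => real => 'b::real_normed_vector" where
 "lfronts L y = (\<Sum>(p, d)\<leftarrow>L. if p <= y then d else 0)"

lemma lfronts_conv: "lfronts L = fronts {..<length L} (%k. fst (L ! k)) (%k. snd (L ! k))"
 unfolding lfronts_def fronts_def fun_eq_iff by (auto simp: sum_list_sum_nth case_prod_unfold atLeast0LessThan)

definition step_approximable :: "(real => 'b::euclidean_space) => bool" where
 "step_approximable f \<longleftrightarrow> integrable lborel f & (\<forall>e>0. \<exists>L. sum_list (map snd L) = 0 &
   (ndist1 f (lfronts L)) < e)"

lemma lfronts_integrable:
 fixes L :: "(real \<times> 'b::euclidean_space) list"
 assumes "sum_list (map snd L) = 0" shows "integrable lborel (lfronts L)" unfolding lfronts_conv using assms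
 by (intro fronts_integrable) (auto simp: sum_list_sum_nth atLeast0LessThan)

lemma step_approximable_lfronts:
 fixes L :: "(real \<times> 'b::euclidean_space) list"
 assumes "sum_list (map snd L) = 0" shows "step_approximable (lfronts L)" unfolding step_approximable_def using assms
 by (auto intro!: lfronts_integrable exI[of _ L])

lemma step_approximable_limit:
 fixes f :: "real => 'b::euclidean_space"
 assumes "integrable lborel f" "!!e. e > 0 ==> \<exists>g. step_approximable g & (ndist1 f g) < e"
 shows "step_approximable f" unfolding step_approximable_def
proof (intro conjI allI impI assms(1))
 fix e :: real assume "e > 0"
 then obtain g where g: "step_approximable g" "(ndist1 f g) < e/2" using assms(2)[of "e/2"] by auto
 then obtain L where L: "sum_list (map snd L) = 0" "(ndist1 g (lfronts L)) < e/2"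
  using \<open>e > 0\<close> unfolding step_approximable_def by (meson half_gt_zero)
 have i: "integrable lborel g" "integrable lborel (lfronts L)" using g L lfronts_integrable by (auto simp: step_approximable_def)
 have "(ndist1 f (lfronts L)) <= (LBINT x. norm (f x - g x) + norm (g x - lfronts L x))"
  by (rule integral_mono) (use assms(1) i in \<open>auto intro: norm_diff_triangle_ineq norm_triangle_le_diff norm_diff_triangle_le\<close>)
 also have "... = (ndist1 f g) + (ndist1 g (lfronts L))" by (rule Bochner_Integration.integral_add) (use assms(1) i in auto)
 finally show "\<exists>L. sum_list (map snd L) = 0 & (ndist1 f (lfronts L)) < e" using g L by (intro exI[of _ L]) linarith
qed

lemma step_approximable_add:
 fixes f g :: "real => 'b::euclidean_space"
 assumes "step_approximable f" "step_approximable g"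
 shows "step_approximable (%x. f x + g x)" unfolding step_approximable_def
proof (intro conjI allI impI)
 show fg: "integrable lborel (%x. f x + g x)" using assms by (auto simp: step_approximable_def)
 fix e :: real assume e: "e > 0"
 obtain L where L: "sum_list (map snd L) = 0" "(ndist1 f (lfronts L)) < e/2" using assms(1) e unfolding step_approximable_def by (meson half_gt_zero)
 obtain L' where L': "sum_list (map snd L') = 0" "(ndist1 g (lfronts L')) < e/2"
  using assms(2) e unfolding step_approximable_def by (meson half_gt_zero)
 have i: "integrable lborel f" "integrable lborel g" "integrable lborel (lfronts L)" "integrable lborel (lfronts L')"
  using assms L L' lfronts_integrable by (auto simp: step_approximable_def)
 have s: "lfronts (L @ L') x = lfronts L x + lfronts L' x" for x by (simp add: lfronts_def)
 have "(LBINT x. norm (f x + g x - lfronts (L @ L') x)) <= (LBINT x. norm (f x - lfronts L x) + norm (g x - lfronts L' x))"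
  unfolding s by (rule integral_mono) (use i in \<open>auto intro: norm_diff_triangle_ineq\<close>)
 also have "... = (ndist1 f (lfronts L)) + (ndist1 g (lfronts L'))" by (rule Bochner_Integration.integral_add) (use i in auto)
 finally show "\<exists>L. sum_list (map snd L) = 0 & (LBINT x. norm (f x + g x - lfronts L x)) < e" using L L' by (intro exI[of _ "L @ L'"]) auto
qed

lemma step_approximable_indicator:
 fixes c :: "'b::euclidean_space"
 shows "step_approximable (%x. indicator {a..<b} x *\<^sub>R c)"
proof (cases "a <= b")
 case True
 then have "(%x. indicator {a..<b} x *\<^sub>R c) = lfronts [(a, c), (b, - c)]" by (auto simp: fun_eq_iff lfronts_def)
 then show ?thesis using step_approximable_lfronts[of "[(a, c), (b, - c)]"] by simp
next
 case False
 then have "(%x. indicator {a..<b} x *\<^sub>R c) = lfronts []" by (auto simp: fun_eq_iff lfronts_def)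
 then show ?thesis using step_approximable_lfronts[of "[]"] by simp
qed

lemma step_approximable_diff:
 fixes f g :: "real => 'b::euclidean_space"
 assumes "step_approximable f" "step_approximable g"
 shows "step_approximable (%x. f x - g x)"
proof -
 have "step_approximable (%x. - g x)" unfolding step_approximable_def
 proof (intro conjI allI impI)
  show "integrable lborel (%x. - g x)" using assms by (auto simp: step_approximable_def)
  fix e :: real assume "e > 0"
  then obtain L where L: "sum_list (map snd L) = 0" "(ndist1 g (lfronts L)) < e" using assms(2) unfolding step_approximable_def by metis
  have *: "lfronts (map (%(p,d). (p,-d)) L) x = - lfronts L x" for x unfolding lfronts_def by (induction L) auto
  have "sum_list (map snd (map (%(p,d). (p,-d)) L)) = - sum_list (map snd L)" by (induction L) auto
  moreover have "norm (- g x - - lfronts L x) = norm (g x - lfronts L x)" for x by (metis minus_diff_minus norm_minus_cancel)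
  ultimately show "\<exists>L. sum_list (map snd L) = 0 & (LBINT x. norm (- g x - lfronts L x)) < e"
   using L * by (intro exI[of _ "map (%(p,d). (p,-d)) L"]) (simp only: minus_zero)
 qed
 from step_approximable_add[OF assms(1) this] show ?thesis by simp
qed

lemma step_approximable_seq:
 fixes f :: "real => 'b::euclidean_space"
 assumes s: "!!n. step_approximable (s n)" and lim: "!!x. (%n. s n x) \<longlonglongrightarrow> f x"
  and bd: "!!n x. norm (s n x) <= w x" "integrable lborel w"
 shows "step_approximable f"
proof -
 have sm: "s n \<in> borel_measurable lborel" for n using s[of n] borel_measurable_integrable by (auto simp: step_approximable_def)
 have fm: "f \<in> borel_measurable lborel" by (rule borel_measurable_LIMSEQ_metric[OF sm lim])
 have fi: "integrable lborel f" by (rule integrable_dominated_convergence[where s = s, OF fm sm bd(2)]) (use lim bd in auto)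
 have "(%n. \<integral>x. norm (f x - s n x) \<partial>lborel) \<longlonglongrightarrow> integral\<^sup>L (lborel :: real measure) (%x. 0)"
 proof (rule integral_dominated_convergence[where w = "%x. 2 * w x"])
  have "(%n. norm (f x - s n x)) \<longlonglongrightarrow> 0" for x using tendsto_norm[OF tendsto_diff[OF tendsto_const lim[of x]], of "f x"] by simp
  then show "AE x in lborel. (%n. norm (f x - s n x)) \<longlonglongrightarrow> 0" by simp
  have "norm (f x) <= w x" for x by (rule LIMSEQ_le_const2[OF tendsto_norm[OF lim]]) (use bd in auto)
  then have "norm (f x - s n x) <= 2 * w x" for n x using norm_triangle_ineq4[of "f x" "s n x"] bd(1)[of n x] by (smt (verit))
  then show "AE x in lborel. norm (norm (f x - s n x)) <= 2 * w x" for n by simp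
 qed (use bd fm sm in auto)
 then have "\<exists>n. (ndist1 f (s n)) < e" if "e > 0" for e using order_tendstoD(2)[of _ 0 sequentially e] that by (auto simp: eventually_sequentially)
 then show ?thesis using step_approximable_limit[OF fi] s by blast
qed

text \<open>Dynkin argument over the half-lines, which are stable under intersection and generate
  the Borel sets. The cut-off to a bounded window keeps every indicator integrable, also that of a
  complement.\<close>

lemma step_approximable_indicator_bounded:
 fixes c :: "'b::euclidean_space"
 assumes "A \<in> sets borel"
 shows "step_approximable (%x. indicator (A \<inter> {- real n..<real n}) x *\<^sub>R c)"
proof -
 let ?I = "{- real n..<real n}"
 have wi: "integrable lborel (%x. indicator ?I x * norm c :: real)" by simp
 have "{..<a} \<inter> {..<b} \<in> range lessThan" for a b :: real using rangeI[of lessThan "min a b"] by (simp add: Int_def lessThan_def)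
 then have "Int_stable (range (%a::real. {..<a}))" unfolding Int_stable_def by blast
 moreover have "range (%a::real. {..<a}) \<subseteq> Pow UNIV" by auto
 moreover have "A \<in> sigma_sets UNIV (range (%a::real. {..<a}))" using assms by (simp add: borel_Iio)
 ultimately show ?thesis
 proof (induction rule: sigma_sets_induct_disjoint)
  case (basic A)
  then obtain a where "A = {..<a}" by auto
  then have "A \<inter> ?I = {- real n..<min a (real n)}" by auto
  then show ?case using step_approximable_indicator by simp
 next
  case empty
  then show ?case using step_approximable_lfronts[of "[]"] by (simp add: lfronts_def[abs_def])
 next
  case (compl A)
  have "(%x. indicator ?I x *\<^sub>R c - indicator (A \<inter> ?I) x *\<^sub>R c) = (%x. indicator ((UNIV - A) \<inter> ?I) x *\<^sub>R c)"
   by (rule ext) (simp split: split_indicator)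
  then show ?case using step_approximable_diff[OF step_approximable_indicator[of "- real n" "real n" c] compl.IH] by simp
 next
  case (union A)
  define s where "s m x = (\<Sum>i<m. indicator (A i \<inter> ?I) x *\<^sub>R c)" for m x
  have s_eq: "s m x = indicator ((\<Union>i<m. A i) \<inter> ?I) x *\<^sub>R c" for m x
  proof -
   have d: "disjoint_family_on (%i. A i \<inter> ?I) {..<m}" using union(1) by (auto simp: disjoint_family_on_def)
   have "(\<Union>i<m. A i) \<inter> ?I = (\<Union>i<m. A i \<inter> ?I)" by blast
   then have "indicator ((\<Union>i<m. A i) \<inter> ?I) x = (\<Sum>i<m. indicator (A i \<inter> ?I) x :: real)" using indicator_UN_disjoint[OF _ d, of x] by simp
   then show ?thesis unfolding s_def using scaleR_left.sum[of "%i. indicator (A i \<inter> ?I) x" "{..<m}" c] by simp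
  qed
  show ?case
  proof (rule step_approximable_seq[where s = s, OF _ _ _ wi])
   show "step_approximable (s m)" for m unfolding s_def
   proof (induction m)
    case 0
    show ?case using step_approximable_lfronts[of "[]"] by (simp add: lfronts_def[abs_def])
   next
    case (Suc m)
    then show ?case using step_approximable_add[OF _ union.IH[of m]] by (simp only: sum.lessThan_Suc)
   qed
   show "norm (s m x) <= indicator ?I x * norm c" for m x unfolding s_eq by (auto simp: indicator_def)
   show "(%m. s m x) \<longlonglongrightarrow> indicator (\<Union> (range A) \<inter> ?I) x *\<^sub>R c" for x
   proof (cases "\<exists>i. x \<in> A i")
    case True
    then obtain i where i: "x \<in> A i" by auto
    then have "eventually (%m. s m x = indicator (\<Union> (range A) \<inter> ?I) x *\<^sub>R c) sequentially"
    unfolding s_eq eventually_sequentially by (intro exI[of _ "Suc i"]) (auto simp: indicator_def)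
    then show ?thesis by (rule tendsto_eventually)
   next
    case False
    then show ?thesis unfolding s_eq by (auto simp: indicator_def)
   qed
  qed
 qed
qed

theorem step_functions_dense:
 fixes f :: "real => 'b::euclidean_space"
 assumes "integrable lborel f"
 shows "step_approximable f" using assms
proof (induction rule: integrable_induct)
 case (base A c)
 define w where "w x = indicator A x * norm c" for x :: real
 show ?case
 proof (rule step_approximable_seq[where s = "%n x. indicator (A \<inter> {- real n..<real n}) x *\<^sub>R c" and w = w])
  show "step_approximable (%x. indicator (A \<inter> {- real n..<real n}) x *\<^sub>R c)" for n using base by (intro step_approximable_indicator_bounded) auto
  show "integrable lborel w" unfolding w_def using base by auto
  show "(%n. indicator (A \<inter> {- real n..<real n}) x *\<^sub>R c) \<longlonglongrightarrow> indicator A x *\<^sub>R c" for x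
  proof (rule tendsto_eventually)
   obtain m :: nat where "\<bar>x\<bar> < real m" using reals_Archimedean2 by blast
   then show "eventually (%n. indicator (A \<inter> {- real n..<real n}) x *\<^sub>R c = indicator A x *\<^sub>R c) sequentially"
    unfolding eventually_sequentially by (intro exI[of _ m]) (auto simp: indicator_def)
  qed
 qed (auto simp: w_def indicator_def)
next
 case (add f g)
 then show ?case by (intro step_approximable_add)
next
 case (lim f s)
 show ?case
 proof (rule step_approximable_limit)
  \<comment> \<open>The simple approximations satisfy |s_n| <= 2 |f|, whence the majorant 3
    |f|.\<close>
  have "(%n. \<integral>x. norm (f x - s n x) \<partial>lborel) \<longlonglongrightarrow> integral\<^sup>L (lborel :: real measure) (%x. 0)"
  proof (rule integral_dominated_convergence[where w = "%x. 3 * norm (f x)"])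
   have "(%n. norm (f x - s n x)) \<longlonglongrightarrow> 0" for x using tendsto_norm[OF tendsto_diff[OF tendsto_const lim(2)[of x]], of "f x"] by simp
   then show "AE x in lborel. (%n. norm (f x - s n x)) \<longlonglongrightarrow> 0" by simp
   have "norm (f x - s n x) <= 3 * norm (f x)" for n x using norm_triangle_ineq4[of "f x" "s n x"] lim(3)[of x n] by simp
   then show "AE x in lborel. norm (norm (f x - s n x)) <= 3 * norm (f x)" for n by simp
  qed (use lim in auto)
  then have "\<exists>n. (ndist1 f (s n)) < e" if "e > 0" for e using order_tendstoD(2)[of _ 0 sequentially e] that by (auto simp: eventually_sequentially)
  then show "\<exists>g. step_approximable g & (ndist1 f g) < e" if "e > 0" for e using that lim by blast
 qed (use lim in auto)
qed

section \<open>Right increments\<close>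

text \<open>Continuous induction: let c be the supremum of the times up to which f - K t has not
  exceeded its initial value. Continuity extends the bound to c, and the right increment at c
  carries it further unless c = b.\<close>

lemma right_increments_le_aux:
 fixes f :: "real => real"
 assumes "a <= b" "continuous_on {a..b} f"
  and inc: "!!t. t \<in> {a..<b} ==> \<exists>h>0. \<forall>s. t < s & s < t + h & s <= b --> f s - f t <= K * (s - t)"
 shows "f b - f a <= K * (b - a)"
proof -
 define g where "g s = f s - K * s" for s
 have gc: "continuous_on {a..b} g" unfolding g_def by (intro continuous_intros assms)
 define G where "G = {t \<in> {a..b}. \<forall>s\<in>{a..t}. g s <= g a}"
 have aG: "a \<in> G" using assms(1) by (auto simp: G_def)
 have bdd: "bdd_above G" by (rule bdd_aboveI[of _ b]) (auto simp: G_def)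
 define c where "c = Sup G"
 have "a <= c" unfolding c_def using aG bdd by (rule cSup_upper)
 moreover have "c <= b" unfolding c_def
 proof (rule cSup_least)
  show "G ~= {}" using aG by blast
 qed (simp add: G_def)
 ultimately have c: "a <= c" "c <= b" .
 have below: "g s <= g a" if s: "a <= s" "s < c" for s
 proof -
  obtain t where "t \<in> G" "s < t" using less_cSup_iff[of G s] aG bdd s unfolding c_def by auto
  then show ?thesis using s by (auto simp: G_def)
 qed
 have gca: "g c <= g a"
 proof (cases "c = a")
  case False
  then have "a < c" using c by simp
  have "continuous_on {a..c} g" using gc by (rule continuous_on_subset) (use c in auto)
  then have "(g \<longlongrightarrow> g c) (at_left c)" using \<open>a < c\<close> by (rule continuous_on_Icc_at_leftD)
  moreover have "eventually (%s. g s <= g a) (at_left c)" unfolding eventually_at_left[OF \<open>a < c\<close>] using below \<open>a < c\<close> by (meson less_imp_le)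
  ultimately show ?thesis by (rule tendsto_upperbound) simp
 qed simp
 have "c = b"
 proof (rule ccontr)
  assume "c ~= b"
  then have "c < b" using c by simp
  then obtain h where h: "h > 0" "!!s. c < s ==> s < c + h ==> s <= b ==> f s - f c <= K * (s - c)" using inc[of c] c by auto
  define d where "d = min b (c + h/2)"
  have d: "c < d" "d <= b" "d < c + h" using h \<open>c < b\<close> by (auto simp: d_def)
  have "g s <= g a" if "s \<in> {a..d}" for s
  proof -
   consider "s < c" | "s = c" | "s > c" by linarith
   then show ?thesis
   proof cases
    case 3
    then have "g s <= g c" using h(2)[of s] that d by (auto simp: g_def algebra_simps)
    then show ?thesis using gca by simp
   qed (use below gca that in auto)
  qed
  then have "d \<in> G" using d c by (auto simp: G_def)
  then have "d <= c" unfolding c_def using bdd by (rule cSup_upper)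
  then show False using d by simp
 qed
 then show ?thesis using gca by (simp add: g_def algebra_simps)
qed

text \<open>Exceptional points are removed one at a time: the estimate holds up to c and from every
  s > c on, and continuity lets s tend to c. In the applications they are interaction times of
  fronts.\<close>

lemma right_increments_le:
 fixes f :: "real => real"
 assumes "finite B" "a <= b" "continuous_on {a..b} f"
  and "!!t. t \<in> {a..<b} - B ==> \<exists>h>0. \<forall>s. t < s & s < t + h & s <= b --> f s - f t <= K * (s - t)"
 shows "f b - f a <= K * (b - a)" using assms
proof (induction B arbitrary: a b)
 case empty
 then show ?case by (intro right_increments_le_aux) auto
next
 case (insert c B)
 show ?case
 proof (cases "c \<in> {a..<b}")
  case False
  then show ?thesis using insert.prems by (intro insert.IH) auto
 next
  case True
  have 1: "f c - f a <= K * (c - a)"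
  proof (rule insert.IH)
   show "continuous_on {a..c} f" using insert.prems(2) by (rule continuous_on_subset) (use True in auto)
   show "\<exists>h>0. \<forall>s. t < s & s < t + h & s <= c --> f s - f t <= K * (s - t)" if tB: "t \<in> {a..<c} - B" for t
   proof -
    obtain h where "h > 0" "!!s. t < s ==> s < t + h ==> s <= b ==> f s - f t <= K * (s - t)" using insert.prems(3)[of t] tB True by auto
    then show ?thesis using True by (intro exI[of _ h]) auto
   qed
  qed (use True in auto)
  have 2: "f b - f s <= K * (b - s)" if "s \<in> {c<..b}" for s
  proof (rule insert.IH)
   show "continuous_on {s..b} f" using insert.prems(2) by (rule continuous_on_subset) (use True that in auto)
   show "\<exists>h>0. \<forall>u. t < u & u < t + h & u <= b --> f u - f t <= K * (u - t)" if "t \<in> {s..<b} - B" for t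
    using insert.prems(3)[of t] that True \<open>s \<in> {c<..b}\<close> by auto
  qed (use that in auto)
  have "c < b" using True by simp
  have "continuous_on {c..b} (%s. f s - K * s)" using insert.prems(2) by (intro continuous_intros) (rule continuous_on_subset, use True in auto)
  then have "((%s. f s - K * s) \<longlongrightarrow> f c - K * c) (at_right c)" using \<open>c < b\<close> by (rule continuous_on_Icc_at_rightD)
  moreover have "eventually (%s. f b - K * b <= f s - K * s) (at_right c)"
   unfolding eventually_at_right[OF \<open>c < b\<close>] using 2 \<open>c < b\<close> by (intro exI[of _ b]) (auto simp: algebra_simps)
  ultimately have "f b - K * b <= f c - K * c" by (rule tendsto_lowerbound) simp
  then show ?thesis using 1 by (simp add: algebra_simps)
 qed
qed

section \<open>Front tracking for Burgers' equation\<close>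

text \<open>The function vanishes to the left of all fronts, so it takes the values v k between
  ordered fronts exactly when v 0 = 0, as \<open>admissible\<close> demands.\<close>

definition steps :: "nat => (nat => real) => (nat => real) => real => real" where
 "steps N x v = fronts {1..N} x (%k. v k - v (k - 1))"

text \<open>Rankine-Hugoniot speed for the flux s^2 / 2, used for upward jumps as well.\<close>

definition speed :: "(nat => real) => nat => real" where
 "speed v k = (v (k - 1) + v k) / 2"

text \<open>Upward jumps violate the entropy condition; those of size at most \<eta> are tolerated
  as substitutes for rarefactions.\<close>

definition admissible :: "real => real => nat => (nat => real) => bool" where
 "admissible \<eta> V N v \<longleftrightarrow> v 0 = 0 & v N = 0 & (\<Sum>k\<in>{1..N}. \<bar>v k - v (k - 1)\<bar>) <= V &
   (\<forall>k\<in>{1..N}. v k - v (k - 1) <= \<eta>)"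

lemma sum_telescope_1: "(\<Sum>k\<in>{1..N}. v k - v (k - 1)) = v N - v 0" for v :: "nat => 'b::ab_group_add"
 by (induction N) auto

lemma admissible_bound:
 assumes "admissible \<eta> V N v" "k <= N" shows "\<bar>v k\<bar> <= V"
proof -
 have "v 0 = 0" using assms by (simp add: admissible_def)
 then have "\<bar>v k\<bar> = \<bar>\<Sum>i\<in>{1..k}. v i - v (i - 1)\<bar>" unfolding sum_telescope_1 by simp
 also have "... <= (\<Sum>i\<in>{1..k}. \<bar>v i - v (i - 1)\<bar>)" by (rule sum_abs)
 also have "... <= (\<Sum>i\<in>{1..N}. \<bar>v i - v (i - 1)\<bar>)" by (rule sum_mono2) (use assms in auto)
 finally show ?thesis using assms by (simp add: admissible_def)
qed

lemma admissible_V_nonneg: "admissible \<eta> V N v ==> 0 <= V"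
 using admissible_bound[of \<eta> V N v 0] by simp

lemma admissible_speed:
 assumes "admissible \<eta> V N v" "k \<in> {1..N}" shows "\<bar>speed v k\<bar> <= V"
proof -
 have "k <= N" "k - 1 <= N" using assms(2) by auto
 from this[THEN admissible_bound[OF assms(1)]] show ?thesis unfolding speed_def by (auto simp: abs_le_iff)
qed

lemma admissible_sum: "admissible \<eta> V N v ==> (\<Sum>k\<in>{1..N}. v k - v (k - 1)) = 0"
 by (simp only: sum_telescope_1 admissible_def)

lemma sum_merge:
 fixes f :: "nat => 'b::comm_monoid_add"
 assumes "1 <= k" "k < N"
 shows "(\<Sum>i\<in>{1..N}. f i) = (\<Sum>i\<in>{1..N-1}. if i < k then f i else if i = k then f k + f (Suc k) else f (Suc i))"
proof -
 have "Suc k <= N" using assms by simp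
 then show ?thesis
 proof (induction N rule: dec_induct)
  case base
  have "(\<Sum>i\<in>{1..k}. if i < k then f i else if i = k then f k + f (Suc k) else f (Suc i))
   = (\<Sum>i\<in>{1..<k}. f i) + (f k + f (Suc k))" using assms by (subst atLeastLessThanSuc_atLeastAtMost[symmetric]) (auto simp: sum.atLeastLessThan_Suc)
  then show ?case using assms by (subst atLeastLessThanSuc_atLeastAtMost[symmetric]) (auto simp: sum.atLeastLessThan_Suc add.assoc)
 next
  case (step n)
  have "{1..n} = insert n {1..n-1}" using step by auto
  moreover have "n \<notin> {1..n-1}" using step by auto
  ultimately show ?case using step by (simp add: add.commute)
 qed
qed

definition drop_index :: "nat => (nat => 'b) => nat => 'b" where
 "drop_index k x i = (if i < k then x i else x (Suc i))"

lemma merge_steps: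
 assumes k: "1 <= k" "k < N" and xk: "x k = x (Suc k)"
 shows "steps (N - 1) (drop_index k x) (drop_index k v) = steps N x v"
proof
 fix y
 show "steps (N - 1) (drop_index k x) (drop_index k v) y = steps N x v y" unfolding steps_def fronts_def sum_merge[OF k]
  by (rule sum.cong) (use k xk in \<open>auto simp: drop_index_def\<close>)
qed

text \<open>The speeds of neighbours k and k + 1 are ordered for a collision iff v (k + 1) <= v (k -
  1). The merged jump therefore points downward and respects the bound \<eta>, while the variation
  cannot increase.\<close>

lemma merge_admissible:
 assumes k: "1 <= k" "k < N" and adm: "admissible \<eta> V N v" and s: "speed v (Suc k) <= speed v k" and "0 <= \<eta>"
 shows "admissible \<eta> V (N - 1) (drop_index k v)"
proof -
 have d: "v (Suc k) <= v (k - 1)" using s by (simp add: speed_def)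
 have "(\<Sum>i\<in>{1..N-1}. \<bar>drop_index k v i - drop_index k v (i - 1)\<bar>) <= (\<Sum>i\<in>{1..N}. \<bar>v i - v (i - 1)\<bar>)"
  unfolding sum_merge[OF k] by (rule sum_mono) (auto simp: drop_index_def)
 moreover have "drop_index k v i - drop_index k v (i - 1) <= \<eta>" if "i \<in> {1..N-1}" for i
 proof -
  consider "i < k" | "i = k" | "i > k" by linarith
  then show ?thesis
  proof cases
   case 3
   then have "Suc i \<in> {1..N}" "\<not> i - 1 < k" "Suc (i - 1) = i" using that by auto
   then show ?thesis using adm unfolding admissible_def drop_index_def using 3 by force
  qed (use adm that d assms in \<open>auto simp: admissible_def drop_index_def\<close>)
 qed
 ultimately show ?thesis using adm k by (auto simp: admissible_def drop_index_def)
qed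

lemma steps_outside:
 assumes "admissible \<eta> V N v" "!!k. k \<in> {1..N} ==> x k \<in> {a..b}" "y \<notin> {a..b}"
 shows "steps N x v y = 0" unfolding steps_def by (rule fronts_outside) (use assms admissible_sum in auto)

lemma steps_integrable:
 assumes "admissible \<eta> V N v" shows "integrable lborel (steps N x v)"
 unfolding steps_def by (rule fronts_integrable) (use assms admissible_sum in auto)

text \<open>\<open>LS\<close> records each front as a space-time line, by its position at time 0 and
  its speed. That finitely many lines suffice is what later bounds the number of crossings with
  fronts of other families.\<close>

definition local_tracking ::
 "real => real => real => (real \<times> real) set => (real => real => real) => real => bool" where
 "local_tracking \<eta> V A LS w \<tau> \<longleftrightarrow> (\<exists>h>0. \<exists>N x v. admissible \<eta> V N v &
   (\<forall>k\<in>{1..<N}. x k < x (Suc k)) &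
   (\<forall>k\<in>{1..N}. \<bar>x k\<bar> <= A & (x k - speed v k * \<tau>, speed v k) \<in> LS) &
   (\<forall>\<tau>'\<in>{\<tau>..<\<tau>+h}. w \<tau>' = steps N (%k. x k + speed v k * (\<tau>' - \<tau>)) v))"

lemma local_tracking_cong:
 assumes "local_tracking \<eta> V A LS w \<tau>" "LS \<subseteq> LS'" "0 < d" "!!\<tau>'. \<tau>' \<in> {\<tau>..<\<tau>+d} ==> w' \<tau>' = w \<tau>'"
 shows "local_tracking \<eta> V A LS' w' \<tau>"
proof -
 obtain h N x v where h: "h > 0" "admissible \<eta> V N v" "\<forall>k\<in>{1..<N}. x k < x (Suc k)"
  "\<forall>k\<in>{1..N}. \<bar>x k\<bar> <= A & (x k - speed v k * \<tau>, speed v k) \<in> LS"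
  "\<forall>\<tau>'\<in>{\<tau>..<\<tau>+h}. w \<tau>' = steps N (%k. x k + speed v k * (\<tau>' - \<tau>)) v" using assms(1) unfolding local_tracking_def by auto
 show ?thesis unfolding local_tracking_def by (intro exI[of _ "min h d"] conjI exI[of _ N] exI[of _ x] exI[of _ v]) (use h assms in auto)
qed

lemma local_trackingI:
 assumes "h > 0" "admissible \<eta> V N v" "!!k. k \<in> {1..<N} ==> x k < x (Suc k)"
  "!!k. k \<in> {1..N} ==> \<bar>x k\<bar> <= A" "!!k. k \<in> {1..N} ==> (x k - speed v k * \<tau>, speed v k) \<in> LS"
  "!!\<tau>'. \<tau>' \<in> {\<tau>..<\<tau>+h} ==> w \<tau>' = steps N (%k. x k + speed v k * (\<tau>' - \<tau>)) v"
 shows "local_tracking \<eta> V A LS w \<tau>" unfolding local_tracking_def using assms by blast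

definition tracking :: "real => real => real => real => real => (real => real => real) => bool" where
 "tracking \<eta> V A a b w \<longleftrightarrow>
   (\<forall>\<tau>\<in>{a..b}. \<exists>N x v. admissible \<eta> V N v & (\<forall>k\<in>{1..N}. \<bar>x k\<bar> <= A + V * (\<tau> - a)) & w \<tau> = steps N x v) &
   (\<forall>\<tau>\<in>{a..b}. \<forall>\<tau>'\<in>{a..b}. (dist1 (w \<tau>) (w \<tau>')) <= V * V * \<bar>\<tau> - \<tau>'\<bar>) &
   (\<exists>B LS. finite B & finite LS & (\<forall>\<tau>\<in>{a..<b} - B. local_tracking \<eta> V (A + V * (\<tau> - a)) LS w \<tau>))"

lemma tracking_integrable:
 assumes "tracking \<eta> V A a b w" "\<tau> \<in> {a..b}" shows "integrable lborel (w \<tau>)" using assms steps_integrable unfolding tracking_def by metis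

lemma tracking_glue:
 assumes ab: "a <= c" "c <= b" and w1: "tracking \<eta> V A a c w1" and w2: "tracking \<eta> V (A + V * (c - a)) c b w2"
  and eq: "w1 c = w2 c"
 shows "tracking \<eta> V A a b (%\<tau>. if \<tau> < c then w1 \<tau> else w2 \<tau>)" (is "tracking _ _ _ _ _ ?w")
proof -
 have lip1: "(dist1 (w1 \<tau>) (w1 \<tau>')) <= V * V * \<bar>\<tau> - \<tau>'\<bar>" if "\<tau> \<in> {a..c}" "\<tau>' \<in> {a..c}" for \<tau> \<tau>' using w1 that by (auto simp: tracking_def)
 have lip2: "(dist1 (w2 \<tau>) (w2 \<tau>')) <= V * V * \<bar>\<tau> - \<tau>'\<bar>" if "\<tau> \<in> {c..b}" "\<tau>' \<in> {c..b}" for \<tau> \<tau>' using w2 that by (auto simp: tracking_def)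
 have lip12: "(dist1 (w1 \<tau>) (w2 \<tau>')) <= V * V * \<bar>\<tau> - \<tau>'\<bar>" if "\<tau> \<in> {a..c}" "\<tau>' \<in> {c..b}" for \<tau> \<tau>'
 proof -
  have i: "integrable lborel (w1 \<tau>)" "integrable lborel (w1 c)" "integrable lborel (w2 c)" "integrable lborel (w2 \<tau>')"
   using tracking_integrable[OF w1] tracking_integrable[OF w2] that ab by auto
  have "(dist1 (w1 \<tau>) (w2 \<tau>')) <= (LBINT y. \<bar>w1 \<tau> y - w1 c y\<bar> + \<bar>w2 c y - w2 \<tau>' y\<bar>)" by (rule integral_mono) (use i eq in auto)
  also have "... = (dist1 (w1 \<tau>) (w1 c)) + (dist1 (w2 c) (w2 \<tau>'))" by (rule Bochner_Integration.integral_add) (use i in auto)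
  also have "... <= V * V * \<bar>\<tau> - c\<bar> + V * V * \<bar>c - \<tau>'\<bar>" using lip1[of \<tau> c] lip2[of c \<tau>'] that ab by auto
  also have "... = V * V * \<bar>\<tau> - \<tau>'\<bar>" using that by (simp add: distrib_left[symmetric])
  finally show ?thesis .
 qed
 have lip: "(dist1 (?w \<tau>) (?w \<tau>')) <= V * V * \<bar>\<tau> - \<tau>'\<bar>" if "\<tau> \<in> {a..b}" "\<tau>' \<in> {a..b}" for \<tau> \<tau>'
 proof -
  have *: "(dist1 (w2 \<tau>) (w1 \<tau>')) <= V * V * \<bar>\<tau> - \<tau>'\<bar>" if "\<tau>' \<in> {a..c}" "\<tau> \<in> {c..b}" using lip12[OF that] by (simp add: abs_minus_commute)
  show ?thesis using lip1[of \<tau> \<tau>'] lip2[of \<tau> \<tau>'] lip12[of \<tau> \<tau>'] * that by auto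
 qed
 have vals: "\<exists>N x v. admissible \<eta> V N v & (\<forall>k\<in>{1..N}. \<bar>x k\<bar> <= A + V * (\<tau> - a)) & ?w \<tau> = steps N x v"
  if "\<tau> \<in> {a..b}" for \<tau>
 proof (cases "\<tau> < c")
  case True
  then show ?thesis using w1 that by (auto simp: tracking_def)
 next
  case False
  have e: "A + V * (c - a) + V * (\<tau> - c) = A + V * (\<tau> - a)" by (simp add: algebra_simps)
  have "\<exists>N x v. admissible \<eta> V N v & (\<forall>k\<in>{1..N}. \<bar>x k\<bar> <= A + V * (c - a) + V * (\<tau> - c)) & w2 \<tau> = steps N x v"
   using w2 that False unfolding tracking_def by simp
  then show ?thesis using False unfolding e by simp
 qed
 obtain B1 L1 where 1: "finite B1" "finite L1" "!!\<tau>. \<tau> \<in> {a..<c} - B1 ==> local_tracking \<eta> V (A + V * (\<tau> - a)) L1 w1 \<tau>"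
  using w1 unfolding tracking_def by blast
 obtain B2 L2 where 2: "finite B2" "finite L2" "!!\<tau>. \<tau> \<in> {c..<b} - B2 ==> local_tracking \<eta> V (A + V * (c - a) + V * (\<tau> - c)) L2 w2 \<tau>"
  using w2 unfolding tracking_def by blast
 have loc: "local_tracking \<eta> V (A + V * (\<tau> - a)) (L1 \<union> L2) ?w \<tau>" if t: "\<tau> \<in> {a..<b} - (B1 \<union> B2)" for \<tau>
 proof (cases "\<tau> < c")
  case True
  then have "local_tracking \<eta> V (A + V * (\<tau> - a)) L1 w1 \<tau>" using 1(3)[of \<tau>] t by auto
  then show ?thesis by (rule local_tracking_cong[where d = "c - \<tau>"]) (use True in auto)
 next
  case False
  have e: "A + V * (c - a) + V * (\<tau> - c) = A + V * (\<tau> - a)" by (simp add: algebra_simps)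
  have "local_tracking \<eta> V (A + V * (\<tau> - a)) L2 w2 \<tau>" using 2(3)[of \<tau>] t False unfolding e by auto
  then show ?thesis by (rule local_tracking_cong[where d = 1]) (use False in auto)
 qed
 show ?thesis unfolding tracking_def using vals lip loc 1 2 by (intro conjI exI[of _ "B1 \<union> B2"] exI[of _ "L1 \<union> L2"]) auto
qed

text \<open>Neighbours may start at one point only if their speeds spread them. As gaps are affine
  in time and nonnegative at the end, the order is strict at all interior times; the initial time
  itself is exceptional.\<close>

lemma tracking_straight:
 assumes ab: "a <= b" and adm: "admissible \<eta> V N v"
  and A: "!!k. k \<in> {1..N} ==> \<bar>x k\<bar> <= A"
  and start: "!!k. k \<in> {1..<N} ==> x k < x (Suc k) \<or> x k = x (Suc k) & speed v k < speed v (Suc k)"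
  and stop: "!!k. k \<in> {1..<N} ==> x k + speed v k * (b - a) <= x (Suc k) + speed v (Suc k) * (b - a)"
 shows "tracking \<eta> V A a b (%\<tau>. steps N (%k. x k + speed v k * (\<tau> - a)) v)" (is "tracking _ _ _ _ _ ?w")
proof -
 have V: "0 <= V" using admissible_V_nonneg[OF adm] .
 have bd: "\<bar>x k + speed v k * (\<tau> - a)\<bar> <= A + V * (\<tau> - a)" if "k \<in> {1..N}" "\<tau> \<in> {a..b}" for k \<tau>
 proof -
  have "\<bar>speed v k * (\<tau> - a)\<bar> <= V * (\<tau> - a)" using admissible_speed[OF adm that(1)] that by (auto simp: abs_mult intro: mult_right_mono)
  then show ?thesis using A[OF that(1)] by linarith
 qed
 have lip: "(dist1 (?w \<tau>) (?w \<tau>')) <= V * V * \<bar>\<tau> - \<tau>'\<bar>" for \<tau> \<tau>'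
 proof -
  have "(dist1 (?w \<tau>) (?w \<tau>'))
    <= (\<Sum>k\<in>{1..N}. norm (v k - v (k - 1)) * \<bar>(x k + speed v k * (\<tau> - a)) - (x k + speed v k * (\<tau>' - a))\<bar>)"
   unfolding steps_def using fronts_move[of "{1..N}" "%k. v k - v (k - 1)" "%k. x k + speed v k * (\<tau> - a)" "%k. x k + speed v k * (\<tau>' - a)"] admissible_sum[OF adm]
   by simp
  also have "... <= (\<Sum>k\<in>{1..N}. \<bar>v k - v (k - 1)\<bar> * (V * \<bar>\<tau> - \<tau>'\<bar>))"
  proof (rule sum_mono)
   fix k assume "k \<in> {1..N}"
   have "(x k + speed v k * (\<tau> - a)) - (x k + speed v k * (\<tau>' - a)) = speed v k * (\<tau> - \<tau>')" by (simp add: algebra_simps)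
   then show "norm (v k - v (k - 1)) * \<bar>(x k + speed v k * (\<tau> - a)) - (x k + speed v k * (\<tau>' - a))\<bar> <= \<bar>v k - v (k - 1)\<bar> * (V * \<bar>\<tau> - \<tau>'\<bar>)"
    using admissible_speed[OF adm \<open>k \<in> {1..N}\<close>] by (auto simp: abs_mult intro!: mult_left_mono mult_right_mono)
  qed
  also have "... = (\<Sum>k\<in>{1..N}. \<bar>v k - v (k - 1)\<bar>) * (V * \<bar>\<tau> - \<tau>'\<bar>)" by (simp add: sum_distrib_right)
  also have "... <= V * (V * \<bar>\<tau> - \<tau>'\<bar>)" using adm V by (intro mult_right_mono) (auto simp: admissible_def)
  finally show ?thesis by (simp add: mult.assoc)
 qed
 define LS where "LS = (%k. (x k - speed v k * a, speed v k)) ` {1..N}"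
 have loc: "local_tracking \<eta> V (A + V * (\<tau> - a)) LS ?w \<tau>" if "\<tau> \<in> {a..<b} - {a}" for \<tau>
 proof (rule local_trackingI[where h = "b - \<tau>" and N = N and x = "%k. x k + speed v k * (\<tau> - a)" and v = v])
  fix k assume k: "k \<in> {1..<N}"
  show "x k + speed v k * (\<tau> - a) < x (Suc k) + speed v (Suc k) * (\<tau> - a)"
  proof (cases "speed v k < speed v (Suc k)")
   case True
   then have "speed v k * (\<tau> - a) < speed v (Suc k) * (\<tau> - a)" using that by (intro mult_strict_right_mono) auto
   then show ?thesis using start[OF k] by auto
  next
   case False
   then have x: "x k < x (Suc k)" using start[OF k] by auto
   show ?thesis
   proof (cases "speed v k = speed v (Suc k)")
    case False
    then have "(speed v k - speed v (Suc k)) * (\<tau> - a) < (speed v k - speed v (Suc k)) * (b - a)"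
    using \<open>\<not> speed v k < speed v (Suc k)\<close> that by (intro mult_strict_left_mono) auto
    then show ?thesis using stop[OF k] by (simp add: algebra_simps)
   qed (use x in simp)
  qed
 next
  fix k assume k: "k \<in> {1..N}"
  show "\<bar>x k + speed v k * (\<tau> - a)\<bar> <= A + V * (\<tau> - a)" using bd[OF k] that by auto
  have "(x k + speed v k * (\<tau> - a) - speed v k * \<tau>, speed v k) = (x k - speed v k * a, speed v k)" by (simp add: algebra_simps)
  then show "(x k + speed v k * (\<tau> - a) - speed v k * \<tau>, speed v k) \<in> LS" unfolding LS_def using k by (rule image_eqI)
 next
  fix \<tau>' assume "\<tau>' \<in> {\<tau>..<\<tau> + (b - \<tau>)}"
  show "steps N (%k. x k + speed v k * (\<tau>' - a)) v = steps N (%k. x k + speed v k * (\<tau> - a) + speed v k * (\<tau>' - \<tau>)) v" by (simp add: algebra_simps)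
 qed (use that adm in auto)
 have fin: "finite {a}" "finite LS" by (auto simp: LS_def)
 have "\<exists>N' x' v'. admissible \<eta> V N' v' & (\<forall>k\<in>{1..N'}. \<bar>x' k\<bar> <= A + V * (\<tau> - a)) & ?w \<tau> = steps N' x' v'"
  if "\<tau> \<in> {a..b}" for \<tau> by (rule exI[of _ N], rule exI[of _ "%k. x k + speed v k * (\<tau> - a)"], rule exI[of _ v]) (use adm bd that in auto)
 moreover have "\<exists>B LS. finite B & finite LS & (\<forall>\<tau>\<in>{a..<b} - B. local_tracking \<eta> V (A + V * (\<tau> - a)) LS ?w \<tau>)" using fin loc by blast
 ultimately show ?thesis unfolding tracking_def using lip by simp
qed

text \<open>Induction on the number of fronts. Fronts move straight up to the first meeting, where a
  pair merges and one front fewer is left; fronts that start together without spreading merge at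
  once.\<close>

theorem tracking_exists:
 assumes "a <= b" "0 <= \<eta>" "admissible \<eta> V N v"
  and "!!k. k \<in> {1..N} ==> \<bar>x k\<bar> <= A" "!!k. k \<in> {1..<N} ==> x k <= x (Suc k)"
 shows "\<exists>w. tracking \<eta> V A a b w & w a = steps N x v" using assms
proof (induction N arbitrary: a A x v)
 case 0
 then show ?case by (intro exI[of _ "%\<tau>. steps 0 (%k. x k + speed v k * (\<tau> - a)) v"] conjI tracking_straight) auto
next
 case (Suc N)
 note adm = Suc.prems(3)
 have merge: "\<exists>w. tracking \<eta> V A' a' b w & w a' = steps (Suc N) x' v"
  if k: "k \<in> {1..<Suc N}" "x' k = x' (Suc k)" "speed v (Suc k) <= speed v k"
   and A': "!!k. k \<in> {1..Suc N} ==> \<bar>x' k\<bar> <= A'" and so: "!!k. k \<in> {1..<Suc N} ==> x' k <= x' (Suc k)" and "a' <= b"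
  for k x' A' a'
 proof -
  have k': "1 <= k" "k < Suc N" using k by auto
  have "\<exists>w. tracking \<eta> V A' a' b w & w a' = steps N (drop_index k x') (drop_index k v)"
  proof (rule Suc.IH)
   show "admissible \<eta> V N (drop_index k v)" using merge_admissible[OF k' adm k(3) Suc.prems(2)] by simp
   show "\<bar>drop_index k x' i\<bar> <= A'" if "i \<in> {1..N}" for i using that by (auto simp: drop_index_def intro!: A')
   show "drop_index k x' i <= drop_index k x' (Suc i)" if "i \<in> {1..<N}" for i using that so[of i] so[of "Suc i"] k(2) by (auto simp: drop_index_def)
  qed (use that Suc.prems in auto)
  then show ?thesis using merge_steps[OF k' k(2), of v] by simp
 qed
 show ?case
 proof (cases "\<exists>k\<in>{1..<Suc N}. x k = x (Suc k) & speed v (Suc k) <= speed v k")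
  case True
  then show ?thesis using merge[of _ x A a] Suc.prems by blast
 next
  case False
  have start: "x k < x (Suc k) \<or> x k = x (Suc k) & speed v k < speed v (Suc k)" if "k \<in> {1..<Suc N}" for k
   using False Suc.prems(5)[OF that] that by force
  let ?st = "%\<tau>. steps (Suc N) (%k. x k + speed v k * (\<tau> - a)) v"
  show ?thesis
  proof (cases "\<forall>k\<in>{1..<Suc N}. x k + speed v k * (b - a) <= x (Suc k) + speed v (Suc k) * (b - a)")
   case True
   have "tracking \<eta> V A a b ?st" by (rule tracking_straight) (use Suc.prems start True in auto)
   then show ?thesis by (intro exI[of _ ?st]) auto
  next
   case nstop: False
   \<comment> \<open>\<open>Q\<close> holds the approaching neighbours and \<open>T k\<close> the
     time until such a pair meets. The minimum over \<open>Q\<close> is the first collision, since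
     the gaps of the other neighbours never shrink.\<close>
   define Q where "Q = {k \<in> {1..<Suc N}. speed v (Suc k) < speed v k}"
   define T where "T k = (x (Suc k) - x k) / (speed v k - speed v (Suc k))" for k
   obtain j where j: "j \<in> {1..<Suc N}" "x (Suc j) + speed v (Suc j) * (b - a) < x j + speed v j * (b - a)" using nstop by force
   have jQ: "j \<in> Q"
   proof -
    have "\<not> speed v j <= speed v (Suc j)"
    proof
    assume "speed v j <= speed v (Suc j)"
    then have "speed v j * (b - a) <= speed v (Suc j) * (b - a)" using Suc.prems(1) by (intro mult_right_mono) auto
    then show False using j(2) Suc.prems(5)[OF j(1)] by linarith
    qed
    then show ?thesis using j(1) by (auto simp: Q_def)
   qed
   have "finite Q" by (simp add: Q_def)
   then obtain k where k: "k \<in> Q" "!!i. i \<in> Q ==> T k <= T i" using jQ by (metis arg_min_least arg_min_if_finite(1) empty_iff)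
   have Tpos: "0 <= T k" using k(1) Suc.prems(5)[of k] by (auto simp: T_def Q_def)
   have "T j < b - a" using j jQ by (auto simp: T_def Q_def field_simps)
   then have Tk: "T k < b - a" using k(2)[OF jQ] by simp
   define c where "c = a + T k"
   have c: "a <= c" "c <= b" using Tpos Tk by (auto simp: c_def)
   have stop: "x i + speed v i * (c - a) <= x (Suc i) + speed v (Suc i) * (c - a)" if i: "i \<in> {1..<Suc N}" for i
   proof (cases "i \<in> Q")
    case True
    then have pos: "0 < speed v i - speed v (Suc i)" by (auto simp: Q_def)
    have "T k <= T i" using k True by auto
    then have "(speed v i - speed v (Suc i)) * T k <= (speed v i - speed v (Suc i)) * T i" using pos by (intro mult_left_mono) auto
    also have "... = x (Suc i) - x i" using pos by (simp add: T_def)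
    finally show ?thesis by (simp add: c_def algebra_simps)
   next
    case False
    then have "speed v i * (c - a) <= speed v (Suc i) * (c - a)" using i c by (intro mult_right_mono) (auto simp: Q_def)
    then show ?thesis using Suc.prems(5)[OF i] by linarith
   qed
   have t1: "tracking \<eta> V A a c ?st" by (rule tracking_straight) (use Suc.prems start stop c in auto)
   have meet: "x k + speed v k * (c - a) = x (Suc k) + speed v (Suc k) * (c - a)" using k(1) by (auto simp: c_def T_def Q_def field_simps)
   have A': "\<bar>x i + speed v i * (c - a)\<bar> <= A + V * (c - a)" if "i \<in> {1..Suc N}" for i
   proof -
    have "\<bar>speed v i * (c - a)\<bar> <= V * (c - a)" using admissible_speed[OF adm that] c by (auto simp: abs_mult intro: mult_right_mono)
    then show ?thesis using Suc.prems(4)[OF that] by linarith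
   qed
   obtain w where w: "tracking \<eta> V (A + V * (c - a)) c b w" "w c = ?st c"
    using merge[of k "%i. x i + speed v i * (c - a)" "A + V * (c - a)" c] k meet A' stop c by (auto simp: Q_def)
   have g: "tracking \<eta> V A a b (%\<tau>. if \<tau> < c then ?st \<tau> else w \<tau>)" by (rule tracking_glue[OF c t1 w(1)]) (use w in simp)
   show ?thesis by (rule exI[of _ "%\<tau>. if \<tau> < c then ?st \<tau> else w \<tau>"]) (use g w c in auto)
  qed
 qed
qed

section \<open>Entropy solutions and front tracking\<close>

text \<open>Kruzhkov's entropy flux for the flux s^2 / 2.\<close>

definition kflux :: "real => real => real" where
 "kflux u c = sgn (u - c) * (u\<^sup>2 / 2 - c\<^sup>2 / 2)"

lemma kflux_eq: "kflux u c = \<bar>u - c\<bar> * (u + c) / 2"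
 by (auto simp: kflux_def sgn_if abs_if power2_eq_square algebra_simps)

lemma kflux_measurable [measurable]: "(%z. kflux (f z) c) \<in> borel_measurable M" if "f \<in> borel_measurable M"
 unfolding kflux_eq using that by measurable

text \<open>Entropy production against the constant u at a jump from a to b with Rankine-Hugoniot
  speed. It has the wrong sign only for an upward jump with u in between, where it equals (b - u)(u
  - a) <= (b - a)^2 / 4; this is the origin of \<eta> / 4.\<close>

lemma front_dissipation:
 fixes u a b \<eta> :: real
 assumes "b - a <= \<eta>" "0 <= \<eta>"
 shows "(kflux u b - kflux u a) - (a + b) / 2 * (\<bar>u - b\<bar> - \<bar>u - a\<bar>) <= \<eta> / 4 * \<bar>b - a\<bar>"
proof -
 have e: "(kflux u b - kflux u a) - (a + b) / 2 * (\<bar>u - b\<bar> - \<bar>u - a\<bar>) = (\<bar>u - b\<bar> * (u - a) - \<bar>u - a\<bar> * (u - b)) / 2"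
  by (simp add: kflux_eq field_simps)
 have nn: "0 <= \<eta> / 4 * \<bar>b - a\<bar>" using assms by simp
 consider "a <= u" "b <= u" | "u <= a" "u <= b" | "a < u" "u < b" | "b < u" "u < a" by linarith
 then show ?thesis
 proof cases
  case 3
  have "0 <= ((u - a) - (b - u))\<^sup>2" by simp
  then have "(b - u) * (u - a) * 4 <= (b - a) * (b - a)" by (simp add: power2_eq_square algebra_simps)
  also have "... <= \<eta> * (b - a)" using 3 assms by (intro mult_right_mono) auto
  finally have "(b - u) * (u - a) <= \<eta> / 4 * \<bar>b - a\<bar>" using 3 by simp
  moreover have "(\<bar>u - b\<bar> * (u - a) - \<bar>u - a\<bar> * (u - b)) / 2 = (b - u) * (u - a)" using 3 by (simp add: field_simps)
  ultimately show ?thesis unfolding e by simp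
 next
  case 4
  have "0 <= (u - b) * (a - u)" using 4 by simp
  moreover have "(\<bar>u - b\<bar> * (u - a) - \<bar>u - a\<bar> * (u - b)) / 2 = - ((u - b) * (a - u))" using 4 by (simp add: field_simps)
  ultimately show ?thesis unfolding e using nn by linarith
 qed (use nn e in \<open>auto simp: algebra_simps\<close>)
qed

subsection \<open>Travelling test functions\<close>

text \<open>As \<open>m\<close> grows this tends to the indicator of the half-plane to the right of
  the line y = c + s t.\<close>

definition wavefront :: "real => real => real => real \<times> real => real" where
 "wavefront m s c z = ramp (m * (snd z - s * fst z - c))"

definition wavefront' :: "real => real => real => real \<times> real => real" where
 "wavefront' m s c z = m * ramp' (m * (snd z - s * fst z - c))"

lemma ramp_has_derivative_compose:
 assumes "(g has_derivative g') (at z)"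
 shows "((%z. ramp (g z)) has_derivative (%v. ramp' (g z) * g' v)) (at z)"
 using has_derivative_compose[OF assms, of ramp "%v. ramp' (g z) * v"] ramp_deriv[of "g z"] by (simp add: has_field_derivative_def)

lemma wavefront_deriv: "(wavefront m s c has_derivative (%v. wavefront' m s c z * (snd v - s * fst v))) (at z)"
 unfolding wavefront_def[abs_def] wavefront'_def by (rule has_derivative_eq_rhs[OF ramp_has_derivative_compose]) (auto intro!: derivative_eq_intros)

lemma C_k_wavefront: "C_k k (wavefront m s c)"
proof -
 have "bounded_linear (%z::real\<times>real. m * snd z - m * s * fst z)" by (intro bounded_linear_intros)
 from C_k_affine_real[OF this C_k_ramp, of k "- m * c"] show ?thesis unfolding wavefront_def[abs_def] by (simp add: algebra_simps)
qed

text \<open>A smooth cut-off in time, rising on [a, a + \<delta>] and falling on [b - \<delta>, b].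
  Its derivative mollifies evaluation at a minus evaluation at b.\<close>

definition window :: "real => real => real => real => real" where
 "window a b \<delta> t = ramp ((t - a) / \<delta>) - ramp ((t - (b - \<delta>)) / \<delta>)"

definition window' :: "real => real => real => real => real" where
 "window' a b \<delta> t = ramp' ((t - a) / \<delta>) / \<delta> - ramp' ((t - (b - \<delta>)) / \<delta>) / \<delta>"

lemma window_deriv: "((%z. window a b \<delta> (fst z)) has_derivative (%v. window' a b \<delta> (fst z) * fst v)) (at (z::real\<times>real))"
 unfolding window_def window'_def by (rule has_derivative_eq_rhs[OF has_derivative_diff[OF ramp_has_derivative_compose ramp_has_derivative_compose]])
   (auto intro!: derivative_eq_intros simp: divide_inverse algebra_simps)

lemma C_k_window: "C_k k (%z::real\<times>real. window a b \<delta> (fst z))"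
proof -
 have l: "bounded_linear (%z::real\<times>real. (1/\<delta>) * fst z)" by (intro bounded_linear_intros)
 have "C_k k (%z::real\<times>real. ramp ((fst z - e) / \<delta>))" for e using C_k_affine_real[OF l C_k_ramp, of k "- e / \<delta>"] by (simp add: diff_divide_distrib)
 then show ?thesis unfolding window_def by (intro C_k_diff)
qed

lemma window_nonneg: "0 < \<delta> ==> 2 * \<delta> <= b - a ==> 0 <= window a b \<delta> t"
 unfolding window_def by (simp, rule monoD[OF ramp_mono]) (simp add: divide_right_mono)

lemma window_le_1: "window a b \<delta> t <= 1"
 unfolding window_def using ramp_le_1[of "(t - a) / \<delta>"] ramp_nonneg[of "(t - (b - \<delta>)) / \<delta>"] by linarith

lemma window_outside:
 assumes "0 < \<delta>" "2 * \<delta> <= b - a" "t \<notin> {a..b}"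
 shows "window a b \<delta> t = 0" "window' a b \<delta> t = 0"
proof -
 consider "t < a" | "t > b" using assms by force
 then have "window a b \<delta> t = 0 & window' a b \<delta> t = 0"
 proof cases
  case 1
  then have "(t - a) / \<delta> <= 0" "(t - (b - \<delta>)) / \<delta> <= 0" using assms by (auto simp: divide_le_0_iff)
  then show ?thesis by (simp add: window_def window'_def ramp_eq_0 ramp'_eq_0)
 next
  case 2
  then have "(t - a) / \<delta> >= 1" "(t - (b - \<delta>)) / \<delta> >= 1" using assms by (auto simp: field_simps)
  then show ?thesis by (simp add: window_def window'_def ramp_eq_1 ramp'_eq_0)
 qed
 then show "window a b \<delta> t = 0" "window' a b \<delta> t = 0" by auto
qed

lemma ramp'_bounded: "\<exists>C\<ge>0. \<forall>x. ramp' x <= C"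
proof -
 have "compact (ramp' ` {0..1})" by (intro compact_continuous_image ramp'_cont compact_Icc)
 then obtain C where C: "!!x. x \<in> {0..1} ==> norm (ramp' x) <= C" by (meson bounded_iff compact_imp_bounded image_eqI)
 have "ramp' x <= max 0 C" for x
 proof (cases "x \<in> {0..1}")
  case False then show ?thesis by (subst ramp'_eq_0) auto
 qed (use C[of x] in auto)
 then show ?thesis by (intro exI[of _ "max 0 C"]) auto
qed

lemma ramp_measurable [measurable]: "ramp \<in> borel_measurable borel"
 using C_k_ramp[of 0] by (intro borel_measurable_continuous_onI) simp

lemma ramp'_measurable [measurable]: "ramp' \<in> borel_measurable borel"
 by (intro borel_measurable_continuous_onI ramp'_cont)

lemma ramp'_integral: "integrable lborel ramp'" "(LBINT x. ramp' x) = 1"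
proof -
 have "(ramp' has_integral (ramp 1 - ramp 0)) {0..1}" by (rule fundamental_theorem_of_calculus)
    (auto intro!: has_vector_derivative_at_within simp: has_real_derivative_iff_has_vector_derivative[symmetric] intro: has_field_derivative_at_within ramp_deriv)
 then have i: "(ramp' has_integral 1) {0..1}" by (simp add: ramp_eq_0 ramp_eq_1)
 have e: "(%x. indicator {0..1} x *\<^sub>R ramp' x) = ramp'"
 proof
  show "indicator {0..1} x *\<^sub>R ramp' x = ramp' x" for x using ramp'_eq_0[of x] by (cases "x \<in> {0..1}") auto
 qed
 have "set_integrable lborel {0..1} ramp'" by (rule borel_integrable_compact[of "{0..1}" ramp', folded set_integrable_def]) (auto intro: ramp'_cont)
 then have si: "set_integrable lborel {0..1} ramp'" .
 then show "integrable lborel ramp'" unfolding set_integrable_def e .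
 show "(LBINT x. ramp' x) = 1" using set_borel_integral_eq_integral(2)[OF si] i unfolding set_lebesgue_integral_def e by (simp add: integral_unique)
qed

lemma ramp'_scaled_integral:
 assumes "0 < m"
 shows "integrable lborel (%y. m * ramp' (m * (y - c)))" "(LBINT y. m * ramp' (m * (y - c))) = 1"
proof -
 have *: "(%y. m * ramp' (m * (y - c))) = (%y. m * ramp' (- m * c + m * y))" by (simp add: algebra_simps)
 show "integrable lborel (%y. m * ramp' (m * (y - c)))"
  unfolding * using lborel_integrable_real_affine[OF ramp'_integral(1), of m "- m * c"] assms by simp
 show "(LBINT y. m * ramp' (m * (y - c))) = 1" unfolding * using lborel_integral_real_affine[of m ramp' "- m * c"] assms ramp'_integral(2) by simp
qed

lemma integrable_plane:
 fixes f :: "real \<times> real => real"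
 assumes [measurable]: "f \<in> borel_measurable borel" and "!!z. \<bar>f z\<bar> <= M" "!!z. z \<notin> {a..b} \<times> {c..d} ==> f z = 0"
 shows "integrable lborel f"
proof (rule Bochner_Integration.integrable_bound)
 have "{a..b} \<times> {c..d} = cbox (a, c) (b, d)" by (simp add: cbox_Pair_eq)
 moreover have "integrable lborel (indicat_real (cbox (a, c) (b, d)))" by (rule integrable_real_indicator[OF _ emeasure_lborel_cbox_finite]) simp
 ultimately show "integrable lborel (%z. M * indicator ({a..b} \<times> {c..d}) z :: real)" by simp
 have "0 <= M" using assms(2) abs_ge_zero order_trans by blast
 then show "AE z in lborel. norm (f z) <= norm (M * indicator ({a..b} \<times> {c..d}) z :: real)" using assms(2,3) by (auto simp: indicator_def)
qed simp

lemma integral_plane: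
 fixes f :: "real \<times> real => real"
 assumes "integrable lborel f"
 shows "(LBINT z. f z) = (LBINT t. (LBINT y. f (t, y)))"
  and "integrable lborel (%t. \<integral>y. f (t, y) \<partial>lborel)"
 using lborel_pair.integral_fst'[of f] lborel_pair.integrable_fst'[of f] assms by (simp_all add: lborel_prod)

text \<open>The kernel is a probability density supported in [c, c + \<delta>]. Uniformity in c
  covers both kernels of \<open>window'\<close>, the one that starts at the evaluation point and the
  one that ends there.\<close>

lemma mollify:
 fixes g :: "real => real"
 assumes g: "continuous_on {0..} g" and "0 < a" "0 < e"
 shows "\<exists>d>0. \<forall>\<delta> c. 0 < \<delta> & \<delta> <= d & a - \<delta> <= c & c <= a -->
  integrable lborel (%t. ramp' ((t - c) / \<delta>) / \<delta> * g t) & \<bar>(LBINT t. ramp' ((t - c) / \<delta>) / \<delta> * g t) - g a\<bar> <= e"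
proof -
 have "isCont g a" using continuous_on_subset[OF g, of "{0<..}"] \<open>0 < a\<close> by (simp add: continuous_on_eq_continuous_at subset_eq)
 then obtain d where d: "d > 0" "!!t. \<bar>t - a\<bar> < d ==> \<bar>g t - g a\<bar> < e" using \<open>0 < e\<close> unfolding continuous_at_eps_delta dist_real_def by metis
 define d' where "d' = min (d/2) (a/2)"
 have d': "d' > 0" "d' < d" "d' < a" using d \<open>0 < a\<close> by (auto simp: d'_def)
 have "integrable lborel (%t. ramp' ((t - c) / \<delta>) / \<delta> * g t) & \<bar>(LBINT t. ramp' ((t - c) / \<delta>) / \<delta> * g t) - g a\<bar> <= e"
  if \<delta>: "0 < \<delta>" "\<delta> <= d'" and c: "a - \<delta> <= c" "c <= a" for \<delta> c
 proof -
  let ?r = "%t. ramp' ((t - c) / \<delta>) / \<delta>"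
  have r: "integrable lborel ?r" "(LBINT t. ?r t) = 1" using ramp'_scaled_integral[of "1/\<delta>" c] \<delta> by simp_all
  have supp: "?r t = 0" if "t \<notin> {c..c+\<delta>}" for t
  proof -
   have "(t - c) / \<delta> <= 0 \<or> 1 <= (t - c) / \<delta>" using that \<delta> by (auto simp: field_simps)
   then show ?thesis using ramp'_eq_0 by simp
  qed
  have "continuous_on {c..c+\<delta>} (%t. ?r t * g t)"
   by (intro continuous_intros continuous_on_compose2[OF ramp'_cont[of UNIV]] continuous_on_subset[OF g]) (use \<delta> c d' in auto)
  from borel_integrable_compact[OF compact_Icc this]
  have int: "integrable lborel (%t. ?r t * g t)"
   by (rule Bochner_Integration.integrable_cong[THEN iffD1, rotated 2]) (use supp in \<open>auto simp: indicator_def\<close>)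
  have b: "?r t * (g a - e) <= ?r t * g t & ?r t * g t <= ?r t * (g a + e)" for t
  proof (cases "t \<in> {c..c+\<delta>}")
   case True
   then have "\<bar>t - a\<bar> < d" using \<delta> c d' by (auto simp: abs_less_iff)
   from d(2)[OF this] show ?thesis using ramp'_nonneg \<delta> by (intro conjI mult_left_mono) auto
  next
   case False
   then show ?thesis by (simp only: supp mult_zero_left order_refl simp_thms)
  qed
  have "(LBINT t. ?r t * (g a - e)) <= (LBINT t. ?r t * g t)" "(LBINT t. ?r t * g t) <= (LBINT t. ?r t * (g a + e))"
   by (rule integral_mono, (intro integrable_mult_left r(1) int)+, use b in blast)+
  then show ?thesis using int unfolding integral_mult_left_zero r(2) by auto
 qed
 then show ?thesis using d'(1) by blast
qed

lemma plane_measurable_fst [measurable]: "(fst :: real \<times> real => real) \<in> borel_measurable borel"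
 by (intro borel_measurable_continuous_onI continuous_intros)

lemma plane_measurable_snd [measurable]: "(snd :: real \<times> real => real) \<in> borel_measurable borel"
 by (intro borel_measurable_continuous_onI continuous_intros)

text \<open>The evolution is measurable only on the half-plane and bounded only almost everywhere on
  each slice. Cutting off in time and truncating the values gives a bounded Borel function on the
  plane that still agrees with it on every slice almost everywhere, so that Fubini and dominated
  convergence apply.\<close>

lemma bounded_L1_evolution_representative:
 assumes "bounded_L1_evolution \<sigma>0 \<sigma>"
 obtains u M where "u \<in> borel_measurable borel" "0 <= M" "!!z. \<bar>u z\<bar> <= M"
  "!!\<tau>. 0 <= \<tau> ==> AE y in lborel. u (\<tau>, y) = \<sigma> \<tau> y"
  "AE z in lborel. 0 <= fst z --> u z = \<sigma> (fst z) (snd z)"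
proof -
 define s where "s z = indicator ({0..} \<times> UNIV) z * \<sigma> (fst z) (snd z)" for z :: "real \<times> real"
 have s [measurable]: "s \<in> borel_measurable borel" using assms unfolding bounded_L1_evolution_def set_borel_measurable_def s_def[abs_def] by simp
 have s_eq: "0 <= fst z ==> s z = \<sigma> (fst z) (snd z)" for z unfolding s_def by (cases z) auto
 obtain M0 where M0: "!!\<tau>. 0 <= \<tau> ==> AE y in lborel. \<bar>\<sigma> \<tau> y\<bar> <= M0" using assms unfolding bounded_L1_evolution_def by auto
 define M where "M = max 0 M0"
 define u where "u z = max (- M) (min M (s z))" for z
 have ae: "AE y in lborel. u (\<tau>, y) = \<sigma> \<tau> y" if "0 <= \<tau>" for \<tau> using M0[OF that] by eventually_elim (use s_eq that in \<open>auto simp: u_def M_def\<close>)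
 have um [measurable]: "u \<in> borel_measurable borel" unfolding u_def[abs_def] by measurable
 have "AE z in lborel \<Otimes>\<^sub>M lborel. u z = s z"
 proof (rule lborel_pair.AE_pair_measure)
  show "{x \<in> space (lborel \<Otimes>\<^sub>M lborel). u x = s x} \<in> sets (lborel \<Otimes>\<^sub>M lborel)" unfolding lborel_prod by measurable
  have "AE y in lborel. u (\<tau>, y) = s (\<tau>, y)" for \<tau>
  proof (cases "0 <= \<tau>")
   case True then show ?thesis using ae[OF True] s_eq[of "(\<tau>, _)"] by simp
  next
   case False then show ?thesis by (simp add: u_def s_def M_def)
  qed
  then show "AE x in lborel. AE y in lborel. u (x, y) = s (x, y)" by simp
 qed
 then have ae2: "AE z in lborel. 0 <= fst z --> u z = \<sigma> (fst z) (snd z)" unfolding lborel_prod by eventually_elim (use s_eq in auto)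
 show ?thesis by (rule that[of u M, OF um _ _ ae ae2]) (auto simp: M_def u_def)
qed

lemma L1_evolution_integrable:
 assumes "bounded_L1_evolution \<sigma>0 \<sigma>" "0 <= \<tau>" shows "integrable lborel (\<sigma> \<tau>)" using assms unfolding bounded_L1_evolution_def by auto

lemma L1_evolution_tendsto:
 assumes ev: "bounded_L1_evolution \<sigma>0 \<sigma>" and "0 <= t"
 shows "((%\<tau>. \<integral>y. \<bar>\<sigma> \<tau> y - \<sigma> t y\<bar> \<partial>lborel) \<longlongrightarrow> 0) (at t within {0..})"
proof -
 have "((%\<tau>. L1_dist (\<sigma> \<tau>) (\<sigma> t)) \<longlongrightarrow> 0) (at t within {0..})" using assms unfolding bounded_L1_evolution_def by auto
 moreover have "eventually (%\<tau>. L1_dist (\<sigma> \<tau>) (\<sigma> t) = ennreal (dist1 (\<sigma> \<tau>) (\<sigma> t))) (at t within {0..})"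
  unfolding eventually_at_filter using L1_evolution_integrable[OF ev] \<open>0 <= t\<close> by (auto simp: L1_dist_eq)
 ultimately have "((%\<tau>. ennreal (dist1 (\<sigma> \<tau>) (\<sigma> t))) \<longlongrightarrow> ennreal 0) (at t within {0..})" using Lim_transform_eventually by (metis (mono_tags) ennreal_0)
 then show ?thesis by (subst (asm) tendsto_ennreal_iff) (auto intro: integral_nonneg)
qed

lemma integral_abs_diff_continuous:
 fixes f g :: "real => real => real"
 assumes fi: "!!t. t \<in> T ==> integrable lborel (f t)" and gi: "!!t. t \<in> T ==> integrable lborel (g t)"
  and fc: "!!t. t \<in> T ==> ((%\<tau>. \<integral>y. \<bar>f \<tau> y - f t y\<bar> \<partial>lborel) \<longlongrightarrow> 0) (at t within T)"
  and gc: "!!t. t \<in> T ==> ((%\<tau>. \<integral>y. \<bar>g \<tau> y - g t y\<bar> \<partial>lborel) \<longlongrightarrow> 0) (at t within T)"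
 shows "continuous_on T (%t. \<integral>y. \<bar>f t y - g t y\<bar> \<partial>lborel)" unfolding continuous_on_def
proof
 fix t assume t: "t \<in> T"
 let ?G = "%t. \<integral>y. \<bar>f t y - g t y\<bar> \<partial>lborel"
 have "\<bar>?G \<tau> - ?G t\<bar> <= (dist1 (f \<tau>) (f t)) + (dist1 (g \<tau>) (g t))" if "\<tau> \<in> T" for \<tau>
 proof -
  note i = fi[OF that] gi[OF that] fi[OF t] gi[OF t]
  have "\<bar>?G \<tau> - ?G t\<bar> = \<bar>\<integral>y. \<bar>f \<tau> y - g \<tau> y\<bar> - \<bar>f t y - g t y\<bar> \<partial>lborel\<bar>" using i by (subst Bochner_Integration.integral_diff) auto
  also have "... <= (LBINT y. \<bar>\<bar>f \<tau> y - g \<tau> y\<bar> - \<bar>f t y - g t y\<bar>\<bar>)" by (rule integral_abs_bound)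
  also have "... <= (LBINT y. \<bar>f \<tau> y - f t y\<bar> + \<bar>g \<tau> y - g t y\<bar>)" by (rule integral_mono) (use i in auto)
  also have "... = (dist1 (f \<tau>) (f t)) + (dist1 (g \<tau>) (g t))" using i by (intro Bochner_Integration.integral_add) auto
  finally show ?thesis .
 qed
 then have "eventually (%\<tau>. norm (?G \<tau> - ?G t) <= (dist1 (f \<tau>) (f t)) + (dist1 (g \<tau>) (g t))) (at t within T)" by (auto simp: eventually_at_filter)
 moreover have "((%\<tau>. (dist1 (f \<tau>) (f t)) + (dist1 (g \<tau>) (g t))) \<longlongrightarrow> 0) (at t within T)" using tendsto_add[OF fc[OF t] gc[OF t]] by simp
 ultimately have "((%\<tau>. ?G \<tau> - ?G t) \<longlongrightarrow> 0) (at t within T)" by (rule Lim_null_comparison)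
 then show "(?G \<longlongrightarrow> ?G t) (at t within T)" by (simp add: LIM_zero_iff)
qed

text \<open>By Tonelli, since the L1 norm of the slices is continuous in time, hence bounded on a
  compact interval.\<close>

lemma representative_integrable_strip:
 assumes ev: "bounded_L1_evolution \<sigma>0 \<sigma>" and [measurable]: "u \<in> borel_measurable borel"
  and u: "!!\<tau>. 0 <= \<tau> ==> AE y in lborel. u (\<tau>, y) = \<sigma> \<tau> y" and "0 <= a"
 shows "integrable lborel (%z. indicator {a..b} (fst z) * u z)"
proof -
 have "continuous_on {0..} (%t. \<integral>y. \<bar>\<sigma> t y - (%_ _. 0) t y\<bar> \<partial>lborel)"
  by (rule integral_abs_diff_continuous) (use L1_evolution_tendsto[OF ev] L1_evolution_integrable[OF ev] in auto)
 then have c: "continuous_on {a..b} (%t. \<integral>y. \<bar>\<sigma> t y\<bar> \<partial>lborel)" by simp (rule continuous_on_subset, use \<open>0 <= a\<close> in auto)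
 have "compact ((%t. \<integral>y. \<bar>\<sigma> t y\<bar> \<partial>lborel) ` {a..b})" by (rule compact_continuous_image[OF c]) simp
 then obtain C where C: "!!t. t \<in> {a..b} ==> norm (LBINT y. \<bar>\<sigma> t y\<bar>) <= C" by (meson bounded_iff compact_imp_bounded image_eqI)
 have C': "(LBINT y. \<bar>\<sigma> t y\<bar>) <= C" if "t \<in> {a..b}" for t using C[OF that] by simp
 have "(\<integral>\<^sup>+z. ennreal (norm (indicator {a..b} (fst z) * u z)) \<partial>lborel) = (\<integral>\<^sup>+t. (\<integral>\<^sup>+y. ennreal (norm (indicator {a..b} t * u (t, y))) \<partial>lborel) \<partial>lborel)"
  by (subst lborel_prod[symmetric], subst lborel.nn_integral_fst[symmetric]) (auto simp: lborel_prod)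
 also have "... <= (\<integral>\<^sup>+t. ennreal (max 0 C) * indicator {a..b} t \<partial>lborel)"
 proof (rule nn_integral_mono)
  fix t :: real
  show "(\<integral>\<^sup>+y. ennreal (norm (indicator {a..b} t * u (t, y))) \<partial>lborel) <= ennreal (max 0 C) * indicator {a..b} t"
  proof (cases "t \<in> {a..b}")
   case True
   then have "0 <= t" using \<open>0 <= a\<close> by simp
   have "(\<integral>\<^sup>+y. ennreal (norm (indicator {a..b} t * u (t, y))) \<partial>lborel) = (\<integral>\<^sup>+y. ennreal \<bar>\<sigma> t y\<bar> \<partial>lborel)"
    using u[OF \<open>0 <= t\<close>] True by (intro nn_integral_cong_AE) auto
   also have "... = ennreal (LBINT y. \<bar>\<sigma> t y\<bar>)" by (rule nn_integral_eq_integral) (use L1_evolution_integrable[OF ev \<open>0 <= t\<close>] in auto)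
   also have "... <= ennreal (max 0 C)" using C'[OF True] by (intro ennreal_leI) simp
   finally show ?thesis using True by simp
  qed simp
 qed
 also have "... < \<infinity>" by (cases "a <= b") (auto simp: nn_integral_cmult_indicator ennreal_mult_less_top)
 finally show ?thesis by (intro integrableI_bounded) auto
qed

lemma test_function_I:
 assumes "!!k. C_k k \<psi>" "!!z. z \<notin> {a..b} \<times> {c..d} ==> \<psi> z = 0" "0 < a"
 shows "test_function \<psi>" unfolding test_function_def smooth_def
 using assms by (intro conjI allI exI[of _ "{a..b} \<times> {c..d}"]) (auto intro: compact_Times)

lemma half_plane_integral:
 assumes ev: "bounded_L1_evolution \<sigma>0 \<sigma>" and um [measurable]: "u \<in> borel_measurable borel"
  and u: "AE z in lborel. 0 <= fst z --> u z = \<sigma> (fst z) (snd z)"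
  and \<Phi>: "!!f. f \<in> borel_measurable borel ==> (%z. \<Phi> (f z) z :: real) \<in> borel_measurable borel"
  and z: "!!s z. fst z < 0 ==> \<Phi> s z = 0"
 shows "(LINT z:{0..} \<times> UNIV|lborel. \<Phi> (\<sigma> (fst z) (snd z)) z) = (LBINT z. \<Phi> (u z) z)" unfolding set_lebesgue_integral_def
proof (rule integral_cong_AE)
 let ?s = "%z. indicator ({0..} \<times> UNIV) z *\<^sub>R \<sigma> (fst z) (snd z)"
 have "?s \<in> borel_measurable borel" using ev by (simp add: bounded_L1_evolution_def set_borel_measurable_def)
 then have "(%z. \<Phi> (?s z) z) \<in> borel_measurable borel" by (rule \<Phi>)
 also have "(%z. \<Phi> (?s z) z) = (%z. indicator ({0..} \<times> UNIV) z *\<^sub>R \<Phi> (\<sigma> (fst z) (snd z)) z)" using z by (auto simp: fun_eq_iff indicator_def)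
 finally show "(%z. indicator ({0..} \<times> UNIV) z *\<^sub>R \<Phi> (\<sigma> (fst z) (snd z)) z) \<in> borel_measurable lborel" by simp
 show "(%z. \<Phi> (u z) z) \<in> borel_measurable lborel" using \<Phi>[OF um] by simp
 show "AE z in lborel. indicator ({0..} \<times> UNIV) z *\<^sub>R \<Phi> (\<sigma> (fst z) (snd z)) z = \<Phi> (u z) z"
  using u by eventually_elim (use z in \<open>auto simp: indicator_def mem_Times_iff\<close>)
qed

lemma entropy_inequality:
 assumes ent: "entropy_solution (%s. s\<^sup>2 / 2) \<sigma>0 \<sigma>"
  and u: "AE z in lborel. 0 <= fst z --> u z = \<sigma> (fst z) (snd z)"
  and \<psi>: "test_function \<psi>" "!!z. 0 <= \<psi> z" "!!z. (\<psi> has_derivative D z) (at z)"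
  and z: "!!z. fst z < 0 ==> D z = (%_. 0)"
  and um: "u \<in> borel_measurable borel" and [measurable]: "(%z. D z (1, 0)) \<in> borel_measurable borel" "(%z. D z (0, 1)) \<in> borel_measurable borel"
 shows "0 <= (LBINT z. \<bar>u z - c\<bar> * D z (1, 0) + kflux (u z) c * D z (0, 1))"
proof -
 have D: "frechet_derivative \<psi> (at z) = D z" for z using frechet_derivative_at[OF \<psi>(3)] by simp
 have "0 <= (LINT z:{0..} \<times> UNIV|lborel. \<bar>\<sigma> (fst z) (snd z) - c\<bar> * D z (1, 0) + kflux (\<sigma> (fst z) (snd z)) c * D z (0, 1))"
  using ent \<psi> unfolding entropy_solution_def kflux_def D by (auto simp: D)
 also have "... = (LBINT z. \<bar>u z - c\<bar> * D z (1, 0) + kflux (u z) c * D z (0, 1))"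
  by (rule half_plane_integral[OF _ um u, of \<sigma>0 "%s z. \<bar>s - c\<bar> * D z (1, 0) + kflux s c * D z (0, 1)"])
   (use ent z in \<open>auto simp: entropy_solution_def\<close>)
 finally show ?thesis .
qed

text \<open>As \<delta> tends to 0, the weight \<open>window'\<close> becomes evaluation at a minus
  evaluation at b. A weak inequality in time thus compares the values at the two times.\<close>

lemma window_increment:
 fixes f :: "real \<times> real => real"
 assumes g: "continuous_on {0..} g" and ab: "0 < a" "a < b" and fg: "!!t. t \<in> {a..b} ==> (LBINT y. f (t, y)) = g t"
  and f: "!!\<delta>. 0 < \<delta> ==> 2 * \<delta> <= b - a ==>
   integrable lborel (%z. window' a b \<delta> (fst z) * f z) & 0 <= (LBINT z. window' a b \<delta> (fst z) * f z) + c"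
 shows "g b - g a <= c"
proof (rule field_le_epsilon)
 fix e :: real assume e: "0 < e"
 have e2: "0 < e/2" "0 < b" using e ab by auto
 obtain d1 where d1: "d1 > 0" "!!\<delta> c. 0 < \<delta> ==> \<delta> <= d1 ==> a - \<delta> <= c ==> c <= a ==> integrable lborel (%t. ramp' ((t - c) / \<delta>) / \<delta> * g t) &
   \<bar>(LBINT t. ramp' ((t - c) / \<delta>) / \<delta> * g t) - g a\<bar> <= e/2" using mollify[OF g ab(1) e2(1)] by blast
 obtain d2 where d2: "d2 > 0" "!!\<delta> c. 0 < \<delta> ==> \<delta> <= d2 ==> b - \<delta> <= c ==> c <= b ==> integrable lborel (%t. ramp' ((t - c) / \<delta>) / \<delta> * g t) &
   \<bar>(LBINT t. ramp' ((t - c) / \<delta>) / \<delta> * g t) - g b\<bar> <= e/2" using mollify[OF g e2(2,1)] by blast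
 define \<delta> where "\<delta> = min (min d1 d2) ((b - a) / 2)"
 have \<delta>: "0 < \<delta>" "2 * \<delta> <= b - a" "\<delta> <= d1" "\<delta> <= d2" using d1(1) d2(1) ab min.cobounded2[of "min d1 d2" "(b - a) / 2"] unfolding \<delta>_def by auto
 let ?r = "%c t. ramp' ((t - c) / \<delta>) / \<delta> * g t"
 have m: "integrable lborel (?r a) & \<bar>(LBINT t. ?r a t) - g a\<bar> <= e/2"
  "integrable lborel (?r (b - \<delta>)) & \<bar>(LBINT t. ?r (b - \<delta>) t) - g b\<bar> <= e/2" using d1(2)[of \<delta> a] d2(2)[of \<delta> "b - \<delta>"] \<delta> by auto
 have "(LBINT y. window' a b \<delta> t * f (t, y)) = ?r a t - ?r (b - \<delta>) t" for t
  unfolding left_diff_distrib[symmetric] window'_def[symmetric] integral_mult_right_zero using window_outside[OF \<delta>(1,2), of t] fg[of t] by auto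
 then have "(LBINT z. window' a b \<delta> (fst z) * f z) = (LBINT t. ?r a t) - (LBINT t. ?r (b - \<delta>) t)"
  using m f[OF \<delta>(1,2)] by (simp add: integral_plane(1))
 then show "g b - g a <= c + e" using m f[OF \<delta>(1,2)] by linarith
qed

section \<open>Kruzhkov's inequality against finitely many straight fronts\<close>

lemma abel_fronts:
 fixes f d :: "nat => real"
 shows "(\<Sum>k\<le>N. f k * (d k - d (Suc k))) = f 0 * d 0 - f N * d (Suc N) + (\<Sum>k\<in>{1..N}. (f k - f (k - 1)) * d k)"
 by (induction N) (auto simp: algebra_simps)

lemma sum_step_weights:
 fixes f b :: "nat => real"
 assumes "j <= N" "!!k. k <= j ==> b k = 1" "!!k. j < k ==> k <= Suc N ==> b k = 0"
 shows "(\<Sum>k\<le>N. f k * (b k - b (Suc k))) = f j"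
proof -
 have "(\<Sum>k\<le>N. f k * (b k - b (Suc k))) = (\<Sum>k\<in>{j}. f k * (b k - b (Suc k)))"
 proof (rule sum.mono_neutral_right)
  show "\<forall>i\<in>{..N} - {j}. f i * (b i - b (Suc i)) = 0"
  proof
   fix i assume "i \<in> {..N} - {j}"
   then consider "i < j" | "j < i" "i <= N" by fastforce
   then show "f i * (b i - b (Suc i)) = 0" by cases (use assms(2)[of i] assms(2)[of "Suc i"] assms(3)[of i] assms(3)[of "Suc i"] in auto)
  qed
 qed (use assms in auto)
 then show ?thesis using assms(2)[of j] assms(3)[of "Suc j"] assms(1) by simp
qed

definition bounded_fun :: "('a => real) => bool" where "bounded_fun f \<longleftrightarrow> (\<exists>B. \<forall>x. \<bar>f x\<bar> <= B)"

lemma bounded_fun_const: "bounded_fun (%x. c)" by (auto simp: bounded_fun_def)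

lemma bounded_funI: "(!!x. \<bar>f x\<bar> <= B) ==> bounded_fun f" by (auto simp: bounded_fun_def)

lemma bounded_fun_add: "bounded_fun f ==> bounded_fun g ==> bounded_fun (%x. f x + g x)"
 unfolding bounded_fun_def by (metis abs_triangle_ineq add_mono order_trans)

lemma bounded_fun_minus: "bounded_fun f ==> bounded_fun (%x. - f x)"
 unfolding bounded_fun_def by simp

lemma bounded_fun_diff: "bounded_fun f ==> bounded_fun g ==> bounded_fun (%x. f x - g x)"
 using bounded_fun_add[of f "%x. - g x"] bounded_fun_minus[of g] by simp

lemma bounded_fun_mult: "bounded_fun f ==> bounded_fun g ==> bounded_fun (%x. f x * g x)"
 unfolding bounded_fun_def abs_mult by (meson abs_ge_zero mult_mono order_trans)

lemma bounded_fun_divide: "bounded_fun f ==> bounded_fun (%x. f x / c)"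
 unfolding divide_inverse by (intro bounded_fun_mult bounded_fun_const)

lemma bounded_fun_abs: "bounded_fun f ==> bounded_fun (%x. \<bar>f x\<bar>)"
 unfolding bounded_fun_def by simp

lemma bounded_fun_sum: "(!!i. i \<in> I ==> bounded_fun (f i)) ==> bounded_fun (%x. \<Sum>i\<in>I. f i x)"
 by (induction I rule: infinite_finite_induct) (auto intro: bounded_fun_add bounded_fun_const)

lemmas bounded_fun_intros = bounded_fun_const bounded_fun_add bounded_fun_minus bounded_fun_diff bounded_fun_mult
 bounded_fun_divide bounded_fun_abs bounded_fun_sum

lemma bounded_fun_ramp': "bounded_fun (%x. ramp' (f x))"
 using ramp'_bounded ramp'_nonneg by (auto simp: bounded_fun_def)

lemma bounded_fun_wavefront: "bounded_fun (wavefront m s c)"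
 by (rule bounded_funI[of _ 1]) (auto simp: wavefront_def ramp_nonneg ramp_le_1)

lemma bounded_fun_wavefront': "bounded_fun (wavefront' m s c)"
 unfolding wavefront'_def[abs_def] by (intro bounded_fun_intros bounded_fun_ramp')

lemma bounded_fun_window: "bounded_fun (%z. window a b \<delta> (f z))"
 unfolding window_def[abs_def] using bounded_funI[of "%z. ramp (g z)" 1 for g :: "_ => real"]
 by (intro bounded_fun_intros) (auto simp: ramp_nonneg ramp_le_1)

lemma bounded_fun_window': "bounded_fun (%z. window' a b \<delta> (f z))"
 unfolding window'_def[abs_def] by (intro bounded_fun_intros bounded_fun_ramp')

lemma integrable_plane':
 fixes f :: "real \<times> real => real"
 assumes "f \<in> borel_measurable borel" "bounded_fun f" "!!z. z \<notin> {a..b} \<times> {c..d} ==> f z = 0"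
 shows "integrable lborel f" using assms integrable_plane unfolding bounded_fun_def by metis

lemma wavefront_measurable [measurable]: "wavefront m s c \<in> borel_measurable borel"
 unfolding wavefront_def[abs_def] by measurable
lemma wavefront'_measurable [measurable]: "wavefront' m s c \<in> borel_measurable borel"
 unfolding wavefront'_def[abs_def] by measurable
lemma window_measurable [measurable]: "window a b \<delta> \<in> borel_measurable borel"
 unfolding window_def[abs_def] by measurable
lemma window'_measurable [measurable]: "window' a b \<delta> \<in> borel_measurable borel"
 unfolding window'_def[abs_def] by measurable

text \<open>The lines cut the strip into cells on which the tracked function is a constant v k.
  Testing Kruzhkov's inequality for this constant with a smoothed indicator of the cell, and summing
  over k, compares u with the tracked function without doubling of variables.\<close>

locale moving_partition =
 fixes N :: nat and c v :: "nat => real" and \<eta> V A a b \<delta> M :: real and u :: "real \<times> real => real"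
 assumes adm: "admissible \<eta> V N v" and \<eta>: "0 <= \<eta>" and A: "0 <= A"
  and lines: "!!k t. k \<in> {1..N} ==> t \<in> {a..b} ==> \<bar>c k + speed v k * t\<bar> <= A"
  and sorted: "!!k t. k \<in> {1..<N} ==> t \<in> {a..b} ==> c k + speed v k * t <= c (Suc k) + speed v (Suc k) * t"
  and \<delta>: "0 < \<delta>" "2 * \<delta> <= b - a" and a: "0 < a"
  and um [measurable]: "u \<in> borel_measurable borel" and uM: "!!z. \<bar>u z\<bar> <= M"
  and ustrip: "integrable lborel (%z. indicator {a..b} (fst z) * u z)"
begin

text \<open>Indices 0 and N + 1 are artificial fronts at rest at -R n and R n, which make the outer
  cells bounded. Their steepness stays 1, so their contributions remain dominated, while the true
  fronts sharpen with n. The offset 2 in \<open>R\<close> keeps the outer ramps away from the inner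
  ones.\<close>

definition mm where "mm n k = (if k = 0 \<or> k = Suc N then 1 else real (Suc n))"
definition R where "R n = A + 2 + real n"
definition cc where "cc n k = (if k = 0 then - R n else if k = Suc N then R n else c k)"
definition ss where "ss k = (if k = 0 \<or> k = Suc N then 0 else speed v k)"
definition Z where "Z n k = wavefront (mm n k) (ss k) (cc n k)"
definition Z' where "Z' n k = wavefront' (mm n k) (ss k) (cc n k)"
definition th where "th z = window a b \<delta> (fst z)" for z :: "real \<times> real"
definition th' where "th' z = window' a b \<delta> (fst z)" for z :: "real \<times> real"
definition W where "W z = steps N (%k. c k + speed v k * fst z) v (snd z)"

lemma meas [measurable]: "Z n k \<in> borel_measurable borel" "Z' n k \<in> borel_measurable borel"
 "th \<in> borel_measurable borel" "th' \<in> borel_measurable borel" "W \<in> borel_measurable borel"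
 unfolding Z_def Z'_def th_def[abs_def] th'_def[abs_def] W_def[abs_def] steps_def fronts_def by measurable

lemma bdd: "bounded_fun (Z n k)" "bounded_fun (Z' n k)" "bounded_fun th" "bounded_fun th'" "bounded_fun u"
 unfolding Z_def Z'_def th_def[abs_def] th'_def[abs_def]
 by (rule bounded_fun_wavefront bounded_fun_wavefront' bounded_fun_window bounded_fun_window' bounded_funI[OF uM])+

lemma th_outside: "fst z \<notin> {a..b} ==> th z = 0" "fst z \<notin> {a..b} ==> th' z = 0"
 unfolding th_def th'_def using window_outside[OF \<delta>] by auto

lemma th_nonneg: "0 <= th z" unfolding th_def by (rule window_nonneg[OF \<delta>])

lemma Z'_nonneg: "0 <= Z' n k z"
 unfolding Z'_def wavefront'_def mm_def by (auto intro!: mult_nonneg_nonneg ramp'_nonneg)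

lemma Z_range: "0 <= Z n k z" "Z n k z <= 1"
 unfolding Z_def wavefront_def by (auto intro: ramp_nonneg ramp_le_1)

lemma scale_ge_1: "1 <= x ==> 1 <= real (Suc n) * x"
 using mult_mono[of 1 "real (Suc n)" 1 x] by simp

lemma inner_low:
 assumes "fst z \<in> {a..b}" "k \<in> {1..N}" "snd z <= - A"
 shows "Z n k z = 0" "Z' n k z = 0"
proof -
 have "snd z - speed v k * fst z - c k <= 0" using lines[OF assms(2,1)] assms(3) by (auto simp: abs_le_iff)
 then have "real (Suc n) * (snd z - speed v k * fst z - c k) <= 0" by (intro mult_nonneg_nonpos) auto
 then show "Z n k z = 0" "Z' n k z = 0" using assms(2)
  by (auto simp: Z_def Z'_def wavefront_def wavefront'_def mm_def ss_def cc_def ramp_eq_0 ramp'_eq_0)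
qed

lemma inner_high:
 assumes "fst z \<in> {a..b}" "k \<in> {1..N}" "A + 1 <= snd z"
 shows "Z n k z = 1" "Z' n k z = 0"
proof -
 have "1 <= snd z - speed v k * fst z - c k" using lines[OF assms(2,1)] assms(3) by (auto simp: abs_le_iff)
 then have "1 <= real (Suc n) * (snd z - speed v k * fst z - c k)" by (rule scale_ge_1)
 then show "Z n k z = 1" "Z' n k z = 0" using assms(2)
  by (auto simp: Z_def Z'_def wavefront_def wavefront'_def mm_def ss_def cc_def ramp_eq_1 ramp'_eq_0)
qed

lemma Z_outer: "Z n 0 z = ramp (snd z + R n)" "Z n (Suc N) z = ramp (snd z - R n)"
 "Z' n 0 z = ramp' (snd z + R n)" "Z' n (Suc N) z = ramp' (snd z - R n)"
 by (auto simp: Z_def Z'_def wavefront_def wavefront'_def mm_def ss_def cc_def)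

lemma Z_low:
 assumes "fst z \<in> {a..b}" "k <= Suc N" "snd z <= - R n"
 shows "Z n k z = 0" "Z' n k z = 0"
proof -
 have R: "A + 2 <= R n" by (simp add: R_def)
 consider "k = 0" | "k = Suc N" | "k \<in> {1..N}" using assms(2) by force
 then have "Z n k z = 0 & Z' n k z = 0" by cases (use assms inner_low[of z k] R A in \<open>auto simp: Z_outer ramp_eq_0 ramp'_eq_0\<close>)
 then show "Z n k z = 0" "Z' n k z = 0" by auto
qed

lemma Z_high:
 assumes "fst z \<in> {a..b}" "k <= Suc N" "R n + 1 <= snd z"
 shows "Z n k z = 1" "Z' n k z = 0"
proof -
 have R: "A + 2 <= R n" by (simp add: R_def)
 consider "k = 0" | "k = Suc N" | "k \<in> {1..N}" using assms(2) by force
 then have "Z n k z = 1 & Z' n k z = 0" by cases (use assms inner_high[of z k] R A in \<open>auto simp: Z_outer ramp_eq_1 ramp'_eq_0\<close>)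
 then show "Z n k z = 1" "Z' n k z = 0" by auto
qed

text \<open>This makes the test functions \<open>psi\<close> nonnegative. Against an artificial
  front it holds because inner ramps vary only for y in [-A, A + 1], where the outer ramps are
  constant.\<close>

lemma Z_decreasing:
 assumes t: "fst z \<in> {a..b}" and k: "k <= N" shows "Z n (Suc k) z <= Z n k z"
proof -
 have R: "A + 2 <= R n" by (simp add: R_def)
 consider "k = 0" "N = 0" | "k = 0" "N >= 1" | "k \<in> {1..<N}" | "k = N" "N >= 1" using k by force
 then show ?thesis
 proof cases
  case 1
  have "snd z - R n <= snd z + R n" using R A by simp
  then have "Z n (Suc N) z <= Z n 0 z" unfolding Z_outer by (rule monoD[OF ramp_mono])
  moreover have "k = N" using 1 by simp
  ultimately show ?thesis using \<open>k = 0\<close> by metis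
 next
  case 2
  show ?thesis
  proof (cases "snd z <= - A")
   case True
   then show ?thesis using inner_low[OF t, of 1] 2 Z_range by simp
  next
   case False
   then have "Z n 0 z = 1" unfolding Z_outer using R by (intro ramp_eq_1) simp
   then show ?thesis using 2 Z_range by simp
  qed
 next
  case 3
  have "snd z - speed v (Suc k) * fst z - c (Suc k) <= snd z - speed v k * fst z - c k" using sorted[OF 3 t] by simp
  then show ?thesis using 3 unfolding Z_def wavefront_def by (intro monoD[OF ramp_mono]) (auto simp: mm_def ss_def cc_def intro!: mult_left_mono)
 next
  case 4
  show ?thesis
  proof (cases "A + 1 <= snd z")
   case True
   then show ?thesis using inner_high[OF t, of N] 4 Z_range by simp
  next
   case False
   then have "Z n (Suc N) z = 0" unfolding Z_outer using R by (intro ramp_eq_0) simp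
   then show ?thesis using 4 Z_range by simp
  qed
 qed
qed

definition psi where "psi n k z = th z * (Z n k z - Z n (Suc k) z)"

definition Dpsi where "Dpsi n k z h = th z * (Z' n k z * (snd h - ss k * fst h) - Z' n (Suc k) z * (snd h - ss (Suc k) * fst h))
  + th' z * fst h * (Z n k z - Z n (Suc k) z)"

lemma psi_deriv: "(psi n k has_derivative Dpsi n k z) (at z)"
 unfolding psi_def[abs_def] Dpsi_def[abs_def] th_def th'_def Z_def Z'_def
 by (rule has_derivative_mult[OF window_deriv has_derivative_diff[OF wavefront_deriv wavefront_deriv]])

lemma strip_cases:
 assumes "z \<notin> {a..b} \<times> {- R n..R n + 1}"
 obtains "fst z \<notin> {a..b}" | "fst z \<in> {a..b}" "snd z <= - R n" | "fst z \<in> {a..b}" "R n + 1 <= snd z" using assms by (cases z) force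

lemma psi_test: "k <= N ==> test_function (psi n k)"
proof (rule test_function_I[of _ a b "- R n" "R n + 1"])
 assume k: "k <= N"
 show "C_k j (psi n k)" for j unfolding psi_def[abs_def] th_def Z_def by (intro C_k_mult C_k_window C_k_diff C_k_wavefront)
 fix z assume "z \<notin> {a..b} \<times> {- R n..R n + 1}"
 then show "psi n k z = 0" by (cases rule: strip_cases) (use k th_outside Z_low[of z] Z_high[of z] in \<open>auto simp: psi_def\<close>)
qed (rule a)

lemma psi_nonneg: "k <= N ==> 0 <= psi n k z"
 using th_outside[of z] th_nonneg[of z] Z_decreasing[of z k n] by (cases "fst z \<in> {a..b}") (auto simp: psi_def)

definition J where "J n k z = \<bar>u z - v k\<bar> * Dpsi n k z (1, 0) + kflux (u z) (v k) * Dpsi n k z (0, 1)"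

lemma strip_integrable:
 assumes "f \<in> borel_measurable borel" "bounded_fun f" "!!z. fst z \<notin> {a..b} ==> f z = 0"
  "!!z. (!!k. k <= Suc N ==> Z n k z = 0 & Z' n k z = 0) ==> f z = 0" "!!z. (!!k. k <= Suc N ==> Z n k z = 1 & Z' n k z = 0) ==> f z = 0"
 shows "integrable lborel f"
proof (rule integrable_plane'[OF assms(1,2), of a b "- R n" "R n + 1"])
 fix z assume "z \<notin> {a..b} \<times> {- R n..R n + 1}"
 then show "f z = 0" by (cases rule: strip_cases) (use assms(3-5)[of z] Z_low[of z] Z_high[of z] in auto)
qed

lemma J_integrable: "k <= N ==> integrable lborel (J n k)"
 unfolding J_def[abs_def] Dpsi_def kflux_eq by (rule strip_integrable[of _ n]) (measurable, intro bounded_fun_intros bdd, auto simp: th_outside)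

text \<open>The sum of the Kruzhkov integrands over all cells splits into the time derivative
  \<open>T1\<close>, the entropy production \<open>T2\<close> along the fronts and the flux
  \<open>T3\<close> through the artificial fronts.\<close>

definition S where "S n z = (\<Sum>k\<le>N. \<bar>u z - v k\<bar> * (Z n k z - Z n (Suc k) z))"
definition T1 where "T1 n z = th' z * S n z"
definition T2 where "T2 n z = th z * (\<Sum>k\<in>{1..N}. \<eta> / 4 * \<bar>v k - v (k - 1)\<bar> * Z' n k z)"
definition T3 where "T3 n z = th z * (Z' n 0 z + Z' n (Suc N) z) * \<bar>u z\<bar> * M / 2"

lemma T_integrable: "integrable lborel (T1 n)" "integrable lborel (T2 n)" "integrable lborel (T3 n)"
 unfolding T1_def[abs_def] T2_def[abs_def] T3_def[abs_def] S_def
 by (rule strip_integrable[of _ n], measurable, intro bounded_fun_intros bdd, auto simp: th_outside)+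

lemma v_ends: "v 0 = 0" "v N = 0" using adm by (auto simp: admissible_def)

text \<open>Summation by parts moves the differences from the smoothed indicators to the entropies,
  so that each front carries the quantity estimated in \<open>front_dissipation\<close>. At both
  ends the constant is 0 and the speed is 0, which leaves the outer flux only.\<close>

lemma sum_J_le: "(\<Sum>k\<le>N. J n k z) <= T1 n z + T2 n z + T3 n z"
proof -
 let ?f = "%k. - \<bar>u z - v k\<bar>" and ?q = "%k. kflux (u z) (v k)"
 have "J n k z = th' z * (\<bar>u z - v k\<bar> * (Z n k z - Z n (Suc k) z))
   + th z * (?f k * (Z' n k z * ss k - Z' n (Suc k) z * ss (Suc k)) + ?q k * (Z' n k z - Z' n (Suc k) z))" for k
  by (simp add: J_def Dpsi_def algebra_simps)
 then have "(\<Sum>k\<le>N. J n k z) = T1 n z + th z * ((\<Sum>k\<le>N. ?f k * (Z' n k z * ss k - Z' n (Suc k) z * ss (Suc k)))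
   + (\<Sum>k\<le>N. ?q k * (Z' n k z - Z' n (Suc k) z)))" by (simp only: T1_def S_def sum.distrib sum_distrib_left[symmetric])
 also have "(\<Sum>k\<le>N. ?f k * (Z' n k z * ss k - Z' n (Suc k) z * ss (Suc k)))
   = (\<Sum>k\<in>{1..N}. (?f k - ?f (k - 1)) * (Z' n k z * ss k))" using abel_fronts[of ?f "%k. Z' n k z * ss k" N] by (simp add: ss_def)
 also have "(\<Sum>k\<le>N. ?q k * (Z' n k z - Z' n (Suc k) z)) = kflux (u z) 0 * (Z' n 0 z - Z' n (Suc N) z)
   + (\<Sum>k\<in>{1..N}. (?q k - ?q (k - 1)) * Z' n k z)" using abel_fronts[of ?q "%k. Z' n k z" N] unfolding v_ends by (simp add: algebra_simps)
 finally have 1: "(\<Sum>k\<le>N. J n k z) = T1 n z + th z * ((\<Sum>k\<in>{1..N}. (?f k - ?f (k - 1)) * (Z' n k z * ss k))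
  + (kflux (u z) 0 * (Z' n 0 z - Z' n (Suc N) z) + (\<Sum>k\<in>{1..N}. (?q k - ?q (k - 1)) * Z' n k z)))" .
 have "(\<Sum>k\<in>{1..N}. (?f k - ?f (k - 1)) * (Z' n k z * ss k)) + (\<Sum>k\<in>{1..N}. (?q k - ?q (k - 1)) * Z' n k z)
   = (\<Sum>k\<in>{1..N}. ((?q k - ?q (k - 1)) - ss k * (\<bar>u z - v k\<bar> - \<bar>u z - v (k - 1)\<bar>)) * Z' n k z)"
  unfolding sum.distrib[symmetric] by (rule sum.cong) (auto simp: algebra_simps)
 also have "... <= (\<Sum>k\<in>{1..N}. \<eta> / 4 * \<bar>v k - v (k - 1)\<bar> * Z' n k z)"
 proof (rule sum_mono)
  fix k assume k: "k \<in> {1..N}"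
  have up: "v k - v (k - 1) <= \<eta>" using adm k by (auto simp: admissible_def)
  have s: "ss k = (v (k - 1) + v k) / 2" using k by (simp add: ss_def speed_def)
  have "(?q k - ?q (k - 1)) - ss k * (\<bar>u z - v k\<bar> - \<bar>u z - v (k - 1)\<bar>) <= \<eta> / 4 * \<bar>v k - v (k - 1)\<bar>" unfolding s by (rule front_dissipation[OF up \<eta>])
  then show "((?q k - ?q (k - 1)) - ss k * (\<bar>u z - v k\<bar> - \<bar>u z - v (k - 1)\<bar>)) * Z' n k z <= \<eta> / 4 * \<bar>v k - v (k - 1)\<bar> * Z' n k z"
   by (rule mult_right_mono[OF _ Z'_nonneg])
 qed
 finally have 2: "(\<Sum>k\<in>{1..N}. (?f k - ?f (k - 1)) * (Z' n k z * ss k)) + (\<Sum>k\<in>{1..N}. (?q k - ?q (k - 1)) * Z' n k z)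
   <= (\<Sum>k\<in>{1..N}. \<eta> / 4 * \<bar>v k - v (k - 1)\<bar> * Z' n k z)" .
 have 3: "kflux (u z) 0 * (Z' n 0 z - Z' n (Suc N) z) <= (Z' n 0 z + Z' n (Suc N) z) * \<bar>u z\<bar> * M / 2"
 proof -
  have "\<bar>u z\<bar> * \<bar>u z\<bar> <= \<bar>u z\<bar> * M" using uM[of z] by (intro mult_left_mono) auto
  moreover have "\<bar>kflux (u z) 0\<bar> = \<bar>u z\<bar> * \<bar>u z\<bar> / 2" unfolding kflux_eq by (simp add: abs_mult)
  ultimately have "\<bar>kflux (u z) 0\<bar> <= \<bar>u z\<bar> * M / 2" by linarith
  then have "\<bar>kflux (u z) 0\<bar> * \<bar>Z' n 0 z - Z' n (Suc N) z\<bar> <= (\<bar>u z\<bar> * M / 2) * (Z' n 0 z + Z' n (Suc N) z)"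
   using Z'_nonneg[of n 0 z] Z'_nonneg[of n "Suc N" z] by (intro mult_mono) auto
  moreover have "kflux (u z) 0 * (Z' n 0 z - Z' n (Suc N) z) <= \<bar>kflux (u z) 0\<bar> * \<bar>Z' n 0 z - Z' n (Suc N) z\<bar>" by (metis abs_ge_self abs_mult)
  ultimately show ?thesis by (simp add: mult.commute mult.left_commute)
 qed
 have T3': "T3 n z = th z * ((Z' n 0 z + Z' n (Suc N) z) * \<bar>u z\<bar> * M / 2)" by (simp add: T3_def mult.assoc)
 have 4: "T1 n z + T2 n z + T3 n z = T1 n z + th z * ((\<Sum>k\<in>{1..N}. \<eta> / 4 * \<bar>v k - v (k - 1)\<bar> * Z' n k z)
    + (Z' n 0 z + Z' n (Suc N) z) * \<bar>u z\<bar> * M / 2)" unfolding T2_def T3' by (simp only: distrib_left[of "th z"] add.assoc)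
 show ?thesis unfolding 1 4 by (intro add_left_mono mult_left_mono th_nonneg) (use 2 3 in linarith)
qed

text \<open>Each inner \<open>Z'\<close> has unit mass on every time slice, so the fronts produce at
  most \<eta> V / 4 per unit of time.\<close>

lemma T2_integral: "(LBINT z. T2 n z) <= \<eta> * V / 4 * (b - a)"
proof -
 let ?K = "\<Sum>k\<in>{1..N}. \<eta> / 4 * \<bar>v k - v (k - 1)\<bar>"
 have Z'y: "Z' n k (t, y) = real (Suc n) * ramp' (real (Suc n) * (y - (speed v k * t + c k)))" if "k \<in> {1..N}" for k t y
  using that by (auto simp: Z'_def wavefront'_def mm_def ss_def cc_def diff_diff_eq)
 have inner: "(LBINT y. T2 n (t, y)) = window a b \<delta> t * ?K" for t
 proof -
  have i: "integrable lborel (%y. Z' n k (t, y))" "(LBINT y. Z' n k (t, y)) = 1" if "k \<in> {1..N}" for k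
   unfolding Z'y[OF that] by (rule ramp'_scaled_integral; simp)+
  have "(LBINT y. T2 n (t, y)) = window a b \<delta> t * (LBINT y. (\<Sum>k\<in>{1..N}. \<eta> / 4 * \<bar>v k - v (k - 1)\<bar> * Z' n k (t, y)))"
   unfolding T2_def th_def fst_conv by (rule integral_mult_right_zero)
  also have "(LBINT y. (\<Sum>k\<in>{1..N}. \<eta> / 4 * \<bar>v k - v (k - 1)\<bar> * Z' n k (t, y)))
   = (\<Sum>k\<in>{1..N}. \<integral>y. \<eta> / 4 * \<bar>v k - v (k - 1)\<bar> * Z' n k (t, y) \<partial>lborel)"
   by (rule Bochner_Integration.integral_sum) (use i in \<open>auto intro!: integrable_mult_right\<close>)
  also have "... = ?K" by (rule sum.cong) (use i in \<open>auto simp only: integral_mult_right_zero mult_1_right\<close>)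
  finally show ?thesis .
 qed
 have K0: "0 <= ?K" using \<eta> by (intro sum_nonneg) auto
 have KV: "?K <= \<eta> * V / 4" using adm \<eta> unfolding sum_distrib_left[symmetric] by (simp add: admissible_def mult_left_mono)
 have "(LBINT z. T2 n z) = (LBINT t. window a b \<delta> t * ?K)" using integral_plane(1)[OF T_integrable(2)[of n]] unfolding inner .
 also have "... <= (LBINT t. (\<eta> * V / 4) * indicator {a..b} t)"
 proof (rule integral_mono)
  show "integrable lborel (%t. window a b \<delta> t * ?K)" using integral_plane(2)[OF T_integrable(2)[of n]] unfolding inner .
  show "integrable lborel (%t. (\<eta> * V / 4) * indicator {a..b} t :: real)" using \<delta> by auto
  show "window a b \<delta> t * ?K <= \<eta> * V / 4 * indicator {a..b} t" for t
  proof (cases "t \<in> {a..b}")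
   case True
   have "window a b \<delta> t * ?K <= 1 * ?K" using window_le_1 K0 by (intro mult_right_mono) auto
   then show ?thesis using KV True by simp
  next
   case False
   then show ?thesis using window_outside[OF \<delta>] by simp
  qed
 qed
 also have "... = \<eta> * V / 4 * (b - a)" using \<delta> by simp
 finally show ?thesis .
qed

text \<open>The outer ramps escape to infinity while u is integrable over the strip.\<close>

lemma T3_limit: "(%n. \<integral>z. T3 n z \<partial>lborel) \<longlonglongrightarrow> 0"
proof -
 obtain C where C: "0 <= C" "!!x. ramp' x <= C" using ramp'_bounded by auto
 have M: "0 <= M" using uM[of "(0,0)"] by linarith
 have "(%n. \<integral>z. T3 n z \<partial>lborel) \<longlonglongrightarrow> integral\<^sup>L (lborel :: (real \<times> real) measure) (%z. 0)"
 proof (rule integral_dominated_convergence[where w = "%z. C * M * \<bar>indicator {a..b} (fst z) * u z\<bar>"])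
  show "integrable lborel (%z. C * M * \<bar>indicator {a..b} (fst z) * u z\<bar>)" by (rule integrable_mult_right, rule integrable_abs, rule ustrip)
  have "(%n. T3 n z) \<longlonglongrightarrow> 0" for z
  proof (rule tendsto_eventually)
   obtain n0 :: nat where n0: "\<bar>snd z\<bar> < real n0" using reals_Archimedean2 by blast
   show "eventually (%n. T3 n z = 0) sequentially" unfolding eventually_sequentially
   proof (intro exI[of _ n0] allI impI)
    fix n assume "n0 <= n"
    then have "1 <= snd z + R n" "snd z - R n <= 0" using n0 A by (auto simp: R_def)
    then show "T3 n z = 0" by (simp add: T3_def Z_outer ramp'_eq_0)
   qed
  qed
  then show "AE z in lborel. (%n. T3 n z) \<longlonglongrightarrow> 0" by simp
  have "\<bar>T3 n z\<bar> <= C * M * \<bar>indicator {a..b} (fst z) * u z\<bar>" for n z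
  proof (cases "fst z \<in> {a..b}")
   case True
   have w: "\<bar>th z\<bar> <= 1" using th_nonneg[of z] window_le_1[of a b \<delta> "fst z"] by (simp add: th_def)
   have z: "\<bar>Z' n 0 z + Z' n (Suc N) z\<bar> <= 2 * C"
    using C(2)[of "snd z + R n"] C(2)[of "snd z - R n"] Z'_nonneg[of n 0 z] Z'_nonneg[of n "Suc N" z] by (simp add: Z_outer)
   have "\<bar>T3 n z\<bar> = \<bar>th z\<bar> * \<bar>Z' n 0 z + Z' n (Suc N) z\<bar> * (\<bar>u z\<bar> * M / 2)" using M by (simp add: T3_def abs_mult)
   also have "... <= 1 * (2 * C) * (\<bar>u z\<bar> * M / 2)" using w z M C(1) by (intro mult_right_mono mult_mono) auto
   finally show ?thesis using True by (simp add: mult.commute mult.left_commute)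
  next
   case False
   then show ?thesis using th_outside[of z] M C by (simp add: T3_def)
  qed
  then show "AE z in lborel. norm (T3 n z) <= C * M * \<bar>indicator {a..b} (fst z) * u z\<bar>" for n by simp
 qed (use T_integrable in auto)
 then show ?thesis by simp
qed

end

lemma AE_not_on_line: "AE z in (lborel :: (real \<times> real) measure). snd z ~= c + s * fst z"
proof -
 have "AE z in lborel \<Otimes>\<^sub>M lborel. snd z ~= c + s * fst z"
 proof (rule lborel_pair.AE_pair_measure)
  show "{x \<in> space (lborel \<Otimes>\<^sub>M lborel). snd x ~= c + s * fst x} \<in> sets (lborel \<Otimes>\<^sub>M lborel)" unfolding lborel_prod by measurable
  have "AE y in lborel. snd (x, y) ~= c + s * fst (x, y)" for x using AE_lborel_singleton by simp
  then show "AE x in lborel. AE y in lborel. snd (x, y) ~= c + s * fst (x, y)" by simp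
 qed
 then show ?thesis unfolding lborel_prod .
qed

context moving_partition begin

lemma S_bounds: "0 <= S n z" if "fst z \<in> {a..b}"
 unfolding S_def by (intro sum_nonneg mult_nonneg_nonneg) (use Z_decreasing[OF that] in auto)

text \<open>A majorant independent of n: the two outer cells carry the constant 0 and the inner
  cells lie over a bounded interval, while the weights telescope to at most 1.\<close>

lemma S_le:
 assumes t: "fst z \<in> {a..b}"
 shows "S n z <= \<bar>u z\<bar> + V * real (Suc N) * indicator {- (A + 1)..A + 1} (snd z)"
proof -
 have V: "0 <= V" using admissible_V_nonneg[OF adm] .
 have "S n z <= (\<Sum>k\<le>N. \<bar>u z\<bar> * (Z n k z - Z n (Suc k) z) + V * indicator {- (A + 1)..A + 1} (snd z))" unfolding S_def
 proof (rule sum_mono)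
  fix k assume "k \<in> {..N}"
  then have k: "k <= N" by simp
  have d: "0 <= Z n k z - Z n (Suc k) z" using Z_decreasing[OF t k] by simp
  have "\<bar>u z - v k\<bar> * (Z n k z - Z n (Suc k) z) <= (\<bar>u z\<bar> + \<bar>v k\<bar>) * (Z n k z - Z n (Suc k) z)" using d by (intro mult_right_mono) auto
  also have "... = \<bar>u z\<bar> * (Z n k z - Z n (Suc k) z) + \<bar>v k\<bar> * (Z n k z - Z n (Suc k) z)" by (rule distrib_right)
  also have "\<bar>v k\<bar> * (Z n k z - Z n (Suc k) z) <= V * indicator {- (A + 1)..A + 1} (snd z)"
  proof (cases "k = 0 \<or> k = N")
   case True
   then show ?thesis using v_ends V by auto
  next
   case False
   then have kk: "k \<in> {1..N}" "Suc k \<in> {1..N}" using k by auto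
   show ?thesis
   proof (cases "snd z \<in> {- (A + 1)..A + 1}")
    case True
    have "Z n k z - Z n (Suc k) z <= 1" using Z_range[of n k z] Z_range[of n "Suc k" z] by linarith
    then have "\<bar>v k\<bar> * (Z n k z - Z n (Suc k) z) <= V * 1" using admissible_bound[OF adm k] d V by (intro mult_mono) auto
    then show ?thesis using True by simp
   next
    case False
    then consider "snd z <= - A" | "A + 1 <= snd z" by fastforce
    then have "Z n k z - Z n (Suc k) z = 0"
    by cases (use inner_low[OF t kk(1)] inner_low[OF t kk(2)] inner_high[OF t kk(1)] inner_high[OF t kk(2)] in auto)
    then show ?thesis using V by simp
   qed
  qed
  finally show "\<bar>u z - v k\<bar> * (Z n k z - Z n (Suc k) z)
    <= \<bar>u z\<bar> * (Z n k z - Z n (Suc k) z) + V * indicator {- (A + 1)..A + 1} (snd z)" by simp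
 qed
 also have "... = \<bar>u z\<bar> * (\<Sum>k\<le>N. Z n k z - Z n (Suc k) z) + V * real (Suc N) * indicator {- (A + 1)..A + 1} (snd z)"
  by (simp add: sum.distrib sum_distrib_left)
 also have "(\<Sum>k\<le>N. Z n k z - Z n (Suc k) z) = Z n 0 z - Z n (Suc N) z" by (rule sum_telescope)
 also have "\<bar>u z\<bar> * (Z n 0 z - Z n (Suc N) z) <= \<bar>u z\<bar> * 1" using Z_range[of n 0 z] Z_range[of n "Suc N" z] by (intro mult_left_mono) auto
 finally show ?thesis by simp
qed

text \<open>Off the lines every smoothed indicator is exactly 0 or 1 for large n, so the weights
  single out the cell that contains the point.\<close>

lemma S_limit:
 assumes t: "fst z \<in> {a..b}" and off: "!!k. k \<in> {1..N} ==> snd z ~= c k + speed v k * fst z"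
 shows "eventually (%n. S n z = \<bar>u z - W z\<bar>) sequentially"
proof -
 define Q where "Q = {k \<in> {1..N}. c k + speed v k * fst z < snd z}"
 define j where "j = Max (insert 0 Q)"
 have fin: "finite (insert 0 Q)" by (simp add: Q_def)
 have j0: "j \<in> insert 0 Q" unfolding j_def by (rule Max_in[OF fin]) simp
 then have jN: "j <= N" by (auto simp: Q_def)
 have mono: "c i + speed v i * fst z <= c k + speed v k * fst z" if "1 <= i" "i <= k" "k <= N" for i k using that(2,1,3)
 proof (induction k rule: dec_induct)
  case (step m)
  then show ?case using sorted[of m, OF _ t] by (force intro: order_trans)
 qed simp
 have below: "c k + speed v k * fst z < snd z" if "k \<in> {1..j}" for k using j0 mono[of k j] that jN by (auto simp: Q_def)
 have above: "snd z < c k + speed v k * fst z" if "j < k" "k <= N" for k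
 proof -
  have "k \<notin> Q" using Max_ge[OF fin, of k] that by (auto simp: j_def)
  then show ?thesis using off[of k] that by (auto simp: Q_def)
 qed
 define bb where "bb k = (if k <= j then 1 else 0 :: real)" for k
 have "eventually (%n. Z n k z = bb k) sequentially" if "k <= Suc N" for k
 proof -
  obtain n0 :: nat where n0: "\<bar>snd z\<bar> < real n0" using reals_Archimedean2 by blast
  consider "k = 0" | "k = Suc N" | "k \<in> {1..j}" | "j < k" "k \<in> {1..N}" using \<open>k <= Suc N\<close> by force
  then show ?thesis
  proof cases
   case 1
   show ?thesis unfolding eventually_sequentially using n0 A 1 by (intro exI[of _ n0]) (auto simp: Z_outer R_def bb_def intro!: ramp_eq_1)
  next
   case 2
   show ?thesis unfolding eventually_sequentially using n0 A 2 jN by (intro exI[of _ n0]) (auto simp: Z_outer R_def bb_def intro!: ramp_eq_0)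
  next
   case 3
   define e where "e = snd z - speed v k * fst z - c k"
   have "e > 0" using below[OF 3] by (simp add: e_def)
   obtain n1 :: nat where n1: "1 / e < real n1" using reals_Archimedean2 by blast
   have "Z n k z = 1" if "n1 <= n" for n
   proof -
    have "1 / e <= real (Suc n)" using n1 that by simp
    then have "1 <= real (Suc n) * e" using \<open>e > 0\<close> by (simp add: field_simps)
    then show ?thesis using 3 jN by (auto simp: Z_def wavefront_def mm_def ss_def cc_def e_def intro!: ramp_eq_1)
   qed
   then show ?thesis using 3 by (auto simp: eventually_sequentially bb_def)
  next
   case 4
   have "real (Suc n) * (snd z - speed v k * fst z - c k) <= 0" for n using above[of k] 4 by (intro mult_nonneg_nonpos) auto
   then have "Z n k z = 0" for n using 4 by (auto simp: Z_def wavefront_def mm_def ss_def cc_def intro!: ramp_eq_0)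
   then show ?thesis using 4 by (auto simp: bb_def)
  qed
 qed
 then have "eventually (%n. \<forall>k\<in>{..Suc N}. Z n k z = bb k) sequentially" by (intro eventually_ball_finite) auto
 moreover have "W z = v j"
 proof -
  have "W z = (\<Sum>k\<in>{1..N}. if k \<in> {1..j} then v k - v (k - 1) else 0)" unfolding W_def steps_def fronts_def
  proof (rule sum.cong[OF refl])
   fix k assume "k \<in> {1..N}"
   then show "(if c k + speed v k * fst z <= snd z then v k - v (k - 1) else 0) = (if k \<in> {1..j} then v k - v (k - 1) else 0)"
    using below[of k] above[of k] by (cases "k <= j") auto
  qed
  also have "... = (\<Sum>k\<in>{1..j}. v k - v (k - 1))" using jN by (intro sum.mono_neutral_cong_right) auto
  also have "... = v j" unfolding sum_telescope_1 using v_ends by simp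
  finally show ?thesis .
 qed
 ultimately show ?thesis
 proof (elim eventually_mono)
  fix n assume e: "\<forall>k\<in>{..Suc N}. Z n k z = bb k"
  have "S n z = (\<Sum>k\<le>N. \<bar>u z - v k\<bar> * (bb k - bb (Suc k)))" unfolding S_def using e by (intro sum.cong) auto
  also have "... = \<bar>u z - v j\<bar>" by (rule sum_step_weights[OF jN]) (auto simp: bb_def)
  finally show "S n z = \<bar>u z - W z\<bar>" using \<open>W z = v j\<close> by simp
 qed
qed

lemma T1_limit:
 "(%n. \<integral>z. T1 n z \<partial>lborel) \<longlonglongrightarrow> (LBINT z. th' z * \<bar>u z - W z\<bar>)"
 "integrable lborel (%z. th' z * \<bar>u z - W z\<bar>)"
proof -
 obtain C where C: "!!z. \<bar>th' z\<bar> <= C" using bdd(4) unfolding bounded_fun_def by auto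
 have C0: "0 <= C" using C[of "(0,0)"] by linarith
 have V: "0 <= V" using admissible_V_nonneg[OF adm] .
 let ?d = "%z. C * (\<bar>indicator {a..b} (fst z) * u z\<bar> + V * real (Suc N) * indicator ({a..b} \<times> {- (A + 1)..A + 1}) z)"
 have rect: "integrable lborel (%z. indicator ({a..b} \<times> {- (A + 1)..A + 1}) z :: real)"
 proof (rule integrable_plane'[of _ a b "- (A + 1)" "A + 1"])
  have "closed ({a..b} \<times> {- (A + 1)..A + 1})" by (intro closed_Times closed_atLeastAtMost)
  then show "(%z. indicator ({a..b} \<times> {- (A + 1)..A + 1}) z :: real) \<in> borel_measurable borel" by (intro borel_measurable_indicator borel_closed)
 qed (auto intro: bounded_funI[of _ 1] simp: indicator_def)
 have d: "integrable lborel ?d" by (intro integrable_mult_right Bochner_Integration.integrable_add integrable_abs ustrip rect)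
 have dom: "\<bar>T1 n z\<bar> <= ?d z" for n z
 proof (cases "fst z \<in> {a..b}")
  case True
  have "\<bar>T1 n z\<bar> = \<bar>th' z\<bar> * S n z" using S_bounds[OF True, of n] by (simp add: T1_def abs_mult)
  also have "... <= C * (\<bar>u z\<bar> + V * real (Suc N) * indicator {- (A + 1)..A + 1} (snd z))"
   using S_le[OF True, of n] S_bounds[OF True, of n] C C0 by (intro mult_mono) auto
  also have "... = ?d z" using True by (cases z) (auto simp: indicator_def)
  finally show ?thesis .
 next
  case False
  then show ?thesis using th_outside[of z] C0 V by (simp add: T1_def)
 qed
 have "AE z in lborel. \<forall>k\<in>{1..N}. snd z ~= c k + speed v k * fst z" by (intro AE_finite_allI) (auto intro: AE_not_on_line)
 then have lim: "AE z in lborel. (%n. T1 n z) \<longlonglongrightarrow> th' z * \<bar>u z - W z\<bar>"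
 proof eventually_elim
  case (elim z)
  show ?case
  proof (cases "fst z \<in> {a..b}")
   case True
   have "eventually (%n. T1 n z = th' z * \<bar>u z - W z\<bar>) sequentially" using S_limit[OF True] elim by (auto simp: T1_def elim!: eventually_mono)
   then show ?thesis by (rule tendsto_eventually)
  qed (use th_outside[of z] in \<open>simp add: T1_def\<close>)
 qed
 have m: "(%z. th' z * \<bar>u z - W z\<bar>) \<in> borel_measurable lborel" by measurable
 have m1: "T1 n \<in> borel_measurable lborel" for n using T_integrable(1)[of n] by auto
 show "(%n. \<integral>z. T1 n z \<partial>lborel) \<longlonglongrightarrow> (LBINT z. th' z * \<bar>u z - W z\<bar>)"
  by (rule integral_dominated_convergence[where w = ?d and s = T1, OF m m1 d lim]) (use dom in auto)
 show "integrable lborel (%z. th' z * \<bar>u z - W z\<bar>)"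
  by (rule integrable_dominated_convergence[where w = ?d and s = T1, OF m m1 d lim]) (use dom in auto)
qed

lemma strip_inequality:
 assumes "!!n k. k <= N ==> 0 <= (LBINT z. J n k z)"
 shows "0 <= (LBINT z. th' z * \<bar>u z - W z\<bar>) + \<eta> * V / 4 * (b - a)"
proof -
 have "0 <= (LBINT z. T1 n z) + \<eta> * V / 4 * (b - a) + (LBINT z. T3 n z)" for n
 proof -
  have "0 <= (\<Sum>k\<le>N. \<integral>z. J n k z \<partial>lborel)" using assms by (intro sum_nonneg) auto
  also have "... = (LBINT z. (\<Sum>k\<le>N. J n k z))" by (rule Bochner_Integration.integral_sum[symmetric]) (use J_integrable in auto)
  also have "... <= (LBINT z. T1 n z + T2 n z + T3 n z)" by (rule integral_mono) (use J_integrable T_integrable sum_J_le in auto)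
  also have "... = (LBINT z. T1 n z) + (LBINT z. T2 n z) + (LBINT z. T3 n z)" by (simp add: T_integrable)
  finally show ?thesis using T2_integral[of n] by simp
 qed
 then show ?thesis using tendsto_add[OF tendsto_add[OF T1_limit(1) tendsto_const[of "\<eta> * V / 4 * (b - a)"]] T3_limit]
  by (intro LIMSEQ_le_const[of _ _ 0]) auto
qed

end

lemma entropy_vs_lines:
 assumes ent: "entropy_solution (%s. s\<^sup>2 / 2) \<sigma>0 \<sigma>"
  and adm: "admissible \<eta> V N v" and \<eta>: "0 <= \<eta>" and A: "0 <= A" and ab: "0 < a" "a < b"
  and lines: "!!k t. k \<in> {1..N} ==> t \<in> {a..b} ==> \<bar>c k + speed v k * t\<bar> <= A"
  and sorted: "!!k t. k \<in> {1..<N} ==> t \<in> {a..b} ==> c k + speed v k * t <= c (Suc k) + speed v (Suc k) * t"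
  and w: "!!t. w t = steps N (%k. c k + speed v k * t) v"
 shows "(dist1 (\<sigma> b) (w b)) - (dist1 (\<sigma> a) (w a)) <= \<eta> * V / 4 * (b - a)"
proof -
 define g where "g t = (dist1 (\<sigma> t) (w t))" for t
 have ev: "bounded_L1_evolution \<sigma>0 \<sigma>" using ent by (simp add: entropy_solution_def)
 have wi: "integrable lborel (w t)" for t unfolding w using steps_integrable[OF adm] .
 have wc: "((%\<tau>. \<integral>y. \<bar>w \<tau> y - w t y\<bar> \<partial>lborel) \<longlongrightarrow> 0) (at t within {0..})" for t
 proof (rule Lim_null_comparison)
  show "eventually (%\<tau>. norm (dist1 (w \<tau>) (w t))
    <= (\<Sum>k\<in>{1..N}. norm (v k - v (k - 1)) * \<bar>(c k + speed v k * \<tau>) - (c k + speed v k * t)\<bar>)) (at t within {0..})"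
  proof (rule always_eventually, rule allI)
   fix \<tau>
   have "(ndist1 (w \<tau>) (w t)) <= (\<Sum>k\<in>{1..N}. norm (v k - v (k - 1)) * \<bar>(c k + speed v k * \<tau>) - (c k + speed v k * t)\<bar>)"
    unfolding w steps_def by (rule fronts_move) (use admissible_sum[OF adm] in auto)
   then show "norm (dist1 (w \<tau>) (w t)) <= (\<Sum>k\<in>{1..N}. norm (v k - v (k - 1)) * \<bar>(c k + speed v k * \<tau>) - (c k + speed v k * t)\<bar>)" by simp
  qed
  show "((%\<tau>. \<Sum>k\<in>{1..N}. norm (v k - v (k - 1)) * \<bar>(c k + speed v k * \<tau>) - (c k + speed v k * t)\<bar>) \<longlongrightarrow> 0) (at t within {0..})"
   by (rule tendsto_eq_rhs[OF tendsto_sum]) (auto intro!: tendsto_eq_intros)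
 qed
 have gc: "continuous_on {0..} g" unfolding g_def
  by (rule integral_abs_diff_continuous) (use L1_evolution_integrable[OF ev] wi L1_evolution_tendsto[OF ev] wc in auto)
 obtain u M where u: "u \<in> borel_measurable borel" "0 <= M" "!!z. \<bar>u z\<bar> <= M"
  "!!\<tau>. 0 <= \<tau> ==> AE y in lborel. u (\<tau>, y) = \<sigma> \<tau> y"
  "AE z in lborel. 0 <= fst z --> u z = \<sigma> (fst z) (snd z)" using bounded_L1_evolution_representative[OF ev] by blast
 have fg: "(LBINT y. \<bar>u (t, y) - w t y\<bar>) = g t" if "t \<in> {a..b}" for t
 proof -
  have "\<sigma> t \<in> borel_measurable borel" "w t \<in> borel_measurable borel" "(%y. u (t, y)) \<in> borel_measurable borel"
   using L1_evolution_integrable[OF ev, of t] wi[of t] that ab u(1) by auto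
  then show ?thesis unfolding g_def using u(4)[of t] that ab by (intro integral_cong_AE) auto
 qed
 have "integrable lborel (%z. window' a b \<delta> (fst z) * \<bar>u z - w (fst z) (snd z)\<bar>) &
   0 <= (LBINT z. window' a b \<delta> (fst z) * \<bar>u z - w (fst z) (snd z)\<bar>) + \<eta> * V / 4 * (b - a)"
  if \<delta>: "0 < \<delta>" "2 * \<delta> <= b - a" for \<delta>
 proof -
  interpret mp: moving_partition N c v \<eta> V A a b \<delta> M u
   by unfold_locales (use adm \<eta> A lines sorted \<delta> ab u representative_integrable_strip[OF ev u(1,4)] in auto)
  have "0 <= (LBINT z. mp.J n k z)" if "k <= N" for n k unfolding mp.J_def
  proof (rule entropy_inequality[OF ent u(5) mp.psi_test mp.psi_nonneg mp.psi_deriv])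
   show "mp.Dpsi n k z = (%_. 0)" if "fst z < 0" for z using mp.th_outside[of z] that ab by (auto simp: mp.Dpsi_def fun_eq_iff)
  qed (use that u in \<open>auto simp: mp.Dpsi_def\<close>)
  from mp.strip_inequality[OF this] mp.T1_limit(2) show ?thesis by (simp add: mp.th'_def mp.W_def w)
 qed
 from window_increment[OF gc ab _ this] fg show ?thesis by (simp add: g_def)
qed

text \<open>The distance is continuous in time, and outside finitely many times its right increments
  are bounded by \<open>entropy_vs_lines\<close>.\<close>

theorem entropy_tracking:
 assumes ent: "entropy_solution (%s. s\<^sup>2 / 2) \<sigma>0 \<sigma>"
  and tr: "tracking \<eta> V A 0 T w" and \<eta>: "0 <= \<eta>" and A: "0 <= A" and \<tau>: "\<tau> \<in> {0..T}"
 shows "(dist1 (\<sigma> \<tau>) (w \<tau>)) <= (dist1 (\<sigma> 0) (w 0)) + \<eta> * V / 4 * \<tau>"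
proof -
 define g where "g t = (dist1 (\<sigma> t) (w t))" for t
 have ev: "bounded_L1_evolution \<sigma>0 \<sigma>" using ent by (simp add: entropy_solution_def)
 have "continuous_on {0..T} g" unfolding g_def
 proof (rule integral_abs_diff_continuous)
  fix t assume t: "t \<in> {0..T}"
  then show "integrable lborel (\<sigma> t)" using L1_evolution_integrable[OF ev] by simp
  show "integrable lborel (w t)" using tracking_integrable[OF tr t] .
  show "((%\<tau>. \<integral>y. \<bar>\<sigma> \<tau> y - \<sigma> t y\<bar> \<partial>lborel) \<longlongrightarrow> 0) (at t within {0..T})" by (rule tendsto_within_subset[OF L1_evolution_tendsto[OF ev]]) (use t in auto)
  show "((%\<tau>. \<integral>y. \<bar>w \<tau> y - w t y\<bar> \<partial>lborel) \<longlongrightarrow> 0) (at t within {0..T})"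
  proof (rule Lim_null_comparison)
   show "eventually (%\<tau>. norm (dist1 (w \<tau>) (w t)) <= V * V * \<bar>\<tau> - t\<bar>) (at t within {0..T})"
    using tr t unfolding tracking_def eventually_at_filter by (auto intro!: always_eventually)
   show "((%\<tau>. V * V * \<bar>\<tau> - t\<bar>) \<longlongrightarrow> 0) (at t within {0..T})" by (auto intro!: tendsto_eq_intros)
  qed
 qed
 then have gc: "continuous_on {0..\<tau>} g" by (rule continuous_on_subset) (use \<tau> in auto)
 obtain B LS where B: "finite B" "!!t. t \<in> {0..<T} - B ==> local_tracking \<eta> V (A + V * (t - 0)) LS w t" using tr unfolding tracking_def by blast
 have "g \<tau> - g 0 <= \<eta> * V / 4 * (\<tau> - 0)"
 proof (rule right_increments_le[OF _ _ gc])
  \<comment> \<open>Time 0 counts as exceptional because test functions vanish near it; continuity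
    of the distance bridges the gap.\<close>
  show "finite (insert 0 B)" using B by simp
  fix t assume t: "t \<in> {0..<\<tau>} - insert 0 B"
  then have "local_tracking \<eta> V (A + V * (t - 0)) LS w t" using B(2) \<tau> by auto
  then obtain h N x v where h0: "h > 0" "admissible \<eta> V N v" "\<forall>k\<in>{1..<N}. x k < x (Suc k)"
   "\<forall>k\<in>{1..N}. \<bar>x k\<bar> <= A + V * (t - 0) & (x k - speed v k * t, speed v k) \<in> LS"
   "\<forall>s\<in>{t..<t+h}. w s = steps N (%k. x k + speed v k * (s - t)) v" unfolding local_tracking_def by blast
  then have h: "h > 0" "admissible \<eta> V N v" "!!k. k \<in> {1..<N} ==> x k < x (Suc k)"
   "!!k. k \<in> {1..N} ==> \<bar>x k\<bar> <= A + V * t"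
   "!!s. s \<in> {t..<t+h} ==> w s = steps N (%k. x k + speed v k * (s - t)) v" by auto
  have V: "0 <= V" using admissible_V_nonneg[OF h(2)] .
  have "eventually (%d. \<forall>k\<in>{1..<N}. x k + speed v k * d < x (Suc k) + speed v (Suc k) * d) (at_right 0)"
  proof (intro eventually_ball_finite ballI)
   fix k assume k: "k \<in> {1..<N}"
   have "((%d. x (Suc k) + speed v (Suc k) * d - (x k + speed v k * d)) \<longlongrightarrow> x (Suc k) + speed v (Suc k) * 0 - (x k + speed v k * 0)) (at_right 0)"
    by (intro tendsto_intros)
   then have "eventually (%d. 0 < x (Suc k) + speed v (Suc k) * d - (x k + speed v k * d)) (at_right 0)"
    by (rule order_tendstoD(1)) (use h(3)[OF k] in simp)
   then show "eventually (%d. x k + speed v k * d < x (Suc k) + speed v (Suc k) * d) (at_right 0)" by (rule eventually_mono) simp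
  qed simp
  then obtain h1 where h1: "h1 > 0" "!!d k. 0 < d ==> d < h1 ==> k \<in> {1..<N} ==> x k + speed v k * d < x (Suc k) + speed v (Suc k) * d"
   unfolding eventually_at_right_field by auto
  show "\<exists>h>0. \<forall>s. t < s & s < t + h & s <= \<tau> --> g s - g t <= \<eta> * V / 4 * (s - t)"
  proof (intro exI[of _ "min h h1"] conjI allI impI)
   fix s assume s: "t < s & s < t + min h h1 & s <= \<tau>"
   then have s': "s < t + h" "s < t + h1" by auto
   define c where "c k = x k - speed v k * t" for k
   define w' where "w' r = steps N (%k. c k + speed v k * r) v" for r
   have w': "w' r = w r" if "r \<in> {t..s}" for r using h(5)[of r] that s' by (simp add: w'_def c_def algebra_simps)
   have "(dist1 (\<sigma> s) (w' s)) - (dist1 (\<sigma> t) (w' t)) <= \<eta> * V / 4 * (s - t)"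
   proof (rule entropy_vs_lines[OF ent h(2) \<eta>])
    show "0 <= A + V * s" using A V s t by auto
    fix k r assume r: "r \<in> {t..s}"
    have cr: "c i + speed v i * r = x i + speed v i * (r - t)" for i by (simp add: c_def algebra_simps)
    show "\<bar>c k + speed v k * r\<bar> <= A + V * s" if k: "k \<in> {1..N}"
    proof -
    have "\<bar>speed v k * (r - t)\<bar> <= V * (s - t)" using admissible_speed[OF h(2) k] r V by (auto simp: abs_mult intro!: mult_mono)
    then show ?thesis unfolding cr using h(4)[OF k] by (simp add: algebra_simps)
    qed
    show "c k + speed v k * r <= c (Suc k) + speed v (Suc k) * r" if k: "k \<in> {1..<N}"
    unfolding cr using h(3)[OF k] h1(2)[of "r - t" k] r s' k by (cases "r = t") auto
   qed (use s t in \<open>auto simp: w'_def\<close>)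
   then show "g s - g t <= \<eta> * V / 4 * (s - t)" unfolding g_def using w' s by simp
  qed (use h h1 in auto)
 qed (use \<tau> in auto)
 then show ?thesis by (simp add: g_def)
qed

subsection \<open>Stationary solutions\<close>

text \<open>The signed functions are traded for the nonnegative densities f^+ + g^- and g^+ + f^-,
  whose difference is f - g. Finite measures on the line are determined by their values on
  half-lines.\<close>

lemma AE_eq_of_tail_integrals:
 fixes f g :: "real => real"
 assumes f: "integrable lborel f" and g: "integrable lborel g"
  and eq: "!!x. (LBINT y. f y * indicator {x<..} y) = (LBINT y. g y * indicator {x<..} y)"
 shows "AE y in lborel. f y = g y"
proof -
 have [measurable]: "f \<in> borel_measurable borel" "g \<in> borel_measurable borel" using f g by auto
 have fi: "integrable lborel (%y. u y * indicator {x<..} y)" if "integrable lborel u" for u :: "real => real" and x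
  using integrable_mult_indicator[OF _ that, of "{x<..}"] by (simp add: mult.commute)
 define h where "h u v y = max 0 (u y) + max 0 (- v y)" for u v :: "real => real" and y
 have em: "emeasure (density lborel (h u v)) {x<..} = ennreal (LBINT y. h u v y * indicator {x<..} y)"
  "integrable lborel (%y. h u v y * indicator {x<..} y)" if i: "integrable lborel u" "integrable lborel v" for u v x
 proof -
  have [measurable]: "u \<in> borel_measurable borel" "v \<in> borel_measurable borel" using i by auto
  have m: "h u v \<in> borel_measurable borel" unfolding h_def[abs_def] by measurable
  show hi: "integrable lborel (%y. h u v y * indicator {x<..} y)" by (rule fi) (use i in \<open>auto simp: h_def[abs_def]\<close>)
  show "emeasure (density lborel (h u v)) {x<..} = ennreal (LBINT y. h u v y * indicator {x<..} y)"
   using m by (subst emeasure_density, simp, simp, subst nn_integral_eq_integral[OF hi, symmetric])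
    (auto simp: h_def ennreal_mult' ennreal_indicator intro!: nn_integral_cong split: split_indicator)
 qed
 have "density lborel (h f g) = density lborel (h g f)"
 proof (rule measure_eqI_lessThan)
  fix x
  have "h f g y - h g f y = f y - g y" for y by (auto simp: h_def max_def)
  then have "(LBINT y. h f g y * indicator {x<..} y) - (LBINT y. h g f y * indicator {x<..} y)
    = (LBINT y. f y * indicator {x<..} y - g y * indicator {x<..} y)"
   using em(2) f g by (subst Bochner_Integration.integral_diff[symmetric]) (auto simp: left_diff_distrib[symmetric])
  also have "... = 0" using fi f g eq by (subst Bochner_Integration.integral_diff) auto
  finally show "emeasure (density lborel (h f g)) {x<..} = emeasure (density lborel (h g f)) {x<..}" using em(1) f g by simp
 qed (use em(1) f g in auto)
 then have "AE y in lborel. ennreal (h f g y) = ennreal (h g f y)"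
  by (subst (asm) sigma_finite_measure.density_unique_iff[OF lborel.sigma_finite_measure_axioms]) (auto simp: h_def[abs_def])
 then show ?thesis by eventually_elim (auto simp: h_def max_def split: if_splits)
qed

text \<open>Testing with a time window times a smoothed indicator of a half-line shows that tail
  integrals are constant for positive times. Continuity in L1 includes time 0, and the tails
  determine the function.\<close>

theorem weak_solution_stationary:
 assumes ws: "weak_solution (%_. 0) \<sigma>0 \<sigma>" and \<tau>: "0 <= \<tau>"
 shows "AE y in lborel. \<sigma> \<tau> y = \<sigma> 0 y"
proof (rule AE_eq_of_tail_integrals)
 have ev: "bounded_L1_evolution \<sigma>0 \<sigma>" using ws by (simp add: weak_solution_def)
 note si = L1_evolution_integrable[OF ev]
 show "integrable lborel (\<sigma> \<tau>)" "integrable lborel (\<sigma> 0)" using si \<tau> by auto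
 obtain u M where u: "u \<in> borel_measurable borel" "0 <= M" "!!z. \<bar>u z\<bar> <= M"
  "!!\<tau>. 0 <= \<tau> ==> AE y in lborel. u (\<tau>, y) = \<sigma> \<tau> y"
  "AE z in lborel. 0 <= fst z --> u z = \<sigma> (fst z) (snd z)" using bounded_L1_evolution_representative[OF ev] by blast
 note [measurable] = u(1)
 fix x :: real
 define m where "m n = real (Suc n)" for n
 \<comment> \<open>A smoothed indicator of (x, \<infinity>) with support in
   [x, x + m n + 1].\<close>
 define ph where "ph n y = ramp (m n * (y - x)) - ramp (y - x - m n)" for n y
 have phm [measurable]: "ph n \<in> borel_measurable borel" for n unfolding ph_def[abs_def] by measurable
 have ph1: "\<bar>ph n y\<bar> <= 1" for n y
  using ramp_nonneg[of "m n * (y - x)"] ramp_nonneg[of "y - x - m n"] ramp_le_1[of "m n * (y - x)"] ramp_le_1[of "y - x - m n"]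
  by (auto simp: ph_def abs_le_iff)
 have spi: "integrable lborel (%y. \<sigma> t y * ph n y)" if "0 <= t" for t n by (rule Bochner_Integration.integrable_bound[OF si[OF that]])
    (use si[OF that] ph1[of n] in \<open>auto simp: abs_mult intro!: mult_left_le\<close>)
 define G where "G n t = (LBINT y. \<sigma> t y * ph n y)" for n t
 have Gc: "continuous_on {0..} (G n)" for n unfolding continuous_on_def
 proof
  fix t :: real assume t: "t \<in> {0..}"
  have "norm (G n s - G n t) <= (dist1 (\<sigma> s) (\<sigma> t))" if s: "0 <= s" for s
  proof -
   have "norm (G n s - G n t) = \<bar>\<integral>y. \<sigma> s y * ph n y - \<sigma> t y * ph n y \<partial>lborel\<bar>"
    unfolding G_def using spi t s by (subst Bochner_Integration.integral_diff) auto
   also have "... <= (LBINT y. \<bar>\<sigma> s y * ph n y - \<sigma> t y * ph n y\<bar>)" by (rule integral_abs_bound)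
   also have "... <= (dist1 (\<sigma> s) (\<sigma> t))"
   proof (rule integral_mono)
    show "\<bar>\<sigma> s y * ph n y - \<sigma> t y * ph n y\<bar> <= \<bar>\<sigma> s y - \<sigma> t y\<bar>" for y
    using mult_left_le[OF ph1[of n y], of "\<bar>\<sigma> s y - \<sigma> t y\<bar>"] by (simp add: left_diff_distrib[symmetric] abs_mult)
   qed (use spi si t s in auto)
   finally show ?thesis .
  qed
  then have "eventually (%s. norm (G n s - G n t) <= (dist1 (\<sigma> s) (\<sigma> t))) (at t within {0..})" by (auto simp: eventually_at_filter)
  then have "((%s. G n s - G n t) \<longlongrightarrow> 0) (at t within {0..})" by (rule Lim_null_comparison) (rule L1_evolution_tendsto[OF ev], use t in simp)
  then show "(G n \<longlongrightarrow> G n t) (at t within {0..})" by (simp add: LIM_zero_iff)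
 qed
 have ph0: "ph n y = 0" if y: "y \<notin> {x..x + m n + 1}" for n y
 proof -
  consider "y <= x" | "x + m n + 1 <= y" using y by fastforce
  then show ?thesis
  proof cases
   case 1
   then have "m n * (y - x) <= 0" by (auto simp: m_def intro!: mult_nonneg_nonpos)
   then show ?thesis using 1 by (simp add: ph_def ramp_eq_0 m_def)
  next
   case 2
   have "1 * 1 <= m n * (y - x)" by (rule mult_mono) (use 2 in \<open>auto simp: m_def\<close>)
   then show ?thesis using 2 by (simp add: ph_def ramp_eq_1)
  qed
 qed
 have G_const: "G n b = G n a" if ab: "0 < a" "a < b" for n a b
 proof -
  have w: "integrable lborel (%z. window' a b \<delta> (fst z) * (u z * ph n (snd z))) &
    (LBINT z. window' a b \<delta> (fst z) * (u z * ph n (snd z))) = 0" if \<delta>: "0 < \<delta>" "2 * \<delta> <= b - a" for \<delta>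
  proof
   let ?p = "%z. wavefront (m n) 0 x z - wavefront 1 0 (x + m n) z"
   define \<psi> where "\<psi> z = window a b \<delta> (fst z) * ?p z" for z
   define D where "D z h = window a b \<delta> (fst z) * (wavefront' (m n) 0 x z * (snd h - 0 * fst h) - wavefront' 1 0 (x + m n) z * (snd h - 0 * fst h))
    + window' a b \<delta> (fst z) * fst h * ?p z" for z h
   have "(\<psi> has_derivative D z) (at z)" for z unfolding \<psi>_def[abs_def] D_def[abs_def]
    by (rule has_derivative_mult[OF window_deriv has_derivative_diff[OF wavefront_deriv wavefront_deriv]])
   then have fD: "frechet_derivative \<psi> (at z) = D z" for z using frechet_derivative_at by metis
   have phz: "?p z = ph n (snd z)" for z by (simp add: wavefront_def ph_def algebra_simps)
   have out: "window a b \<delta> (fst z) * ph n (snd z) = 0" "window' a b \<delta> (fst z) * (u z * ph n (snd z)) = 0"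
    if "z \<notin> {a..b} \<times> {x..x + m n + 1}" for z using that window_outside[OF \<delta>, of "fst z"] ph0[of "snd z" n] by (cases z; auto)+
   have "C_k k \<psi>" for k unfolding \<psi>_def[abs_def] by (intro C_k_mult C_k_window C_k_diff C_k_wavefront)
   then have "test_function \<psi>" by (rule test_function_I[of _ a b x "x + m n + 1"]) (use ab out in \<open>simp_all add: \<psi>_def phz\<close>)
   then have "0 = (LINT z:{0..} \<times> UNIV|lborel. \<sigma> (fst z) (snd z) * D z (1, 0) + 0 * D z (0, 1))"
    using ws unfolding weak_solution_def by (auto simp: fD)
   also have "... = (LINT z:{0..} \<times> UNIV|lborel. window' a b \<delta> (fst z) * (\<sigma> (fst z) (snd z) * ph n (snd z)))" by (simp add: D_def phz mult_ac)
   also have "... = (LBINT z. window' a b \<delta> (fst z) * (u z * ph n (snd z)))"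
    by (rule half_plane_integral[OF ev u(1,5), of "%s z. window' a b \<delta> (fst z) * (s * ph n (snd z))"]) (use window_outside[OF \<delta>] ab in auto)
   finally show "(LBINT z. window' a b \<delta> (fst z) * (u z * ph n (snd z))) = 0" by simp
   show "integrable lborel (%z. window' a b \<delta> (fst z) * (u z * ph n (snd z)))" by (rule integrable_plane'[of _ a b x "x + m n + 1", OF _ _ out(2)])
    (auto intro!: bounded_fun_intros bounded_funI[OF u(3)] bounded_fun_window' bounded_funI[OF ph1])
  qed
  have Gu: "(LBINT y. u (t, y) * ph n y) = G n t" if "t \<in> {a..b}" for t
   unfolding G_def using u(4)[of t] that ab spi[of t n] by (intro integral_cong_AE) auto
  have "G n b - G n a <= 0" by (rule window_increment[OF Gc ab, of "%z. u z * ph n (snd z)"]) (use Gu w in auto)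
  moreover have "- G n b - - G n a <= 0"
   by (rule window_increment[OF continuous_on_minus[OF Gc] ab, of "%z. - (u z * ph n (snd z))"]) (use Gu w in auto)
  ultimately show ?thesis by simp
 qed
 have G0: "G n t = G n 1" if "0 <= t" for n t by (rule continuous_constant_on_closure[of "{0<..}" "G n" "G n 1" t])
   (use Gc that G_const[of 1] G_const[of _ 1] in \<open>auto simp: linorder_neq_iff, metis linorder_neqE_linordered_idom\<close>)
 have lim: "(%n. G n t) \<longlonglongrightarrow> (LBINT y. \<sigma> t y * indicator {x<..} y)" if t: "0 <= t" for t unfolding G_def
 proof (rule integral_dominated_convergence[where w = "%y. \<bar>\<sigma> t y\<bar>"])
  have "eventually (%n. ph n y = indicator {x<..} y) sequentially" for y
  proof (cases "x < y")
   case True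
   obtain n0 :: nat where n0: "1 / (y - x) + (y - x) < real n0" using reals_Archimedean2 by blast
   have "ph n y = 1" if "n0 <= n" for n
   proof -
    have "0 < 1 / (y - x)" "real n0 < m n" using True that by (auto simp: m_def)
    then have "1 / (y - x) <= m n" "y - x <= m n" using n0 True by linarith+
    then show ?thesis using True by (simp add: ph_def ramp_eq_0 ramp_eq_1 pos_divide_le_eq)
   qed
   then show ?thesis using True by (auto simp: eventually_sequentially)
  next
   case False
   then have "m n * (y - x) <= 0" "y - x - m n <= 0" for n by (auto simp: m_def intro!: mult_nonneg_nonpos)
   then show ?thesis using False by (simp add: ph_def ramp_eq_0)
  qed
  then show "AE y in lborel. (%n. \<sigma> t y * ph n y) \<longlonglongrightarrow> \<sigma> t y * indicator {x<..} y" by (intro AE_I2 tendsto_mult tendsto_const tendsto_eventually)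
  show "AE y in lborel. norm (\<sigma> t y * ph n y) <= \<bar>\<sigma> t y\<bar>" for n using mult_left_le[OF ph1] by (auto simp: abs_mult)
 qed (use si[OF t] spi[OF t] in auto)
 show "(LBINT y. \<sigma> \<tau> y * indicator {x<..} y) = (LBINT y. \<sigma> 0 y * indicator {x<..} y)"
  using lim[OF \<tau>] lim[OF order_refl] unfolding G0[OF \<tau>] G0[OF order_refl] by (rule LIMSEQ_unique)
qed

section \<open>Local Taylor estimates\<close>

abbreviation fd :: "('a::euclidean_space => 'b::real_normed_vector) => 'a => 'a => 'b" where
 "fd f x \<equiv> frechet_derivative f (at x)"

lemma C_k_has_derivative: "C_k (Suc k) f ==> (f has_derivative fd f x) (at x)"
 by (rule C_k_SucD)

lemma fd_linear: "C_k (Suc k) f ==> linear (fd f x)"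
 by (rule linear_frechet_derivative) simp

lemma fd_basis:
 assumes "C_k (Suc k) f" shows "fd f x v = (\<Sum>i\<in>Basis. (v \<bullet> i) *\<^sub>R fd f x i)"
proof -
 have "fd f x (\<Sum>i\<in>Basis. (v \<bullet> i) *\<^sub>R i) = (\<Sum>i\<in>Basis. (v \<bullet> i) *\<^sub>R fd f x i)"
  by (simp add: linear_sum[OF fd_linear[OF assms]] linear_scale[OF fd_linear[OF assms]])
 then show ?thesis by (simp add: euclidean_representation)
qed

lemma finite_uniform_bound:
 assumes "finite I" "!!i. i \<in> I ==> \<exists>L\<ge>0. P i L" "!!i L L'. P i L ==> L <= L' ==> P i L'"
 shows "\<exists>L\<ge>0::real. \<forall>i\<in>I. P i L" using assms(1,2)
proof (induction I rule: finite_induct)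
 case (insert i I)
 obtain L1 where "0 <= L1" "\<forall>i\<in>I. P i L1" using insert by auto
 moreover obtain L2 where "0 <= L2" "P i L2" using insert.prems[of i] by auto
 ultimately show ?case by (intro exI[of _ "max L1 L2"]) (auto intro: assms(3))
qed auto

text \<open>\<open>C_k\<close> controls derivatives one direction at a time; linearity turns bounds
  on basis vectors into a bound uniform in the direction.\<close>

lemma bound_from_basis:
 fixes D :: "'p => 'a::euclidean_space => 'b::real_normed_vector"
 assumes lin: "!!p. linear (D p)" and D: "!!i. \<exists>L\<ge>0. \<forall>p\<in>X. norm (D p i) <= L * g p" and g: "!!p. 0 <= g p"
 shows "\<exists>L\<ge>0. \<forall>p\<in>X. \<forall>v. norm (D p v) <= L * g p * norm v"
proof -
 have "\<exists>L\<ge>0. \<forall>i\<in>Basis. \<forall>p\<in>X. norm (D p i) <= L * g p" by (rule finite_uniform_bound[OF finite_Basis D]) (meson g mult_right_mono order_trans)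
 then obtain L where L: "0 <= L" "!!i p. i \<in> Basis ==> p \<in> X ==> norm (D p i) <= L * g p" by blast
 have "norm (D p v) <= real DIM('a) * L * g p * norm v" if "p \<in> X" for p v
 proof -
  have "D p v = (\<Sum>i\<in>Basis. (v \<bullet> i) *\<^sub>R D p i)"
   by (subst euclidean_representation[symmetric, of v]) (simp only: linear_sum[OF lin] linear_scale[OF lin])
  also have "norm ... <= (\<Sum>i\<in>(Basis :: 'a set). norm v * (L * g p))" by (rule sum_norm_le) (use L that in \<open>auto intro!: mult_mono Basis_le_norm\<close>)
  finally show ?thesis by (simp add: mult_ac)
 qed
 then show ?thesis using L(1) by (intro exI[of _ "real DIM('a) * L"]) auto
qed

lemma C_1_deriv_bound:
 fixes f :: "'a::euclidean_space => 'b::real_normed_vector"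
 assumes "C_k (Suc 0) f"
 shows "\<exists>L\<ge>0. \<forall>x\<in>cball x0 \<rho>. \<forall>v. norm (fd f x v) <= L * norm v"
proof -
 have "\<exists>L\<ge>0. \<forall>x\<in>cball x0 \<rho>. norm (fd f x i) <= L * 1" for i
 proof -
  have "continuous_on (cball x0 \<rho>) (%x. fd f x i)" using C_k_SucD(2)[OF assms, of i] continuous_on_subset by auto
  then have "compact ((%x. fd f x i) ` cball x0 \<rho>)" by (intro compact_continuous_image) auto
  then obtain M where "\<forall>y\<in>(%x. fd f x i) ` cball x0 \<rho>. norm y <= M" using compact_imp_bounded bounded_iff by metis
  then show ?thesis by (intro exI[of _ "max 0 M"]) auto
 qed
 from bound_from_basis[OF fd_linear[OF assms] this] show ?thesis by simp
qed

lemma C_1_lipschitz: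
 fixes f :: "'a::euclidean_space => 'b::real_normed_vector"
 assumes "C_k (Suc 0) f"
 shows "\<exists>L\<ge>0. \<forall>x\<in>cball x0 \<rho>. \<forall>y\<in>cball x0 \<rho>. norm (f x - f y) <= L * norm (x - y)"
proof -
 obtain L where L: "0 <= L" "!!x v. x \<in> cball x0 \<rho> ==> norm (fd f x v) <= L * norm v" using C_1_deriv_bound[OF assms] by metis
 have "norm (f x - f y) <= L * norm (x - y)" if "x \<in> cball x0 \<rho>" "y \<in> cball x0 \<rho>" for x y by (rule differentiable_bound[OF convex_cball _ _ that])
    (use C_k_has_derivative[OF assms] L in \<open>auto intro: has_derivative_at_withinI onorm_bound\<close>)
 then show ?thesis using L(1) by auto
qed

lemma C_2_deriv_lipschitz:
 fixes f :: "'a::euclidean_space => 'b::real_normed_vector"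
 assumes "C_k (Suc (Suc 0)) f"
 shows "\<exists>L\<ge>0. \<forall>x\<in>cball x0 \<rho>. \<forall>y\<in>cball x0 \<rho>. \<forall>v. norm (fd f x v - fd f y v) <= L * norm (x - y) * norm v"
proof -
 let ?D = "%p v. fd f (fst p) v - fd f (snd p) v" and ?B = "cball x0 \<rho>"
 have "\<exists>L\<ge>0. \<forall>p\<in>?B \<times> ?B. norm (?D p i) <= L * norm (fst p - snd p)" for i using C_1_lipschitz[OF C_k_SucD(2)[OF assms], of x0 \<rho> i] by simp
 from bound_from_basis[OF linear_compose_sub[OF fd_linear[OF assms] fd_linear[OF assms]] this] show ?thesis by auto
qed

lemma C_2_taylor:
 fixes f :: "'a::euclidean_space => 'b::real_normed_vector"
 assumes "C_k (Suc (Suc 0)) f"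
 shows "\<exists>L\<ge>0. \<forall>x\<in>cball x0 \<rho>. \<forall>y\<in>cball x0 \<rho>. norm (f y - f x - fd f x (y - x)) <= L * (norm (y - x))\<^sup>2"
proof -
 have C1: "C_k (Suc 0) f" using C_k_mono_Suc[OF assms] .
 obtain L where L: "0 <= L" "!!x y v. x \<in> cball x0 \<rho> ==> y \<in> cball x0 \<rho> ==> norm (fd f x v - fd f y v) <= L * norm (x - y) * norm v"
  using C_2_deriv_lipschitz[OF assms] by metis
 have "norm (f y - f x - fd f x (y - x)) <= L * (norm (y - x))\<^sup>2" if xy: "x \<in> cball x0 \<rho>" "y \<in> cball x0 \<rho>" for x y
 proof -
  let ?S = "cball x0 \<rho> \<inter> cball x (norm (y - x))"
  have lin: "linear (fd f x)" by (rule fd_linear[OF C1])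
  have "norm ((f y - fd f x y) - (f x - fd f x x)) <= L * norm (y - x) * norm (y - x)"
  proof (rule differentiable_bound[where S = ?S and f' = "%z v. fd f z v - fd f x v"])
   show "((%z. f z - fd f x z) has_derivative (%v. fd f z v - fd f x v)) (at z within ?S)" for z
    by (intro has_derivative_diff has_derivative_at_withinI[OF C_k_has_derivative[OF C1]] linear_imp_has_derivative lin)
   show "onorm (%v. fd f z v - fd f x v) <= L * norm (y - x)" if "z \<in> ?S" for z
   proof (rule onorm_bound)
    fix v
    have "norm (fd f z v - fd f x v) <= L * norm (z - x) * norm v" using L(2)[of z x v] that xy by auto
    also have "... <= L * norm (y - x) * norm v" using that L(1) by (intro mult_right_mono mult_left_mono) (auto simp: dist_norm norm_minus_commute)
    finally show "norm (fd f z v - fd f x v) <= L * norm (y - x) * norm v" .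
   qed (use L in auto)
  qed (use xy in \<open>auto simp: dist_norm norm_minus_commute intro!: convex_Int\<close>)
  moreover have "(f y - fd f x y) - (f x - fd f x x) = f y - f x - fd f x (y - x)" by (simp add: linear_diff[OF lin])
  ultimately show ?thesis by (simp add: power2_eq_square mult.assoc)
 qed
 then show ?thesis using L(1) by auto
qed

lemma midpoint_shift: "(1/2) *\<^sub>R (x + y) + (1/2) *\<^sub>R (y - x) = y" "(1/2) *\<^sub>R (x + y) - (1/2) *\<^sub>R (y - x) = (x :: 'a::real_vector)"
 using scaleR_left_distrib[of "1/2" "1/2" x] scaleR_left_distrib[of "1/2" "1/2" y] by (simp_all add: algebra_simps)

lemma C_2_second_difference:
 fixes f :: "'a::euclidean_space => 'b::real_normed_vector"
 assumes "C_k (Suc (Suc 0)) f"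
 shows "\<exists>L\<ge>0. \<forall>m d. m + d \<in> cball x0 \<rho> & m - d \<in> cball x0 \<rho> --> norm (f (m + d) + f (m - d) - 2 *\<^sub>R f m) <= L * (norm d)\<^sup>2"
proof -
 obtain L where L: "0 <= L" "!!x y. x \<in> cball x0 \<rho> ==> y \<in> cball x0 \<rho> ==> norm (f y - f x - fd f x (y - x)) <= L * (norm (y - x))\<^sup>2"
  using C_2_taylor[OF assms] by metis
 have "norm (f (m + d) + f (m - d) - 2 *\<^sub>R f m) <= 2 * L * (norm d)\<^sup>2" if md: "m + d \<in> cball x0 \<rho>" "m - d \<in> cball x0 \<rho>" for m d
 proof -
  have "(1/2) *\<^sub>R (m + d) + (1/2) *\<^sub>R (m - d) \<in> cball x0 \<rho>" using md by (intro convexD[OF convex_cball]) auto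
  then have m: "m \<in> cball x0 \<rho>" by (simp add: scaleR_add_right[symmetric] flip: scaleR_2)
  have "f (m + d) + f (m - d) - 2 *\<^sub>R f m = (f (m + d) - f m - fd f m ((m + d) - m)) + (f (m - d) - f m - fd f m ((m - d) - m))"
   using linear_neg[OF fd_linear[OF C_k_mono_Suc[OF assms]], of m d] by (simp add: scaleR_2 algebra_simps)
  also have "norm ... <= L * (norm ((m + d) - m))\<^sup>2 + L * (norm ((m - d) - m))\<^sup>2" by (intro norm_triangle_mono L(2) m md)
  finally show ?thesis by simp
 qed
 then show ?thesis using L(1) by (intro exI[of _ "2 * L"]) auto
qed

text \<open>Accuracy of the midpoint rule: f (m + e) - f (m - e) - 2 f'(m) e vanishes at e = 0, and
  its derivative in e is a second difference of f', hence O(|e|^2).\<close>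

lemma C_3_midpoint:
 fixes f :: "'a::euclidean_space => 'b::real_normed_vector"
 assumes "C_k (Suc (Suc (Suc 0))) f"
 shows "\<exists>L\<ge>0. \<forall>x\<in>cball x0 \<rho>. \<forall>y\<in>cball x0 \<rho>. norm (f y - f x - fd f ((1/2) *\<^sub>R (x + y)) (y - x)) <= L * (norm (y - x)) ^ 3"
proof -
 have C1: "C_k (Suc 0) f" using C_k_le[OF assms, of "Suc 0"] by simp
 note lin = fd_linear[OF C1]
 let ?D = "%p v. fd f (fst p + snd p) v + fd f (fst p - snd p) v - 2 *\<^sub>R fd f (fst p) v"
 have linD: "linear (?D p)" for p by (intro linear_compose_sub linear_compose_add linear_compose_scale_right lin)
 have "\<exists>L\<ge>0. \<forall>p\<in>{p. fst p + snd p \<in> cball x0 \<rho> & fst p - snd p \<in> cball x0 \<rho>}. norm (?D p i) <= L * (norm (snd p))\<^sup>2" for i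
  using C_2_second_difference[OF C_k_SucD(2)[OF assms], of x0 \<rho> i] by auto
 from bound_from_basis[OF linD this] obtain L where L: "0 <= L" and sd: "!!m d v. m + d \<in> cball x0 \<rho> ==> m - d \<in> cball x0 \<rho> ==>
   norm (fd f (m + d) v + fd f (m - d) v - 2 *\<^sub>R fd f m v) <= L * (norm d)\<^sup>2 * norm v" by fastforce
 have "norm (f y - f x - fd f ((1/2) *\<^sub>R (x + y)) (y - x)) <= L * (norm (y - x)) ^ 3" if xy: "x \<in> cball x0 \<rho>" "y \<in> cball x0 \<rho>" for x y
 proof -
  define m where "m = (1/2) *\<^sub>R (x + y)"
  define d where "d = (1/2) *\<^sub>R (y - x)"
  have md: "m + d = y" "m - d = x" unfolding m_def d_def by (rule midpoint_shift)+
  have yx: "y - x = 2 *\<^sub>R d" by (simp add: d_def)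
  \<comment> \<open>Convex set of the offsets e with |e| <= |d| for which both m + e and m - e stay
    in the ball.\<close>
  let ?S = "cball (x0 - m) \<rho> \<inter> cball (m - x0) \<rho> \<inter> cball 0 (norm d)"
  let ?h = "%e. f (m + e) - f (m - e) - 2 *\<^sub>R fd f m e"
  have S: "m + e \<in> cball x0 \<rho> & m - e \<in> cball x0 \<rho> & norm e <= norm d" if "e \<in> ?S" for e
   using that by (auto simp: dist_norm norm_minus_commute algebra_simps)
  have "norm (?h d - ?h 0) <= L * (norm d)\<^sup>2 * norm (d - 0)"
  proof (rule differentiable_bound)
   fix e assume e: "e \<in> ?S"
   show "(?h has_derivative (%v. fd f (m + e) v + fd f (m - e) v - 2 *\<^sub>R fd f m v)) (at e within ?S)"
    by (rule has_derivative_eq_rhs[OF has_derivative_diff[OF has_derivative_diff[OF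
    has_derivative_compose[OF _ C_k_has_derivative[OF C1]] has_derivative_compose[OF _ C_k_has_derivative[OF C1]]]
    has_derivative_scaleR_right[OF linear_imp_has_derivative[OF lin]]]]) (auto intro!: derivative_eq_intros simp: linear_neg[OF lin])
   show "onorm (%v. fd f (m + e) v + fd f (m - e) v - 2 *\<^sub>R fd f m v) <= L * (norm d)\<^sup>2"
   proof (rule onorm_bound)
    fix v
    have "norm (fd f (m + e) v + fd f (m - e) v - 2 *\<^sub>R fd f m v) <= L * (norm e)\<^sup>2 * norm v" using S[OF e] by (intro sd) auto
    also have "... <= L * (norm d)\<^sup>2 * norm v" using S[OF e] L by (intro mult_right_mono mult_left_mono power_mono) auto
    finally show "norm (fd f (m + e) v + fd f (m - e) v - 2 *\<^sub>R fd f m v) <= L * (norm d)\<^sup>2 * norm v" .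
   qed (use L in auto)
  next
   have "dist x0 y = dist (x0 - m) d" "dist x0 x = dist (m - x0) d"
    unfolding md[symmetric] by (simp_all add: dist_norm norm_minus_commute algebra_simps)
   then show "d \<in> ?S" "0 \<in> ?S" using xy convexD[OF convex_cball, of y x0 \<rho> x "1/2" "1/2"]
    by (auto simp: m_def dist_norm norm_minus_commute scaleR_add_right add.commute)
  qed (intro convex_Int convex_cball)
  also have "... = L * norm d ^ 3" by (simp add: power2_eq_square power3_eq_cube)
  also have "... <= L * norm (y - x) ^ 3" using L by (intro mult_left_mono power_mono) (auto simp: d_def)
  finally show ?thesis using md unfolding m_def[symmetric] yx by (simp add: linear_scale[OF lin] linear_0[OF lin])
 qed
 then show ?thesis using L by blast
qed

text \<open>The mixed difference of f over the parallelogram spanned by t v and t w is symmetric in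
  v and w, and it equals t^2 times either iterated derivative up to O(t^3).\<close>

lemma second_derivative_symmetric:
 fixes f :: "'a::euclidean_space => 'b::real_normed_vector"
 assumes "C_k (Suc (Suc (Suc 0))) f"
 shows "fd (%z. fd f z v) x w = fd (%z. fd f z w) x v"
proof -
 have "C_k (Suc 0) f" using C_k_le[OF assms, of "Suc 0"] by simp
 note lin = fd_linear[OF this]
 have B: "\<exists>K. \<forall>t\<in>{0<..1}. norm (f (x + t *\<^sub>R v + t *\<^sub>R w) - f (x + t *\<^sub>R v) - f (x + t *\<^sub>R w) + f x - t\<^sup>2 *\<^sub>R fd (%z. fd f z w) x v) <= K * t ^ 3"
  for v w :: 'a
 proof -
  let ?R = "norm v + norm w" and ?g = "%z. fd f z w"
  have g: "C_k (Suc (Suc 0)) ?g" by (rule C_k_SucD(2)[OF assms])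
  note lg = fd_linear[OF g]
  obtain L1 where L1: "0 <= L1" "!!z y. z \<in> cball x ?R ==> y \<in> cball x ?R ==> norm (f y - f z - fd f ((1/2) *\<^sub>R (z + y)) (y - z)) <= L1 * (norm (y - z)) ^ 3"
   using C_3_midpoint[OF assms] by metis
  obtain L2 where L2: "0 <= L2" "!!z y. z \<in> cball x ?R ==> y \<in> cball x ?R ==> norm (?g y - ?g z - fd ?g z (y - z)) <= L2 * (norm (y - z))\<^sup>2"
   using C_2_taylor[OF g] by metis
  have "norm (f (x + t *\<^sub>R v + t *\<^sub>R w) - f (x + t *\<^sub>R v) - f (x + t *\<^sub>R w) + f x - t\<^sup>2 *\<^sub>R fd ?g x v) <= (2 * L1 * ?R ^ 3 + 2 * L2 * ?R\<^sup>2) * t ^ 3"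
   if t: "t \<in> {0<..1}" for t
  proof -
   have tv: "norm (s *\<^sub>R v + s' *\<^sub>R w) <= t * ?R" if "0 <= s" "s <= t" "0 <= s'" "s' <= t" for s s'
    using norm_triangle_ineq[of "s *\<^sub>R v" "s' *\<^sub>R w"] mult_right_mono[OF that(2), of "norm v"] mult_right_mono[OF that(4), of "norm w"] that
    by (simp add: distrib_left)
   have tR: "t * ?R <= ?R" using t by (intro mult_left_le_one_le) auto
   have in': "x + (s *\<^sub>R v + s' *\<^sub>R w) \<in> cball x ?R" if "0 <= s" "s <= t" "0 <= s'" "s' <= t" for s s'
    using order_trans[OF tv[OF that] tR] unfolding mem_cball dist_norm by (subst norm_minus_commute) simp
   define P where "P s = f (x + s *\<^sub>R v + t *\<^sub>R w) - f (x + s *\<^sub>R v) - t *\<^sub>R ?g (x + (s *\<^sub>R v + (t / 2) *\<^sub>R w))" for s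
   define Q where "Q s = ?g (x + (s *\<^sub>R v + (t / 2) *\<^sub>R w)) - ?g x - fd ?g x (s *\<^sub>R v + (t / 2) *\<^sub>R w)" for s
   have P: "norm (P s) <= L1 * (t * ?R) ^ 3" if "s \<in> {0, t}" for s
   proof -
    have "P s = f (x + (s *\<^sub>R v + t *\<^sub>R w)) - f (x + (s *\<^sub>R v + 0 *\<^sub>R w)) - fd f ((1/2) *\<^sub>R ((x + (s *\<^sub>R v + 0 *\<^sub>R w)) + (x + (s *\<^sub>R v + t *\<^sub>R w)))) (t *\<^sub>R w)"
    proof -
    have "(1/2) *\<^sub>R ((x + (s *\<^sub>R v + 0 *\<^sub>R w)) + (x + (s *\<^sub>R v + t *\<^sub>R w))) = x + (s *\<^sub>R v + (t / 2) *\<^sub>R w)"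
    by (simp add: scaleR_add_right field_simps flip: scaleR_2)
    then show ?thesis by (simp only: P_def linear_scale[OF lin]) (simp add: add.assoc)
    qed
    also have "norm ... <= L1 * norm (t *\<^sub>R w) ^ 3"
    using L1(2)[of "x + (s *\<^sub>R v + 0 *\<^sub>R w)" "x + (s *\<^sub>R v + t *\<^sub>R w)"] in'[of s 0] in'[of s t] that t by auto
    also have "... <= L1 * (t * ?R) ^ 3" using tv[of 0 t] t L1(1) by (intro mult_left_mono power_mono) auto
    finally show ?thesis .
   qed
   have Q: "norm (t *\<^sub>R Q s) <= t * (L2 * (t * ?R)\<^sup>2)" if "s \<in> {0, t}" for s
   proof -
    have s: "0 <= s" "s <= t" "0 <= t / 2" "t / 2 <= t" using that t by auto
    have "norm (Q s) <= L2 * (norm (s *\<^sub>R v + (t / 2) *\<^sub>R w))\<^sup>2" using L2(2)[OF _ in'[OF s], of x] by (simp add: Q_def)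
    also have "... <= L2 * (t * ?R)\<^sup>2" using tv[OF s] L2(1) by (intro mult_left_mono power_mono) auto
    finally show ?thesis using t by (simp add: mult_left_mono)
   qed
   have "f (x + t *\<^sub>R v + t *\<^sub>R w) - f (x + t *\<^sub>R v) - f (x + t *\<^sub>R w) + f x - t\<^sup>2 *\<^sub>R fd ?g x v = (P t - P 0) + (t *\<^sub>R Q t - t *\<^sub>R Q 0)"
    by (simp add: P_def Q_def linear_add[OF lg] linear_scale[OF lg] power2_eq_square algebra_simps)
   also have "norm ... <= (L1 * (t * ?R) ^ 3 + L1 * (t * ?R) ^ 3) + (t * (L2 * (t * ?R)\<^sup>2) + t * (L2 * (t * ?R)\<^sup>2))"
    by (intro norm_triangle_mono order_trans[OF norm_triangle_ineq4 add_mono] P Q) auto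
   also have "... = (2 * L1 * ?R ^ 3 + 2 * L2 * ?R\<^sup>2) * t ^ 3" unfolding power_mult_distrib by (simp add: eval_nat_numeral algebra_simps)
   finally show ?thesis .
  qed
  then show ?thesis by blast
 qed
 obtain K1 where K1: "!!t. t \<in> {0<..1} ==> norm (f (x + t *\<^sub>R v + t *\<^sub>R w) - f (x + t *\<^sub>R v) - f (x + t *\<^sub>R w) + f x - t\<^sup>2 *\<^sub>R fd (%z. fd f z w) x v) <= K1 * t ^ 3"
  using B by metis
 obtain K2 where K2: "!!t. t \<in> {0<..1} ==> norm (f (x + t *\<^sub>R w + t *\<^sub>R v) - f (x + t *\<^sub>R w) - f (x + t *\<^sub>R v) + f x - t\<^sup>2 *\<^sub>R fd (%z. fd f z v) x w) <= K2 * t ^ 3"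
  using B by metis
 let ?E = "norm (fd (%z. fd f z w) x v - fd (%z. fd f z v) x w)"
 have "?E <= (K1 + K2) * t" if t: "t \<in> {0<..1}" for t
 proof -
  have "t\<^sup>2 * ?E = norm (t\<^sup>2 *\<^sub>R (fd (%z. fd f z w) x v - fd (%z. fd f z v) x w))" by simp
  also have "t\<^sup>2 *\<^sub>R (fd (%z. fd f z w) x v - fd (%z. fd f z v) x w)
   = (f (x + t *\<^sub>R w + t *\<^sub>R v) - f (x + t *\<^sub>R w) - f (x + t *\<^sub>R v) + f x - t\<^sup>2 *\<^sub>R fd (%z. fd f z v) x w)
    - (f (x + t *\<^sub>R v + t *\<^sub>R w) - f (x + t *\<^sub>R v) - f (x + t *\<^sub>R w) + f x - t\<^sup>2 *\<^sub>R fd (%z. fd f z w) x v)" by (simp add: algebra_simps)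
  also have "norm ... <= K2 * t ^ 3 + K1 * t ^ 3" by (intro order_trans[OF norm_triangle_ineq4] add_mono K1 K2 t)
  also have "... = t\<^sup>2 * ((K1 + K2) * t)" by (simp add: power2_eq_square power3_eq_cube algebra_simps)
  finally show ?thesis using t by simp
 qed
 then have "eventually (%t. ?E <= (K1 + K2) * t) (at_right 0)" unfolding eventually_at_right_field by (intro exI[of _ 1]) auto
 moreover have "((%t. (K1 + K2) * t) \<longlongrightarrow> (K1 + K2) * 0) (at_right 0)" by (intro tendsto_intros)
 ultimately have "?E <= (K1 + K2) * 0" by (intro tendsto_lowerbound) auto
 then show ?thesis by simp
qed

section \<open>Eigenstructure\<close>

locale hyperbolic =
 fixes F :: "real ^ 'n => real ^ 'n" and lam :: "nat => real ^ 'n => real"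
  and l r :: "nat => real ^ 'n => real ^ 'n" and U0 :: "real ^ 'n" and I :: "nat set"
 assumes I_eq: "I = {1..CARD('n)}"
  and smooth_F: "smooth F"
  and ordered: "!!U. ordered_eigenvalues (jacobian F (at U)) (%j. lam j U)"
  and const_mult: "constant_multiplicity lam"
  and dual: "dual_eigenvectors F lam l r"
  and fields: "!!j. j \<in> I ==> genuinely_nonlinear lam r j \<or> linearly_degenerate lam r j"
begin

lemma finite_I [simp]: "finite I" and card_I: "card I = CARD('n)" by (auto simp: I_eq)

lemma C_F: "C_k k F" using smooth_F by (simp add: smooth_def)
lemma C_l: "j \<in> I ==> C_k k (l j)" using dual by (simp add: dual_eigenvectors_def smooth_def I_eq)
lemma C_r: "j \<in> I ==> C_k k (r j)" using dual by (simp add: dual_eigenvectors_def smooth_def I_eq)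

lemma dual_basis: "j \<in> I ==> k \<in> I ==> l j U \<bullet> r k U = (if j = k then 1 else 0)"
 using dual by (simp add: dual_eigenvectors_def I_eq)

lemma lam_mono: "j \<in> I ==> k \<in> I ==> j <= k ==> lam j U <= lam k U"
 using ordered[of U] by (simp add: ordered_eigenvalues_def I_eq)

lemma lam_eq_or: "j \<in> I ==> k \<in> I ==> lam j = lam k \<or> (\<forall>U. lam j U ~= lam k U)"
 using const_mult by (auto simp: constant_multiplicity_def fun_eq_iff I_eq)

lemma jacobian_fd: "jacobian F (at U) *v v = fd F U v"
proof -
 have "F differentiable (at U)" using C_F[of "Suc 0"] by simp
 then have "(F has_derivative (%h. jacobian F (at U) *v h)) (at U)" by (simp add: jacobian_works)
 then have "(%h. jacobian F (at U) *v h) = fd F U" by (rule frechet_derivative_at)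
 then show ?thesis by metis
qed

lemma eig_r: "j \<in> I ==> fd F U (r j U) = lam j U *\<^sub>R r j U"
 using dual unfolding dual_eigenvectors_def jacobian_fd[symmetric] I_eq by simp

lemma eig_l: assumes "j \<in> I" shows "l j U \<bullet> fd F U v = lam j U * (l j U \<bullet> v)"
proof -
 have "l j U v* jacobian F (at U) = lam j U *\<^sub>R l j U" using dual assms by (simp add: dual_eigenvectors_def I_eq)
 then have "(l j U v* jacobian F (at U)) \<bullet> v = lam j U * (l j U \<bullet> v)" by simp
 then show ?thesis unfolding jacobian_fd[symmetric] by (simp add: dot_lmul_matrix)
qed

lemma fd_F_sum: "fd F U v = (\<Sum>i\<in>Basis. (v \<bullet> i) *\<^sub>R fd F U i)"
 by (rule fd_basis[OF C_F[of "Suc 0"]])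

lemma lam_eq: "j \<in> I ==> lam j U = l j U \<bullet> (\<Sum>i\<in>Basis. (r j U \<bullet> i) *\<^sub>R fd F U i)"
 using eig_r[of j U] dual_basis[of j j U] unfolding fd_F_sum[of U "r j U", symmetric] by simp

text \<open>The eigenvalues inherit smoothness from the eigenvectors through the formula of
  \<open>lam_eq\<close>.\<close>

lemma C_lam: assumes "j \<in> I" shows "C_k k (lam j)"
proof -
 have "C_k k (%U. l j U \<bullet> (\<Sum>i\<in>Basis. (r j U \<bullet> i) *\<^sub>R fd F U i))" by (intro C_k_inner C_l C_k_sum C_k_scaleR C_r C_k_const C_k_SucD(2)[OF C_F] assms)
 moreover have "lam j = (%U. l j U \<bullet> (\<Sum>i\<in>Basis. (r j U \<bullet> i) *\<^sub>R fd F U i))" by (rule ext) (rule lam_eq[OF assms])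
 ultimately show ?thesis by (simp only:)
qed

lemma r_eq_zero: assumes "!!j. j \<in> I ==> l j U \<bullet> v = 0" shows "v = 0"
proof -
 have inj: "inj_on (%j. l j U) I"
 proof (rule inj_onI)
  fix j k assume jk: "j \<in> I" "k \<in> I" "l j U = l k U"
  then have "l j U \<bullet> r k U = 1" using dual_basis[of k k U] by simp
  then show "j = k" using dual_basis[OF jk(1,2), of U] by (auto split: if_splits)
 qed
 have ind: "independent ((%j. l j U) ` I)"
 proof (rule independent_if_scalars_zero)
  fix f x assume s: "(\<Sum>x\<in>(%j. l j U) ` I. f x *\<^sub>R x) = 0" and x: "x \<in> (%j. l j U) ` I"
  obtain k where k: "k \<in> I" "x = l k U" using x by auto
  have "0 = (\<Sum>j\<in>I. f (l j U) *\<^sub>R l j U) \<bullet> r k U" using s by (simp add: sum.reindex[OF inj])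
  also have "... = (\<Sum>j\<in>I. f (l j U) * (if j = k then 1 else 0))" unfolding inner_sum_left by (rule sum.cong) (use dual_basis k in auto)
  also have "... = f x" using k by (simp add: if_distrib cong: if_cong)
  finally show "f x = 0" by simp
 qed simp
 have "card ((%j. l j U) ` I) = DIM(real ^ 'n)" using card_image[OF inj] by (simp add: card_I)
 then have "span ((%j. l j U) ` I) = UNIV" using ind dim_eq_card_independent[OF ind] by (simp add: dim_eq_full[symmetric])
 then have "v \<in> span ((%j. l j U) ` I)" by simp
 then have "orthogonal v v" by (rule orthogonal_to_span) (use assms in \<open>auto simp: orthogonal_def inner_commute\<close>)
 then show ?thesis by (simp add: orthogonal_def)
qed

lemma expand_r: "v = (\<Sum>j\<in>I. (l j U \<bullet> v) *\<^sub>R r j U)"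
proof -
 have "v - (\<Sum>j\<in>I. (l j U \<bullet> v) *\<^sub>R r j U) = 0"
 proof (rule r_eq_zero)
  fix k assume k: "k \<in> I"
  have "l k U \<bullet> (\<Sum>j\<in>I. (l j U \<bullet> v) *\<^sub>R r j U) = (\<Sum>j\<in>I. (l j U \<bullet> v) * (if j = k then 1 else 0))"
   unfolding inner_sum_right by (rule sum.cong) (use dual_basis[OF k] in auto)
  also have "... = l k U \<bullet> v" using k by (simp add: if_distrib cong: if_cong)
  finally show "l k U \<bullet> (v - (\<Sum>j\<in>I. (l j U \<bullet> v) *\<^sub>R r j U)) = 0" by (simp add: inner_diff_right)
 qed
 then show ?thesis by simp
qed

lemma gnl_deriv: "genuinely_nonlinear lam r j ==> fd (lam j) U (r j U) = 1"
 and ld_deriv: "linearly_degenerate lam r j ==> fd (lam j) U (r j U) = 0" unfolding genuinely_nonlinear_def linearly_degenerate_def gderiv_def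
 by (metis frechet_derivative_at inner_commute)+

lemma not_both: "genuinely_nonlinear lam r j ==> \<not> linearly_degenerate lam r j"
 using gnl_deriv ld_deriv by (metis zero_neq_one)

lemma D2_sum:
 "fd (%z. fd F z w) U v = (\<Sum>i\<in>Basis. (w \<bullet> i) *\<^sub>R fd (%z. fd F z i) U v)"
proof -
 have 1: "((%z. fd F z i) has_derivative fd (%z. fd F z i) U) (at U)" for i by (rule C_k_has_derivative[of 0]) (rule C_k_SucD(2)[OF C_F])
 have "((%z. \<Sum>i\<in>Basis. (w \<bullet> i) *\<^sub>R fd F z i) has_derivative (%v. \<Sum>i\<in>Basis. (w \<bullet> i) *\<^sub>R fd (%z. fd F z i) U v)) (at U)"
  by (intro has_derivative_sum has_derivative_scaleR_right 1)
 then have "((%z. fd F z w) has_derivative (%v. \<Sum>i\<in>Basis. (w \<bullet> i) *\<^sub>R fd (%z. fd F z i) U v)) (at U)" unfolding fd_F_sum[of _ w, symmetric] .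
 from fun_cong[OF frechet_derivative_at[OF this], of v] show ?thesis by (rule sym)
qed

lemma differentiated_eigenvector:
 assumes j: "j \<in> I"
 shows "fd F U (fd (r j) U v) + fd (%z. fd F z (r j U)) U v = fd (lam j) U v *\<^sub>R r j U + lam j U *\<^sub>R fd (r j) U v"
proof -
 have 1: "((%z. fd F z i) has_derivative fd (%z. fd F z i) U) (at U)" for i by (rule C_k_has_derivative[of 0]) (rule C_k_SucD(2)[OF C_F])
 have 2: "(r j has_derivative fd (r j) U) (at U)" by (rule C_k_has_derivative[OF C_r[OF j]])
 have 3: "(lam j has_derivative fd (lam j) U) (at U)" by (rule C_k_has_derivative[OF C_lam[OF j]])
 have "((%z. \<Sum>i\<in>Basis. (r j z \<bullet> i) *\<^sub>R fd F z i) has_derivative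
   (%v. \<Sum>i\<in>Basis. (r j U \<bullet> i) *\<^sub>R fd (%z. fd F z i) U v + (fd (r j) U v \<bullet> i) *\<^sub>R fd F U i)) (at U)"
  by (intro has_derivative_sum has_derivative_scaleR has_derivative_inner_left 1 2)
 then have a: "((%z. fd F z (r j z)) has_derivative
   (%v. \<Sum>i\<in>Basis. (r j U \<bullet> i) *\<^sub>R fd (%z. fd F z i) U v + (fd (r j) U v \<bullet> i) *\<^sub>R fd F U i)) (at U)" unfolding fd_F_sum[of _ "r j _", symmetric] .
 have "(%z. fd F z (r j z)) = (%z. lam j z *\<^sub>R r j z)" using eig_r[OF j] by auto
 then have b: "((%z. fd F z (r j z)) has_derivative (%v. lam j U *\<^sub>R fd (r j) U v + fd (lam j) U v *\<^sub>R r j U)) (at U)"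
  using has_derivative_scaleR[OF 3 2] by (simp only:)
 from fun_cong[OF has_derivative_unique[OF a b], of v]
 have "(\<Sum>i\<in>Basis. (r j U \<bullet> i) *\<^sub>R fd (%z. fd F z i) U v + (fd (r j) U v \<bullet> i) *\<^sub>R fd F U i)
  = lam j U *\<^sub>R fd (r j) U v + fd (lam j) U v *\<^sub>R r j U" by metis
 then show ?thesis unfolding sum.distrib D2_sum[of "r j U" U v, symmetric] fd_F_sum[of U "fd (r j) U v", symmetric] by (simp add: add.commute)
qed

text \<open>The Lie bracket of the eigenvector fields, up to the sign convention.\<close>

definition comm where "comm j k U = fd (r j) U (r k U) - fd (r k) U (r j U)"

text \<open>Differentiate the eigenvalue relation of j along \<open>r k\<close> and that of k along
  \<open>r j\<close> and subtract: the second derivatives of F cancel by symmetry.\<close>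

lemma comm_eq:
 assumes jk: "j \<in> I" "k \<in> I" "lam j = lam k"
 shows "fd F U (comm j k U) - lam j U *\<^sub>R comm j k U = fd (lam j) U (r k U) *\<^sub>R r j U - fd (lam j) U (r j U) *\<^sub>R r k U"
proof -
 have sym: "fd (%z. fd F z (r j U)) U (r k U) = fd (%z. fd F z (r k U)) U (r j U)" by (rule second_derivative_symmetric[OF C_F])
 have d: "fd F U (comm j k U) = fd F U (fd (r j) U (r k U)) - fd F U (fd (r k) U (r j U))"
  unfolding comm_def by (rule linear_diff[OF fd_linear[OF C_F]])
 have 1: "fd F U (fd (r j) U (r k U)) = fd (lam j) U (r k U) *\<^sub>R r j U + lam j U *\<^sub>R fd (r j) U (r k U) - fd (%z. fd F z (r j U)) U (r k U)"
  using differentiated_eigenvector[OF jk(1), of U "r k U"] by (simp add: eq_diff_eq)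
 have 2: "fd F U (fd (r k) U (r j U)) = fd (lam k) U (r j U) *\<^sub>R r k U + lam k U *\<^sub>R fd (r k) U (r j U) - fd (%z. fd F z (r k U)) U (r j U)"
  using differentiated_eigenvector[OF jk(2), of U "r j U"] by (simp add: eq_diff_eq)
 show ?thesis unfolding d 1 2 sym jk(3) unfolding comm_def by (simp add: scaleR_diff_right)
qed

lemma l_comm:
 assumes "i \<in> I" "j \<in> I" "k \<in> I" "lam j = lam k"
 shows "(lam i U - lam j U) * (l i U \<bullet> comm j k U)
  = fd (lam j) U (r k U) * (if i = j then 1 else 0) - fd (lam j) U (r j U) * (if i = k then 1 else 0)"
proof -
 have "l i U \<bullet> (fd F U (comm j k U) - lam j U *\<^sub>R comm j k U) = (lam i U - lam j U) * (l i U \<bullet> comm j k U)"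
  using eig_l[OF assms(1), of U "comm j k U"] by (simp add: inner_diff_right left_diff_distrib)
 moreover have "l i U \<bullet> (fd (lam j) U (r k U) *\<^sub>R r j U - fd (lam j) U (r j U) *\<^sub>R r k U)
  = fd (lam j) U (r k U) * (if i = j then 1 else 0) - fd (lam j) U (r j U) * (if i = k then 1 else 0)"
  using dual_basis[OF assms(1,2), of U] dual_basis[OF assms(1,3), of U] by (simp add: inner_diff_right)
 ultimately show ?thesis using comm_eq[OF assms(2-4), of U] by simp
qed

text \<open>Boillat's observation: a multiple eigenvalue is linearly degenerate.\<close>

lemma multiple_deriv_zero:
 assumes "j \<in> I" "k \<in> I" "lam j = lam k" "j ~= k"
 shows "fd (lam j) U (r k U) = 0" using l_comm[of j j k U] assms by simp

lemma gnl_simple: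
 assumes "j \<in> I" "k \<in> I" "lam j = lam k" "genuinely_nonlinear lam r j"
 shows "k = j"
proof (rule ccontr)
 assume "k ~= j"
 then have "fd (lam k) U0 (r j U0) = 0" using multiple_deriv_zero[of k j U0] assms by auto
 then show False using gnl_deriv[OF assms(4), of U0] assms(3) by simp
qed

lemma ld_deriv_group:
 assumes "j \<in> I" "k \<in> I" "lam j = lam k" "linearly_degenerate lam r j"
 shows "fd (lam j) U (r k U) = 0" using multiple_deriv_zero[OF assms(1-3)] ld_deriv[OF assms(4)] by (cases "j = k") auto

text \<open>The bracket of two fields with a common eigenvalue has no component along eigenvectors
  of other eigenvalues, because the factor lam i - lam j never vanishes. This is the integrability
  condition behind the ansatz.\<close>

lemma group_involutive:
 assumes "i \<in> I" "j \<in> I" "k \<in> I" "lam j = lam k" "lam i ~= lam j"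
 shows "l i U \<bullet> fd (r j) U (r k U) = l i U \<bullet> fd (r k) U (r j U)"
proof -
 have "lam i U ~= lam j U" using lam_eq_or[OF assms(1,2)] assms(5) by blast
 moreover have "i ~= j" "i ~= k" using assms by auto
 ultimately have "l i U \<bullet> comm j k U = 0" using l_comm[OF assms(1-4), of U] by simp
 then show ?thesis by (simp add: comm_def inner_diff_right)
qed

lemma differentiated_duality:
 assumes "i \<in> I" "j \<in> I"
 shows "fd (l i) U v \<bullet> r j U = - (l i U \<bullet> fd (r j) U v)"
proof -
 have "((%z. l i z \<bullet> r j z) has_derivative (%v. l i U \<bullet> fd (r j) U v + fd (l i) U v \<bullet> r j U)) (at U)"
  by (rule has_derivative_inner[OF C_k_has_derivative[OF C_l] C_k_has_derivative[OF C_r]]) (use assms in auto)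
 moreover have "((%z. l i z \<bullet> r j z) has_derivative (%v. 0)) (at U)" using dual_basis[OF assms] by simp
 ultimately have "(%v. l i U \<bullet> fd (r j) U v + fd (l i) U v \<bullet> r j U) = (%v. 0)" by (rule has_derivative_unique)
 then have "l i U \<bullet> fd (r j) U v + fd (l i) U v \<bullet> r j U = 0" by metis
 then show ?thesis by simp
qed

end

section \<open>Uniform constants near the base state\<close>

locale hyperbolic_bounds = hyperbolic F lam l r U0 I
 for F :: "real ^ 'n => real ^ 'n" and lam l r U0 I +
 fixes C :: real
 assumes C1: "1 <= C"
  and bound_l: "!!j x. j \<in> I ==> x \<in> cball U0 1 ==> norm (l j x) <= C"
  and bound_r: "!!j x. j \<in> I ==> x \<in> cball U0 1 ==> norm (r j x) <= C"
  and bound_lam: "!!j x. j \<in> I ==> x \<in> cball U0 1 ==> \<bar>lam j x\<bar> <= C"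
  and lip_l: "!!j x y. j \<in> I ==> x \<in> cball U0 1 ==> y \<in> cball U0 1 ==> norm (l j x - l j y) <= C * norm (x - y)"
  and lip_r: "!!j x y. j \<in> I ==> x \<in> cball U0 1 ==> y \<in> cball U0 1 ==> norm (r j x - r j y) <= C * norm (x - y)"
  and lip_lam: "!!j x y. j \<in> I ==> x \<in> cball U0 1 ==> y \<in> cball U0 1 ==> \<bar>lam j x - lam j y\<bar> <= C * norm (x - y)"
  and mid_F: "!!x y. x \<in> cball U0 1 ==> y \<in> cball U0 1 ==> norm (F y - F x - fd F ((1/2) *\<^sub>R (x + y)) (y - x)) <= C * norm (y - x) ^ 3"
  and mid_lam: "!!j x y. j \<in> I ==> x \<in> cball U0 1 ==> y \<in> cball U0 1 ==> \<bar>lam j ((1/2) *\<^sub>R (x + y)) - (lam j x + lam j y) / 2\<bar> <= C * norm (y - x) ^ 2"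
  and taylor_l: "!!j x. j \<in> I ==> x \<in> cball U0 1 ==> norm (l j x - l j U0 - fd (l j) U0 (x - U0)) <= C * (norm (x - U0))\<^sup>2"
  and taylor_lam: "!!j x. j \<in> I ==> x \<in> cball U0 1 ==> \<bar>lam j x - lam j U0 - fd (lam j) U0 (x - U0)\<bar> <= C * (norm (x - U0))\<^sup>2"
  and bound_fd_l: "!!j v. j \<in> I ==> norm (fd (l j) U0 v) <= C * norm v"
  and bound_fd_lam: "!!j v. j \<in> I ==> \<bar>fd (lam j) U0 v\<bar> <= C * norm v"
  and bound_fd_r: "!!j v. j \<in> I ==> norm (fd (r j) U0 v) <= C * norm v"
  and gap: "!!i j. i \<in> I ==> j \<in> I ==> lam i ~= lam j ==> 1 / C <= \<bar>lam i U0 - lam j U0\<bar>"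

context hyperbolic begin

lemma uniform_family:
 assumes "!!j. j \<in> I ==> \<exists>L\<ge>0. P j L" "!!j L L'. P j L ==> L <= L' ==> P j L'"
 shows "\<forall>\<^sub>F L::real in at_top. \<forall>j\<in>I. P j L"
proof -
 have "\<exists>L\<ge>0. \<forall>i\<in>I. P i L" by (rule finite_uniform_bound[OF finite_I]) (use assms in blast)+
 then show ?thesis using assms(2) unfolding eventually_at_top_linorder by blast
qed

lemma continuous_bound:
 fixes f :: "real ^ 'n => 'b::real_normed_vector"
 assumes "C_k 0 f" shows "\<exists>L\<ge>0. \<forall>x\<in>cball U0 1. norm (f x) <= L"
proof -
 have "compact (f ` cball U0 1)" using assms by (intro compact_continuous_image) (auto intro: continuous_on_subset)
 then obtain M where "\<forall>y\<in>f ` cball U0 1. norm y <= M" using compact_imp_bounded bounded_iff by metis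
 then show ?thesis by (intro exI[of _ "max 0 M"]) auto
qed

text \<open>Each estimate holds for all large constants, so a filter at infinity merges finitely
  many of them into one \<open>C\<close>, which also bounds the reciprocal of the spectral gap. The
  gap is positive because distinct eigenvalue functions differ at every state.\<close>

lemma bounds_exist: "\<exists>C. hyperbolic_bounds F lam l r U0 I C"
proof -
 let ?B = "cball U0 1"
 have U0: "U0 \<in> ?B" by simp
 have "\<exists>L. \<forall>x\<in>?B. \<forall>y\<in>?B. norm (F y - F x - fd F ((1/2) *\<^sub>R (x + y)) (y - x)) <= L * norm (y - x) ^ 3" using C_3_midpoint[OF C_F] by blast
 then have F: "\<forall>\<^sub>F L in at_top. \<forall>x\<in>?B. \<forall>y\<in>?B. norm (F y - F x - fd F ((1/2) *\<^sub>R (x + y)) (y - x)) <= L * norm (y - x) ^ 3"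
  unfolding eventually_at_top_linorder by (meson mult_right_mono norm_ge_zero order_trans zero_le_power)
 have 1: "\<forall>\<^sub>F L in at_top. \<forall>j\<in>I. \<forall>x\<in>?B. norm (l j x) <= L" "\<forall>\<^sub>F L in at_top. \<forall>j\<in>I. \<forall>x\<in>?B. norm (r j x) <= L"
  "\<forall>\<^sub>F L in at_top. \<forall>j\<in>I. \<forall>x\<in>?B. norm (lam j x) <= L" by (rule uniform_family, intro continuous_bound C_l C_r C_lam, assumption, meson order_trans)+
 have 2: "\<forall>\<^sub>F L in at_top. \<forall>j\<in>I. \<forall>x\<in>?B. \<forall>y\<in>?B. norm (l j x - l j y) <= L * norm (x - y)"
  "\<forall>\<^sub>F L in at_top. \<forall>j\<in>I. \<forall>x\<in>?B. \<forall>y\<in>?B. norm (r j x - r j y) <= L * norm (x - y)"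
  "\<forall>\<^sub>F L in at_top. \<forall>j\<in>I. \<forall>x\<in>?B. \<forall>y\<in>?B. norm (lam j x - lam j y) <= L * norm (x - y)"
  by (rule uniform_family, intro C_1_lipschitz C_l C_r C_lam, assumption, meson mult_right_mono norm_ge_zero order_trans)+
 have 3: "\<forall>\<^sub>F L in at_top. \<forall>j\<in>I. \<forall>m d. m + d \<in> ?B & m - d \<in> ?B --> norm (lam j (m + d) + lam j (m - d) - 2 *\<^sub>R lam j m) <= L * (norm d)\<^sup>2"
  by (rule uniform_family) (intro C_2_second_difference[OF C_lam], assumption, meson mult_right_mono zero_le_power2 order_trans)
 have 4: "\<forall>\<^sub>F L in at_top. \<forall>j\<in>I. \<forall>x\<in>?B. \<forall>y\<in>?B. norm (l j y - l j x - fd (l j) x (y - x)) <= L * (norm (y - x))\<^sup>2"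
  "\<forall>\<^sub>F L in at_top. \<forall>j\<in>I. \<forall>x\<in>?B. \<forall>y\<in>?B. norm (lam j y - lam j x - fd (lam j) x (y - x)) <= L * (norm (y - x))\<^sup>2"
  by (rule uniform_family, intro C_2_taylor C_l C_lam, assumption, meson mult_right_mono zero_le_power2 order_trans)+
 have 5: "\<forall>\<^sub>F L in at_top. \<forall>j\<in>I. \<forall>x\<in>?B. \<forall>v. norm (fd (l j) x v) <= L * norm v"
  "\<forall>\<^sub>F L in at_top. \<forall>j\<in>I. \<forall>x\<in>?B. \<forall>v. norm (fd (lam j) x v) <= L * norm v"
  "\<forall>\<^sub>F L in at_top. \<forall>j\<in>I. \<forall>x\<in>?B. \<forall>v. norm (fd (r j) x v) <= L * norm v"
  by (rule uniform_family, intro C_1_deriv_bound C_l C_lam C_r, assumption, meson mult_right_mono norm_ge_zero order_trans)+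
 have "\<forall>\<^sub>F L in at_top. 1 / L <= \<bar>lam i U0 - lam j U0\<bar>" if "i \<in> I" "j \<in> I" "lam i ~= lam j" for i j
 proof -
  have "0 < \<bar>lam i U0 - lam j U0\<bar>" using lam_eq_or[of i j] that by auto
  with real_tendsto_divide_at_top[OF tendsto_const filterlim_ident]
  have "\<forall>\<^sub>F L in at_top. 1 / L < \<bar>lam i U0 - lam j U0\<bar>" by (rule order_tendstoD(2))
  then show ?thesis by eventually_elim simp
 qed
 then have gap: "\<forall>\<^sub>F L in at_top. \<forall>i\<in>I. \<forall>j\<in>{j \<in> I. lam i ~= lam j}. 1 / L <= \<bar>lam i U0 - lam j U0\<bar>" by (intro eventually_ball_finite ballI) auto
 have "\<forall>\<^sub>F C in at_top. hyperbolic_bounds F lam l r U0 I C" using F 1 2 3 4 5 gap eventually_ge_at_top[of 1]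
 proof eventually_elim
  case (elim C)
  show ?case
  proof unfold_locales
   show "\<bar>lam j ((1/2) *\<^sub>R (x + y)) - (lam j x + lam j y) / 2\<bar> <= C * norm (y - x) ^ 2"
    if j: "j \<in> I" and xy: "x \<in> ?B" "y \<in> ?B" for j x y
   proof -
    let ?m = "(1/2) *\<^sub>R (x + y)" and ?d = "(1/2) *\<^sub>R (y - x)"
    have "norm (lam j (?m + ?d) + lam j (?m - ?d) - 2 *\<^sub>R lam j ?m) <= C * (norm ?d)\<^sup>2"
    by (rule elim(8)[rule_format, OF j]) (use midpoint_shift[of x y] xy in auto)
    then have "\<bar>lam j y + lam j x - 2 * lam j ?m\<bar> <= C * (norm ?d)\<^sup>2" unfolding midpoint_shift by simp
    moreover have "C * (norm ?d)\<^sup>2 <= C * (norm (y - x))\<^sup>2" "0 <= C * (norm (y - x))\<^sup>2" using elim(15) by (auto intro!: mult_left_mono power_mono)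
    ultimately show ?thesis unfolding abs_le_iff by (intro conjI) (simp_all add: field_simps)
   qed
   show "1 / C <= \<bar>lam i U0 - lam j U0\<bar>" if "i \<in> I" "j \<in> I" "lam i ~= lam j" for i j using elim(14) that by auto
  qed (use elim U0 in auto)
 qed
 then show ?thesis using eventually_happens'[OF trivial_limit_at_top_linorder] by blast
qed

end

lemma eventually_small: "0 < b ==> eventually (%\<epsilon>. a * \<epsilon> < b) (at_right (0::real))"
proof -
 assume b: "0 < b"
 have "((%\<epsilon>. a * \<epsilon>) \<longlongrightarrow> a * 0) (at_right 0)" by (intro tendsto_intros)
 then show ?thesis using b by (simp add: order_tendstoD(2))
qed

lemma small_multiples:
 assumes "finite A" "\<forall>p\<in>A. 0 < snd p" shows "\<exists>x>0::real. \<forall>(a, b)\<in>A. a * x < b"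
proof -
 have "eventually (%x. 0 < x & (\<forall>p\<in>A. fst p * x < snd p)) (at_right 0)"
  using assms by (intro eventually_conj eventually_ball_finite ballI eventually_small eventually_at_right_less) auto
 from eventually_happens'[OF _ this] show ?thesis by (force simp: case_prod_unfold)
qed

context hyperbolic_bounds begin

lemma C0: "0 <= C" using C1 by simp

lemma expand_bound:
 assumes "x \<in> cball U0 1" shows "norm v <= C * (\<Sum>j\<in>I. \<bar>l j x \<bullet> v\<bar>)"
proof -
 have "norm v = norm (\<Sum>j\<in>I. (l j x \<bullet> v) *\<^sub>R r j x)" using expand_r[of v x] by simp
 also have "... <= (\<Sum>j\<in>I. \<bar>l j x \<bullet> v\<bar> * C)" by (rule sum_norm_le) (use bound_r assms in \<open>auto intro: mult_left_mono\<close>)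
 also have "... = C * (\<Sum>j\<in>I. \<bar>l j x \<bullet> v\<bar>)" by (subst sum_distrib_right[symmetric]) (rule mult.commute)
 finally show ?thesis .
qed

section \<open>Elementary waves of small strength\<close>

lemma midpoint_in: "x \<in> cball U0 \<rho> ==> y \<in> cball U0 \<rho> ==> (1/2) *\<^sub>R (x + y) \<in> cball U0 \<rho>"
 unfolding scaleR_add_right by (rule convexD[OF convex_cball]) auto

text \<open>Almost satisfying the Rankine-Hugoniot relations with a speed near \<open>\<lambda>\<^sub>i\<close> forces the jump to be
  almost parallel to the eigenspace at the midpoint: pair the relation with \<open>l\<^sub>k\<close> there.\<close>

lemma transversal_component:
 assumes i: "i \<in> I" and k: "k \<in> I" and ne: "lam k ~= lam i"
  and us: "us \<in> cball U0 \<rho>" and ut: "ut \<in> cball U0 \<rho>" and \<rho>: "\<rho> <= 1"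
  and rh: "norm (F ut - F us - s *\<^sub>R (ut - us)) <= K * norm (ut - us) ^ 3"
  and s: "\<bar>s - lam i U0\<bar> <= \<theta>" and small: "\<theta> + C * \<rho> <= 1 / (2 * C)"
 shows "\<bar>l k ((1/2) *\<^sub>R (us + ut)) \<bullet> (ut - us)\<bar> <= 2 * C * C * (K + C) * norm (ut - us) ^ 3"
proof -
 let ?m = "(1/2) *\<^sub>R (us + ut)" and ?d = "ut - us"
 have m: "?m \<in> cball U0 \<rho>" using midpoint_in[OF us ut] .
 have sub: "cball U0 \<rho> \<subseteq> cball U0 1" using \<rho> by (rule subset_cball)
 have "norm (fd F ?m ?d - s *\<^sub>R ?d) <= norm (F ut - F us - s *\<^sub>R ?d) + norm (F ut - F us - fd F ?m ?d)"
  using norm_triangle_ineq4[of "F ut - F us - s *\<^sub>R ?d" "F ut - F us - fd F ?m ?d"] by simp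
 also have "... <= K * norm ?d ^ 3 + C * norm ?d ^ 3" using rh mid_F[of us ut] subsetD[OF sub us] subsetD[OF sub ut] by (intro add_mono) auto
 finally have 1: "norm (fd F ?m ?d - s *\<^sub>R ?d) <= (K + C) * norm ?d ^ 3" by (simp add: distrib_right)
 have "l k ?m \<bullet> (fd F ?m ?d - s *\<^sub>R ?d) = (lam k ?m - s) * (l k ?m \<bullet> ?d)"
  using eig_l[OF k, of ?m ?d] by (simp add: inner_diff_right left_diff_distrib)
 moreover have "\<bar>l k ?m \<bullet> (fd F ?m ?d - s *\<^sub>R ?d)\<bar> <= C * ((K + C) * norm ?d ^ 3)"
  by (rule order_trans[OF Cauchy_Schwarz_ineq2]) (use bound_l[OF k] m sub 1 C0 in \<open>intro mult_mono, auto\<close>)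
 ultimately have 2: "\<bar>lam k ?m - s\<bar> * \<bar>l k ?m \<bullet> ?d\<bar> <= C * ((K + C) * norm ?d ^ 3)" by (simp add: abs_mult)
 have "\<bar>lam k ?m - lam k U0\<bar> <= C * norm (?m - U0)" using lip_lam[OF k, of ?m U0] m sub by auto
 also have "... <= C * \<rho>" using m C0 by (intro mult_left_mono) (auto simp: dist_norm norm_minus_commute)
 finally have "\<bar>lam k ?m - s\<bar> >= 1 / C - C * \<rho> - \<theta>" using gap[OF k i ne] s by (auto simp: abs_if split: if_splits)
 then have 3: "1 / (2 * C) <= \<bar>lam k ?m - s\<bar>" using small C1 by (simp add: field_simps)
 have "1 / (2 * C) * \<bar>l k ?m \<bullet> ?d\<bar> <= \<bar>lam k ?m - s\<bar> * \<bar>l k ?m \<bullet> ?d\<bar>" using 3 by (intro mult_right_mono) auto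
 also note 2
 finally show ?thesis using C1 by (simp add: field_simps)
qed

text \<open>What rarefactions, shocks and contacts have in common up to the order needed:
  Rankine-Hugoniot with the mean speed up to a cubic defect, edges close to the eigenvalue, opening
  only by an increase of the eigenvalue, and mean speed correct to second order. The estimates of
  fans then need no distinction of types.\<close>

definition near_wave :: "real => nat => real ^ 'n => real ^ 'n => real => real => bool" where
 "near_wave K i us ut a b \<longleftrightarrow> a <= b & norm (F ut - F us - ((a + b) / 2) *\<^sub>R (ut - us)) <= K * norm (ut - us) ^ 3 &
   \<bar>a - lam i us\<bar> <= K * norm (ut - us) & \<bar>b - lam i us\<bar> <= K * norm (ut - us) &
   b - a <= max 0 (lam i ut - lam i us) & \<bar>(a + b) / 2 - (lam i us + lam i ut) / 2\<bar> <= K * (norm (ut - us))\<^sup>2"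

lemma near_wave_mono: "near_wave K i us ut a b ==> K <= K' ==> near_wave K' i us ut a b"
 unfolding near_wave_def by (meson mult_right_mono norm_ge_zero order_trans zero_le_power zero_le_power2)

lemma ld_near_wave:
 assumes "F ut - F us = a *\<^sub>R (ut - us)" "lam i us = a" "lam i ut = a" "0 <= K"
 shows "near_wave K i us ut a a" using assms by (simp add: near_wave_def)

text \<open>As a and b are the eigenvalues at the ends, b - a is at most \<open>C\<close> times the
  jump. The defect of the Rankine-Hugoniot relation is of third order because its leading density
  (\<xi> - c) r is odd about the mean speed c.\<close>

lemma rarefaction_wave:
 assumes j: "j \<in> I" and gnl: "genuinely_nonlinear lam r j"
  and ab: "a = lam j us" "b = lam j ut" "a <= b" and \<phi>ab: "\<phi> a = us" "\<phi> b = ut"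
  and \<phi>': "!!\<xi>. \<xi> \<in> {a..b} ==> (\<phi> has_vector_derivative r j (\<phi> \<xi>)) (at \<xi> within {a..b})"
  and us: "us \<in> cball U0 \<rho>" and ut: "ut \<in> cball U0 \<rho>" and \<rho>: "4 * C * C * \<rho> < 1/2"
 shows "near_wave (C ^ 5) j us ut a b" "!!\<xi>. \<xi> \<in> {a..b} ==> norm (\<phi> \<xi> - us) <= C * C * norm (ut - us)"
proof -
 have CC: "1 <= C * C" using C1 mult_mono[of 1 C 1 C] by simp
 have \<rho>0: "0 <= \<rho>" using us by (auto intro: order_trans[OF zero_le_dist])
 have \<rho>1: "4 * \<rho> <= 1/2" using \<rho> mult_right_mono[OF CC, of "4 * \<rho>"] \<rho>0 by (simp add: mult_ac)
 have sub: "us \<in> cball U0 1" "ut \<in> cball U0 1" using us ut \<rho>1 \<rho>0 by auto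
 have len: "b - a <= C * norm (ut - us)" using lip_lam[OF j sub(2,1)] ab by (simp add: abs_le_iff)
 have "norm (ut - us) <= 2 * \<rho>" using us ut norm_triangle_ineq4[of "ut - U0" "us - U0"] by (auto simp: dist_norm norm_minus_commute)
 then have len2: "b - a <= C * (2 * \<rho>)" using len C0 mult_left_mono order_trans by blast
 have cont: "continuous_on {a..b} \<phi>" by (rule continuous_on_vector_derivative[OF \<phi>'])
 have lip: "norm (\<phi> \<xi>' - \<phi> \<xi>) <= C * (\<xi>' - \<xi>)"
  if t: "a <= \<xi>" "\<xi> <= \<xi>'" "\<xi>' <= b" and stay: "!!t. t \<in> {\<xi>..\<xi>'} ==> \<phi> t \<in> cball U0 1" for \<xi> \<xi>'
 proof -
  have "norm (\<phi> \<xi>' - \<phi> \<xi>) <= C * norm (\<xi>' - \<xi>)"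
  proof (rule differentiable_bound[where S = "{\<xi>..\<xi>'}" and f' = "%t h. h *\<^sub>R r j (\<phi> t)"])
   fix t assume t': "t \<in> {\<xi>..\<xi>'}"
   have "(\<phi> has_vector_derivative r j (\<phi> t)) (at t within {a..b})" using \<phi>' t' t by auto
   then have "(\<phi> has_vector_derivative r j (\<phi> t)) (at t within {\<xi>..\<xi>'})" by (rule has_vector_derivative_within_subset) (use t in auto)
   then show "(\<phi> has_derivative (%h. h *\<^sub>R r j (\<phi> t))) (at t within {\<xi>..\<xi>'})" by (simp add: has_vector_derivative_def)
   show "onorm (%h. h *\<^sub>R r j (\<phi> t)) <= C"
   proof (rule onorm_bound)
    fix h :: real
    have "\<bar>h\<bar> * norm (r j (\<phi> t)) <= \<bar>h\<bar> * C" using bound_r[OF j stay[OF t']] by (intro mult_left_mono) auto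
    then show "norm (h *\<^sub>R r j (\<phi> t)) <= C * norm h" by (simp add: mult.commute)
   qed (rule C0)
  qed (use t in auto)
  then show ?thesis using t by simp
 qed
 \<comment> \<open>The curve starts within 1/8 of \<open>U0\<close>. Up to the first time at which
   it is 3/4 away, its velocity is at most \<open>C\<close>, so it has moved by at most 1/4, a
   contradiction.\<close>
 have stay: "\<phi> \<xi> \<in> cball U0 1" if t: "\<xi> \<in> {a..b}" for \<xi>
 proof (rule ccontr)
  assume out: "\<phi> \<xi> \<notin> cball U0 1"
  let ?m = "%t. norm (\<phi> t - U0)"
  have mc: "continuous_on {a..b} ?m" by (intro continuous_intros cont)
  have ma: "?m a <= 1/8" using us \<phi>ab \<rho>1 by (simp add: dist_norm norm_minus_commute)
  define S where "S = {a..b} \<inter> ?m -` {3/4..}"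
  have "closed S" unfolding S_def by (rule continuous_closed_preimage[OF mc]) auto
  then have "compact S" unfolding S_def by (metis closed_Int_compact compact_Icc compact_Int_closed inf.left_idem inf_commute)
  moreover have "S ~= {}" using out t by (auto simp: S_def dist_norm norm_minus_commute intro!: exI[of _ \<xi>])
  ultimately obtain t0 where t0: "t0 \<in> S" "!!t. t \<in> S ==> t0 <= t" using compact_attains_inf by metis
  have t0ab: "a <= t0" "t0 <= b" "3/4 <= ?m t0" using t0(1) by (auto simp: S_def)
  have "continuous_on {a..t0} ?m" using mc by (rule continuous_on_subset) (use t0ab in auto)
  then obtain t1 where t1: "a <= t1" "t1 <= t0" "?m t1 = 3/4" using IVT'[of ?m a "3/4" t0] ma t0ab by auto
  then have "t1 \<in> S" using t0ab by (auto simp: S_def)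
  then have "t1 = t0" using t0(2) t1 by force
  then have mt0: "?m t0 = 3/4" using t1 by simp
  have "\<phi> t \<in> cball U0 1" if "t \<in> {a..t0}" for t
  proof (cases "t = t0")
   case False
   then have "t \<notin> S" using t0(2)[of t] that by auto
   then show ?thesis using that t0ab by (auto simp: S_def dist_norm norm_minus_commute)
  qed (use mt0 in \<open>simp add: dist_norm norm_minus_commute\<close>)
  then have "norm (\<phi> t0 - \<phi> a) <= C * (t0 - a)" by (intro lip) (use t0ab in auto)
  also have "... <= C * (C * (2 * \<rho>))" using len2 t0ab C0 by (intro mult_left_mono) auto
  also have "... <= 1/4" using \<rho> by simp
  finally have "norm (\<phi> t0 - \<phi> a) <= 1/4" .
  then have "?m t0 <= 1/4 + 1/8" using ma norm_triangle_ineq[of "\<phi> t0 - \<phi> a" "\<phi> a - U0"] by simp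
  then show False using mt0 by simp
 qed
 show nr: "norm (\<phi> \<xi> - us) <= C * C * norm (ut - us)" if t: "\<xi> \<in> {a..b}" for \<xi>
 proof -
  have "norm (\<phi> \<xi> - \<phi> a) <= C * (\<xi> - a)" by (rule lip) (use t stay in auto)
  also have "... <= C * (C * norm (ut - us))" using t len C0 by (intro mult_left_mono) auto
  finally show ?thesis using \<phi>ab by (simp add: mult.assoc)
 qed
 have param: "lam j (\<phi> \<xi>) = \<xi>" if t: "\<xi> \<in> {a..b}" for \<xi>
 proof -
  have "((%t. lam j (\<phi> t) - t) has_derivative (%h. 0)) (at t within {a..b})" if "t \<in> {a..b}" for t
  proof -
   have 1: "(\<phi> has_derivative (%h. h *\<^sub>R r j (\<phi> t))) (at t within {a..b})" using \<phi>'[OF that] by (simp add: has_vector_derivative_def)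
   have "((%t. lam j (\<phi> t)) has_derivative (%h. fd (lam j) (\<phi> t) (h *\<^sub>R r j (\<phi> t)))) (at t within {a..b})"
    by (rule has_derivative_compose[OF 1 C_k_has_derivative[OF C_lam[OF j]]])
   moreover have "fd (lam j) (\<phi> t) (h *\<^sub>R r j (\<phi> t)) = h" for h using gnl_deriv[OF gnl] by (simp add: linear_scale[OF fd_linear[OF C_lam[OF j]]])
   ultimately have "((%t. lam j (\<phi> t)) has_derivative (%h. h)) (at t within {a..b})" by simp
   then show ?thesis by (auto intro!: derivative_eq_intros)
  qed
  then obtain e where e: "!!t. t \<in> {a..b} ==> lam j (\<phi> t) - t = e" using has_derivative_zero_constant[of "{a..b}" "%t. lam j (\<phi> t) - t"] by auto
  have "e = 0" using e[of a] \<phi>ab ab by auto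
  then show ?thesis using e[OF t] by simp
 qed
 let ?c = "(a + b) / 2"
 have c: "?c \<in> {a..b}" using ab by auto
 \<comment> \<open>Along the curve F changes at \<xi> times the rate of \<phi>, so the derivative of
   \<open>?G\<close> is (\<xi> - ?c) (r (\<phi> \<xi>) - r (\<phi> ?c)), which is quadratic in b -
   a. The last term of \<open>?G\<close> has equal values at both ends and drops out of the
   difference.\<close>
 let ?G = "%\<xi>. F (\<phi> \<xi>) - ?c *\<^sub>R \<phi> \<xi> - ((\<xi> - ?c)\<^sup>2 / 2) *\<^sub>R r j (\<phi> ?c)"
 have "norm (?G b - ?G a) <= C * C * (b - a)\<^sup>2 * norm (b - a)"
 proof (rule differentiable_bound[where S = "{a..b}" and f' = "%t h. h *\<^sub>R ((t - ?c) *\<^sub>R (r j (\<phi> t) - r j (\<phi> ?c)))"])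
  fix t assume t: "t \<in> {a..b}"
  have 1: "(\<phi> has_derivative (%h. h *\<^sub>R r j (\<phi> t))) (at t within {a..b})" using \<phi>'[OF t] by (simp add: has_vector_derivative_def)
  have 2: "((%t. F (\<phi> t)) has_derivative (%h. fd F (\<phi> t) (h *\<^sub>R r j (\<phi> t)))) (at t within {a..b})"
   by (rule has_derivative_compose[OF 1 C_k_has_derivative[OF C_F]])
  have 3: "((%t. ((t - ?c)\<^sup>2 / 2) *\<^sub>R r j (\<phi> ?c)) has_derivative (%h. (h * (t - ?c)) *\<^sub>R r j (\<phi> ?c))) (at t within {a..b})"
  proof -
   have "((%t. (t - c)\<^sup>2 / 2) has_derivative (%h. h * (t - c))) (at t within {a..b})" for c
    by (auto intro!: derivative_eq_intros simp: algebra_simps diff_divide_distrib)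
   then show ?thesis by (rule has_derivative_scaleR_left)
  qed
  have tc: "\<bar>t - ?c\<bar> <= b - a" using t ab(3) by (intro abs_leI) (simp_all add: field_simps)
  have "fd F (\<phi> t) (h *\<^sub>R r j (\<phi> t)) = (h * t) *\<^sub>R r j (\<phi> t)" for h
   using eig_r[OF j, of "\<phi> t"] param[OF t] by (simp add: linear_scale[OF fd_linear[OF C_F]])
  then show "(?G has_derivative (%h. h *\<^sub>R ((t - ?c) *\<^sub>R (r j (\<phi> t) - r j (\<phi> ?c))))) (at t within {a..b})"
   by (intro has_derivative_eq_rhs[OF has_derivative_diff[OF has_derivative_diff[OF 2 has_derivative_scaleR_right[OF 1]] 3]])
    (auto simp: algebra_simps)
  have "norm (\<phi> t - \<phi> ?c) <= C * \<bar>t - ?c\<bar>"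
  proof (cases "t <= ?c")
   case True
   have "norm (\<phi> ?c - \<phi> t) <= C * (?c - t)" by (rule lip) (use t c True stay in auto)
   then show ?thesis using True by (simp add: norm_minus_commute)
  next
   case False
   have "norm (\<phi> t - \<phi> ?c) <= C * (t - ?c)" by (rule lip) (use t c False stay in auto)
   then show ?thesis using False by simp
  qed
  also have "... <= C * (b - a)" using tc C0 by (intro mult_left_mono) auto
  finally have 4: "norm (r j (\<phi> t) - r j (\<phi> ?c)) <= C * (C * (b - a))" using lip_r[OF j stay[OF t] stay[OF c]] C0 by (meson mult_left_mono order_trans)
  have "\<bar>t - ?c\<bar> * norm (r j (\<phi> t) - r j (\<phi> ?c)) <= (b - a) * (C * (C * (b - a)))" using 4 tc ab(3) by (intro mult_mono) auto
  then have 5: "norm ((t - ?c) *\<^sub>R (r j (\<phi> t) - r j (\<phi> ?c))) <= C * C * (b - a)\<^sup>2" by (simp add: power2_eq_square mult_ac)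
  show "onorm (%h. h *\<^sub>R ((t - ?c) *\<^sub>R (r j (\<phi> t) - r j (\<phi> ?c)))) <= C * C * (b - a)\<^sup>2"
  proof (rule onorm_bound)
   fix h :: real
   show "norm (h *\<^sub>R ((t - ?c) *\<^sub>R (r j (\<phi> t) - r j (\<phi> ?c)))) <= C * C * (b - a)\<^sup>2 * norm h"
    unfolding norm_scaleR[of h] using mult_left_mono[OF 5, of "\<bar>h\<bar>"] by (simp add: mult.commute)
  qed (use C0 in auto)
 qed (use ab in auto)
 also have "?G b - ?G a = F ut - F us - ?c *\<^sub>R (ut - us)"
 proof -
  have "(b - ?c)\<^sup>2 = (a - ?c)\<^sup>2" by (simp add: power2_eq_square field_simps)
  then show ?thesis using \<phi>ab by (simp add: scaleR_diff_right)
 qed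
 also have "C * C * (b - a)\<^sup>2 * norm (b - a) = C * C * (b - a) ^ 3" using ab by (simp add: power2_eq_square power3_eq_cube)
 also have "... <= C * C * (C * norm (ut - us)) ^ 3" using len ab C0 by (intro mult_left_mono power_mono) auto
 also have "... = C ^ 5 * norm (ut - us) ^ 3" by (simp add: power_mult_distrib eval_nat_numeral)
 finally have rh: "norm (F ut - F us - ?c *\<^sub>R (ut - us)) <= C ^ 5 * norm (ut - us) ^ 3" .
 have C5: "C <= C ^ 5" using C1 by (simp add: self_le_power)
 have "b - a <= C ^ 5 * norm (ut - us)" using len mult_right_mono[OF C5, of "norm (ut - us)"] by simp
 then show "near_wave (C ^ 5) j us ut a b" unfolding near_wave_def using rh ab C0 by auto
qed

text \<open>The Lax inequalities place the speed near lam j, so all other components of the jump are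
  cubic and the jump is comparable to its j-th component. Dividing the relation paired with
  \<open>l j\<close> by that component gives the speed at the midpoint up to second order.\<close>

lemma shock_wave:
 assumes j: "j \<in> I" and simple: "!!k. k \<in> I ==> k ~= j ==> lam k ~= lam j"
  and rh: "F ut - F us = a *\<^sub>R (ut - us)" and lax: "lam j ut < a" "a < lam j us"
  and us: "us \<in> cball U0 \<rho>" and ut: "ut \<in> cball U0 \<rho>" and \<rho>: "\<rho> <= 1" "4 * C * C * \<rho> <= 1 / 2"
   "16 * real (card I) * C ^ 4 * \<rho>\<^sup>2 <= 1 / 2"
 shows "near_wave (C + 2 * C ^ 3) j us ut a a"
proof -
 let ?m = "(1/2) *\<^sub>R (us + ut)" and ?d = "ut - us"
 have m: "?m \<in> cball U0 \<rho>" using midpoint_in[OF us ut] .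
 have sub: "cball U0 \<rho> \<subseteq> cball U0 1" using \<rho>(1) by (rule subset_cball)
 have us1: "us \<in> cball U0 1" and ut1: "ut \<in> cball U0 1" and m1: "?m \<in> cball U0 1" using us ut m sub by auto
 have d2: "norm ?d <= 2 * \<rho>" using us ut norm_triangle_ineq4[of "ut - U0" "us - U0"] by (auto simp: dist_norm norm_minus_commute)
 have d0: "?d ~= 0" using lax by auto
 have l1: "\<bar>lam j ut - lam j us\<bar> <= C * norm ?d" using lip_lam[OF j ut1 us1] .
 have "\<bar>lam j us - lam j U0\<bar> <= C * norm (us - U0)" using lip_lam[OF j us1, of U0] by simp
 also have "... <= C * \<rho>" using us C0 by (intro mult_left_mono) (auto simp: dist_norm norm_minus_commute)
 finally have "\<bar>a - lam j U0\<bar> <= C * norm ?d + C * \<rho>" using l1 lax by linarith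
 also have "... <= 3 * C * \<rho>" using mult_left_mono[OF d2 C0] by (simp add: mult_ac)
 finally have s: "\<bar>a - lam j U0\<bar> <= 3 * C * \<rho>" .
 have small: "3 * C * \<rho> + C * \<rho> <= 1 / (2 * C)" using \<rho>(2) C1 by (simp add: field_simps)
 have tr: "\<bar>l k ?m \<bullet> ?d\<bar> <= 2 * C * C * (0 + C) * norm ?d ^ 3" if "k \<in> I" "k ~= j" for k
  by (rule transversal_component[OF j that(1) simple[OF that] us ut \<rho>(1) _ s small]) (use rh in simp)
 have "norm ?d <= C * (\<Sum>k\<in>I. \<bar>l k ?m \<bullet> ?d\<bar>)" by (rule expand_bound[OF m1])
 also have "(\<Sum>k\<in>I. \<bar>l k ?m \<bullet> ?d\<bar>) = \<bar>l j ?m \<bullet> ?d\<bar> + (\<Sum>k\<in>I - {j}. \<bar>l k ?m \<bullet> ?d\<bar>)" by (rule sum.remove) (use j in auto)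
 also have "(\<Sum>k\<in>I - {j}. \<bar>l k ?m \<bullet> ?d\<bar>) <= (\<Sum>k\<in>I. 2 * C * C * (0 + C) * norm ?d ^ 3)"
 proof -
  have "(\<Sum>k\<in>I - {j}. \<bar>l k ?m \<bullet> ?d\<bar>) <= (\<Sum>k\<in>I - {j}. 2 * C * C * (0 + C) * norm ?d ^ 3)" by (rule sum_mono) (use tr in auto)
  also have "... <= (\<Sum>k\<in>I. 2 * C * C * (0 + C) * norm ?d ^ 3)" by (rule sum_mono2) (use C0 in auto)
  finally show ?thesis .
 qed
 also have "C * (\<bar>l j ?m \<bullet> ?d\<bar> + (\<Sum>k\<in>I. 2 * C * C * (0 + C) * norm ?d ^ 3)) = C * \<bar>l j ?m \<bullet> ?d\<bar> + 2 * real (card I) * C ^ 4 * (norm ?d)\<^sup>2 * norm ?d"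
  by (simp add: eval_nat_numeral algebra_simps)
 finally have 1: "norm ?d <= C * \<bar>l j ?m \<bullet> ?d\<bar> + 2 * real (card I) * C ^ 4 * (norm ?d)\<^sup>2 * norm ?d" using C0 by (simp add: mult_left_mono)
 have "(norm ?d)\<^sup>2 <= (2 * \<rho>)\<^sup>2" using d2 by (intro power_mono) auto
 then have "2 * real (card I) * C ^ 4 * (norm ?d)\<^sup>2 <= 2 * real (card I) * C ^ 4 * (2 * \<rho>)\<^sup>2" using C0 by (intro mult_left_mono) auto
 also have "... <= 1/2" using \<rho>(3) by (simp add: power_mult_distrib)
 finally have "2 * real (card I) * C ^ 4 * (norm ?d)\<^sup>2 * norm ?d <= 1/2 * norm ?d" by (rule mult_right_mono) simp
 then have 2: "norm ?d <= 2 * C * \<bar>l j ?m \<bullet> ?d\<bar>" using 1 by simp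
 have "norm (fd F ?m ?d - a *\<^sub>R ?d) = norm (F ut - F us - fd F ?m ?d)" unfolding rh by (rule norm_minus_commute)
 also have "... <= C * norm ?d ^ 3" using mid_F[OF us1 ut1] .
 finally have 3: "norm (fd F ?m ?d - a *\<^sub>R ?d) <= C * norm ?d ^ 3" .
 have "l j ?m \<bullet> (fd F ?m ?d - a *\<^sub>R ?d) = (lam j ?m - a) * (l j ?m \<bullet> ?d)"
  using eig_l[OF j, of ?m ?d] by (simp add: inner_diff_right left_diff_distrib)
 moreover have "\<bar>l j ?m \<bullet> (fd F ?m ?d - a *\<^sub>R ?d)\<bar> <= C * (C * norm ?d ^ 3)"
  by (rule order_trans[OF Cauchy_Schwarz_ineq2]) (use bound_l[OF j m1] 3 C0 in \<open>intro mult_mono, auto\<close>)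
 ultimately have 4: "\<bar>lam j ?m - a\<bar> * \<bar>l j ?m \<bullet> ?d\<bar> <= C * (C * norm ?d ^ 3)" by (simp add: abs_mult)
 have "\<bar>lam j ?m - a\<bar> * norm ?d <= \<bar>lam j ?m - a\<bar> * (2 * C * \<bar>l j ?m \<bullet> ?d\<bar>)" using 2 by (intro mult_left_mono) auto
 also have "... = 2 * C * (\<bar>lam j ?m - a\<bar> * \<bar>l j ?m \<bullet> ?d\<bar>)" by (simp add: mult_ac)
 also have "... <= 2 * C * (C * (C * norm ?d ^ 3))" using 4 C0 by (intro mult_left_mono) auto
 also have "... = (2 * C ^ 3 * (norm ?d)\<^sup>2) * norm ?d" by (simp add: eval_nat_numeral algebra_simps)
 finally have 5: "\<bar>lam j ?m - a\<bar> <= 2 * C ^ 3 * (norm ?d)\<^sup>2" using d0 by simp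
 have 6: "\<bar>lam j ?m - (lam j us + lam j ut) / 2\<bar> <= C * (norm ?d)\<^sup>2" using mid_lam[OF j us1 ut1] .
 have "\<bar>a - (lam j us + lam j ut) / 2\<bar> <= (C + 2 * C ^ 3) * (norm ?d)\<^sup>2" using 5 6 by (simp add: distrib_right abs_le_iff)
 moreover have "\<bar>a - lam j us\<bar> <= C * norm ?d" using l1 lax by linarith
 moreover have "C * norm ?d <= (C + 2 * C ^ 3) * norm ?d" using C0 by (intro mult_right_mono) auto
 ultimately show ?thesis unfolding near_wave_def using rh C0 by auto
qed

lemma elementary_near_wave:
 "\<exists>\<rho> K. 0 < \<rho> & \<rho> <= 1 & 0 <= K & (\<forall>j us ut a b \<phi>. j \<in> I --> us \<in> cball U0 \<rho> --> ut \<in> cball U0 \<rho> -->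
   elementary_wave F lam r j us ut a b \<phi> --> near_wave K j us ut a b &
   (\<forall>\<xi>. a < \<xi> & \<xi> < b --> norm (\<phi> \<xi> - us) <= K * norm (ut - us)) &
   (linearly_degenerate lam r j --> a = b & F ut - F us = a *\<^sub>R (ut - us) & lam j ut = a & lam j us = a))"
proof -
 define n where "n = real (card I)"
 define K where "K = C ^ 5 + (C + 2 * C ^ 3) + C * C"
 obtain \<rho> where "0 < \<rho>" "\<forall>(a, b)\<in>{(1, 1), (4 * C * C, 1/2), (16 * n * C ^ 4, 1/2)}. a * \<rho> < b"
  using small_multiples[of "{(1, 1), (4 * C * C, 1/2), (16 * n * C ^ 4, 1/2)}"] by auto
 then have \<rho>: "0 < \<rho>" and \<rho>1: "\<rho> <= 1" and \<rho>2: "4 * C * C * \<rho> <= 1/2" "4 * C * C * \<rho> < 1/2" and \<rho>n: "16 * n * C ^ 4 * \<rho> <= 1/2" by auto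
 have "16 * n * C ^ 4 * \<rho> * \<rho> <= 1/2 * 1" using \<rho>n \<rho> \<rho>1 by (intro mult_mono) auto
 then have \<rho>3: "16 * n * C ^ 4 * \<rho>\<^sup>2 <= 1/2" by (simp add: power2_eq_square mult.assoc)
 have K: "0 <= K" "C ^ 5 <= K" "C + 2 * C ^ 3 <= K" "C * C <= K" using C0 by (auto simp: K_def)
 have main: "near_wave K j us ut a b &
   (\<forall>\<xi>. a < \<xi> & \<xi> < b --> norm (\<phi> \<xi> - us) <= K * norm (ut - us)) &
   (linearly_degenerate lam r j --> a = b & F ut - F us = a *\<^sub>R (ut - us) & lam j ut = a & lam j us = a)"
  if j: "j \<in> I" and us: "us \<in> cball U0 \<rho>" and ut: "ut \<in> cball U0 \<rho>" and ew: "elementary_wave F lam r j us ut a b \<phi>"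
  for j us ut a b \<phi> using ew unfolding elementary_wave_def
 proof (elim disjE conjE)
  assume gnl: "genuinely_nonlinear lam r j" and 1: "a = lam j us" "b = lam j ut" "a <= b" "\<phi> a = us" "\<phi> b = ut"
   and 2: "\<forall>\<xi>\<in>{a..b}. (\<phi> has_vector_derivative r j (\<phi> \<xi>)) (at \<xi> within {a..b})"
  note rw = rarefaction_wave[OF j gnl 1 _ us ut \<rho>2(2)]
  have "norm (\<phi> \<xi> - us) <= K * norm (ut - us)" if "a < \<xi> & \<xi> < b" for \<xi>
   using rw(2)[of \<xi>] 2 that K(4) by (meson atLeastAtMost_iff less_imp_le mult_right_mono norm_ge_zero order_trans)
  moreover have "near_wave K j us ut a b" by (rule near_wave_mono[OF rw(1) K(2)]) (use 2 in auto)
  ultimately show ?thesis using not_both[OF gnl] by blast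
 next
  assume gnl: "genuinely_nonlinear lam r j" and 1: "a = b" "F ut - F us = a *\<^sub>R (ut - us)" "lam j ut < a" "a < lam j us"
  have "near_wave (C + 2 * C ^ 3) j us ut a a"
   by (rule shock_wave[OF j _ 1(2-4) us ut \<rho>1 \<rho>2(1)]) (use gnl_simple[OF j _ _ gnl] \<rho>3 in \<open>auto simp: n_def\<close>)
  then show ?thesis using near_wave_mono K(3) not_both[OF gnl] 1 by auto
 next
  assume ld: "linearly_degenerate lam r j" and 1: "a = b" "F ut - F us = a *\<^sub>R (ut - us)" "lam j ut = a" "a = lam j us"
  then show ?thesis using ld_near_wave[OF 1(2) 1(4)[symmetric] 1(3) K(1)] by auto
 qed
 show ?thesis using \<rho> \<rho>1 K(1) main by blast
qed

end

text \<open>Riemann profiles carry no measurability assumption, so the L1 bound is expressed through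
  a Borel majorant off a finite set.\<close>

definition L1_dominated :: "(real => 'b::real_normed_vector) => (real => 'b) => real => bool" where
 "L1_dominated u v e \<longleftrightarrow> (\<exists>g E. finite E & g \<in> borel_measurable borel & (\<forall>\<xi>. 0 <= g \<xi>) &
   (\<forall>\<xi>. \<xi> \<notin> E --> norm (u \<xi> - v \<xi>) <= g \<xi>) & (\<integral>\<^sup>+ \<xi>. ennreal (g \<xi>) \<partial>lborel) <= ennreal e)"

section \<open>Riemann fans, condensed to one wave per eigenvalue\<close>

locale fan = hyperbolic_bounds F lam l r U0 I C
 for F :: "real ^ 'n => real ^ 'n" and lam l r U0 I C +
 fixes K \<rho> :: real and um up :: "real ^ 'n" and om :: "nat => real ^ 'n" and a b :: "nat => real"
  and \<phi> :: "nat => real => real ^ 'n" and w :: "real => real ^ 'n"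
 assumes K1: "1 <= K" and \<rho>1: "\<rho> <= 1"
  and om_ends: "om 0 = um" "om (card I) = up"
  and wave: "!!k. k \<in> I ==> near_wave K k (om (k - 1)) (om k) (a k) (b k)"
  and profile: "!!k \<xi>. k \<in> I ==> a k < \<xi> ==> \<xi> < b k ==> norm (\<phi> k \<xi> - om (k - 1)) <= K * norm (om k - om (k - 1))"
  and order: "!!k. k \<in> I ==> Suc k \<in> I ==> b k <= a (Suc k)"
  and w_left: "!!\<xi>. \<xi> < a 1 ==> w \<xi> = um" and w_right: "!!\<xi>. b (card I) < \<xi> ==> w \<xi> = up"
  and w_wave: "!!k \<xi>. k \<in> I ==> a k < \<xi> ==> \<xi> < b k ==> w \<xi> = \<phi> k \<xi>"
  and w_gap: "!!k \<xi>. k \<in> I ==> Suc k \<in> I ==> b k < \<xi> ==> \<xi> < a (Suc k) ==> w \<xi> = om k"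
  and om_in: "!!k. k <= card I ==> om k \<in> cball U0 \<rho>"
  and om_near: "!!k. k <= card I ==> norm (om k - um) <= K * norm (up - um)"
  and \<rho>_small: "(2 * K * \<rho> + C * \<rho>) + C * \<rho> <= 1 / (2 * C)"
  and d1: "norm (up - um) <= 1"
begin

lemma I_iff: "k \<in> I \<longleftrightarrow> 1 <= k & k <= card I" using I_eq card_I by simp

abbreviation "n \<equiv> card I"

lemma n1: "1 <= n" using card_I by (simp add: Suc_leI)

lemma K0: "0 <= K" using K1 by simp

lemma ab: "k \<in> I ==> a k <= b k" using wave unfolding near_wave_def by blast

end

text \<open>In a condensed fan, only the first wave of a multiple eigenvalue may be nontrivial.\<close>

locale lax_fan = fan +
 assumes once: "!!k m. k \<in> I ==> m \<in> I ==> k < m ==> lam k = lam m ==> om m = om (m - 1) & a m = a k & b m = b k"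

locale raw_fan = fan +
 assumes ld: "!!k. k \<in> I ==> linearly_degenerate lam r k ==> a k = b k &
    F (om k) - F (om (k - 1)) = a k *\<^sub>R (om k - om (k - 1)) & lam k (om k) = a k & lam k (om (k - 1)) = a k"
begin

definition G where "G i = {k \<in> I. lam k = lam i}"
definition lo where "lo i = Min (G i)"
definition hi where "hi i = Max (G i)"
text \<open>The state behind the whole group of k. Thus the first index of a group carries its
  entire jump and the later ones carry none.\<close>

definition om' where "om' k = (if k = 0 then um else om (hi k))"
definition a' where "a' k = a (lo k)"
definition b' where "b' k = b (hi k)"

lemma G_props:
 assumes i: "i \<in> I"
 shows "i \<in> G i" "lo i \<in> G i" "hi i \<in> G i" "G i = {lo i..hi i}" "1 <= lo i" "hi i <= n"
proof -
 have fin: "finite (G i)" by (simp add: G_def)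
 show ii: "i \<in> G i" using i by (simp add: G_def)
 show lo: "lo i \<in> G i" unfolding lo_def by (rule Min_in[OF fin]) (use ii in auto)
 show hi: "hi i \<in> G i" unfolding hi_def by (rule Max_in[OF fin]) (use ii in auto)
 have lhI: "lo i \<in> I" "hi i \<in> I" using lo hi by (auto simp: G_def)
 then show "1 <= lo i" "hi i <= n" using I_iff by auto
 show "G i = {lo i..hi i}"
 proof
  show "G i \<subseteq> {lo i..hi i}" using fin Min_le Max_ge by (auto simp: lo_def hi_def)
  show "{lo i..hi i} \<subseteq> G i"
  proof
   fix k assume k: "k \<in> {lo i..hi i}"
   have kI: "k \<in> I" using k \<open>1 <= lo i\<close> \<open>hi i <= n\<close> I_iff by auto
   have "lam k U = lam i U" for U using lam_mono[OF lhI(1) kI, of U] lam_mono[OF kI lhI(2), of U] k lo hi by (auto simp: G_def)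
   then show "k \<in> G i" using kI by (auto simp: G_def)
  qed
 qed
qed

lemma same: "lam k = lam i ==> lo k = lo i & hi k = hi i" by (simp add: lo_def hi_def G_def)

lemma om'_pred: assumes k: "k \<in> I" shows "om' (k - 1) = (if k = lo k then om (k - 1) else om' k)"
proof (cases "k = lo k")
 case True
 show ?thesis
 proof (cases "k = 1")
  case False
  then have k1: "k - 1 \<in> I" using k unfolding I_iff by linarith
  have "hi (k - 1) = k - 1"
  proof (rule ccontr)
   assume "hi (k - 1) ~= k - 1"
   then have "k \<in> {lo (k - 1)..hi (k - 1)}" using G_props(1,4)[OF k1] k1 I_iff[of "k - 1"] by force
   then have "k \<in> G (k - 1)" unfolding G_props(4)[OF k1] .
   then have "k - 1 \<in> G k" using k1 by (simp add: G_def)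
   then have "lo k <= k - 1" using G_props(4)[OF k] by simp
   then show False using True k1 I_iff[of "k - 1"] by linarith
  qed
  then show ?thesis using True k1 I_iff[of "k - 1"] om_ends by (simp add: om'_def)
 qed (use True om_ends in \<open>simp add: om'_def\<close>)
next
 case False
 then have "k - 1 \<in> G k" "k - 1 ~= 0" using G_props[OF k] by auto
 then show ?thesis using same[of "k - 1" k] False k I_iff[of k] by (auto simp: om'_def G_def)
qed

text \<open>Consecutive contacts of a group share the intermediate state, at which their common
  eigenvalue equals both speeds. So all speeds agree and the Rankine-Hugoniot relations add up to
  one.\<close>

lemma ld_chain:
 assumes i: "i \<in> I" and ldi: "linearly_degenerate lam r i"
 shows "F (om (hi i)) - F (om (lo i - 1)) = a' i *\<^sub>R (om (hi i) - om (lo i - 1))"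
  "a' i = b' i" "lam i (om (lo i - 1)) = a' i" "lam i (om (hi i)) = a' i"
proof -
 note g = G_props[OF i]
 have ldk: "a k = b k & F (om k) - F (om (k - 1)) = a k *\<^sub>R (om k - om (k - 1)) & lam i (om k) = a k & lam i (om (k - 1)) = a k"
  if "k \<in> {lo i..hi i}" for k
 proof -
  have "k \<in> G i" unfolding g(4) by (rule that)
  then have kI: "k \<in> I" and eq: "lam k = lam i" by (auto simp: G_def)
  have "linearly_degenerate lam r k"
  proof (rule ccontr)
   assume n: "\<not> linearly_degenerate lam r k"
   then have "genuinely_nonlinear lam r k" using fields[OF kI] by blast
   then have "k = i" using gnl_simple[OF kI i eq] by simp
   then show False using n ldi by simp
  qed
  from ld[OF kI this] show ?thesis by (simp only: eq simp_thms)
 qed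
 have "m <= hi i ==> F (om m) - F (om (lo i - 1)) = a (lo i) *\<^sub>R (om m - om (lo i - 1)) & a m = a (lo i)" if "lo i <= m" for m using that
 proof (induction m rule: dec_induct)
  case base
  show ?case using ldk[of "lo i"] base by simp
 next
  case (step m)
  have 1: "F (om m) - F (om (lo i - 1)) = a (lo i) *\<^sub>R (om m - om (lo i - 1))" "a m = a (lo i)" using step by auto
  have 2: "a (Suc m) = a m" "F (om (Suc m)) - F (om m) = a (Suc m) *\<^sub>R (om (Suc m) - om m)" using ldk[of m] ldk[of "Suc m"] step by auto
  have "F (om (Suc m)) - F (om (lo i - 1)) = (F (om (Suc m)) - F (om m)) + (F (om m) - F (om (lo i - 1)))" by simp
  also have "... = a (lo i) *\<^sub>R (om (Suc m) - om (lo i - 1))" unfolding 1 2 by (simp add: scaleR_add_right[symmetric])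
  finally show ?case using 1 2 by simp
 qed
 from this[of "hi i"] show "F (om (hi i)) - F (om (lo i - 1)) = a' i *\<^sub>R (om (hi i) - om (lo i - 1))"
  "a' i = b' i" "lam i (om (lo i - 1)) = a' i" "lam i (om (hi i)) = a' i" using ldk[of "hi i"] ldk[of "lo i"] g by (auto simp: a'_def b'_def)
qed

lemma gnl_group: "i \<in> I ==> genuinely_nonlinear lam r i ==> lo i = i & hi i = i"
proof -
 assume i: "i \<in> I" and g: "genuinely_nonlinear lam r i"
 have "G i = {i}" using gnl_simple[OF i _ _ g] i by (auto simp: G_def)
 then show ?thesis by (auto simp: lo_def hi_def)
qed

lemma a'b': "k \<in> I ==> a' k = b' k \<or> lo k = k & hi k = k"
 using fields[of k] gnl_group ld_chain(2) by blast

lemma boundary: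
 assumes k: "k \<in> I" "Suc k \<in> I"
 shows "lam (Suc k) = lam k & b' k = a' (Suc k) \<or> hi k = k & lo (Suc k) = Suc k"
proof (cases "lam (Suc k) = lam k")
 case True
 then have "Suc k \<in> G k" using k by (simp add: G_def)
 then have "lo k ~= k \<or> hi k ~= k" using G_props(4)[OF k(1)] by auto
 then show ?thesis using a'b'[OF k(1)] same[OF True] True by (auto simp: a'_def b'_def)
next
 case False
 have "Suc k \<notin> {lo k..hi k}" "k \<notin> {lo (Suc k)..hi (Suc k)}"
  unfolding G_props(4)[OF k(1), symmetric] G_props(4)[OF k(2), symmetric] using False by (auto simp: G_def)
 moreover have "k \<in> {lo k..hi k}" "Suc k \<in> {lo (Suc k)..hi (Suc k)}" using G_props(1,4) k by auto
 ultimately show ?thesis by auto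
qed

text \<open>Pairing a jump with left eigenvectors of a group only sees the total jump of the group,
  which must therefore be concentrated in one wave before single waves can be estimated.\<close>

lemma condensed: "lax_fan F lam l r U0 I C K \<rho> um up om' a' b' \<phi> w"
proof (unfold_locales, rule K1, rule \<rho>1)
 have n: "1 \<in> I" "n \<in> I" using n1 I_iff by auto
 have ends: "lo 1 = 1" "hi n = n" using G_props(1,4,5)[OF n(1)] G_props(1,4,6)[OF n(2)] by (metis atLeastAtMost_iff le_antisym)+
 show "om' 0 = um" "om' n = up" using om_ends ends n1 by (auto simp: om'_def)
 show "w \<xi> = um" if "\<xi> < a' 1" for \<xi> using w_left that ends by (simp add: a'_def)
 show "w \<xi> = up" if "b' n < \<xi>" for \<xi> using w_right that ends by (simp add: b'_def)
 fix k
 have hk: "hi k <= n" if "k ~= 0" "k <= n" using G_props(6)[of k] that I_iff[of k] by simp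
 show "om' k \<in> cball U0 \<rho>" if "k <= n" using that om_in hk om_in[of 0] om_ends by (simp add: om'_def)
 show "norm (om' k - um) <= K * norm (up - um)" if "k <= n" using that om_near hk K0 by (simp add: om'_def)
 assume k: "k \<in> I"
 note g = G_props[OF k]
 have k0: "k ~= 0" using k I_iff by auto
 show "near_wave K k (om' (k - 1)) (om' k) (a' k) (b' k)"
 proof (cases "genuinely_nonlinear lam r k")
  case True
  then show ?thesis using gnl_group[OF k] wave[OF k] om'_pred[OF k] k0 by (simp add: om'_def a'_def b'_def)
 next
  case False
  then have "linearly_degenerate lam r k" using fields[OF k] by blast
  note c = ld_chain[OF k this]
  show ?thesis unfolding c(2)[symmetric] using om'_pred[OF k] k0 c K0 by (intro ld_near_wave) (auto simp: om'_def split: if_splits)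
 qed
 have single: "k = lo k & hi k = k" if "a' k < b' k" using a'b'[OF k] that by auto
 show "norm (\<phi> k \<xi> - om' (k - 1)) <= K * norm (om' k - om' (k - 1))" "w \<xi> = \<phi> k \<xi>" if "a' k < \<xi>" "\<xi> < b' k" for \<xi>
  using profile[OF k, of \<xi>] w_wave[OF k, of \<xi>] single om'_pred[OF k] k0 that by (auto simp: om'_def a'_def b'_def)
 show "om' m = om' (m - 1) & a' m = a' k & b' m = b' k" if m: "m \<in> I" "k < m" "lam k = lam m" for m
  using same[OF m(3)] om'_pred[OF m(1)] g(1,4) m(2) by (auto simp: a'_def b'_def)
 assume Sk: "Suc k \<in> I"
 show "b' k <= a' (Suc k)" using boundary[OF k Sk] order[OF k Sk] by (auto simp: a'_def b'_def)
 show "w \<xi> = om' k" if "b' k < \<xi>" "\<xi> < a' (Suc k)" for \<xi> using boundary[OF k Sk] w_gap[OF k Sk, of \<xi>] that k0 by (auto simp: a'_def b'_def om'_def)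
qed (rule \<rho>_small, rule d1)

end

section \<open>Strength of the waves outside one group\<close>

context lax_fan begin

definition d where "d = norm (up - um)"
definition M where "M = (1/2) *\<^sub>R (um + up)"
definition \<Delta> where "\<Delta> i = om i - om (i - 1)"

lemma d0: "0 <= d" by (simp add: d_def)
lemma d_le_1: "d <= 1" using d1 by (simp add: d_def)

lemma sub1: "cball U0 \<rho> \<subseteq> cball U0 1" using \<rho>1 by (rule subset_cball)

lemma step_in: "k \<in> I ==> om k \<in> cball U0 \<rho>" "k \<in> I ==> om (k - 1) \<in> cball U0 \<rho>"
 using om_in[of k] om_in[of "k - 1"] I_iff[of k] by auto

lemma step_near: "k \<in> I ==> norm (om k - um) <= K * d" "k \<in> I ==> norm (om (k - 1) - um) <= K * d"
 using om_near[of k] om_near[of "k - 1"] I_iff[of k] by (auto simp: d_def)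

lemma telescope: "m <= k ==> (\<Sum>i\<in>{Suc m..k}. \<Delta> i) = om k - om m"
 by (induction k rule: dec_induct) (auto simp: \<Delta>_def)

lemma \<Delta>_bound: "i \<in> I ==> norm (\<Delta> i) <= 2 * K * d"
 using step_near[of i] norm_triangle_ineq4[of "om i - um" "om (i - 1) - um"] by (simp add: \<Delta>_def)

definition T where "T = 2 * C * C * (K + C)"

lemma T0: "0 <= T" using C0 K0 by (simp add: T_def)

lemma transversal_wave:
 assumes i: "i \<in> I" and k: "k \<in> I" and ne: "lam k ~= lam i"
 shows "\<bar>l k ((1/2) *\<^sub>R (om (i - 1) + om i)) \<bullet> \<Delta> i\<bar> <= T * norm (\<Delta> i) ^ 3"
proof -
 note cw = wave[OF i]
 let ?s = "(a i + b i) / 2"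
 have "norm (\<Delta> i) <= 2 * \<rho>" unfolding \<Delta>_def
  using step_in[OF i] norm_triangle_ineq4[of "om i - U0" "om (i - 1) - U0"] by (auto simp: dist_norm norm_minus_commute)
 then have "K * norm (\<Delta> i) <= 2 * K * \<rho>" using mult_left_mono[of _ _ K] K0 by fastforce
 moreover have "\<bar>?s - lam i (om (i - 1))\<bar> <= K * norm (\<Delta> i)" using cw unfolding near_wave_def \<Delta>_def[symmetric] abs_le_iff by (simp add: field_simps)
 moreover have "\<bar>lam i (om (i - 1)) - lam i U0\<bar> <= C * \<rho>"
 proof -
  have "\<bar>lam i (om (i - 1)) - lam i U0\<bar> <= C * norm (om (i - 1) - U0)" using lip_lam[OF i, of "om (i - 1)" U0] step_in[OF i] sub1 by auto
  also have "... <= C * \<rho>" using step_in(2)[OF i] C0 by (intro mult_left_mono) (auto simp: dist_norm norm_minus_commute)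
  finally show ?thesis .
 qed
 ultimately have s: "\<bar>?s - lam i U0\<bar> <= 2 * K * \<rho> + C * \<rho>" by linarith
 show ?thesis unfolding \<Delta>_def T_def by (rule transversal_component[OF i k ne step_in(2,1)[OF i] \<rho>1 _ s \<rho>_small]) (use cw in \<open>simp add: near_wave_def\<close>)
qed

text \<open>\<open>K1'\<close> bounds the pairing of a wave with foreign left eigenvectors,
  \<open>K2'\<close> the sharper one for the distinguished group, and \<open>K3'\<close> combines
  both over all indices.\<close>

definition K1' where "K1' = 4 * T * K\<^sup>2 + C * (K + 1)"
definition K2' where "K2' = 8 * T * K ^ 3 + 2 * C * K"
definition K3' where "K3' = C * (real n)\<^sup>2 * (1 + K1' + real n * K2')"

lemma consts0: "0 <= K1'" "0 <= K2'" "0 <= K3'"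
 using T0 K0 C0 by (auto simp: K1'_def K2'_def K3'_def)

lemma M_in: "M \<in> cball U0 1"
 unfolding M_def using midpoint_in[OF om_in[of 0] om_in[of n]] om_ends sub1 by auto

text \<open>\<open>transversal_wave\<close> holds at the midpoint of the single wave; moving
  \<open>l k\<close> to the common midpoint \<open>M\<close> costs its Lipschitz constant times the
  distance \<open>D\<close>.\<close>

lemma shifted_pairing:
 assumes i: "i \<in> I" and k: "k \<in> I" and ne: "lam k ~= lam i" and m: "norm ((um - om (i - 1)) + (up - om i)) <= 2 * D"
 shows "\<bar>l k M \<bullet> \<Delta> i\<bar> <= T * norm (\<Delta> i) ^ 3 + C * D * norm (\<Delta> i)"
proof -
 let ?m = "(1/2) *\<^sub>R (om (i - 1) + om i)"
 have mi: "?m \<in> cball U0 1" using midpoint_in[OF step_in(2,1)[OF i]] sub1 by auto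
 have "M - ?m = (1/2) *\<^sub>R ((um - om (i - 1)) + (up - om i))" by (simp add: M_def algebra_simps)
 then have m': "norm (M - ?m) <= D" using m by simp
 have "l k M \<bullet> \<Delta> i = l k ?m \<bullet> \<Delta> i + (l k M - l k ?m) \<bullet> \<Delta> i" by (simp add: inner_diff_left)
 moreover have "\<bar>(l k M - l k ?m) \<bullet> \<Delta> i\<bar> <= (C * D) * norm (\<Delta> i)"
 proof (rule order_trans[OF Cauchy_Schwarz_ineq2], rule mult_right_mono)
  show "norm (l k M - l k ?m) <= C * D" using lip_l[OF k M_in mi] mult_left_mono[OF m' C0] by linarith
 qed simp
 ultimately show ?thesis using transversal_wave[OF i k ne] by linarith
qed

lemma pairing_other:
 assumes i: "i \<in> I" and k: "k \<in> I" and ne: "lam k ~= lam i"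
 shows "\<bar>l k M \<bullet> \<Delta> i\<bar> <= K1' * d * norm (\<Delta> i)"
proof -
 have "(um - om (i - 1)) + (up - om i) = (um - om (i - 1)) + (um - om i) + (up - um)" by simp
 also have "norm ... <= K * d + K * d + d" using step_near[OF i] by (intro norm_triangle_mono) (simp_all add: norm_minus_commute d_def)
 also have "... <= 2 * ((K + 1) * d)" using d0 by (simp add: algebra_simps)
 finally have sp: "\<bar>l k M \<bullet> \<Delta> i\<bar> <= T * norm (\<Delta> i) ^ 3 + C * ((K + 1) * d) * norm (\<Delta> i)" by (rule shifted_pairing[OF i k ne])
 have "norm (\<Delta> i) ^ 3 = (norm (\<Delta> i))\<^sup>2 * norm (\<Delta> i)" by (simp add: eval_nat_numeral)
 also have "... <= (2 * K * d)\<^sup>2 * norm (\<Delta> i)" using \<Delta>_bound[OF i] by (intro mult_right_mono power_mono) auto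
 also have "... = 4 * K\<^sup>2 * (d * d) * norm (\<Delta> i)" by (simp add: power2_eq_square)
 also have "... <= 4 * K\<^sup>2 * d * norm (\<Delta> i)" using d_le_1 d0 by (intro mult_right_mono mult_left_mono) (auto intro: mult_left_le)
 finally have "T * norm (\<Delta> i) ^ 3 <= T * (4 * K\<^sup>2 * d * norm (\<Delta> i))" using T0 by (rule mult_left_mono)
 then show ?thesis using sp by (simp add: K1'_def algebra_simps)
qed

end

locale lax_fan_first = lax_fan +
 fixes j assumes j: "j \<in> I" and first: "!!i. i \<in> I ==> i < j ==> lam i ~= lam j"
begin

definition others where "others = {i \<in> I. lam i ~= lam j}"
text \<open>\<open>e'\<close> is the true strength of the waves outside the group, while
  \<open>e\<close> is read off from the two outer states alone. For small d the former turns out to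
  be O(e + d^3).\<close>

definition e' where "e' = (\<Sum>i\<in>others. norm (\<Delta> i))"
definition e where "e = (\<Sum>i\<in>others. \<bar>l i M \<bullet> (up - um)\<bar>)"

lemma others_I: "others \<subseteq> I" "finite others" by (auto simp: others_def)
lemma e'0: "0 <= e'" unfolding e'_def by (rule sum_nonneg) simp
lemma e0: "0 <= e" unfolding e_def by (rule sum_nonneg) simp

lemma group_trivial: "i \<in> I ==> i \<notin> others ==> i ~= j ==> \<Delta> i = 0 & j < i & a i = a j & b i = b j"
 using once[OF j, of i] first[of i] unfolding others_def \<Delta>_def by (metis (mono_tags, lifting) eq_iff_diff_eq_0 linorder_neqE_nat mem_Collect_eq)

lemma other_\<Delta>: "i \<in> others ==> norm (\<Delta> i) <= e'"
 unfolding e'_def using others_I by (intro member_le_sum) auto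

lemma sum_\<Delta>: assumes "Q \<subseteq> I" "j \<notin> Q" shows "norm (\<Sum>k\<in>Q. \<Delta> k) <= e'"
proof -
 have "norm (\<Sum>k\<in>Q. \<Delta> k) = norm (\<Sum>k\<in>Q \<inter> others. \<Delta> k)" by (rule arg_cong[where f = norm], rule sum.mono_neutral_right)
   (use assms group_trivial finite_subset[OF assms(1)] in auto)
 also have "... <= (\<Sum>k\<in>Q \<inter> others. norm (\<Delta> k))" by (rule norm_sum)
 also have "... <= e'" unfolding e'_def by (rule sum_mono2) (use others_I in auto)
 finally show ?thesis .
qed

lemma prefix_small: assumes "k < j" shows "norm (om k - um) <= e'"
 using telescope[of 0 k] om_ends sum_\<Delta>[of "{Suc 0..k}"] assms j I_iff by force

lemma suffix_small: assumes "j <= k" "k <= n" shows "norm (up - om k) <= e'"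
 using telescope[of k n] om_ends sum_\<Delta>[of "{Suc k..n}"] assms j I_iff by force

text \<open>The wave of the group spans the whole jump up to the foreign waves, so its midpoint is
  within \<open>e'\<close> of \<open>M\<close> and the shift costs d e' instead of d^2.\<close>

lemma pairing_group:
 assumes i: "i \<in> I" "i \<notin> others" and k: "k \<in> others"
 shows "\<bar>l k M \<bullet> \<Delta> i\<bar> <= K2' * (d ^ 3 + d * e')"
proof (cases "i = j")
 case True
 have kI: "k \<in> I" and ne: "lam k ~= lam j" using k by (auto simp: others_def)
 have "norm ((um - om (j - 1)) + (up - om j)) <= e' + e'"
  using prefix_small[of "j - 1"] suffix_small[of j] j I_iff[of j] by (intro norm_triangle_mono) (auto simp: norm_minus_commute)
 then have sp: "\<bar>l k M \<bullet> \<Delta> j\<bar> <= T * norm (\<Delta> j) ^ 3 + C * e' * norm (\<Delta> j)" by (intro shifted_pairing[OF j kI ne]) simp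
 have "norm (\<Delta> j) ^ 3 <= (2 * K * d) ^ 3" using \<Delta>_bound[OF j] by (intro power_mono) auto
 then have 1: "T * norm (\<Delta> j) ^ 3 <= T * (8 * K ^ 3 * d ^ 3)" using T0 by (intro mult_left_mono) (auto simp: power_mult_distrib)
 have 2: "C * e' * norm (\<Delta> j) <= C * e' * (2 * K * d)" using \<Delta>_bound[OF j] C0 e'0 by (intro mult_left_mono) auto
 have "\<bar>l k M \<bullet> \<Delta> j\<bar> <= 8 * T * K ^ 3 * d ^ 3 + 2 * C * K * (d * e')" using sp 1 2 by (simp add: algebra_simps)
 also have "... <= K2' * d ^ 3 + K2' * (d * e')" using T0 K0 C0 d0 e'0 by (intro add_mono mult_right_mono) (auto simp: K2'_def)
 finally show ?thesis using True by (simp add: distrib_left)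
qed (use group_trivial[OF i] consts0 d0 e'0 in simp)

text \<open>A foreign wave is recovered from its pairings. With left eigenvectors of other
  eigenvalues they are O(d e'). With its own, subtract from the pairing of the total jump, at most
  \<open>e\<close>, the other waves: foreign ones give d e', the distinguished group d^3 + d e', and
  its own group nothing more.\<close>

lemma e'_bound_raw: "e' <= K3' * (e + d ^ 3 + d * e')"
proof -
 define B where "B = d ^ 3 + d * e'"
 let ?X = "e + (K1' + real n * K2') * B"
 have B: "0 <= B" "d * e' <= B" using d0 e'0 by (auto simp: B_def)
 have K1B: "K1' * (d * e') <= K1' * B" using B consts0 by (intro mult_left_mono) auto
 have X0: "0 <= ?X" using e0 consts0 B by simp
 have main: "\<bar>l k M \<bullet> \<Delta> i\<bar> <= ?X" if i: "i \<in> others" and k: "k \<in> I" for i k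
 proof (cases "lam k = lam i")
  case False
  have iI: "i \<in> I" using i by (simp add: others_def)
  have "K1' * d * norm (\<Delta> i) <= K1' * d * e'" using other_\<Delta>[OF i] consts0 d0 by (intro mult_left_mono) auto
  then have "\<bar>l k M \<bullet> \<Delta> i\<bar> <= K1' * B" using pairing_other[OF iI k False] K1B by (simp add: mult.assoc)
  moreover have "0 <= real n * K2' * B" using consts0 B by simp
  ultimately show ?thesis using e0 by (simp add: distrib_right)
 next
  case True
  show ?thesis
  proof (cases "\<Delta> i = 0")
   case False
   have iI: "i \<in> I" and ko: "k \<in> others" using i k True by (auto simp: others_def)
   have tot: "up - um = (\<Sum>m\<in>I. \<Delta> m)" using telescope[of 0 n] om_ends I_eq card_I by simp
   have "l k M \<bullet> (up - um) = (\<Sum>m\<in>I. l k M \<bullet> \<Delta> m)" unfolding tot by (rule inner_sum_right)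
   also have "... = l k M \<bullet> \<Delta> i + (\<Sum>m\<in>I - {i}. l k M \<bullet> \<Delta> m)" by (rule sum.remove[OF finite_I iI])
   finally have "\<bar>l k M \<bullet> \<Delta> i\<bar> <= \<bar>l k M \<bullet> (up - um)\<bar> + (\<Sum>m\<in>I - {i}. \<bar>l k M \<bullet> \<Delta> m\<bar>)" using sum_abs[of "%m. l k M \<bullet> \<Delta> m" "I - {i}"] by linarith
   moreover have "\<bar>l k M \<bullet> (up - um)\<bar> <= e" unfolding e_def using ko others_I by (intro member_le_sum) auto
   moreover have "(\<Sum>m\<in>I - {i}. \<bar>l k M \<bullet> \<Delta> m\<bar>) <= (\<Sum>m\<in>I. (if m \<in> others then K1' * d * norm (\<Delta> m) else 0) + K2' * B)"
   proof (rule order_trans[OF sum_mono sum_mono2[of I "I - {i}"]])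
    fix m assume m: "m \<in> I - {i}"
    have K2B: "0 <= K2' * B" using consts0 B by simp
    show "\<bar>l k M \<bullet> \<Delta> m\<bar> <= (if m \<in> others then K1' * d * norm (\<Delta> m) else 0) + K2' * B"
    proof (cases "lam m = lam i")
    case True
    then have "\<Delta> m = 0" using once[of i m] once[of m i] iI m False by (metis DiffE \<Delta>_def diff_self insertI1 linorder_neqE_nat)
    then show ?thesis using K2B consts0 d0 by simp
    next
    case False
    then show ?thesis using pairing_other[of m k] pairing_group[of m k] m k ko \<open>lam k = lam i\<close> K2B by (auto simp: B_def)
    qed
   qed (use consts0 d0 B in auto)
   moreover have "... = K1' * (d * e') + real n * (K2' * B)"
    using others_I by (simp add: sum.distrib e'_def sum_distrib_left mult.assoc sum.inter_restrict[symmetric] Int_absorb1)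
   ultimately show ?thesis using K1B by (simp add: distrib_right mult.assoc)
  qed (use X0 in simp)
 qed
 have "norm (\<Delta> i) <= C * (real n * ?X)" if "i \<in> others" for i
 proof -
  have "norm (\<Delta> i) <= C * (\<Sum>k\<in>I. \<bar>l k M \<bullet> \<Delta> i\<bar>)" by (rule expand_bound[OF M_in])
  also have "... <= C * (\<Sum>k\<in>I. ?X)" using main[OF that] C0 by (intro mult_left_mono sum_mono) auto
  finally show ?thesis by simp
 qed
 then have "e' <= (\<Sum>i\<in>others. C * (real n * ?X))" unfolding e'_def by (rule sum_mono)
 also have "... <= (\<Sum>i\<in>I. C * (real n * ?X))" using others_I X0 C0 by (intro sum_mono2) auto
 also have "... = C * (real n)\<^sup>2 * ?X" by (simp add: power2_eq_square)
 also have "... <= C * (real n)\<^sup>2 * ((1 + K1' + real n * K2') * (e + B))"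
 proof (rule mult_left_mono)
  have "0 <= (K1' + real n * K2') * e" using e0 consts0 by simp
  then show "?X <= (1 + K1' + real n * K2') * (e + B)" using B by (simp add: algebra_simps)
 qed (use C0 in auto)
 finally show ?thesis by (simp add: K3'_def B_def mult.assoc add.assoc)
qed

text \<open>For small d the term d e' is absorbed into the left-hand side.\<close>

lemma e'_bound: assumes "K3' * d <= 1 / 2" shows "e' <= 2 * K3' * (e + d ^ 3)"
proof -
 have "K3' * d * e' <= 1 / 2 * e'" using assms e'0 by (rule mult_right_mono)
 then show ?thesis using e'_bound_raw by (simp add: algebra_simps)
qed

end

section \<open>Distance between a fan and a single jump\<close>

context lax_fan begin

definition Lam where "Lam = C + 2 * K"

lemma ba: "i \<in> I ==> k \<in> I ==> i < k ==> b i <= a k"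
proof (induction k)
 case (Suc k)
 show ?case
 proof (cases "i = k")
  case False
  then have kI: "k \<in> I" and "i < k" using Suc.prems I_iff by auto
  then have "b i <= a k" using Suc by auto
  also have "... <= b k" by (rule ab[OF kI])
  also have "... <= a (Suc k)" by (rule order[OF kI Suc.prems(2)])
  finally show ?thesis .
 qed (use order Suc.prems in auto)
qed simp

lemma a_mono: "i \<in> I ==> k \<in> I ==> i <= k ==> a i <= a k"
 using ba[of i k] ab[of i] by (cases "i = k") auto

lemma b_mono: "i \<in> I ==> k \<in> I ==> i <= k ==> b i <= b k"
 using ba[of i k] ab[of k] by (cases "i = k") auto

lemma speeds_bounded: assumes k: "k \<in> I" shows "\<bar>a k\<bar> <= Lam" "\<bar>b k\<bar> <= Lam"
proof -
 have "norm (om k - om (k - 1)) <= norm (om k - U0) + norm (om (k - 1) - U0)" using norm_triangle_ineq4[of "om k - U0" "om (k - 1) - U0"] by simp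
 also have "... <= 1 + 1" using step_in[OF k] \<rho>1 by (intro add_mono) (auto simp: dist_norm norm_minus_commute)
 finally have "K * norm (om k - om (k - 1)) <= K * 2" using K0 by (intro mult_left_mono) auto
 moreover have "\<bar>lam k (om (k - 1))\<bar> <= C" using bound_lam[OF k] step_in(2)[OF k] sub1 by blast
 moreover have "\<bar>a k - lam k (om (k - 1))\<bar> <= K * norm (om k - om (k - 1))" "\<bar>b k - lam k (om (k - 1))\<bar> <= K * norm (om k - om (k - 1))"
  using wave[OF k] unfolding near_wave_def by blast+
 ultimately show "\<bar>a k\<bar> <= Lam" "\<bar>b k\<bar> <= Lam" unfolding Lam_def by linarith+
qed

lemma locate:
 assumes "\<xi> \<notin> a ` I \<union> b ` I"
 obtains "\<xi> < a 1" | "b n < \<xi>" | k where "k \<in> I" "a k < \<xi>" "\<xi> < b k"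
  | k where "k \<in> I" "Suc k \<in> I" "b k < \<xi>" "\<xi> < a (Suc k)"
proof (cases "\<xi> < a 1")
 case False
 define k where "k = Max {k \<in> I. a k < \<xi>}"
 have 1: "1 \<in> I" "n \<in> I" using n1 I_iff by auto
 have fin: "finite {k \<in> I. a k < \<xi>}" by simp
 have "a 1 < \<xi>" using False assms 1 by force
 then have k: "k \<in> {k \<in> I. a k < \<xi>}" unfolding k_def by (intro Max_in[OF fin]) (use 1 in auto)
 show ?thesis
 proof (cases "\<xi> < b k")
  case True
  then show ?thesis using k that(3)[of k] by auto
 next
  case False
  then have bk: "b k < \<xi>" using assms k by force
  show ?thesis
  proof (cases "k = n")
   case True
   then show ?thesis using bk that(2) by simp
  next
   case False
   then have Sk: "Suc k \<in> I" using k I_iff[of k] I_iff[of "Suc k"] by auto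
   have "\<not> a (Suc k) < \<xi>"
   proof
    assume "a (Suc k) < \<xi>"
    then have "Suc k \<in> {k \<in> I. a k < \<xi>}" using Sk by simp
    then have "Suc k <= k" using Max_ge[OF fin] unfolding k_def[symmetric] by blast
    then show False by simp
   qed
   then have "\<xi> < a (Suc k)" using assms Sk by force
   then show ?thesis using k Sk bk that(4)[of k] by auto
  qed
 qed
qed (use that in blast)

lemma crude:
 assumes \<xi>: "\<xi> \<notin> a ` I \<union> b ` I"
 shows "norm (w \<xi> - um) <= (K + 2 * K * K + 1) * d" using \<xi>
proof (cases rule: locate)
 case 1
 then show ?thesis using w_left d0 K0 by simp
next
 case 2
 have "1 * d <= (K + 2 * K * K + 1) * d" using d0 K0 by (intro mult_right_mono) auto
 then show ?thesis using w_right[OF 2] by (simp add: d_def)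
next
 case (3 k)
 have "norm (om k - om (k - 1)) <= K * d + K * d" using step_near[OF 3(1)] norm_triangle_ineq4[of "om k - um" "om (k - 1) - um"] by simp
 then have "K * norm (om k - om (k - 1)) <= K * (K * d + K * d)" using K0 by (rule mult_left_mono)
 then have "norm (w \<xi> - om (k - 1)) <= K * (K * d + K * d)" using profile[OF 3] w_wave[OF 3] by simp
 then have "norm (w \<xi> - um) <= K * (K * d + K * d) + K * d"
  using step_near(2)[OF 3(1)] norm_triangle_ineq[of "w \<xi> - om (k - 1)" "om (k - 1) - um"] by simp
 then show ?thesis using d0 by (simp add: algebra_simps)
next
 case (4 k)
 have "K * d <= (K + 2 * K * K + 1) * d" using d0 K0 by (intro mult_right_mono) auto
 then show ?thesis using w_gap[OF 4] step_near(1)[OF 4(1)] by simp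
qed

end

context lax_fan_first begin

text \<open>As j is the first index of its group, only waves of other eigenvalues have been passed
  here.\<close>

lemma left_of_group:
 assumes \<xi>: "\<xi> \<notin> a ` I \<union> b ` I" "\<xi> < a j"
 shows "norm (w \<xi> - um) <= (1 + K) * e'" using \<xi>(1)
proof (cases rule: locate)
 case 1
 then show ?thesis using w_left e'0 K0 by simp
next
 case 2
 have "a j <= b n" using ab[OF j] b_mono[OF j, of n] j I_iff n1 by fastforce
 then show ?thesis using 2 \<xi> by linarith
next
 case (3 k)
 have kj: "k < j" using a_mono[OF j 3(1)] 3(2) \<xi>(2) by fastforce
 have ko: "k \<in> others" using first[OF 3(1) kj] 3(1) by (simp add: others_def)
 have "norm (w \<xi> - om (k - 1)) <= K * norm (\<Delta> k)" using profile[OF 3] w_wave[OF 3] by (simp add: \<Delta>_def)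
 also have "... <= K * e'" using other_\<Delta>[OF ko] K0 by (rule mult_left_mono)
 finally have "norm (w \<xi> - om (k - 1)) <= K * e'" .
 moreover have "norm (om (k - 1) - um) <= e'" using kj by (intro prefix_small) simp
 ultimately show ?thesis using norm_triangle_ineq[of "w \<xi> - om (k - 1)" "om (k - 1) - um"] by (simp add: algebra_simps)
next
 case (4 k)
 have "k < j" using a_mono[OF j 4(1)] ab[OF 4(1)] 4(3) \<xi>(2) by fastforce
 moreover have "e' <= (1 + K) * e'" using e'0 K0 by (simp add: algebra_simps)
 ultimately show ?thesis using w_gap[OF 4] prefix_small[of k] by simp
qed

lemma right_of_group:
 assumes \<xi>: "\<xi> \<notin> a ` I \<union> b ` I" "b j < \<xi>"
 shows "norm (w \<xi> - up) <= (2 + K) * e'" using \<xi>(1)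
proof (cases rule: locate)
 case 1
 have "a 1 <= b j" using ab[OF j] a_mono[of 1 j] j I_iff n1 by fastforce
 then show ?thesis using 1 \<xi> by linarith
next
 case 2
 then show ?thesis using w_right e'0 K0 by simp
next
 case (3 k)
 have kj: "j < k" using b_mono[OF 3(1) j] 3(3) \<xi>(2) by fastforce
 have ko: "k \<in> others" using group_trivial[OF 3(1)] kj 3 \<xi>(2) by fastforce
 have "norm (w \<xi> - om (k - 1)) <= K * norm (\<Delta> k)" using profile[OF 3] w_wave[OF 3] by (simp add: \<Delta>_def)
 also have "... <= K * e'" using other_\<Delta>[OF ko] K0 by (rule mult_left_mono)
 finally have 1: "norm (w \<xi> - om (k - 1)) <= K * e'" .
 have 2: "norm (up - om k) <= e'" using kj 3(1) I_iff by (intro suffix_small) auto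
 have "w \<xi> - up = (w \<xi> - om (k - 1)) - \<Delta> k - (up - om k)" by (simp add: \<Delta>_def)
 also have "norm ... <= K * e' + e' + e'"
  using 1 2 norm_triangle_ineq4[of "w \<xi> - om (k - 1) - \<Delta> k" "up - om k"] norm_triangle_ineq4[of "w \<xi> - om (k - 1)" "\<Delta> k"] other_\<Delta>[OF ko] by linarith
 finally show ?thesis by (simp add: algebra_simps)
next
 case (4 k)
 have "j <= k" using b_mono[OF 4(2) j] ab[OF 4(2)] 4(4) \<xi>(2) by fastforce
 moreover have "e' <= (2 + K) * e'" using e'0 K0 by (simp add: algebra_simps)
 ultimately show ?thesis using w_gap[OF 4] suffix_small[of k] 4(1) I_iff[of k] by (simp add: norm_minus_commute)
qed

text \<open>The mean speed of the wave is the average of its end eigenvalues up to second order, and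
  replacing these ends by the outer states costs O(e'). The spread of the edges is bounded by the
  increase of the eigenvalue.\<close>

lemma speed_error:
 "\<bar>a j - c\<bar> + \<bar>b j - c\<bar> <= 8 * K ^ 3 * d\<^sup>2 + 4 * C * e'
   + 2 * (\<bar>(lam j um + lam j up) / 2 - c\<bar> + max 0 (lam j up - lam j um))"
proof -
 note cw = wave[OF j, unfolded near_wave_def, folded \<Delta>_def]
 have "(norm (\<Delta> j))\<^sup>2 <= (2 * K * d)\<^sup>2" using \<Delta>_bound[OF j] by (intro power_mono) auto
 then have "K * (norm (\<Delta> j))\<^sup>2 <= K * (2 * K * d)\<^sup>2" using K0 by (rule mult_left_mono)
 also have "... = 4 * K ^ 3 * d\<^sup>2" by (simp add: eval_nat_numeral)
 finally have 1: "\<bar>(a j + b j) / 2 - (lam j (om (j - 1)) + lam j (om j)) / 2\<bar> <= 4 * K ^ 3 * d\<^sup>2" using cw by linarith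
 have "um \<in> cball U0 1" "up \<in> cball U0 1" using om_in[of 0] om_in[of n] om_ends sub1 by auto
 then have "\<bar>lam j (om (j - 1)) - lam j um\<bar> <= C * norm (om (j - 1) - um)" "\<bar>lam j (om j) - lam j up\<bar> <= C * norm (om j - up)"
  using step_in[OF j] sub1 by (auto intro!: lip_lam[OF j])
 moreover have "C * norm (om (j - 1) - um) <= C * e'" "C * norm (om j - up) <= C * e'"
  using prefix_small[of "j - 1"] suffix_small[of j] C0 j I_iff[of j] by (auto intro!: mult_left_mono simp: norm_minus_commute)
 ultimately have 2: "\<bar>lam j (om (j - 1)) - lam j um\<bar> <= C * e'" "\<bar>lam j (om j) - lam j up\<bar> <= C * e'" by linarith+
 have 3: "b j - a j <= max 0 (lam j (om j) - lam j (om (j - 1)))" "a j <= b j" using cw by auto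
 have "0 <= C * e'" using C0 e'0 by simp
 then have 4: "max 0 (lam j (om j) - lam j (om (j - 1))) <= max 0 (lam j up - lam j um) + 2 * (C * e')" using 2 by (auto simp: max_def)
 have "\<bar>a j - c\<bar> + \<bar>b j - c\<bar> <= 2 * \<bar>(a j + b j) / 2 - c\<bar> + (b j - a j)" using 3(2) by (auto simp: abs_if field_simps)
 moreover have "\<bar>(a j + b j) / 2 - c\<bar> <= 4 * K ^ 3 * d\<^sup>2 + C * e' + \<bar>(lam j um + lam j up) / 2 - c\<bar>"
  using 1 2 by (auto simp: abs_le_iff abs_if field_simps split: if_splits)
 moreover have "0 <= max 0 (lam j up - lam j um)" by simp
 moreover have "4 * C * e' = 4 * (C * e')" "8 * K ^ 3 * d\<^sup>2 = 2 * (4 * K ^ 3 * d\<^sup>2)" by simp_all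
 ultimately show ?thesis using 3 4 by (simp only:) argo
qed

definition K4 where "K4 = ((2 + K) * (2 * Lam) + (K + 2 * K * K + 2) * (8 * K ^ 3 + 4 * C + 2)) * (1 + 2 * K3')"

text \<open>Between \<open>c\<close> and the edges of the group the difference is O(d) on an
  interval whose length \<open>speed_error\<close> controls. Elsewhere in the bounded range of
  speeds it is O(e').\<close>

theorem fan_error:
 assumes small: "K3' * d <= 1 / 2" and Lamc: "\<bar>c\<bar> <= Lam"
 shows "L1_dominated w (%\<xi>. if \<xi> < c then um else up)
   (K4 * (e + d ^ 3 + d * (\<bar>(lam j um + lam j up) / 2 - c\<bar> + max 0 (lam j up - lam j um))))"
proof -
 let ?A = "min c (a j)" and ?B = "max c (b j)"
 let ?\<gamma> = "\<bar>(lam j um + lam j up) / 2 - c\<bar> + max 0 (lam j up - lam j um)"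
 let ?P = "(2 + K) * e'" and ?Q = "(K + 2 * K * K + 2) * d"
 have Lam0: "0 <= Lam" using C0 K0 by (simp add: Lam_def)
 have PQ0: "0 <= ?P" "0 <= ?Q" using K0 e'0 d0 by simp_all
 define h where "h \<xi> = ?P * indicator {- Lam..Lam} \<xi> + ?Q * indicator {?A..?B} \<xi>" for \<xi> :: real
 have bound: "norm (w \<xi> - (if \<xi> < c then um else up)) <= h \<xi>" if \<xi>: "\<xi> \<notin> a ` I \<union> b ` I" for \<xi>
 proof -
  have 1: "1 \<in> I" "n \<in> I" using I_iff n1 by auto
  have hP: "?P <= h \<xi>" if "\<xi> \<in> {- Lam..Lam}" using that PQ0 by (simp add: h_def)
  consider "\<xi> < - Lam" | "\<xi> > Lam" | "\<xi> \<in> {- Lam..Lam}" "\<xi> < ?A" | "\<xi> \<in> {- Lam..Lam}" "\<xi> > ?B" | "\<xi> \<in> {?A..?B}" by fastforce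
  then show ?thesis
  proof cases
   case 1
   then have "\<xi> < c" "\<xi> < a 1" using Lamc speeds_bounded(1)[OF \<open>1 \<in> I\<close>] by linarith+
   then show ?thesis using w_left PQ0 by (simp add: h_def)
  next
   case 2
   then have "\<not> \<xi> < c" "b n < \<xi>" using Lamc speeds_bounded(2)[OF \<open>n \<in> I\<close>] by linarith+
   then show ?thesis using w_right PQ0 by (simp add: h_def)
  next
   case 3
   then have "norm (w \<xi> - um) <= (1 + K) * e'" by (intro left_of_group \<xi>) simp
   also have "... <= ?P" using e'0 by (simp add: algebra_simps)
   finally show ?thesis using 3 hP by auto
  next
   case 4
   then have "norm (w \<xi> - up) <= ?P" by (intro right_of_group \<xi>) simp
   then show ?thesis using 4 hP by auto
  next
   case 5
   have "norm (w \<xi> - up) <= norm (w \<xi> - um) + d" using norm_triangle_ineq4[of "w \<xi> - um" "up - um"] by (simp add: d_def)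
   then have "norm (w \<xi> - (if \<xi> < c then um else up)) <= (K + 2 * K * K + 1) * d + d" using crude[OF \<xi>] d0 by auto
   also have "... = ?Q" by (simp add: algebra_simps)
   finally show ?thesis using 5 PQ0 by (auto simp: h_def indicator_def)
  qed
 qed
 have len: "?A <= ?B" "?B - ?A <= \<bar>a j - c\<bar> + \<bar>b j - c\<bar>" using ab[OF j] by (auto simp: max_def min_def)
 have "(\<integral>\<^sup>+ \<xi>. ennreal (h \<xi>) \<partial>lborel) = (\<integral>\<^sup>+ \<xi>. ennreal ?P * indicator {- Lam..Lam} \<xi> + ennreal ?Q * indicator {?A..?B} \<xi> \<partial>lborel)"
  unfolding h_def using PQ0 by (intro nn_integral_cong) (auto simp: indicator_def ennreal_plus)
 also have "... = ennreal (?P * (2 * Lam) + ?Q * (?B - ?A))"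
  using Lam0 len(1) PQ0 by (subst nn_integral_add) (auto simp: nn_integral_cmult_indicator ennreal_mult ennreal_plus)
 also have "... <= ennreal (K4 * (e + d ^ 3 + d * ?\<gamma>))"
 proof (rule ennreal_leI)
  define W where "W = e + d ^ 3 + d * ?\<gamma>"
  define H where "H = (1 + 2 * K3') * W"
  have W0: "0 <= W" "e + d ^ 3 <= W" "d * ?\<gamma> <= W" "d ^ 3 <= W" using e0 d0 unfolding W_def by auto
  have K30: "0 <= K3'" by (rule consts0)
  have "e' <= 2 * K3' * (e + d ^ 3)" by (rule e'_bound[OF small])
  also have "... <= H" unfolding H_def using K30 W0 e0 d0 by (intro mult_mono) auto
  finally have e'W: "e' <= H" .
  have WH: "W <= H" unfolding H_def using K30 W0 mult_right_mono[of 1 "1 + 2 * K3'" W] by auto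
  have "?P * (2 * Lam) <= (2 + K) * H * (2 * Lam)" using e'W K0 Lam0 by (intro mult_right_mono mult_left_mono) auto
  moreover have "?Q * (?B - ?A) <= (K + 2 * K * K + 2) * ((8 * K ^ 3 + 4 * C + 2) * H)" unfolding mult.assoc
  proof (rule mult_left_mono)
   have "d * (?B - ?A) <= d * (8 * K ^ 3 * d\<^sup>2 + 4 * C * e' + 2 * ?\<gamma>)" using len speed_error[of c] d0 by (intro mult_left_mono) linarith+
   also have "... = 8 * K ^ 3 * d ^ 3 + 4 * C * (d * e') + 2 * (d * ?\<gamma>)" by (simp add: eval_nat_numeral algebra_simps)
   also have "... <= 8 * K ^ 3 * H + 4 * C * H + 2 * H"
   proof (intro add_mono mult_left_mono)
    have "d * e' <= 1 * e'" using d_le_1 e'0 by (rule mult_right_mono)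
    then show "d * e' <= H" using e'W by linarith
   qed (use K0 C0 W0 WH in linarith | use K0 C0 in simp)+
   finally show "d * (?B - ?A) <= (8 * K ^ 3 + 4 * C + 2) * H" by (simp only: distrib_right)
  qed (use K0 in simp)
  ultimately have "?P * (2 * Lam) + ?Q * (?B - ?A) <= ((2 + K) * (2 * Lam) + (K + 2 * K * K + 2) * (8 * K ^ 3 + 4 * C + 2)) * H"
   by (simp add: algebra_simps)
  then show "?P * (2 * Lam) + ?Q * (?B - ?A) <= K4 * (e + d ^ 3 + d * ?\<gamma>)" unfolding K4_def H_def W_def by (simp only: mult.assoc)
 qed
 finally have "(\<integral>\<^sup>+ \<xi>. ennreal (h \<xi>) \<partial>lborel) <= ennreal (K4 * (e + d ^ 3 + d * ?\<gamma>))" .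
 moreover have "h \<in> borel_measurable borel" unfolding h_def by measurable
 moreover have "0 <= h \<xi>" for \<xi> using PQ0 by (simp add: h_def)
 moreover have "finite (a ` I \<union> b ` I)" by simp
 ultimately show ?thesis unfolding L1_dominated_def using bound by blast
qed

end

section \<open>Riemann problems with nearby states\<close>

context hyperbolic_bounds begin

definition tsize where "tsize j um up = (\<Sum>i\<in>{i \<in> I. lam i ~= lam j}. \<bar>l i ((1/2) *\<^sub>R (um + up)) \<bullet> (up - um)\<bar>)"

text \<open>Rate at which a single jump of speed \<open>c\<close> departs from the Riemann solution:
  transversal part of the jump, leftover of the midpoint estimates, and jump times speed mismatch or
  opening of a rarefaction.\<close>

definition wave_error where "wave_error j c um up = tsize j um up + norm (up - um) ^ 3 +
 norm (up - um) * (\<bar>(lam j um + lam j up) / 2 - c\<bar> + max 0 (lam j up - lam j um))"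

lemma riemann_error:
 assumes R: "standard_riemann_solver F lam r U0 R"
 shows "\<exists>\<rho> K Lam. 0 < \<rho> & \<rho> <= 1 & 0 <= K & C + 1 <= Lam & (\<forall>um\<in>ball U0 \<rho>. \<forall>up\<in>ball U0 \<rho>.
   (\<forall>\<xi>. \<xi> < - Lam --> R um up \<xi> = um) & (\<forall>\<xi>. Lam < \<xi> --> R um up \<xi> = up) &
   (\<forall>j\<in>I. \<forall>c. \<bar>c\<bar> <= Lam --> L1_dominated (R um up) (%\<xi>. if \<xi> < c then um else up) (K * wave_error j c um up)))"
proof -
 obtain \<rho>0 C' where \<rho>0: "0 < \<rho>0" and lax: "!!um up. um \<in> ball U0 \<rho>0 ==> up \<in> ball U0 \<rho>0 ==>
   \<exists>om. lax_solution F lam r um up om (R um up) & (\<forall>j\<in>I. norm (om j - um) <= C' * norm (up - um))"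
  using R unfolding standard_riemann_solver_def I_eq by blast
 obtain \<rho>1 K1 where \<rho>1: "0 < \<rho>1" "\<rho>1 <= 1" "0 <= K1" and ew: "!!j us ut a b \<phi>. j \<in> I ==> us \<in> cball U0 \<rho>1 ==> ut \<in> cball U0 \<rho>1 ==>
   elementary_wave F lam r j us ut a b \<phi> ==> near_wave K1 j us ut a b &
   (\<forall>\<xi>. a < \<xi> & \<xi> < b --> norm (\<phi> \<xi> - us) <= K1 * norm (ut - us)) &
   (linearly_degenerate lam r j --> a = b & F ut - F us = a *\<^sub>R (ut - us) & lam j ut = a & lam j us = a)" using elementary_near_wave by metis
 define K where "K = max 1 (max K1 C')"
 have K: "1 <= K" "K1 <= K" "C' <= K" by (auto simp: K_def)
 define n where "n = real (card I)"
 \<comment> \<open>\<open>T\<close>, \<open>K3\<close>, \<open>Lam\<close> and \<open>KK\<close>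
   anticipate the constants of the fan locales, since the radii must be fixed before any fan is
   given; \<open>K3eq\<close>, \<open>L\<close> and \<open>eq\<close> confirm that they
   agree.\<close>
 define T where "T = 2 * C * C * (K + C)"
 define K3 where "K3 = C * n\<^sup>2 * (1 + (4 * T * K\<^sup>2 + C * (K + 1)) + n * (8 * T * K ^ 3 + 2 * C * K))"
 have T0: "0 <= T" using C0 K by (simp add: T_def)
 have n0: "0 <= n" by (simp add: n_def)
 have K30: "0 <= K3" unfolding K3_def using C0 K T0 n0 by (intro mult_nonneg_nonneg add_nonneg_nonneg) auto
 obtain \<rho>2 where "0 < \<rho>2" "\<forall>(a, b)\<in>{(1, \<rho>1), (2 * K + 2 * C, 1 / (2 * C))}. a * \<rho>2 < b"
  using small_multiples[of "{(1, \<rho>1), (2 * K + 2 * C, 1 / (2 * C))}"] \<rho>1 C1 by auto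
 then have \<rho>2: "0 < \<rho>2" "\<rho>2 <= \<rho>1" "\<rho>2 <= 1" and \<rho>2s: "(2 * K * \<rho>2 + C * \<rho>2) + C * \<rho>2 <= 1 / (2 * C)" using \<rho>1 by (auto simp: algebra_simps)
 obtain \<rho>3 where "0 < \<rho>3" "\<forall>(a, b)\<in>{(1, \<rho>0), (2 * K + 1, \<rho>2), (2, 1), (2 * K3, 1/2)}. a * \<rho>3 < b"
  using small_multiples[of "{(1, \<rho>0), (2 * K + 1, \<rho>2), (2, 1), (2 * K3, 1/2)}"] \<rho>0 \<rho>2 by auto
 then have \<rho>30: "0 < \<rho>3" and \<rho>3: "\<rho>3 <= \<rho>0" "2 * \<rho>3 <= 1" and K\<rho>3: "K * (2 * \<rho>3) + \<rho>3 <= \<rho>2" and K3\<rho>3: "K3 * (2 * \<rho>3) <= 1/2"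
  by (auto simp: algebra_simps)
 define Lam where "Lam = C + 2 * K"
 define KK where "KK = ((2 + K) * (2 * Lam) + (K + 2 * K * K + 2) * (8 * K ^ 3 + 4 * C + 2)) * (1 + 2 * K3)"
 have "0 <= KK" unfolding KK_def Lam_def using C0 K K30 by (intro mult_nonneg_nonneg add_nonneg_nonneg) auto
 moreover have "C + 1 <= Lam" using K by (simp add: Lam_def)
 moreover have "\<rho>3 <= 1" using \<rho>3 by simp
 moreover have "(\<forall>\<xi>. \<xi> < - Lam --> R um up \<xi> = um) & (\<forall>\<xi>. Lam < \<xi> --> R um up \<xi> = up) &
   (\<forall>j\<in>I. \<forall>c. \<bar>c\<bar> <= Lam --> L1_dominated (R um up) (%\<xi>. if \<xi> < c then um else up) (KK * wave_error j c um up))"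
  if um: "um \<in> ball U0 \<rho>3" and up: "up \<in> ball U0 \<rho>3" for um up
 proof -
  have "um \<in> ball U0 \<rho>0" "up \<in> ball U0 \<rho>0" using um up \<rho>3(1) by auto
  then obtain om where ls: "lax_solution F lam r um up om (R um up)" and near: "!!j. j \<in> I ==> norm (om j - um) <= C' * norm (up - um)" using lax by blast
  have card: "CARD('n) = card I" using card_I by simp
  have ome: "om 0 = um" "om (card I) = up" using ls unfolding lax_solution_def card by auto
  obtain a b \<phi> where fan: "(\<forall>j\<in>I. elementary_wave F lam r j (om (j - 1)) (om j) (a j) (b j) (\<phi> j)) &
    (\<forall>j\<in>{1..<card I}. b j <= a (Suc j)) &
    (\<forall>\<xi><a 1. R um up \<xi> = um) & (\<forall>\<xi>>b (card I). R um up \<xi> = up) &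
    (\<forall>j\<in>I. \<forall>\<xi>. a j < \<xi> & \<xi> < b j --> R um up \<xi> = \<phi> j \<xi>) &
    (\<forall>j\<in>{1..<card I}. \<forall>\<xi>. b j < \<xi> & \<xi> < a (Suc j) --> R um up \<xi> = om j)"
   using ls unfolding lax_solution_def card I_eq[unfolded card, symmetric] by (elim conjE exE) (rule that; intro conjI; assumption)
  have wv: "elementary_wave F lam r k (om (k - 1)) (om k) (a k) (b k) (\<phi> k)" if "k \<in> I" for k using fan that by blast
  have ord: "b k <= a (Suc k)" if "k \<in> {1..<card I}" for k using fan that by blast
  have wl: "R um up \<xi> = um" if "\<xi> < a 1" for \<xi> using fan that by blast
  have wr: "R um up \<xi> = up" if "b (card I) < \<xi>" for \<xi> using fan that by blast
  have ww: "R um up \<xi> = \<phi> k \<xi>" if "k \<in> I" "a k < \<xi>" "\<xi> < b k" for k \<xi> using fan that by blast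
  have wg: "R um up \<xi> = om k" if "k \<in> {1..<card I}" "b k < \<xi>" "\<xi> < a (Suc k)" for k \<xi> using fan that by blast
  have dd: "norm (up - um) <= 2 * \<rho>3" using um up norm_triangle_ineq4[of "up - U0" "um - U0"] by (auto simp: dist_norm norm_minus_commute)
  have I_iff: "k \<in> I \<longleftrightarrow> 1 <= k & k <= card I" for k using I_eq card_I by simp
  have near': "norm (om k - um) <= K * norm (up - um)" if "k <= card I" for k
  proof (cases "k = 0")
   case False
   then show ?thesis using near[of k] that I_iff[of k] mult_right_mono[OF K(3), of "norm (up - um)"] by force
  qed (use ome K in simp)
  have omin: "om k \<in> cball U0 \<rho>2" if "k <= card I" for k
  proof -
   have "norm (om k - U0) <= norm (om k - um) + norm (um - U0)" using norm_triangle_ineq[of "om k - um" "um - U0"] by simp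
   also have "... <= K * (2 * \<rho>3) + \<rho>3"
    using order_trans[OF near'[OF that] mult_left_mono[OF dd, of K]] K um by (intro add_mono) (auto simp: dist_norm norm_minus_commute)
   also note K\<rho>3
   finally show ?thesis by (simp add: dist_norm norm_minus_commute)
  qed
  have omin1: "om k \<in> cball U0 \<rho>1" if "k <= card I" for k using omin[OF that] \<rho>2(2) by auto
  have ew': "near_wave K1 k (om (k - 1)) (om k) (a k) (b k) &
   (\<forall>\<xi>. a k < \<xi> & \<xi> < b k --> norm (\<phi> k \<xi> - om (k - 1)) <= K1 * norm (om k - om (k - 1))) &
   (linearly_degenerate lam r k --> a k = b k & F (om k) - F (om (k - 1)) = a k *\<^sub>R (om k - om (k - 1)) & lam k (om k) = a k & lam k (om (k - 1)) = a k)"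
   if "k \<in> I" for k by (rule ew[OF that _ _ wv[OF that]]) (use omin1 that I_iff[of k] in auto)
  interpret rf: raw_fan F lam l r U0 I C K \<rho>2 um up om a b \<phi> "R um up"
  proof (unfold_locales, rule K(1), rule \<rho>2(3), rule ome(1), rule ome(2))
   fix k assume k: "k \<in> I"
   show "near_wave K k (om (k - 1)) (om k) (a k) (b k)" using ew'[OF k] near_wave_mono K(2) by blast
   show "norm (\<phi> k \<xi> - om (k - 1)) <= K * norm (om k - om (k - 1))" if "a k < \<xi>" "\<xi> < b k" for \<xi>
    using ew'[OF k] that mult_right_mono[OF K(2), of "norm (om k - om (k - 1))"] by force
   show "a k = b k & F (om k) - F (om (k - 1)) = a k *\<^sub>R (om k - om (k - 1)) & lam k (om k) = a k & lam k (om (k - 1)) = a k"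
    if "linearly_degenerate lam r k" using ew'[OF k] that by blast
   show "R um up \<xi> = \<phi> k \<xi>" if "a k < \<xi>" "\<xi> < b k" for \<xi> using ww[OF k that] .
   assume k': "Suc k \<in> I"
   have kk: "k \<in> {1..<card I}" using k k' I_iff[of k] I_iff[of "Suc k"] by auto
   show "b k <= a (Suc k)" using ord[OF kk] .
   show "R um up \<xi> = om k" if "b k < \<xi>" "\<xi> < a (Suc k)" for \<xi> using wg[OF kk that] .
  next
   show "norm (up - um) <= 1" using dd \<rho>3(2) by simp
  qed (use wl wr omin near' \<rho>2s in auto)
  interpret lf: lax_fan F lam l r U0 I C K \<rho>2 um up rf.om' rf.a' rf.b' \<phi> "R um up" by (rule rf.condensed)
  have K3eq: "lf.K3' = K3" unfolding lf.K3'_def lf.K1'_def lf.K2'_def lf.T_def K3_def T_def n_def ..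
  have sm: "lf.K3' * lf.d <= 1/2" unfolding K3eq using K3\<rho>3 mult_left_mono[OF dd K30] by (simp add: lf.d_def)
  have L: "lf.Lam = Lam" by (simp add: lf.Lam_def Lam_def)
  have one: "1 \<in> I" "card I \<in> I" using lf.n1 I_iff by auto
  have "R um up \<xi> = um" if "\<xi> < - Lam" for \<xi> by (rule lf.w_left) (use that lf.speeds_bounded(1)[OF one(1)] L in linarith)
  moreover have "R um up \<xi> = up" if "\<xi> > Lam" for \<xi> by (rule lf.w_right) (use that lf.speeds_bounded(2)[OF one(2)] L in linarith)
  moreover have "L1_dominated (R um up) (%\<xi>. if \<xi> < c then um else up) (KK * wave_error j c um up)" if j: "j \<in> I" and c: "\<bar>c\<bar> <= Lam" for j c
  proof -
   \<comment> \<open>In a condensed fan the first index of a group carries its jump, and the error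
     depends on j only through \<open>lam j\<close>.\<close>
   define i where "i = (LEAST k. k \<in> I & lam k = lam j)"
   have "i \<in> I & lam i = lam j" unfolding i_def by (rule LeastI[of _ j]) (use j in simp)
   then have i: "i \<in> I" "lam i = lam j" by auto
   have "lam k ~= lam i" if "k \<in> I" "k < i" for k using not_less_Least[of k "%k. k \<in> I & lam k = lam j"] that i(2) unfolding i_def[symmetric] by simp
   then interpret g: lax_fan_first F lam l r U0 I C K \<rho>2 um up rf.om' rf.a' rf.b' \<phi> "R um up" i by unfold_locales (use i in auto)
   have "g.e = tsize j um up" unfolding g.e_def g.others_def lf.M_def tsize_def i(2) ..
   then have eq: "g.K4 * (g.e + lf.d ^ 3 + lf.d * (\<bar>(lam i um + lam i up) / 2 - c\<bar> + max 0 (lam i up - lam i um))) = KK * wave_error j c um up"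
    unfolding g.K4_def L K3eq lf.d_def KK_def wave_error_def i(2) by simp
   show ?thesis using g.fan_error[OF sm c[folded L]] unfolding eq .
  qed
  ultimately show ?thesis by blast
 qed
 ultimately show ?thesis using \<rho>30 by blast
qed

section \<open>The second-order ansatz\<close>

definition twist where "twist j k = fd (r j) U0 (r k U0)"

text \<open>The quadratic term keeps a single group of equal eigenvalues on its integral manifold through
  \<open>U0\<close> up to third order.\<close>

definition ansatz :: "(nat => real) => real ^ 'n" where
 "ansatz \<alpha> = U0 + (\<Sum>j\<in>I. \<alpha> j *\<^sub>R r j U0) + (1/2) *\<^sub>R (\<Sum>j\<in>I. \<Sum>k\<in>I. (if lam j = lam k then \<alpha> j * \<alpha> k else 0) *\<^sub>R twist j k)"

text \<open>The partial derivative of \<open>ansatz\<close> in the j-th amplitude at p.\<close>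

definition tangent where
 "tangent p j = r j U0 + (1/2) *\<^sub>R (\<Sum>k\<in>I. (if lam j = lam k then p k else 0) *\<^sub>R (twist j k + twist k j))"

definition nn where "nn = real (card I)"

lemma nn1: "1 <= nn" using card_I by (simp add: nn_def Suc_leI)

lemma twist_bound: "j \<in> I ==> k \<in> I ==> norm (twist j k) <= C * C"
 unfolding twist_def using bound_fd_r[of j "r k U0"] bound_r[of k U0] C0 by (meson centre_in_cball mult_left_mono order_trans zero_le_one)

text \<open>For a quadratic map the increment is exactly the derivative at the mean of the
  arguments.\<close>

lemma ansatz_diff:
 "ansatz \<beta> - ansatz \<alpha> = (\<Sum>j\<in>I. (\<beta> j - \<alpha> j) *\<^sub>R tangent (%k. (\<alpha> k + \<beta> k) / 2) j)"
proof -
 let ?p = "%k. (\<alpha> k + \<beta> k) / 2" and ?d = "%k. \<beta> k - \<alpha> k"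
 let ?s = "%j k x. if lam j = lam k then x else (0::real)"
 have "(\<Sum>j\<in>I. \<Sum>k\<in>I. ?s j k (\<beta> j * \<beta> k) *\<^sub>R twist j k) - (\<Sum>j\<in>I. \<Sum>k\<in>I. ?s j k (\<alpha> j * \<alpha> k) *\<^sub>R twist j k)
  = (\<Sum>j\<in>I. \<Sum>k\<in>I. ?s j k (?d j * ?p k) *\<^sub>R twist j k) + (\<Sum>j\<in>I. \<Sum>k\<in>I. ?s j k (?d k * ?p j) *\<^sub>R twist j k)"
  unfolding sum_subtractf[symmetric] sum.distrib[symmetric] scaleR_left_diff_distrib[symmetric] scaleR_left_distrib[symmetric]
  by (intro sum.cong refl arg_cong2[where f = scaleR]) (simp add: field_simps)
 also have "(\<Sum>j\<in>I. \<Sum>k\<in>I. ?s j k (?d k * ?p j) *\<^sub>R twist j k) = (\<Sum>j\<in>I. \<Sum>k\<in>I. ?s j k (?d j * ?p k) *\<^sub>R twist k j)"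
  by (subst sum.swap) (intro sum.cong refl, auto)
 also have "(\<Sum>j\<in>I. \<Sum>k\<in>I. ?s j k (?d j * ?p k) *\<^sub>R twist j k) + (\<Sum>j\<in>I. \<Sum>k\<in>I. ?s j k (?d j * ?p k) *\<^sub>R twist k j)
  = (\<Sum>j\<in>I. ?d j *\<^sub>R (\<Sum>k\<in>I. ?s j k (?p k) *\<^sub>R (twist j k + twist k j)))" unfolding sum.distrib[symmetric] scaleR_sum_right
  by (intro sum.cong refl) (simp add: scaleR_add_right)
 finally have quad: "(\<Sum>j\<in>I. \<Sum>k\<in>I. ?s j k (\<beta> j * \<beta> k) *\<^sub>R twist j k) - (\<Sum>j\<in>I. \<Sum>k\<in>I. ?s j k (\<alpha> j * \<alpha> k) *\<^sub>R twist j k)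
   = (\<Sum>j\<in>I. ?d j *\<^sub>R (\<Sum>k\<in>I. ?s j k (?p k) *\<^sub>R (twist j k + twist k j)))" .
 have "ansatz \<beta> - ansatz \<alpha> = (\<Sum>j\<in>I. ?d j *\<^sub>R r j U0) + (1/2) *\<^sub>R ((\<Sum>j\<in>I. \<Sum>k\<in>I. ?s j k (\<beta> j * \<beta> k) *\<^sub>R twist j k) - (\<Sum>j\<in>I. \<Sum>k\<in>I. ?s j k (\<alpha> j * \<alpha> k) *\<^sub>R twist j k))"
  unfolding ansatz_def by (simp add: scaleR_left_diff_distrib sum_subtractf scaleR_diff_right)
 also have "... = (\<Sum>j\<in>I. ?d j *\<^sub>R r j U0) + (\<Sum>j\<in>I. ?d j *\<^sub>R ((1/2) *\<^sub>R (\<Sum>k\<in>I. ?s j k (?p k) *\<^sub>R (twist j k + twist k j))))"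
  unfolding quad by (subst scaleR_sum_right) (simp only: scaleR_left_commute[of "1/2"])
 also have "... = (\<Sum>j\<in>I. ?d j *\<^sub>R tangent ?p j)" unfolding sum.distrib[symmetric] scaleR_add_right[symmetric] tangent_def ..
 finally show ?thesis .
qed

lemma ansatz_cong: "(!!j. j \<in> I ==> \<alpha> j = \<beta> j) ==> ansatz \<alpha> = ansatz \<beta>"
 unfolding ansatz_def by (intro arg_cong2[where f = "(+)"] arg_cong2[where f = scaleR] sum.cong refl) simp_all

lemma quad_bound:
 assumes "!!j. j \<in> I ==> \<bar>\<alpha> j\<bar> <= X"
 shows "norm (ansatz \<alpha> - U0 - (\<Sum>j\<in>I. \<alpha> j *\<^sub>R r j U0)) <= nn\<^sup>2 * (C * C) * X\<^sup>2"
proof -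
 have "norm (\<Sum>j\<in>I. \<Sum>k\<in>I. (if lam j = lam k then \<alpha> j * \<alpha> k else 0) *\<^sub>R twist j k) <= (\<Sum>j\<in>I. \<Sum>k\<in>I. X * X * (C * C))"
 proof (intro sum_norm_le)
  fix j k assume jk: "j \<in> I" "k \<in> I"
  have "0 <= X" using assms[OF jk(1)] by linarith
  then have "\<bar>if lam j = lam k then \<alpha> j * \<alpha> k else 0\<bar> <= X * X" using assms jk by (auto simp: abs_mult intro!: mult_mono)
  then show "norm ((if lam j = lam k then \<alpha> j * \<alpha> k else 0) *\<^sub>R twist j k) <= X * X * (C * C)"
   unfolding norm_scaleR using twist_bound[OF jk] \<open>0 <= X\<close> by (intro mult_mono) auto
 qed
 also have "... = nn\<^sup>2 * (C * C) * X\<^sup>2" by (simp add: nn_def power2_eq_square)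
 finally have 1: "norm (\<Sum>j\<in>I. \<Sum>k\<in>I. (if lam j = lam k then \<alpha> j * \<alpha> k else 0) *\<^sub>R twist j k) <= nn\<^sup>2 * (C * C) * X\<^sup>2" .
 have "norm (ansatz \<alpha> - U0 - (\<Sum>j\<in>I. \<alpha> j *\<^sub>R r j U0)) = (1/2) * norm (\<Sum>j\<in>I. \<Sum>k\<in>I. (if lam j = lam k then \<alpha> j * \<alpha> k else 0) *\<^sub>R twist j k)"
  unfolding ansatz_def by simp
 also have "... <= nn\<^sup>2 * (C * C) * X\<^sup>2" using 1 norm_ge_zero[of "\<Sum>j\<in>I. \<Sum>k\<in>I. (if lam j = lam k then \<alpha> j * \<alpha> k else 0) *\<^sub>R twist j k"] by linarith
 finally show ?thesis .
qed

lemma linear_bound: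
 assumes "!!j. j \<in> I ==> \<bar>\<alpha> j\<bar> <= X" "0 <= X"
 shows "norm (\<Sum>j\<in>I. \<alpha> j *\<^sub>R r j U0) <= nn * C * X"
proof -
 have "norm (\<Sum>j\<in>I. \<alpha> j *\<^sub>R r j U0) <= (\<Sum>j\<in>I. X * C)" by (intro sum_norm_le) (use assms bound_r[of _ U0] C0 in \<open>auto intro!: mult_mono\<close>)
 then show ?thesis by (simp add: nn_def mult_ac)
qed

lemma ansatz_near:
 assumes "!!j. j \<in> I ==> \<bar>\<alpha> j\<bar> <= X" "0 <= X" "X <= 1"
 shows "norm (ansatz \<alpha> - U0) <= 2 * nn\<^sup>2 * (C * C) * X"
proof -
 have "norm (ansatz \<alpha> - U0) <= norm (ansatz \<alpha> - U0 - (\<Sum>j\<in>I. \<alpha> j *\<^sub>R r j U0)) + norm (\<Sum>j\<in>I. \<alpha> j *\<^sub>R r j U0)"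
  using norm_triangle_ineq[of "ansatz \<alpha> - U0 - (\<Sum>j\<in>I. \<alpha> j *\<^sub>R r j U0)" "\<Sum>j\<in>I. \<alpha> j *\<^sub>R r j U0"] by simp
 also have "... <= nn\<^sup>2 * (C * C) * X\<^sup>2 + nn * C * X" by (intro add_mono quad_bound linear_bound assms)
 also have "... <= nn\<^sup>2 * (C * C) * X + nn\<^sup>2 * (C * C) * X"
 proof (intro add_mono mult_left_mono mult_right_mono)
  show "X\<^sup>2 <= X" using assms by (simp add: power2_eq_square mult_left_le)
  have "nn * C * 1 <= nn * C * (nn * C)" using nn1 C1 by (intro mult_left_mono) (auto intro: order_trans[OF _ mult_mono[of 1 nn 1 C]])
  then show "nn * C <= nn\<^sup>2 * (C * C)" by (simp add: power2_eq_square mult_ac)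
 qed (use assms C0 in auto)
 finally show ?thesis by (simp add: mult_ac)
qed

lemma tangent_near:
 assumes "!!j. j \<in> I ==> \<bar>p j\<bar> <= X" "j \<in> I"
 shows "norm (tangent p j - r j U0) <= nn * (C * C) * X"
proof -
 have "norm (\<Sum>k\<in>I. (if lam j = lam k then p k else 0) *\<^sub>R (twist j k + twist k j)) <= (\<Sum>k\<in>I. X * (C * C + C * C))"
 proof (rule sum_norm_le)
  fix k assume k: "k \<in> I"
  have "0 <= X" using assms(1)[OF k] by linarith
  then show "norm ((if lam j = lam k then p k else 0) *\<^sub>R (twist j k + twist k j)) <= X * (C * C + C * C)"
   unfolding norm_scaleR using assms(1)[OF k] twist_bound[OF assms(2) k] twist_bound[OF k assms(2)] by (intro mult_mono norm_triangle_mono) auto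
 qed
 then show ?thesis unfolding tangent_def nn_def by (simp add: mult_ac)
qed

text \<open>The slope of \<open>lam j\<close> along \<open>r j\<close>, hence the coefficient of the
  quadratic flux in the equation for the j-th amplitude.\<close>

definition kap where "kap j = (if genuinely_nonlinear lam r j then 1 else 0 :: real)"

lemma kap_range: "0 <= kap j" "kap j <= 1" by (auto simp: kap_def)

lemma lam_deriv_group:
 assumes "j \<in> I" "k \<in> I" "lam k = lam j" shows "fd (lam j) U0 (r k U0) = (if k = j then kap j else 0)"
proof (cases "genuinely_nonlinear lam r j")
 case True
 then have "k = j" using gnl_simple[OF assms(1,2)] assms(3) by simp
 then show ?thesis using gnl_deriv[OF True] True by (simp add: kap_def)
next
 case False
 then have "linearly_degenerate lam r j" using fields[OF assms(1)] by blast
 then show ?thesis using ld_deriv_group[OF assms(1,2) assms(3)[symmetric]] False by (simp add: kap_def)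
qed

end

lemma half_sum_diff:
 fixes a b c :: "'a::real_vector"
 shows "(1/2) *\<^sub>R (a + b) - c = (1/2) *\<^sub>R ((a - c) + (b - c))"
proof -
 have "(1/2) *\<^sub>R ((a - c) + (b - c)) = (1/2) *\<^sub>R (a + b) - ((1/2) *\<^sub>R c + (1/2) *\<^sub>R c)" by (simp add: algebra_simps)
 also have "(1/2) *\<^sub>R c + (1/2) *\<^sub>R c = c" by (simp add: scaleR_left_distrib[symmetric])
 finally show ?thesis by simp
qed

context hyperbolic_bounds begin

definition A0 where "A0 = 2 * nn\<^sup>2 * (C * C)"

lemma A0: "1 <= A0" "nn\<^sup>2 * (C * C) <= A0" "nn * (C * C) <= A0" "C + nn * (C * C) <= A0"
proof -
 have a: "1 <= nn\<^sup>2" "nn <= nn\<^sup>2" using nn1 one_le_power[of nn 2] self_le_power[of nn 2] by auto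
 have b: "1 <= C * C" "C <= C * C" using C1 by (auto intro: order_trans[OF _ mult_mono[of 1 C 1 C]] simp: mult_le_cancel_left1)
 have c: "nn * (C * C) <= nn\<^sup>2 * (C * C)" using a b by (intro mult_right_mono) auto
 have "1 * (C * C) <= nn\<^sup>2 * (C * C)" using a b by (intro mult_right_mono) auto
 then show "1 <= A0" "nn\<^sup>2 * (C * C) <= A0" "nn * (C * C) <= A0" "C + nn * (C * C) <= A0" using b c unfolding A0_def by linarith+
qed

lemma tangent_bound:
 assumes "!!k. k \<in> I ==> \<bar>p k\<bar> <= 1" "j \<in> I" shows "norm (tangent p j) <= A0"
proof -
 have "norm (tangent p j) <= norm (tangent p j - r j U0) + norm (r j U0)" using norm_triangle_ineq[of "tangent p j - r j U0" "r j U0"] by simp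
 also have "... <= nn * (C * C) * 1 + C" using tangent_near[OF assms(1)] bound_r[of j U0] assms by (intro add_mono) auto
 finally show ?thesis using A0(4) by linarith
qed

lemma ansatz_lipschitz:
 assumes "!!k. k \<in> I ==> \<bar>\<alpha> k\<bar> <= 1" "!!k. k \<in> I ==> \<bar>\<beta> k\<bar> <= 1"
 shows "norm (ansatz \<beta> - ansatz \<alpha>) <= A0 * (\<Sum>j\<in>I. \<bar>\<beta> j - \<alpha> j\<bar>)"
proof -
 have t: "norm (tangent (%k. (\<alpha> k + \<beta> k) / 2) j) <= A0" if "j \<in> I" for j
 proof (rule tangent_bound[OF _ that])
  fix k assume "k \<in> I" from assms[OF this] show "\<bar>(\<alpha> k + \<beta> k) / 2\<bar> <= 1" by (simp add: abs_le_iff)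
 qed
 have "norm (ansatz \<beta> - ansatz \<alpha>) <= (\<Sum>j\<in>I. \<bar>\<beta> j - \<alpha> j\<bar> * A0)" unfolding ansatz_diff by (rule sum_norm_le) (simp add: mult_left_mono t)
 then show ?thesis by (simp add: sum_distrib_left mult.commute)
qed

end

section \<open>Error of one front of the ansatz\<close>

locale ansatz_pair = hyperbolic_bounds F lam l r U0 I C
 for F :: "real ^ 'n => real ^ 'n" and lam l r U0 I C +
 fixes \<alpha> \<beta> :: "nat => real" and X :: real and j0 :: nat
 assumes X: "0 <= X" "X <= 1" "A0 * X <= 1"
  and \<alpha>: "!!j. j \<in> I ==> \<bar>\<alpha> j\<bar> <= X" and \<beta>: "!!j. j \<in> I ==> \<bar>\<beta> j\<bar> <= X"
  and j0: "j0 \<in> I"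
  and one_group: "!!j. j \<in> I ==> lam j ~= lam j0 ==> \<alpha> j = \<beta> j"
begin

definition p where "p j = (\<alpha> j + \<beta> j) / 2"
definition n1 where "n1 = (\<Sum>j\<in>I. \<bar>\<beta> j - \<alpha> j\<bar>)"
definition um where "um = ansatz \<alpha>"
definition up where "up = ansatz \<beta>"
definition M where "M = (1/2) *\<^sub>R (um + up)"

lemma n1_nonneg: "0 <= n1" by (simp add: n1_def sum_nonneg)

lemma n1_le: "n1 <= 2 * nn * X"
proof -
 have "n1 <= (\<Sum>j\<in>I. 2 * X)" unfolding n1_def
 proof (rule sum_mono)
  fix j assume "j \<in> I" then show "\<bar>\<beta> j - \<alpha> j\<bar> <= 2 * X" using \<alpha>[of j] \<beta>[of j] by linarith
 qed
 then show ?thesis by (simp add: nn_def mult_ac)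
qed

lemma p: assumes "j \<in> I" shows "\<bar>p j\<bar> <= X" using \<alpha>[OF assms] \<beta>[OF assms] unfolding p_def by (simp add: abs_le_iff)

lemma quad_bound': assumes "!!j. j \<in> I ==> \<bar>\<gamma> j\<bar> <= X" shows "norm (ansatz \<gamma> - U0 - (\<Sum>j\<in>I. \<gamma> j *\<^sub>R r j U0)) <= A0 * X\<^sup>2"
proof -
 have "norm (ansatz \<gamma> - U0 - (\<Sum>j\<in>I. \<gamma> j *\<^sub>R r j U0)) <= nn\<^sup>2 * (C * C) * X\<^sup>2" by (rule quad_bound) (rule assms)
 also have "... <= A0 * X\<^sup>2" using A0(2) by (intro mult_right_mono) auto
 finally show ?thesis .
qed

lemma near: "norm (um - U0) <= A0 * X" "norm (up - U0) <= A0 * X" "norm (ansatz p - U0) <= A0 * X"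
 unfolding um_def up_def A0_def by (rule ansatz_near; use \<alpha> \<beta> p X in blast)+

lemma M_near: "norm (M - U0) <= A0 * X"
proof -
 have "M - U0 = (1/2) *\<^sub>R ((um - U0) + (up - U0))" unfolding M_def by (rule half_sum_diff)
 then have "norm (M - U0) = norm ((um - U0) + (up - U0)) / 2" by simp
 then show ?thesis using near norm_triangle_ineq[of "um - U0" "up - U0"] by linarith
qed

lemma in_ball: "norm (x - U0) <= A0 * X ==> x \<in> cball U0 1"
 using X(3) by (simp add: dist_norm norm_minus_commute)

lemmas mem = in_ball[OF near(1)] in_ball[OF near(2)] in_ball[OF near(3)] in_ball[OF M_near]

lemma U0_mem: "U0 \<in> cball U0 1" by simp

lemma jump: "up - um = (\<Sum>j\<in>I. (\<beta> j - \<alpha> j) *\<^sub>R tangent p j)"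
 unfolding up_def um_def ansatz_diff p_def[abs_def] ..

lemma tangent_near': "j \<in> I ==> norm (tangent p j - r j U0) <= A0 * X"
 using tangent_near[OF p] A0(3) X(1) mult_right_mono[OF A0(3), of X] by force

lemma tangent_bound': assumes "j \<in> I" shows "norm (tangent p j) <= A0"
 by (rule tangent_bound[OF _ assms]) (use p X(2) order_trans in blast)

lemma jump_norm: "norm (up - um) <= A0 * n1"
 unfolding up_def um_def n1_def by (rule ansatz_lipschitz) (use \<alpha> \<beta> X(2) order_trans in blast)+

lemma tsize_le:
 assumes "!!i j. i \<in> I ==> lam i ~= lam j0 ==> j \<in> I ==> lam j = lam j0 ==> \<bar>l i M \<bullet> tangent p j\<bar> <= B" "0 <= B"
 shows "tsize j0 um up <= nn * B * n1"
proof -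
 have "\<bar>l i M \<bullet> (up - um)\<bar> <= B * n1" if i: "i \<in> I" "lam i ~= lam j0" for i
 proof -
  have "\<bar>l i M \<bullet> (up - um)\<bar> <= (\<Sum>j\<in>I. \<bar>(\<beta> j - \<alpha> j) * (l i M \<bullet> tangent p j)\<bar>)" unfolding jump inner_sum_right inner_scaleR_right by (rule sum_abs)
  also have "... <= (\<Sum>j\<in>I. \<bar>\<beta> j - \<alpha> j\<bar> * B)"
  proof (rule sum_mono)
   fix j assume j: "j \<in> I"
   show "\<bar>(\<beta> j - \<alpha> j) * (l i M \<bullet> tangent p j)\<bar> <= \<bar>\<beta> j - \<alpha> j\<bar> * B"
   proof (cases "lam j = lam j0")
    case True
    show ?thesis unfolding abs_mult using assms(1)[OF i j True] by (rule mult_left_mono) simp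
   qed (use one_group[OF j] in simp)
  qed
  finally show ?thesis by (simp add: n1_def sum_distrib_left mult.commute)
 qed
 then have "tsize j0 um up <= (\<Sum>i\<in>{i \<in> I. lam i ~= lam j0}. B * n1)" unfolding tsize_def M_def[symmetric] by (intro sum_mono) auto
 also have "... <= (\<Sum>i\<in>I. B * n1)" by (intro sum_mono2) (use assms n1_nonneg in auto)
 finally show ?thesis by (simp add: nn_def mult_ac)
qed

lemma cube: "norm (up - um) ^ 3 <= 4 * A0 ^ 3 * nn\<^sup>2 * X\<^sup>2 * n1"
proof -
 have "norm (up - um) ^ 3 <= (A0 * n1) ^ 3" using jump_norm by (intro power_mono) auto
 also have "... = A0 ^ 3 * (n1 * n1\<^sup>2)" by (simp add: power_mult_distrib power3_eq_cube power2_eq_square)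
 also have "... <= A0 ^ 3 * (n1 * (2 * nn * X)\<^sup>2)" using n1_le n1_nonneg A0(1) by (intro mult_left_mono power_mono) auto
 finally show ?thesis by (simp add: power_mult_distrib mult_ac)
qed

lemma wave_error_le:
 assumes "tsize j0 um up <= B1 * n1" "\<bar>(lam j0 um + lam j0 up) / 2 - c\<bar> <= B2" "max 0 (lam j0 up - lam j0 um) <= B3"
 shows "wave_error j0 c um up <= (B1 + 4 * A0 ^ 3 * nn\<^sup>2 * X\<^sup>2 + A0 * (B2 + B3)) * n1"
proof -
 have "norm (up - um) * (\<bar>(lam j0 um + lam j0 up) / 2 - c\<bar> + max 0 (lam j0 up - lam j0 um)) <= (A0 * n1) * (B2 + B3)"
  using jump_norm assms(2,3) n1_nonneg A0(1) by (intro mult_mono add_mono) auto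
 then show ?thesis unfolding wave_error_def using assms(1) cube by (simp add: algebra_simps)
qed

text \<open>With all families present only orthogonality at \<open>U0\<close> is available: the
  midpoint, the tangents and the speed each deviate by O(X) from their values there.\<close>

lemma wave_error_crude:
 assumes c: "\<bar>c - lam j0 U0\<bar> <= X"
 shows "wave_error j0 c um up <= (2 * C * A0\<^sup>2 * nn + 4 * A0 ^ 3 * nn\<^sup>2 + A0 * ((C * A0 + 1) + 2 * C * A0)) * (X * n1)"
proof -
 have t: "tsize j0 um up <= nn * (2 * C * A0\<^sup>2 * X) * n1"
 proof (rule tsize_le)
  fix i j assume i: "i \<in> I" "lam i ~= lam j0" and j: "j \<in> I" "lam j = lam j0"
  have z: "l i U0 \<bullet> r j U0 = 0" using dual_basis[OF i(1) j(1)] i j by auto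
  have "l i M \<bullet> tangent p j = (l i M - l i U0) \<bullet> tangent p j + l i U0 \<bullet> (tangent p j - r j U0)"
   using z by (simp add: inner_diff_left inner_diff_right)
  then have "\<bar>l i M \<bullet> tangent p j\<bar> <= norm (l i M - l i U0) * norm (tangent p j) + norm (l i U0) * norm (tangent p j - r j U0)"
   using Cauchy_Schwarz_ineq2[of "l i M - l i U0" "tangent p j"] Cauchy_Schwarz_ineq2[of "l i U0" "tangent p j - r j U0"] by linarith
  also have "... <= (C * (A0 * X)) * A0 + C * (A0 * X)"
  proof (intro add_mono mult_mono)
   show "norm (l i M - l i U0) <= C * (A0 * X)" using lip_l[OF i(1) mem(4) U0_mem] mult_left_mono[OF M_near, of C] C0 by linarith
  qed (use tangent_bound'[OF j(1)] tangent_near'[OF j(1)] bound_l[OF i(1) U0_mem] C0 X A0 in auto)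
  also have "... <= (C * (A0 * X)) * A0 + (C * (A0 * X)) * A0" using mult_left_mono[OF A0(1), of "C * (A0 * X)"] A0(1) C0 X by (intro add_left_mono) simp
  finally show "\<bar>l i M \<bullet> tangent p j\<bar> <= 2 * C * A0\<^sup>2 * X" by (simp add: power2_eq_square mult_ac)
 qed (use C0 X in simp)
 have um: "\<bar>lam j0 um - lam j0 U0\<bar> <= C * A0 * X" and up: "\<bar>lam j0 up - lam j0 U0\<bar> <= C * A0 * X"
  using lip_lam[OF j0 mem(1) U0_mem] lip_lam[OF j0 mem(2) U0_mem] mult_left_mono[OF near(1), of C] mult_left_mono[OF near(2), of C] C0
  by (simp_all add: mult.assoc)
 have a: "\<bar>(lam j0 um + lam j0 up) / 2 - c\<bar> <= C * A0 * X + X"  using um up c unfolding abs_le_iff by (simp add: field_simps)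
 have b: "max 0 (lam j0 up - lam j0 um) <= 2 * (C * A0 * X)" using um up by linarith
 have X2: "X\<^sup>2 <= X" using X by (simp add: power2_eq_square mult_left_le)
 have "wave_error j0 c um up <= (nn * (2 * C * A0\<^sup>2 * X) + 4 * A0 ^ 3 * nn\<^sup>2 * X\<^sup>2 + A0 * ((C * A0 * X + X) + 2 * (C * A0 * X))) * n1"
  by (rule wave_error_le[OF t a b])
 also have "... <= (nn * (2 * C * A0\<^sup>2 * X) + 4 * A0 ^ 3 * nn\<^sup>2 * X + A0 * ((C * A0 * X + X) + 2 * (C * A0 * X))) * n1"
  using mult_left_mono[OF X2, of "4 * A0 ^ 3 * nn\<^sup>2"] A0(1) n1_nonneg by (intro mult_right_mono) auto
 also have "... = (2 * C * A0\<^sup>2 * nn + 4 * A0 ^ 3 * nn\<^sup>2 + A0 * ((C * A0 + 1) + 2 * C * A0)) * (X * n1)" by (simp add: algebra_simps)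
 finally show ?thesis .
qed

context
 assumes separated: "!!j. j \<in> I ==> lam j ~= lam j0 ==> \<alpha> j = 0"
begin

lemma \<beta>_sep: "j \<in> I ==> lam j ~= lam j0 ==> \<beta> j = 0" using one_group separated by force
lemma p_sep: "j \<in> I ==> lam j ~= lam j0 ==> p j = 0" using \<beta>_sep separated by (simp add: p_def)

text \<open>The mean of two ansatz states and the ansatz of the mean amplitudes have the same linear
  part, so only quadratic terms remain.\<close>

lemma M_ansatz: "norm (M - ansatz p) <= 2 * (A0 * X\<^sup>2)"
proof -
 let ?L = "%\<gamma>. \<Sum>j\<in>I. \<gamma> j *\<^sub>R r j U0"
 let ?Q = "%\<gamma>. ansatz \<gamma> - U0 - ?L \<gamma>"
 have Lp: "?L p = (1/2) *\<^sub>R (?L \<alpha> + ?L \<beta>)" unfolding sum.distrib[symmetric] scaleR_sum_right p_def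
  by (intro sum.cong refl) (simp add: scaleR_left_distrib[symmetric])
 have Q: "norm (?Q \<gamma>) <= A0 * X\<^sup>2" if "\<gamma> \<in> {\<alpha>, \<beta>, p}" for \<gamma> by (rule quad_bound') (use that \<alpha> \<beta> p in auto)
 have "M - (U0 + (1/2) *\<^sub>R (?L \<alpha> + ?L \<beta>)) = (1/2) *\<^sub>R (?Q \<alpha> + ?Q \<beta>)"
  unfolding M_def um_def up_def diff_diff_eq[symmetric] half_sum_diff by (simp add: algebra_simps)
 with Lp have "M - ansatz p = (1/2) *\<^sub>R (?Q \<alpha> + ?Q \<beta>) - ?Q p" by (simp add: algebra_simps)
 then have "norm (M - ansatz p) <= norm ((1/2) *\<^sub>R (?Q \<alpha> + ?Q \<beta>)) + norm (?Q p)" by (simp only: norm_triangle_ineq4)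
 moreover have "norm ((1/2) *\<^sub>R (?Q \<alpha> + ?Q \<beta>)) = norm (?Q \<alpha> + ?Q \<beta>) / 2" by simp
 ultimately show ?thesis using norm_triangle_ineq[of "?Q \<alpha>" "?Q \<beta>"] Q[of \<alpha>] Q[of \<beta>] Q[of p] by simp
qed

text \<open>First-order terms cancel because \<open>l\<^sub>i \<cdot> Dr\<^sub>j r\<^sub>k\<close> is symmetric in \<open>j\<close>, \<open>k\<close> for a multiple eigenvalue.\<close>

lemma transversal:
 assumes i: "i \<in> I" "lam i ~= lam j0" and j: "j \<in> I" "lam j = lam j0"
 shows "\<bar>l i (ansatz p) \<bullet> tangent p j\<bar> <= 3 * C\<^sup>2 * A0 ^ 3 * X\<^sup>2"
proof -
 let ?W = "ansatz p - U0" and ?L = "\<Sum>k\<in>I. p k *\<^sub>R r k U0" and ?D = "fd (l i) U0"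
 have lin: "linear ?D" by (rule fd_linear[OF C_l[OF i(1)]])
 have z: "l i U0 \<bullet> r j U0 = 0" using dual_basis[OF i(1) j(1)] i j by auto
 let ?c = "%k. if lam j = lam k then p k else 0"
 have pc: "p k = ?c k" if "k \<in> I" for k using p_sep[OF that] j by auto
 have "l i U0 \<bullet> tangent p j = (1/2) * (\<Sum>k\<in>I. ?c k * (l i U0 \<bullet> twist j k + l i U0 \<bullet> twist k j))"
  unfolding tangent_def inner_add_right inner_scaleR_right inner_sum_right using z by simp
 also have "(\<Sum>k\<in>I. ?c k * (l i U0 \<bullet> twist j k + l i U0 \<bullet> twist k j)) = (\<Sum>k\<in>I. 2 * (p k * (l i U0 \<bullet> twist j k)))"
 proof (rule sum.cong[OF refl])
  fix k assume k: "k \<in> I"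
  show "?c k * (l i U0 \<bullet> twist j k + l i U0 \<bullet> twist k j) = 2 * (p k * (l i U0 \<bullet> twist j k))"
  proof (cases "lam j = lam k")
   case True
   then have "l i U0 \<bullet> twist j k = l i U0 \<bullet> twist k j" unfolding twist_def using group_involutive[OF i(1) j(1) k True] i j by simp
   then show ?thesis using True by simp
  next
   case False then show ?thesis using pc[OF k] by simp
  qed
 qed
 finally have a: "l i U0 \<bullet> tangent p j = (\<Sum>k\<in>I. p k * (l i U0 \<bullet> twist j k))" by (simp add: sum_distrib_left[symmetric])
 have "?D ?L \<bullet> r j U0 = (\<Sum>k\<in>I. p k * (?D (r k U0) \<bullet> r j U0))" by (simp add: linear_sum[OF lin] linear_cmul[OF lin] inner_sum_left)
 then have b: "?D ?L \<bullet> r j U0 = - (\<Sum>k\<in>I. p k * (l i U0 \<bullet> twist j k))"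
  using differentiated_duality[OF i(1) j(1), of U0] by (simp add: twist_def sum_negf)
 have LD: "?D (?W - ?L) = ?D ?W - ?D ?L" by (rule linear_diff[OF lin])
 have "l i (ansatz p) \<bullet> tangent p j = (l i (ansatz p) - l i U0 - ?D ?W) \<bullet> tangent p j + ?D ?W \<bullet> (tangent p j - r j U0) + ?D (?W - ?L) \<bullet> r j U0"
  unfolding LD inner_diff_left inner_diff_right using a b by simp
 then have "\<bar>l i (ansatz p) \<bullet> tangent p j\<bar> <= norm (l i (ansatz p) - l i U0 - ?D ?W) * norm (tangent p j)
   + norm (?D ?W) * norm (tangent p j - r j U0) + norm (?D (?W - ?L)) * norm (r j U0)"
  using Cauchy_Schwarz_ineq2[of "l i (ansatz p) - l i U0 - ?D ?W" "tangent p j"]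
   Cauchy_Schwarz_ineq2[of "?D ?W" "tangent p j - r j U0"] Cauchy_Schwarz_ineq2[of "?D (?W - ?L)" "r j U0"] by linarith
 also have "... <= (C * (A0 * X)\<^sup>2) * A0 + (C * (A0 * X)) * (A0 * X) + (C * (A0 * X\<^sup>2)) * C"
 proof (intro add_mono mult_mono)
  have "(norm ?W)\<^sup>2 <= (A0 * X)\<^sup>2" using near(3) by (intro power_mono) auto
  then show "norm (l i (ansatz p) - l i U0 - ?D ?W) <= C * (A0 * X)\<^sup>2"
   using taylor_l[OF i(1) mem(3)] mult_left_mono[of _ _ C] C0 by (meson order_trans)
  show "norm (?D ?W) <= C * (A0 * X)" using bound_fd_l[OF i(1), of ?W] mult_left_mono[OF near(3), of C] C0 by linarith
  have "norm (?W - ?L) <= A0 * X\<^sup>2" by (rule quad_bound') (rule p)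
  then show "norm (?D (?W - ?L)) <= C * (A0 * X\<^sup>2)" using bound_fd_l[OF i(1), of "?W - ?L"] mult_left_mono[of _ _ C] C0 by (meson order_trans)
 qed (use tangent_bound'[OF j(1)] tangent_near'[OF j(1)] bound_r[OF j(1) U0_mem] C0 X A0 in auto)
 also have "... = (C * A0 ^ 3 + C * A0\<^sup>2 + C\<^sup>2 * A0) * X\<^sup>2" by (simp add: power2_eq_square power3_eq_cube algebra_simps)
 also have "... <= (C\<^sup>2 * A0 ^ 3 + C\<^sup>2 * A0 ^ 3 + C\<^sup>2 * A0 ^ 3) * X\<^sup>2"
 proof (rule mult_right_mono[OF add_mono[OF add_mono]])
  have "C <= C\<^sup>2" using self_le_power[of C 2] C1 by simp
  moreover have "A0\<^sup>2 <= A0 ^ 3" "A0 <= A0 ^ 3" using A0(1) power_increasing[of 2 3 A0] self_le_power[of A0 3] by auto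
  ultimately show "C * A0 ^ 3 <= C\<^sup>2 * A0 ^ 3" "C * A0\<^sup>2 <= C\<^sup>2 * A0 ^ 3" "C\<^sup>2 * A0 <= C\<^sup>2 * A0 ^ 3" using A0(1) C0 by (auto intro!: mult_mono)
 qed simp
 finally show ?thesis by simp
qed

lemma lam_ansatz:
 assumes \<gamma>: "!!j. j \<in> I ==> \<bar>\<gamma> j\<bar> <= X" and sep: "!!j. j \<in> I ==> lam j ~= lam j0 ==> \<gamma> j = 0"
  and near\<gamma>: "norm (ansatz \<gamma> - U0) <= A0 * X"
 shows "\<bar>lam j0 (ansatz \<gamma>) - lam j0 U0 - kap j0 * \<gamma> j0\<bar> <= 2 * C * A0\<^sup>2 * X\<^sup>2"
proof -
 let ?W = "ansatz \<gamma> - U0" and ?L = "\<Sum>k\<in>I. \<gamma> k *\<^sub>R r k U0" and ?D = "fd (lam j0) U0"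
 have lin: "linear ?D" by (rule fd_linear[OF C_lam[OF j0]])
 have "?D ?L = (\<Sum>k\<in>I. \<gamma> k * ?D (r k U0))" by (simp add: linear_sum[OF lin] linear_cmul[OF lin])
 also have "... = (\<Sum>k\<in>I. if k = j0 then kap j0 * \<gamma> j0 else 0)"
 proof (rule sum.cong[OF refl])
  fix k assume k: "k \<in> I"
  show "\<gamma> k * ?D (r k U0) = (if k = j0 then kap j0 * \<gamma> j0 else 0)" using lam_deriv_group[OF j0 k] sep[OF k] by (cases "lam k = lam j0") auto
 qed
 finally have L: "?D ?L = kap j0 * \<gamma> j0" using j0 by simp
 have LD: "?D (?W - ?L) = ?D ?W - ?D ?L" by (rule linear_diff[OF lin])
 have "(norm ?W)\<^sup>2 <= (A0 * X)\<^sup>2" using near\<gamma> by (intro power_mono) auto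
 then have 1: "\<bar>lam j0 (ansatz \<gamma>) - lam j0 U0 - ?D ?W\<bar> <= C * (A0 * X)\<^sup>2"
  using taylor_lam[OF j0 in_ball[OF near\<gamma>]] mult_left_mono[of _ _ C] C0 by (meson order_trans)
 have "norm (?W - ?L) <= A0 * X\<^sup>2" by (rule quad_bound') (rule \<gamma>)
 then have 2: "\<bar>?D (?W - ?L)\<bar> <= C * (A0 * X\<^sup>2)" using bound_fd_lam[OF j0, of "?W - ?L"] mult_left_mono[of _ _ C] C0 by (meson order_trans)
 have "A0 * X\<^sup>2 <= A0\<^sup>2 * X\<^sup>2" using A0(1) self_le_power[of A0 2] by (intro mult_right_mono) auto
 then have 3: "C * (A0 * X\<^sup>2) <= C * (A0\<^sup>2 * X\<^sup>2)" using C0 by (rule mult_left_mono)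
 have "\<bar>lam j0 (ansatz \<gamma>) - lam j0 U0 - kap j0 * \<gamma> j0\<bar> <= C * (A0 * X)\<^sup>2 + C * (A0 * X\<^sup>2)" using 1 2 unfolding LD L by linarith
 then show ?thesis using 3 by (simp add: power_mult_distrib mult.assoc)
qed

text \<open>With one group present the transversal pairing gains a factor X, and the speed is
  compared with the eigenvalue along the group. The factor 5 is made up of 3 from
  \<open>transversal\<close> and 2 for moving from \<open>ansatz p\<close> to
  \<open>M\<close>.\<close>

lemma wave_error_separated:
 "wave_error j0 c um up <= (5 * nn * C\<^sup>2 * A0 ^ 3 + 4 * A0 ^ 3 * nn\<^sup>2 + 6 * C * A0 ^ 3 + A0) *
   ((X\<^sup>2 + \<bar>c - lam j0 U0 - kap j0 * p j0\<bar> + max 0 (kap j0 * (\<beta> j0 - \<alpha> j0))) * n1)"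
proof -
 have t: "tsize j0 um up <= nn * (5 * C\<^sup>2 * A0 ^ 3 * X\<^sup>2) * n1"
 proof (rule tsize_le)
  fix i j assume i: "i \<in> I" "lam i ~= lam j0" and j: "j \<in> I" "lam j = lam j0"
  have "\<bar>(l i M - l i (ansatz p)) \<bullet> tangent p j\<bar> <= (C * (2 * (A0 * X\<^sup>2))) * A0" by (rule order_trans[OF Cauchy_Schwarz_ineq2])
    (use tangent_bound'[OF j(1)] lip_l[OF i(1) mem(4) mem(3)] mult_left_mono[OF M_ansatz, of C] C0 A0(1) in \<open>auto intro!: mult_mono\<close>)
  also have "... = 2 * (C * A0\<^sup>2) * X\<^sup>2" by (simp add: power2_eq_square)
  also have "... <= 2 * (C\<^sup>2 * A0 ^ 3) * X\<^sup>2"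
   using C1 A0(1) self_le_power[of C 2] power_increasing[of 2 3 A0] by (intro mult_right_mono mult_left_mono mult_mono) auto
  finally show "\<bar>l i M \<bullet> tangent p j\<bar> <= 5 * C\<^sup>2 * A0 ^ 3 * X\<^sup>2" using transversal[OF i j] by (simp add: inner_diff_left)
 qed (use A0(1) in simp)
 define e where "e = 2 * C * A0\<^sup>2 * X\<^sup>2"
 have um: "\<bar>lam j0 um - lam j0 U0 - kap j0 * \<alpha> j0\<bar> <= e" unfolding e_def
  unfolding um_def by (rule lam_ansatz) (use \<alpha> separated near(1) in \<open>auto simp: um_def\<close>)
 have up: "\<bar>lam j0 up - lam j0 U0 - kap j0 * \<beta> j0\<bar> <= e" unfolding e_def
  unfolding up_def by (rule lam_ansatz) (use \<beta> \<beta>_sep near(2) in \<open>auto simp: up_def\<close>)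
 have kp: "kap j0 * p j0 = (kap j0 * \<alpha> j0 + kap j0 * \<beta> j0) / 2" by (simp add: p_def field_simps)
 have kd: "kap j0 * (\<beta> j0 - \<alpha> j0) = kap j0 * \<beta> j0 - kap j0 * \<alpha> j0" by (simp add: right_diff_distrib)
 have a: "\<bar>(lam j0 um + lam j0 up) / 2 - c\<bar> <= \<bar>c - lam j0 U0 - kap j0 * p j0\<bar> + e" 
 proof -
  define y z where "y = lam j0 um - lam j0 U0 - kap j0 * \<alpha> j0" and "z = lam j0 up - lam j0 U0 - kap j0 * \<beta> j0"
  have "(lam j0 um + lam j0 up) / 2 - c = (y + z) / 2 - (c - lam j0 U0 - kap j0 * p j0)" unfolding y_def z_def kp by (simp add: field_simps)
  moreover have "\<bar>(y + z) / 2\<bar> <= e" using um up unfolding y_def[symmetric] z_def[symmetric] by (simp add: abs_le_iff)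
  ultimately show ?thesis by linarith
 qed
 have b: "max 0 (lam j0 up - lam j0 um) <= max 0 (kap j0 * (\<beta> j0 - \<alpha> j0)) + 2 * e" using um up unfolding kd by linarith
 define s m where "s = \<bar>c - lam j0 U0 - kap j0 * p j0\<bar>" and "m = max 0 (kap j0 * (\<beta> j0 - \<alpha> j0))"
 have sm: "0 <= s" "0 <= m" by (auto simp: s_def m_def)
 have "wave_error j0 c um up <= (nn * (5 * C\<^sup>2 * A0 ^ 3 * X\<^sup>2) + 4 * A0 ^ 3 * nn\<^sup>2 * X\<^sup>2 + A0 * ((s + e) + (m + 2 * e))) * n1"
  unfolding s_def m_def by (rule wave_error_le[OF t a b])
 also have "nn * (5 * C\<^sup>2 * A0 ^ 3 * X\<^sup>2) + 4 * A0 ^ 3 * nn\<^sup>2 * X\<^sup>2 + A0 * ((s + e) + (m + 2 * e))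
   = (5 * nn * C\<^sup>2 * A0 ^ 3 + 4 * A0 ^ 3 * nn\<^sup>2 + 6 * C * A0 ^ 3) * X\<^sup>2 + A0 * (s + m)"
  unfolding e_def by (simp add: algebra_simps power2_eq_square power3_eq_cube)
 also have "... * n1 <= (5 * nn * C\<^sup>2 * A0 ^ 3 + 4 * A0 ^ 3 * nn\<^sup>2 + 6 * C * A0 ^ 3 + A0) * (X\<^sup>2 + s + m) * n1"
 proof (rule mult_right_mono[OF _ n1_nonneg])
  have ge: "0 <= 5 * nn * C\<^sup>2 * A0 ^ 3 + 4 * A0 ^ 3 * nn\<^sup>2 + 6 * C * A0 ^ 3" using nn1 C0 A0(1) by simp
  define k where "k = 5 * nn * C\<^sup>2 * A0 ^ 3 + 4 * A0 ^ 3 * nn\<^sup>2 + 6 * C * A0 ^ 3"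
  have "0 <= k * (s + m)" "0 <= A0 * X\<^sup>2" using ge sm A0(1) by (auto simp: k_def[symmetric])
  then show "(5 * nn * C\<^sup>2 * A0 ^ 3 + 4 * A0 ^ 3 * nn\<^sup>2 + 6 * C * A0 ^ 3) * X\<^sup>2 + A0 * (s + m)
   <= (5 * nn * C\<^sup>2 * A0 ^ 3 + 4 * A0 ^ 3 * nn\<^sup>2 + 6 * C * A0 ^ 3 + A0) * (X\<^sup>2 + s + m)" unfolding k_def[symmetric] by (simp add: algebra_simps)
 qed
 finally show ?thesis unfolding s_def m_def by (simp only: mult.assoc)
qed

end

end

section \<open>Semigroup errors\<close>

text \<open>Right-continuous, with left values \<open>ul\<close>. Points of P may carry no jump,
  since the amplitudes of coinciding fronts can cancel.\<close>

definition step_on :: "real set => (real => 'b) => (real => 'b) => bool" where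
 "step_on P ul u \<longleftrightarrow> finite P & (\<forall>y z. y <= z & P \<inter> {y<..z} = {} --> u y = u z) &
   (\<forall>p\<in>P. \<forall>y<p. P \<inter> {y<..<p} = {} --> u y = ul p)"

lemma step_onD:
 assumes "step_on P ul u"
 shows "finite P" "y <= z ==> P \<inter> {y<..z} = {} ==> u y = u z" "p \<in> P ==> y < p ==> P \<inter> {y<..<p} = {} ==> u y = ul p" using assms unfolding step_on_def by auto

lemma last_before:
 fixes y p :: real
 assumes "finite P" "y < p"
 obtains y' where "y <= y'" "y' < p" "P \<inter> {y'<..<p} = {}"
proof -
 define A where "A = insert y (P \<inter> {y<..<p})"
 have fin: "finite A" using assms by (simp add: A_def)
 define y' where "y' = Max A"
 have "A ~= {}" by (simp add: A_def)
 then have "y' \<in> A" unfolding y'_def by (rule Max_in[OF fin])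
 moreover have le: "q <= y'" if "q \<in> A" for q unfolding y'_def by (rule Max_ge[OF fin that])
 moreover have "y <= y'" by (rule le) (simp add: A_def)
 moreover have "P \<inter> {y'<..<p} = {}"
 proof (rule ccontr)
  assume "P \<inter> {y'<..<p} ~= {}"
  then obtain q where q: "q \<in> P" "y' < q" "q < p" by auto
  then have "q \<in> A" using \<open>y <= y'\<close> by (auto simp: A_def)
  then show False using le[of q] q(2) by simp
 qed
 ultimately show thesis using assms(2) by (intro that[of y']) (auto simp: A_def)
qed

text \<open>\<open>piecewise_constant\<close> asks for genuine jumps, so the other points are
  dropped. The induction removes the last point of P in the interval.\<close>

lemma step_on_jumps:
 assumes "step_on P ul u" shows "step_on {p \<in> P. ul p ~= u p} ul u" (is "step_on ?Q ul u")
proof -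
 note H = step_onD[OF assms]
 have Q1: "u y = u z" if "?Q \<inter> {y<..z} = {}" "y <= z" for y z using that
 proof (induction "card (P \<inter> {y<..z})" arbitrary: z rule: less_induct)
  case less
  show ?case
  proof (cases "P \<inter> {y<..z} = {}")
   case True then show ?thesis using H(2) less.prems by blast
  next
   case False
   have fin: "finite (P \<inter> {y<..z})" using H(1) by simp
   define p where "p = Max (P \<inter> {y<..z})"
   have p: "p \<in> P" "y < p" "p <= z" using Max_in[OF fin False] by (auto simp: p_def)
   have "q <= p" if "q \<in> P" "y < q" "q <= z" for q unfolding p_def using Max_ge[OF fin] that by simp
   then have "P \<inter> {p<..z} = {}" using p by force
   then have a: "u p = u z" using H(2) p by blast
   have b: "ul p = u p" using less.prems p by auto
   obtain y' where y': "y <= y'" "y' < p" "P \<inter> {y'<..<p} = {}" using last_before[OF H(1) p(2)] .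
   have "P \<inter> {y<..y'} \<subseteq> P \<inter> {y<..z}" "p \<in> P \<inter> {y<..z}" "p \<notin> P \<inter> {y<..y'}" using p y' by auto
   then have "P \<inter> {y<..y'} \<subset> P \<inter> {y<..z}" by blast
   then have "card (P \<inter> {y<..y'}) < card (P \<inter> {y<..z})" by (rule psubset_card_mono[OF fin])
   then have "u y = u y'" by (rule less.hyps) (use less.prems y' p in auto)
   then show ?thesis using H(3)[OF p(1) y'(2,3)] a b by simp
  qed
 qed
 have "u y = ul p" if pQ: "p \<in> ?Q" and yp: "y < p" and e: "?Q \<inter> {y<..<p} = {}" for p y
 proof -
  obtain y' where y': "y <= y'" "y' < p" "P \<inter> {y'<..<p} = {}" using last_before[OF H(1) yp] .
  have "u y = u y'" by (rule Q1) (use e y' in auto)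
  moreover have "p \<in> P" using pQ by simp
  ultimately show ?thesis using H(3)[of p y'] y'(2,3) by metis
 qed
 moreover have "finite ?Q" using H(1) by simp
 ultimately show ?thesis unfolding step_on_def using Q1 by blast
qed

lemma step_on_piecewise_constant:
 assumes st: "step_on Q ul u" and jump: "!!q. q \<in> Q ==> ul q ~= u q"
 shows "\<exists>x v. piecewise_constant (card Q) x v u & x ` {1..card Q} = Q & inj_on x {1..card Q} &
   (\<forall>k\<in>{1..card Q}. v (k - 1) = ul (x k) & v k = u (x k))"
proof -
 note H = step_onD[OF st]
 define L where "L = sorted_list_of_set Q"
 define N where "N = card Q"
 define x where "x k = L ! (k - 1)" for k
 have len: "length L = N" and set: "set L = Q" and srt: "sorted_wrt (<) L" using H(1) by (auto simp: L_def N_def)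
 have lt: "x i < x j" if "1 <= i" "i < j" "j <= N" for i j unfolding x_def using that len by (intro sorted_wrt_nth_less[OF srt]) auto
 have le: "x i <= x j" if "1 <= i" "i <= j" "j <= N" for i j using lt[of i j] that by (cases "i = j") auto
 have im: "x ` {1..N} = Q"
 proof -
  have "x ` {1..N} = (%i. L ! i) ` {..<N}"
  proof -
   have "{..<N} = (%k. k - 1) ` {1..N}" by (force simp: image_iff intro: bexI[of _ "Suc _"])
   then show ?thesis by (simp add: image_image x_def)
  qed
  then show ?thesis using len set by (force simp: in_set_conv_nth image_iff)
 qed
 have inj: "inj_on x {1..N}" by (rule linorder_inj_onI) (use lt in force)+
 \<comment> \<open>\<open>v 0\<close> is read off to the left of all jumps; if there are none, any
   point will do.\<close>
 define v where "v k = (if k = 0 then u (if Q = {} then 0 else Min Q - 1) else u (x k))" for k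
 have first: "u y = ul (x 1)" if "1 <= N" "y < x 1" for y
 proof (rule H(3))
  show "x 1 \<in> Q" using im that by auto
  show "Q \<inter> {y<..<x 1} = {}" using im le by fastforce
 qed (use that in simp)
 have between: "u y = u (x k)" if "1 <= k" "k <= N" "x k <= y" "k = N \<or> y < x (Suc k)" for y k
 proof (rule H(2)[symmetric])
  show "Q \<inter> {x k<..y} = {}"
  proof (rule ccontr)
   assume "Q \<inter> {x k<..y} ~= {}"
   then obtain i where i: "i \<in> {1..N}" "x k < x i" "x i <= y" using im by force
   then have "k < i" using le[of i k] that by (metis atLeastAtMost_iff leI not_le)
   then show False using that(4) i le[of "Suc k" i] by auto
  qed
 qed (use that in simp)
 have v0: "v 0 = ul (x 1)" if "1 <= N"
 proof -
  have "Q ~= {}" using that N_def by auto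
  moreover have "Min Q - 1 < x 1" 
  proof -
   have "x 1 \<in> Q" using im that by auto
   then show ?thesis using Min_le[OF H(1), of "x 1"] by linarith
  qed
  ultimately show ?thesis using first[OF that] by (simp add: v_def)
 qed
 have vals: "v (k - 1) = ul (x k) & v k = u (x k)" if k: "k \<in> {1..N}" for k
 proof (cases "k = 1")
  case True then show ?thesis using v0 k by (auto simp: v_def)
 next
  case False
  have "u (x (k - 1)) = ul (x k)"
  proof (rule H(3))
   show "x k \<in> Q" using im k by auto
   show "x (k - 1) < x k" using lt[of "k - 1" k] k False by auto
   show "Q \<inter> {x (k - 1)<..<x k} = {}"
   proof (rule ccontr)
    assume "Q \<inter> {x (k - 1)<..<x k} ~= {}"
    then obtain i where i: "i \<in> {1..N}" "x (k - 1) < x i" "x i < x k" using im by force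
    then have "i < k" using le[of k i] k by (metis atLeastAtMost_iff leI not_le)
    then have "i <= k - 1" by simp
    then show False using i le[of i "k - 1"] k by force
   qed
  qed
  then show ?thesis using False k by (auto simp: v_def)
 qed
 have "piecewise_constant N x v u" unfolding piecewise_constant_def
 proof (intro conjI ballI allI impI)
  fix k assume "k \<in> {1..<N}" then show "x k < x (Suc k)" using lt by simp
 next
  fix k assume k: "k \<in> {1..N}"
  then show "v (k - 1) ~= v k" using vals[OF k] jump[of "x k"] im by auto
 next
  fix k y assume k: "k <= N" and y: "(k = 0 \<or> x k < y) & (k = N \<or> y < x (Suc k))"
  show "u y = v k"
  proof (cases "k = 0")
   case False then show ?thesis using between[of k y] k y by (auto simp: v_def)
  next
   case True
   show ?thesis
   proof (cases "N = 0")
    case True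
    then have "Q = {}" using H(1) by (simp add: N_def)
    then have "u y = u 0" using H(2)[of y 0] H(2)[of 0 y] by (cases "y <= 0") auto
    then show ?thesis using \<open>k = 0\<close> \<open>Q = {}\<close> by (simp add: v_def)
   next
    case False
    then show ?thesis using first[of y] v0 True y by auto
   qed
  qed
 qed
 then show ?thesis using im inj vals unfolding N_def by blast
qed

lemma finite_separated:
 fixes P :: "real set" assumes "finite P"
 shows "\<exists>m>0. \<forall>p\<in>P. \<forall>q\<in>P. p ~= q --> m <= \<bar>p - q\<bar>"
proof -
 let ?A = "insert 1 ((%(p, q). \<bar>p - q\<bar>) ` {z \<in> P \<times> P. fst z ~= snd z})"
 have fin: "finite ?A" using assms by simp
 have "0 < Min ?A" using fin by (subst Min_gr_iff) auto
 moreover have "Min ?A <= \<bar>p - q\<bar>" if "p \<in> P" "q \<in> P" "p ~= q" for p q using that by (intro Min_le[OF fin]) force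
 ultimately show ?thesis by blast
qed

section \<open>Local and accumulated errors of an approximate trajectory\<close>

locale riemann_semigroup = hyperbolic_bounds F lam l r U0 I C
 for F :: "real ^ 'n => real ^ 'n" and lam l r U0 I C +
 fixes D :: "(real => real ^ 'n) set" and S :: "real => (real => real ^ 'n) => real => real ^ 'n"
  and R :: "real ^ 'n => real ^ 'n => real => real ^ 'n"
  and L1 L2 \<delta>0 \<rho> KR Lam :: real
 assumes D_integrable: "!!u. u \<in> D ==> integrable lborel (%x. u x - U0)"
  and \<delta>0: "0 < \<delta>0"
  and D_small: "!!u. integrable lborel (%x. u x - U0) ==> total_variation u < ennreal \<delta>0 ==> u \<in> D"
  and S_D: "!!u t. u \<in> D ==> 0 <= t ==> S t u \<in> D"
  and S_0: "!!u. u \<in> D ==> AE x in lborel. S 0 u x = u x"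
  and S_add: "!!u s t. u \<in> D ==> 0 <= s ==> 0 <= t ==> AE x in lborel. S t (S s u) x = S (t + s) u x"
  and L1: "0 <= L1" and L2: "0 <= L2"
  and S_lipschitz: "!!u v s t. u \<in> D ==> v \<in> D ==> 0 <= s ==> 0 <= t ==>
    L1_dist (S t u) (S s v) <= ennreal L1 * L1_dist u v + ennreal (L2 * \<bar>t - s\<bar>)"
  and S_local: "!!u N x v. u \<in> D ==> piecewise_constant N x v u ==>
    \<exists>\<delta>>0. \<exists>d>0. (\<forall>k\<in>{1..<N}. x k + 2 * d <= x (Suc k)) &
    (\<forall>t\<in>{0<..\<delta>}. AE y in lborel.
    (\<forall>k\<in>{1..N}. \<bar>y - x k\<bar> < d -->
    S t u y = R (v (k - 1)) (v k) ((y - x k) / t)) &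
    ((\<forall>k\<in>{1..N}. d <= \<bar>y - x k\<bar>) --> S t u y = u y))"
  and \<rho>: "0 < \<rho>" "\<rho> <= 1" and KR: "0 <= KR" and Lam: "C + 1 <= Lam"
  and R_left: "!!um up \<xi>. um \<in> ball U0 \<rho> ==> up \<in> ball U0 \<rho> ==> \<xi> < - Lam ==> R um up \<xi> = um"
  and R_right: "!!um up \<xi>. um \<in> ball U0 \<rho> ==> up \<in> ball U0 \<rho> ==> Lam < \<xi> ==> R um up \<xi> = up"
  and R_error: "!!um up j c. um \<in> ball U0 \<rho> ==> up \<in> ball U0 \<rho> ==> j \<in> I ==> \<bar>c\<bar> <= Lam ==>
    L1_dominated (R um up) (%\<xi>. if \<xi> < c then um else up) (KR * wave_error j c um up)"
begin

abbreviation "rate u w E \<equiv> (\<exists>h0>0. \<forall>h. 0 < h & h < h0 --> L1_dist (S h u) (w h) <= ennreal (E * h))"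

lemma wave_error_nonneg: "0 <= wave_error j c um up"
 unfolding wave_error_def tsize_def by (intro add_nonneg_nonneg sum_nonneg mult_nonneg_nonneg) auto

text \<open>Near a genuine jump q the semigroup is a function of (y - q) / h, so scaling turns the
  profile error of \<open>R_error\<close> into h times that error. Away from the jumps both
  functions equal u.\<close>

lemma local_error:
 assumes u: "u \<in> D" and st: "step_on P ul u"
  and vals: "!!q. q \<in> P ==> ul q \<in> ball U0 \<rho> & u q \<in> ball U0 \<rho> & jj q \<in> I & \<bar>c q\<bar> <= Lam"
  and h1: "0 < h1"
  and far: "!!h y. 0 < h ==> h < h1 ==> (!!q. q \<in> P ==> Lam * h <= \<bar>y - q\<bar>) ==> w h y = u y"
  and nearw: "!!h y q. 0 < h ==> h < h1 ==> q \<in> P ==> \<bar>y - q\<bar> < Lam * h ==> w h y = (if y < q + c q * h then ul q else u q)"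
 shows "\<exists>h0>0. \<forall>h. 0 < h & h < h0 -->
   L1_dist (S h u) (w h) <= ennreal (h * (KR * (\<Sum>q\<in>P. wave_error (jj q) (c q) (ul q) (u q))))"
proof -
 note HP = step_onD[OF st]
 define Q where "Q = {p \<in> P. ul p ~= u p}"
 have QP: "Q \<subseteq> P" by (auto simp: Q_def)
 have stQ: "step_on Q ul u" unfolding Q_def by (rule step_on_jumps[OF st])
 note HQ = step_onD[OF stQ]
 obtain x v where pc: "piecewise_constant (card Q) x v u" and im: "x ` {1..card Q} = Q" and inj: "inj_on x {1..card Q}"
  and xv: "!!k. k \<in> {1..card Q} ==> v (k - 1) = ul (x k) & v k = u (x k)" using step_on_piecewise_constant[OF stQ] Q_def by blast
 obtain \<delta> d where \<delta>: "0 < \<delta>" and d: "0 < d" and sep: "!!k. k \<in> {1..<card Q} ==> x k + 2 * d <= x (Suc k)"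
  and sol: "!!t. t \<in> {0<..\<delta>} ==> AE y in lborel. (\<forall>k\<in>{1..card Q}. \<bar>y - x k\<bar> < d --> S t u y = R (v (k - 1)) (v k) ((y - x k) / t)) &
    ((\<forall>k\<in>{1..card Q}. d <= \<bar>y - x k\<bar>) --> S t u y = u y)" using S_local[OF u pc] by blast
 have sep1: "x i + 2 * d <= x j" if "1 <= i" "i < j" "j <= card Q" for i j using that
 proof (induction j)
  case (Suc j)
  show ?case
  proof (cases "i = j")
   case False
   then have "x i + 2 * d <= x j" using Suc by simp
   then show ?thesis using sep[of j] Suc.prems d False by simp
  qed (use sep[of j] Suc.prems in simp)
 qed simp
 have sepQ: "2 * d <= \<bar>p - q\<bar>" if pq: "p \<in> Q" "q \<in> Q" "p ~= q" for p q
 proof -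
  have "p \<in> x ` {1..card Q}" "q \<in> x ` {1..card Q}" using pq(1,2) im by simp_all
  then obtain i j where "i \<in> {1..card Q}" "j \<in> {1..card Q}" "p = x i" "q = x j" by blast
  then show ?thesis using sep1[of i j] sep1[of j i] pq(3) by (cases i j rule: linorder_cases) auto
 qed
 obtain m where m: "0 < m" "!!p q. p \<in> P ==> q \<in> P ==> p ~= q ==> m <= \<bar>p - q\<bar>" using finite_separated[OF HP(1)] by blast
 have Lam0: "0 < Lam" using Lam C0 by linarith
 define good where "good q g E \<longleftrightarrow> finite E & g \<in> borel_measurable borel & (\<forall>\<xi>. 0 <= g \<xi>) &
    (\<forall>\<xi>. \<xi> \<notin> E --> norm (R (ul q) (u q) \<xi> - (if \<xi> < c q then ul q else u q)) <= g \<xi>) &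
    (\<integral>\<^sup>+ \<xi>. ennreal (g \<xi>) \<partial>lborel) <= ennreal (KR * wave_error (jj q) (c q) (ul q) (u q))" for q g E
 have "\<forall>q\<in>P. \<exists>g E. good q g E" unfolding good_def using R_error[unfolded L1_dominated_def] vals by blast
 then obtain g E where "\<forall>q\<in>P. good q (g q) (E q)" by metis
 note gE = this[unfolded good_def]
 \<comment> \<open>Up to this time the fans of different points of P stay disjoint and inside the
   radius d on which the local solution is known.\<close>
 define h0 where "h0 = Min {\<delta>, h1, d / Lam, m / (2 * Lam)}"
 have h0: "0 < h0" unfolding h0_def using \<delta> h1 d m Lam0 by simp
 have "L1_dist (S h u) (w h) <= ennreal (h * (KR * (\<Sum>q\<in>P. wave_error (jj q) (c q) (ul q) (u q))))"
  if h: "0 < h" "h < h0" for h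
 proof -
  have "h < \<delta>" "h < h1" "h < d / Lam" "h < m / (2 * Lam)" using h(2) unfolding h0_def by auto
  then have hs: "h < \<delta>" "h < h1" "Lam * h < d" "2 * (Lam * h) < m" using Lam0 by (auto simp: field_simps)
  \<comment> \<open>Points of P without a jump need care here: \<open>nearw\<close> prescribes w
    near them, but with the same value on both sides.\<close>
  have w_far: "w h y = u y" if y: "!!q. q \<in> Q ==> Lam * h <= \<bar>y - q\<bar>" for y
  proof (cases "\<exists>p\<in>P. \<bar>y - p\<bar> < Lam * h")
   case False then show ?thesis by (intro far h(1) hs(2)) force
  next
   case True
   then obtain p where p: "p \<in> P" "\<bar>y - p\<bar> < Lam * h" by blast
   then have "p \<notin> Q" using y by force
   then have "ul p = u p" using p(1) by (simp add: Q_def)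
   then have "w h y = u p" using nearw[OF h(1) hs(2) p] by simp
   moreover have alone: "q = p" if "q \<in> P" "\<bar>q - p\<bar> < m" for q using m(2)[OF that(1) p(1)] that by force
   have "u y = u p"
   proof (cases "y < p")
    case True
    have "P \<inter> {y<..<p} = {}" using alone p hs(4) by force
    then show ?thesis using HP(3)[OF p(1) True] \<open>ul p = u p\<close> by simp
   next
    case False
    have "P \<inter> {p<..y} = {}" using alone p hs(4) by force
    then show ?thesis using HP(2)[of p y] False by simp
   qed
   ultimately show ?thesis by simp
  qed
  let ?G = "%y. \<Sum>q\<in>Q. g q ((y - q) / h)"
  \<comment> \<open>Exceptional positions. Including the edges -Lam and Lam yields the strict
    inequalities required by \<open>R_left\<close> and \<open>R_right\<close>.\<close>
  define Z where "Z = (\<Union>q\<in>Q. (%\<xi>. q + h * \<xi>) ` (E q \<union> {- Lam, Lam}))"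
  have "finite Z" unfolding Z_def using HQ(1) gE QP by auto
  then have "AE y in lborel. y \<notin> Z" by (intro AE_not_in finite_imp_null_set_lborel)
  moreover have "AE y in lborel. (\<forall>k\<in>{1..card Q}. \<bar>y - x k\<bar> < d --> S h u y = R (v (k - 1)) (v k) ((y - x k) / h)) &
    ((\<forall>k\<in>{1..card Q}. d <= \<bar>y - x k\<bar>) --> S h u y = u y)" by (rule sol) (use h hs in auto)
  ultimately have "AE y in lborel. ennreal (norm (S h u y - w h y)) <= ennreal (?G y)"
  proof eventually_elim
   case (elim y)
   have G0: "0 <= ?G y" using gE QP by (intro sum_nonneg) auto
   show ?case
   proof (cases "\<exists>q\<in>Q. \<bar>y - q\<bar> < d")
    case False
    then have "\<forall>k\<in>{1..card Q}. d <= \<bar>y - x k\<bar>" using im by force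
    then have "S h u y = u y" using elim by blast
    moreover have "w h y = u y" by (rule w_far) (use False hs in force)
    ultimately show ?thesis by simp
   next
    case True
    then obtain q where q: "q \<in> Q" "\<bar>y - q\<bar> < d" by blast
    have "q \<in> x ` {1..card Q}" using q(1) im by simp
    then obtain k where k: "k \<in> {1..card Q}" "x k = q" by auto
    define \<xi> where "\<xi> = (y - q) / h"
    have y\<xi>: "y = q + h * \<xi>" using h by (simp add: \<xi>_def)
    have S: "S h u y = R (ul q) (u q) \<xi>" using elim(2) k q(2) xv[OF k(1)] unfolding \<xi>_def by auto
    have qP: "q \<in> P" using q QP by blast
    have nE: "\<xi> \<notin> E q" "\<xi> ~= - Lam" "\<xi> ~= Lam" using elim(1) q(1) y\<xi> unfolding Z_def by auto
    have alone: "p = q" if "p \<in> Q" "\<bar>p - q\<bar> < 2 * d" for p using sepQ[OF that(1) q(1)] that by force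
    show ?thesis
    proof (cases "\<bar>y - q\<bar> < Lam * h")
    case True
    have "y < q + c q * h \<longleftrightarrow> \<xi> < c q" unfolding y\<xi> using h by (simp add: mult.commute)
    then have "w h y = (if \<xi> < c q then ul q else u q)" using nearw[OF h(1) hs(2) qP True] by simp
    then have "norm (S h u y - w h y) <= g q \<xi>" unfolding S using gE qP nE(1) by auto
    also have "g q \<xi> <= ?G y" unfolding \<xi>_def using gE QP q(1) HQ(1) by (intro member_le_sum) auto
    finally show ?thesis by (rule ennreal_leI)
    next
    case False
    have "w h y = u y"
    proof (rule w_far)
    fix p assume p: "p \<in> Q"
    show "Lam * h <= \<bar>y - p\<bar>"
    proof (cases "p = q")
    case False
    then have "2 * d <= \<bar>p - q\<bar>" using sepQ p q by blast
    then show ?thesis using q(2) hs(3) by linarith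
    qed (use False \<open>\<not> \<bar>y - q\<bar> < Lam * h\<close> in simp)
    qed
    moreover have "R (ul q) (u q) \<xi> = u y"
    proof (cases "y < q")
    case True
    then have "Lam * h <= (- \<xi>) * h" using False y\<xi> h by (simp add: mult.commute)
    then have "Lam <= - \<xi>" using h(1) by (rule mult_right_le_imp_le)
    then have "\<xi> < - Lam" using nE by linarith
    then have "R (ul q) (u q) \<xi> = ul q" using R_left vals qP by blast
    moreover have "Q \<inter> {y<..<q} = {}" using alone q(2) d by force
    ultimately show ?thesis using HQ(3)[OF q(1) True] by simp
    next
    case 2: False
    then have "Lam * h <= \<xi> * h" using False y\<xi> h by (simp add: mult.commute)
    then have "Lam <= \<xi>" using h(1) by (rule mult_right_le_imp_le)
    then have "Lam < \<xi>" using nE by linarith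
    then have "R (ul q) (u q) \<xi> = u q" using R_right vals qP by blast
    moreover have "Q \<inter> {q<..y} = {}" using alone q(2) d by force
    ultimately show ?thesis using HQ(2)[of q y] 2 by simp
    qed
    ultimately show ?thesis using S G0 by simp
    qed
   qed
  qed
  then have "L1_dist (S h u) (w h) <= (\<integral>\<^sup>+ y. ennreal (?G y) \<partial>lborel)" unfolding L1_dist_def by (rule nn_integral_mono_AE)
  also have "... = (\<Sum>q\<in>Q. \<integral>\<^sup>+ y. ennreal (g q ((y - q) / h)) \<partial>lborel)"
  proof -
   have "ennreal (?G y) = (\<Sum>q\<in>Q. ennreal (g q ((y - q) / h)))" for y using gE QP by (subst sum_ennreal) auto
   moreover have "(%y. ennreal (g q ((y - q) / h))) \<in> borel_measurable lborel" if "q \<in> Q" for q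
   proof -
    have [measurable]: "g q \<in> borel_measurable borel" using gE QP that by auto
    show ?thesis by measurable
   qed
   ultimately show ?thesis by (simp add: nn_integral_sum)
  qed
  also have "... <= (\<Sum>q\<in>Q. ennreal (h * (KR * wave_error (jj q) (c q) (ul q) (u q))))"
  proof (rule sum_mono)
   fix q assume q: "q \<in> Q"
   then have qP: "q \<in> P" using QP by blast
   have [measurable]: "g q \<in> borel_measurable borel" using gE qP by auto
   have "(\<integral>\<^sup>+ y. ennreal (g q ((y - q) / h)) \<partial>lborel) = \<bar>h\<bar> * (\<integral>\<^sup>+ y. ennreal (g q ((q + h * y - q) / h)) \<partial>lborel)"
    by (rule nn_integral_real_affine) (use h in auto)
   also have "... = ennreal h * (\<integral>\<^sup>+ y. ennreal (g q y) \<partial>lborel)" using h by simp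
   also have "... <= ennreal h * ennreal (KR * wave_error (jj q) (c q) (ul q) (u q))" using gE qP by (intro mult_left_mono) auto
   also have "... = ennreal (h * (KR * wave_error (jj q) (c q) (ul q) (u q)))" using h by (subst ennreal_mult'') (use KR wave_error_nonneg in auto)
   finally show "(\<integral>\<^sup>+ y. ennreal (g q ((y - q) / h)) \<partial>lborel) <= ennreal (h * (KR * wave_error (jj q) (c q) (ul q) (u q)))" .
  qed
  also have "... = ennreal (\<Sum>q\<in>Q. h * (KR * wave_error (jj q) (c q) (ul q) (u q)))" using h KR wave_error_nonneg by (intro sum_ennreal) auto
  also have "... <= ennreal (\<Sum>q\<in>P. h * (KR * wave_error (jj q) (c q) (ul q) (u q)))"
   using h KR wave_error_nonneg QP HP(1) by (intro ennreal_leI sum_mono2) auto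
  finally show ?thesis by (simp add: sum_distrib_left mult_ac)
 qed
 then show ?thesis using h0 by blast
qed

lemma diff_measurable:
 assumes "u \<in> D" "v \<in> D" shows "(%x. u x - v x) \<in> borel_measurable lborel" "integrable lborel (%x. u x - v x)"
proof -
 have "integrable lborel (%x. (u x - U0) - (v x - U0))"  by (intro Bochner_Integration.integrable_diff D_integrable assms)
 then show "integrable lborel (%x. u x - v x)" by simp
 then show "(%x. u x - v x) \<in> borel_measurable lborel" by auto
qed

lemma D_triangle: "u \<in> D ==> v \<in> D ==> w \<in> D ==> L1_dist u w <= L1_dist u v + L1_dist v w"
 by (intro L1_dist_triangle diff_measurable)

lemma S_contract:
 assumes "u \<in> D" "v \<in> D" "0 <= t" "L1_dist u v <= ennreal e" "0 <= e" shows "L1_dist (S t u) (S t v) <= ennreal (L1 * e)"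
proof -
 have "L1_dist (S t u) (S t v) <= ennreal L1 * L1_dist u v" using S_lipschitz[OF assms(1,2,3,3)] by simp
 also have "... <= ennreal L1 * ennreal e" using assms by (intro mult_left_mono) auto
 finally show ?thesis using L1 assms by (simp add: ennreal_mult)
qed

text \<open>The curve t -> S (b - t) (w t) joins S (b - a) (w a) to w b. By the semigroup property
  and the Lipschitz bound it moves by at most L1 E h between t and t + h, and
  \<open>right_increments_le\<close> sums this up across the finite exceptional set.\<close>

lemma semigroup_error:
 assumes ab: "a <= b" and w: "!!t. t \<in> {a..b} ==> w t \<in> D"
  and M: "0 <= M" "!!s t. s \<in> {a..b} ==> t \<in> {a..b} ==> L1_dist (w s) (w t) <= ennreal (M * \<bar>s - t\<bar>)"
  and B: "finite B" and E: "0 <= E"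
  and loc: "!!t. t \<in> {a..<b} - B ==> \<exists>h0>0. \<forall>h. 0 < h & h < h0 & t + h <= b --> L1_dist (S h (w t)) (w (t + h)) <= ennreal (E * h)"
 shows "L1_dist (S (b - a) (w a)) (w b) <= ennreal (L1 * E * (b - a))"
proof -
 define z where "z t = S (b - t) (w t)" for t
 have zD: "z t \<in> D" if "t \<in> {a..b}" for t unfolding z_def using that w S_D by auto
 define d where "d s t = (ndist1 (z s) (z t))" for s t
 have d: "L1_dist (z s) (z t) = ennreal (d s t)" if "s \<in> {a..b}" "t \<in> {a..b}" for s t
  unfolding d_def by (rule L1_dist_eq) (use zD that diff_measurable in blast)
 have d0: "0 <= d s t" for s t by (simp add: d_def)
 have aI: "a \<in> {a..b}" "b \<in> {a..b}" using ab by auto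
 have tri: "d s a <= d s t + d t a" if "s \<in> {a..b}" "t \<in> {a..b}" for s t
 proof -
  have "ennreal (d s a) <= ennreal (d s t) + ennreal (d t a)" using D_triangle[OF zD[OF that(1)] zD[OF that(2)] zD[OF aI(1)]] d that aI by simp
  then show ?thesis using d0 by (simp add: ennreal_plus[symmetric] del: ennreal_plus)
 qed
 have lip: "d s t <= (L1 * M + L2) * \<bar>s - t\<bar>" if "s \<in> {a..b}" "t \<in> {a..b}" for s t
 proof -
  have "L1_dist (z s) (z t) <= ennreal L1 * L1_dist (w s) (w t) + ennreal (L2 * \<bar>(b - s) - (b - t)\<bar>)"
   unfolding z_def by (rule S_lipschitz) (use that w in auto)
  also have "... <= ennreal L1 * ennreal (M * \<bar>s - t\<bar>) + ennreal (L2 * \<bar>(b - s) - (b - t)\<bar>)" using M(2)[OF that] by (intro add_mono mult_left_mono) auto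
  also have "... = ennreal ((L1 * M + L2) * \<bar>s - t\<bar>)"
   using L1 L2 M(1) by (simp add: ennreal_mult[symmetric] ennreal_plus[symmetric] abs_minus_commute algebra_simps del: ennreal_plus)
  finally show ?thesis unfolding d[OF that] using L1 L2 M by (subst (asm) ennreal_le_iff) auto
 qed
 have dsym: "d s t = d t s" for s t by (simp add: d_def norm_minus_commute)
 have cont: "continuous_on {a..b} (%t. d t a)"
 proof (rule lipschitz_on_continuous_on)
  show "(L1 * M + L2)-lipschitz_on {a..b} (%t. d t a)"
  proof (rule lipschitz_onI)
   fix s t assume st: "s \<in> {a..b}" "t \<in> {a..b}"
   show "dist (d s a) (d t a) <= (L1 * M + L2) * dist s t" using tri[OF st] tri[OF st(2,1)] lip[OF st] dsym[of s t] unfolding dist_real_def by linarith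
  qed (use L1 L2 M in simp)
 qed
 have "d b a - d a a <= (L1 * E) * (b - a)"
 proof (rule right_increments_le[OF B ab cont])
  fix t assume t: "t \<in> {a..<b} - B"
  then obtain h0 where h0: "0 < h0" "!!h. 0 < h & h < h0 & t + h <= b ==> L1_dist (S h (w t)) (w (t + h)) <= ennreal (E * h)" using loc by meson
  show "\<exists>h>0. \<forall>s. t < s & s < t + h & s <= b --> d s a - d t a <= L1 * E * (s - t)"
  proof (intro exI conjI allI impI)
   fix s assume s: "t < s & s < t + h0 & s <= b"
   have st: "s \<in> {a..b}" "t \<in> {a..b}" using s t by auto
   have e: "L1_dist (S (s - t) (w t)) (w s) <= ennreal (E * (s - t))" using h0(2)[of "s - t"] s by simp
   have "L1_dist (z t) (z s) = L1_dist (S (b - s) (S (s - t) (w t))) (S (b - s) (w s))" unfolding z_def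
   proof (rule L1_dist_cong_AE)
    show "AE x in lborel. S (b - t) (w t) x = S (b - s) (S (s - t) (w t)) x"
    using S_add[OF w[OF st(2)], of "s - t" "b - s"] s by (auto simp: eq_commute[of "S (b - t) (w t) _"])
   qed simp
   also have "... <= ennreal (L1 * (E * (s - t)))" by (rule S_contract[OF _ _ _ e]) (use s st w S_D E in auto)
   finally have "d t s <= L1 * (E * (s - t))" unfolding d[OF st(2,1)] using L1 E s by (subst (asm) ennreal_le_iff) auto
   then show "d s a - d t a <= L1 * E * (s - t)" using tri[OF st] dsym[of s t] by (simp add: mult.assoc)
  qed (use h0 in simp)
 qed
 then have "d b a <= L1 * E * (b - a)" by (simp add: d_def)
 moreover have "L1_dist (S (b - a) (w a)) (w b) = ennreal (d a b)"
 proof -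
  have "L1_dist (z a) (z b) = L1_dist (S (b - a) (w a)) (w b)" unfolding z_def by (rule L1_dist_cong_AE) (use S_0[OF w[OF aI(2)]] in auto)
  then show ?thesis using d aI by simp
 qed
 ultimately show ?thesis using dsym[of a b] by (simp add: ennreal_leI)
qed

end

section \<open>Fields made of fronts of all families\<close>

lemma fronts_step:
 "y <= z ==> (!!k. k \<in> K ==> p k \<notin> {y<..z}) ==> fronts K p a y = fronts K p a z" unfolding fronts_def by (rule sum.cong) force+

context hyperbolic_bounds begin

definition K1 where "K1 = 2 * C * A0\<^sup>2 * nn + 4 * A0 ^ 3 * nn\<^sup>2 + A0 * ((C * A0 + 1) + 2 * C * A0)"
definition K2 where "K2 = 5 * nn * C\<^sup>2 * A0 ^ 3 + 4 * A0 ^ 3 * nn\<^sup>2 + 6 * C * A0 ^ 3 + A0"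

lemma K_nonneg: "0 <= K1" "0 <= K2" unfolding K1_def K2_def using C0 A0(1) nn1 by auto

end

text \<open>All fronts at one instant, together with their free motion for a short time. By
  \<open>same_group\<close>, fronts at one position belong to one eigenvalue and share one speed, so
  each position is a single wave. Instants violating this are finitely many and are excluded
  later.\<close>

locale front_field = riemann_semigroup F lam l r U0 I C D S R L1 L2 \<delta>0 \<rho> KR Lam
 for F :: "real ^ 'n => real ^ 'n" and lam l r U0 I C D S R L1 L2 \<delta>0 \<rho> KR Lam +
 fixes N :: "nat => nat" and p c a :: "nat => nat => real" and Y :: real
 assumes Y: "0 <= Y" "A0 * Y < \<rho>" "Y <= 1"
  and amp: "!!j. j \<in> I ==> (\<Sum>i\<in>{1..N j}. \<bar>a j i\<bar>) <= Y"
  and vel: "!!j i. j \<in> I ==> i \<in> {1..N j} ==> \<bar>c j i\<bar> < Lam"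
  and same_group: "!!j j' i i'. j \<in> I ==> j' \<in> I ==> i \<in> {1..N j} ==> i' \<in> {1..N j'} ==> p j i = p j' i' ==>
   lam j = lam j' & c j i = c j' i'"
begin

definition val where "val h y j = fronts {1..N j} (%i. p j i + c j i * h) (a j) y"
abbreviation "field h \<equiv> (%y. ansatz (val h y))"
text \<open>The strict inequality makes this the left limit of \<open>val 0\<close>.\<close>

definition lval where "lval y j = (\<Sum>i\<in>{1..N j}. if p j i < y then a j i else 0)"
definition P where "P = (\<Union>j\<in>I. p j ` {1..N j})"
definition jump where "jump q = (\<Sum>j\<in>I. \<bar>val 0 q j - lval q j\<bar>)"

lemma P_mem: "j \<in> I ==> i \<in> {1..N j} ==> p j i \<in> P" unfolding P_def by blast

lemma finite_P: "finite P" by (simp add: P_def)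

lemma val_bound: "j \<in> I ==> \<bar>val h y j\<bar> <= Y"
 using fronts_norm_le[of "{1..N j}" "%i. p j i + c j i * h" "a j" y] amp[of j] unfolding val_def by simp

lemma lval_bound: assumes "j \<in> I" shows "\<bar>lval y j\<bar> <= Y"
proof -
 have "\<bar>lval y j\<bar> <= (\<Sum>i\<in>{1..N j}. \<bar>a j i\<bar>)" unfolding lval_def by (rule order_trans[OF sum_abs]) (auto intro!: sum_mono)
 then show ?thesis using amp[OF assms] by linarith
qed

lemma small: assumes "!!j. j \<in> I ==> \<bar>\<gamma> j\<bar> <= Y" shows "ansatz \<gamma> \<in> ball U0 \<rho>"
proof -
 have "norm (ansatz \<gamma> - U0) <= A0 * Y" unfolding A0_def by (rule ansatz_near) (use assms Y in auto)
 then show ?thesis using Y(2) by (simp add: dist_norm norm_minus_commute)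
qed

text \<open>A position may belong to several families of one group; every choice leads to the same
  eigenvalue and speed.\<close>

definition fam where "fam q = (SOME j. j \<in> I & q \<in> p j ` {1..N j})"
definition vlc where "vlc q = (SOME s. \<exists>i\<in>{1..N (fam q)}. q = p (fam q) i & s = c (fam q) i)"

lemma fam: assumes "q \<in> P" shows "fam q \<in> I" "q \<in> p (fam q) ` {1..N (fam q)}"
proof -
 have "\<exists>j. j \<in> I & q \<in> p j ` {1..N j}" using assms by (auto simp: P_def)
 from someI_ex[OF this] show "fam q \<in> I" "q \<in> p (fam q) ` {1..N (fam q)}" unfolding fam_def by auto
qed

lemma vlc: assumes "q \<in> P" obtains i where "i \<in> {1..N (fam q)}" "q = p (fam q) i" "vlc q = c (fam q) i"
proof -
 have "\<exists>s. \<exists>i\<in>{1..N (fam q)}. q = p (fam q) i & s = c (fam q) i" using fam[OF assms] by auto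
 from someI_ex[OF this] show thesis using that unfolding vlc_def by blast
qed

lemma same: assumes "j \<in> I" "i \<in> {1..N j}" shows "lam (fam (p j i)) = lam j" "vlc (p j i) = c j i"
proof -
 have q: "p j i \<in> P" using P_mem[OF assms] .
 obtain i' where i': "i' \<in> {1..N (fam (p j i))}" "p j i = p (fam (p j i)) i'" "vlc (p j i) = c (fam (p j i)) i'" by (rule vlc[OF q])
 from same_group[OF assms(1) fam(1)[OF q] assms(2) i'(1,2)] i'(3) show "lam (fam (p j i)) = lam j" "vlc (p j i) = c j i" by simp_all
qed

lemma step: "step_on P (%q. ansatz (lval q)) (field 0)"
 unfolding step_on_def
proof (intro conjI allI impI ballI)
 fix y z assume yz: "y <= z & P \<inter> {y<..z} = {}"
 have "val 0 y j = val 0 z j" if "j \<in> I" for j unfolding val_def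
 proof (rule fronts_step)
  fix k assume "k \<in> {1..N j}"
  from P_mem[OF that this] yz show "p j k + c j k * 0 \<notin> {y<..z}" by auto
 qed (use yz in simp)
 then show "ansatz (val 0 y) = ansatz (val 0 z)" by (rule ansatz_cong)
next
 fix q y assume q: "q \<in> P" "y < q" "P \<inter> {y<..<q} = {}"
 have "val 0 y j = lval q j" if j: "j \<in> I" for j unfolding val_def lval_def fronts_def
 proof (rule sum.cong[OF refl])
  fix i assume "i \<in> {1..N j}"
  then have "p j i \<in> P" by (rule P_mem[OF j])
  then have "p j i <= y \<longleftrightarrow> p j i < q" using q(2,3) by force
  then show "(if p j i + c j i * 0 <= y then a j i else 0) = (if p j i < q then a j i else 0)" by simp
 qed
 then show "ansatz (val 0 y) = ansatz (lval q)" by (rule ansatz_cong)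
qed (rule finite_P)

lemma field_error:
 assumes D: "(field 0) \<in> D"
 shows "\<exists>h0>0. \<forall>h. 0 < h & h < h0 --> L1_dist (S h (field 0)) (field h)
   <= ennreal (h * (KR * (\<Sum>q\<in>P. wave_error (fam q) (vlc q) (ansatz (lval q)) (ansatz (val 0 q)))))"
proof -
 obtain m where m: "0 < m" "!!x y. x \<in> P ==> y \<in> P ==> x ~= y ==> m <= \<bar>x - y\<bar>" using finite_separated[OF finite_P] by blast
 have Lam0: "0 < Lam" using Lam C0 by linarith
 have ch: "\<bar>c j i * h\<bar> < Lam * h" if "j \<in> I" "i \<in> {1..N j}" "0 < h" for j i h
  using mult_strict_right_mono[OF vel[OF that(1,2)] that(3)] that(3) by (simp add: abs_mult)
 \<comment> \<open>Now the time bound: no front is faster than \<open>Lam\<close>, so before m / (2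
   Lam) none covers half the distance between two positions.\<close>
 show ?thesis
 proof (rule local_error[OF D step, where ?h1.0 = "m / (2 * Lam)"])
  fix q assume q: "q \<in> P"
  obtain i where "i \<in> {1..N (fam q)}" "vlc q = c (fam q) i" by (rule vlc[OF q])
  then have "\<bar>vlc q\<bar> <= Lam" using vel fam(1)[OF q] by fastforce
  then show "ansatz (lval q) \<in> ball U0 \<rho> & ansatz (val 0 q) \<in> ball U0 \<rho> & fam q \<in> I & \<bar>vlc q\<bar> <= Lam"
   using small lval_bound val_bound fam(1)[OF q] by blast
 next
  show "0 < m / (2 * Lam)" using m Lam0 by simp
 next
  fix h y assume h: "0 < h" and far: "!!q. q \<in> P ==> Lam * h <= \<bar>y - q\<bar>"
  have "val h y j = val 0 y j" if j: "j \<in> I" for j unfolding val_def fronts_def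
  proof (rule sum.cong[OF refl])
   fix i assume i: "i \<in> {1..N j}"
   then have "p j i \<in> P" by (rule P_mem[OF j])
   from far[OF this] ch[OF j i h] have "p j i + c j i * h <= y \<longleftrightarrow> p j i <= y" by linarith
   then show "(if p j i + c j i * h <= y then a j i else 0) = (if p j i + c j i * 0 <= y then a j i else 0)" by simp
  qed
  then show "ansatz (val h y) = ansatz (val 0 y)" by (rule ansatz_cong)
 next
  fix h y q assume h: "0 < h" "h < m / (2 * Lam)" and q: "q \<in> P" "\<bar>y - q\<bar> < Lam * h"
  have hm: "2 * (Lam * h) < m" using h(2) Lam0 by (simp add: field_simps)
  have "val h y j = (if y < q + vlc q * h then lval q j else val 0 q j)" if j: "j \<in> I" for j
  proof -
   have "val h y j = (\<Sum>i\<in>{1..N j}. if y < q + vlc q * h then (if p j i < q then a j i else 0) else (if p j i <= q then a j i else 0))"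
    unfolding val_def fronts_def
   proof (rule sum.cong[OF refl])
    fix i assume i: "i \<in> {1..N j}"
    then have iP: "p j i \<in> P" by (rule P_mem[OF j])
    show "(if p j i + c j i * h <= y then a j i else 0)
    = (if y < q + vlc q * h then (if p j i < q then a j i else 0) else (if p j i <= q then a j i else 0))"
    proof (cases "p j i = q")
    case True
    then show ?thesis using same(2)[OF j i] by auto
    next
    case False
    then have "m <= \<bar>p j i - q\<bar>" using m(2) iP q(1) by blast
    then have "p j i + c j i * h <= y \<longleftrightarrow> p j i < q" using ch[OF j i h(1)] q(2) hm by linarith
    then show ?thesis using False by auto
    qed
   qed
   then show ?thesis by (simp add: lval_def val_def fronts_def)
  qed
  then have "ansatz (val h y) = ansatz (%j. if y < q + vlc q * h then lval q j else val 0 q j)" by (rule ansatz_cong)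
  then show "ansatz (val h y) = (if y < q + vlc q * h then ansatz (lval q) else ansatz (val 0 q))" by simp
 qed
qed

lemma jump_single: "val 0 q j - lval q j = (\<Sum>i\<in>{1..N j}. if p j i = q then a j i else 0)"
 unfolding val_def lval_def fronts_def sum_subtractf[symmetric] by (rule sum.cong) auto

lemma jump_sum: "(\<Sum>q\<in>P. jump q) <= nn * Y"
proof -
 have "(\<Sum>q\<in>P. jump q) <= (\<Sum>q\<in>P. \<Sum>j\<in>I. \<Sum>i\<in>{1..N j}. if p j i = q then \<bar>a j i\<bar> else 0)"
  unfolding jump_def jump_single by (intro sum_mono order_trans[OF sum_abs]) (auto intro!: sum_mono)
 also have "... = (\<Sum>j\<in>I. \<Sum>i\<in>{1..N j}. \<Sum>q\<in>P. if p j i = q then \<bar>a j i\<bar> else 0)" by (subst sum.swap, rule sum.cong[OF refl], rule sum.swap)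
 also have "... = (\<Sum>j\<in>I. \<Sum>i\<in>{1..N j}. \<bar>a j i\<bar>)"
 proof (intro sum.cong refl)
  fix j i assume "j \<in> I" "i \<in> {1..N j}"
  then have "p j i \<in> P" by (rule P_mem)
  then show "(\<Sum>q\<in>P. if p j i = q then \<bar>a j i\<bar> else 0) = \<bar>a j i\<bar>" using finite_P by simp
 qed
 also have "... <= (\<Sum>j\<in>I. Y)" by (intro sum_mono amp)
 finally show ?thesis by (simp add: nn_def)
qed

lemma pair: assumes q: "q \<in> P" shows "ansatz_pair F lam l r U0 I C (lval q) (val 0 q) Y (fam q)"
proof unfold_locales
 show "A0 * Y <= 1" using Y \<rho> by linarith
 show "fam q \<in> I" by (rule fam(1)[OF q])
 fix j assume j: "j \<in> I" "lam j ~= lam (fam q)"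
 have "(\<Sum>i\<in>{1..N j}. if p j i = q then a j i else 0) = 0" by (rule sum.neutral) (use same(1)[OF j(1)] j(2) in auto)
 then show "lval q j = val 0 q j" unfolding jump_single[symmetric] by simp
qed (use Y lval_bound val_bound in auto)

lemma error_sum:
 assumes D: "(field 0) \<in> D" and K: "0 <= K"
  and e: "!!q. q \<in> P ==> wave_error (fam q) (vlc q) (ansatz (lval q)) (ansatz (val 0 q)) <= K * jump q"
 shows "rate (field 0) field (KR * (K * (nn * Y)))"
proof -
 have "(\<Sum>q\<in>P. wave_error (fam q) (vlc q) (ansatz (lval q)) (ansatz (val 0 q))) <= (\<Sum>q\<in>P. K * jump q)" by (intro sum_mono e)
 also have "... <= K * (nn * Y)" unfolding sum_distrib_left[symmetric] by (intro mult_left_mono jump_sum K)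
 finally have "h * (KR * (\<Sum>q\<in>P. wave_error (fam q) (vlc q) (ansatz (lval q)) (ansatz (val 0 q)))) <= KR * (K * (nn * Y)) * h" if "0 < h" for h
  using that KR by (simp add: mult_left_mono mult.commute)
 then show ?thesis using field_error[OF D] by (meson ennreal_leI order_trans)
qed

lemma crude_error:
 assumes D: "(field 0) \<in> D"
  and c: "!!j i. j \<in> I ==> i \<in> {1..N j} ==> \<bar>c j i - lam j U0\<bar> <= Y"
 shows "rate (field 0) field (KR * (K1 * Y * (nn * Y)))"
proof (rule error_sum[OF D])
 fix q assume q: "q \<in> P"
 interpret ap: ansatz_pair F lam l r U0 I C "lval q" "val 0 q" Y "fam q" by (rule pair[OF q])
 obtain i where "i \<in> {1..N (fam q)}" "vlc q = c (fam q) i" by (rule vlc[OF q])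
 then have "\<bar>vlc q - lam (fam q) U0\<bar> <= Y" using c fam(1)[OF q] by simp
 from ap.wave_error_crude[OF this] show "wave_error (fam q) (vlc q) (ansatz (lval q)) (ansatz (val 0 q)) <= K1 * Y * jump q"
  unfolding ap.um_def ap.up_def ap.n1_def K1_def jump_def by (simp only: mult.assoc)
qed (use K_nonneg Y in simp)

lemma separated_error:
 assumes D: "(field 0) \<in> D"
  and sep: "!!j j' i i'. j \<in> I ==> j' \<in> I ==> lam j ~= lam j' ==> i \<in> {1..N j} ==> lval (p j i) j' = 0"
  and mid: "!!j i. j \<in> I ==> i \<in> {1..N j} ==> c j i - lam j U0 = kap j * ((lval (p j i) j + val 0 (p j i) j) / 2)"
  and up: "!!j i. j \<in> I ==> i \<in> {1..N j} ==> kap j * (val 0 (p j i) j - lval (p j i) j) <= e" and e: "0 <= e"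
 shows "rate (field 0) field (KR * (K2 * (Y\<^sup>2 + e) * (nn * Y)))"
proof (rule error_sum[OF D])
 fix q assume q: "q \<in> P"
 interpret ap: ansatz_pair F lam l r U0 I C "lval q" "val 0 q" Y "fam q" by (rule pair[OF q])
 obtain i where i: "i \<in> {1..N (fam q)}" "q = p (fam q) i" "vlc q = c (fam q) i" by (rule vlc[OF q])
 have 1: "lval q j = 0" if "j \<in> I" "lam j ~= lam (fam q)" for j using sep[OF fam(1)[OF q] that(1) that(2)[symmetric] i(1)] i(2) by simp
 have 2: "vlc q - lam (fam q) U0 - kap (fam q) * ap.p (fam q) = 0" unfolding ap.p_def i(3) using mid[OF fam(1)[OF q] i(1)] i(2) by simp
 have "kap (fam q) * (val 0 q (fam q) - lval q (fam q)) <= e" using up[OF fam(1)[OF q] i(1)] i(2) by simp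
 then have 3: "max 0 (kap (fam q) * (val 0 q (fam q) - lval q (fam q))) <= e" using e by simp
 have "wave_error (fam q) (vlc q) ap.um ap.up <= K2 * ((Y\<^sup>2 + \<bar>vlc q - lam (fam q) U0 - kap (fam q) * ap.p (fam q)\<bar>
   + max 0 (kap (fam q) * (val 0 q (fam q) - lval q (fam q)))) * ap.n1)" unfolding K2_def by (rule ap.wave_error_separated[OF 1])
 also have "... <= K2 * ((Y\<^sup>2 + e) * ap.n1)" unfolding 2 using 3 K_nonneg ap.n1_nonneg by (intro mult_left_mono mult_right_mono) auto
 finally show "wave_error (fam q) (vlc q) (ansatz (lval q)) (ansatz (val 0 q)) <= K2 * (Y\<^sup>2 + e) * jump q"
  unfolding ap.um_def ap.up_def ap.n1_def jump_def by (simp only: mult.assoc)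
qed (use K_nonneg Y e in simp)

end

text \<open>The bound \<eta> on upward jumps is not part of a profile. It belongs to
  \<open>moving\<close>, weighted with \<kappa>, and so concerns genuinely nonlinear families
  only.\<close>

definition profile where "profile V A N x v \<longleftrightarrow> admissible V V N v & (\<forall>k\<in>{1..N}. \<bar>x k\<bar> <= A)"

text \<open>Both kinds of fields in one notion: \<kappa> = 1 is front tracking for Burgers'
  equation, \<kappa> = 0 a profile at rest, whose fronts may share positions. \<open>LS\<close>
  again lists the lines of the fronts.\<close>

definition moving ::
 "real => real => real => real => (real \<times> real) set => (real => real => real) => real => bool" where
 "moving \<kappa> \<eta> V A LS w \<tau> \<longleftrightarrow> (\<exists>h N x v. 0 < h & profile V A N x v &
   (\<forall>k\<in>{1..N}. \<kappa> * (v k - v (k - 1)) <= \<eta> & (x k - \<kappa> * speed v k * \<tau>, \<kappa> * speed v k) \<in> LS) &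
   (\<kappa> ~= 0 --> (\<forall>k\<in>{1..<N}. x k < x (Suc k))) &
   (\<forall>\<tau>'\<in>{\<tau>..<\<tau>+h}. w \<tau>' = steps N (%k. x k + \<kappa> * speed v k * (\<tau>' - \<tau>)) v))"

definition family :: "real => real => real => real => real => (real => real => real) => bool" where
 "family \<kappa> \<eta> V A T w \<longleftrightarrow>
   (\<forall>\<tau>\<in>{0..T}. \<exists>N x v. profile V A N x v & w \<tau> = steps N x v) &
   (\<forall>\<tau>\<in>{0..T}. \<forall>\<tau>'\<in>{0..T}. (dist1 (w \<tau>) (w \<tau>')) <= V * V * \<bar>\<tau> - \<tau>'\<bar>) &
   (\<exists>B LS. finite B & finite LS & (\<forall>\<tau>\<in>{0..<T} - B. moving \<kappa> \<eta> V A LS w \<tau>))"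

lemma admissible_weaken: assumes "admissible \<eta> V N v" shows "admissible V V N v"
proof -
 have "v k - v (k - 1) <= V" if "k \<in> {1..N}" for k
 proof -
  have "v k - v (k - 1) <= \<bar>v k - v (k - 1)\<bar>" by simp
  also have "... <= (\<Sum>k\<in>{1..N}. \<bar>v k - v (k - 1)\<bar>)" using that by (intro member_le_sum) auto
  also have "... <= V" using assms by (simp add: admissible_def)
  finally show ?thesis .
 qed
 then show ?thesis using assms by (simp add: admissible_def)
qed

lemma tracking_family:
 assumes tr: "tracking \<eta> V A 0 T w" and V: "0 <= V" shows "family 1 \<eta> V (A + V * T) T w"
proof -
 have VA: "A + V * (\<tau> - 0) <= A + V * T" if "\<tau> <= T" for \<tau> using mult_left_mono[OF that V] by simp
 obtain B LS where B: "finite B" "finite LS" and loc: "!!\<tau>. \<tau> \<in> {0..<T} - B ==> local_tracking \<eta> V (A + V * (\<tau> - 0)) LS w \<tau>"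
  using tr unfolding tracking_def by blast
 have "moving 1 \<eta> V (A + V * T) LS w \<tau>" if \<tau>: "\<tau> \<in> {0..<T} - B" for \<tau>
 proof -
  obtain h N x v where h: "0 < h" and ad: "admissible \<eta> V N v" and srt: "\<forall>k\<in>{1..<N}. x k < x (Suc k)"
   and xs: "\<forall>k\<in>{1..N}. \<bar>x k\<bar> <= A + V * (\<tau> - 0) & (x k - speed v k * \<tau>, speed v k) \<in> LS"
   and mv: "\<forall>\<tau>'\<in>{\<tau>..<\<tau>+h}. w \<tau>' = steps N (%k. x k + speed v k * (\<tau>' - \<tau>)) v" using loc[OF \<tau>] unfolding local_tracking_def by blast
  have "profile V (A + V * T) N x v" using admissible_weaken[OF ad] xs VA[of \<tau>] \<tau> by (force simp: profile_def)
  moreover have "\<forall>k\<in>{1..N}. 1 * (v k - v (k - 1)) <= \<eta>" using ad by (simp add: admissible_def)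
  ultimately show ?thesis unfolding moving_def using h srt xs mv by (intro exI[of _ h] exI[of _ N] exI[of _ x] exI[of _ v]) auto
 qed
 moreover have "\<exists>N x v. profile V (A + V * T) N x v & w \<tau> = steps N x v" if \<tau>: "\<tau> \<in> {0..T}" for \<tau>
 proof -
  obtain N x v where *: "admissible \<eta> V N v" "\<forall>k\<in>{1..N}. \<bar>x k\<bar> <= A + V * (\<tau> - 0)" "w \<tau> = steps N x v" using tr \<tau> unfolding tracking_def by blast
  have "\<bar>x k\<bar> <= A + V * T" if "k \<in> {1..N}" for k using *(2) that VA[of \<tau>] \<tau> by (meson atLeastAtMost_iff order_trans)
  then have "profile V (A + V * T) N x v" using admissible_weaken[OF *(1)] by (simp add: profile_def)
  then show ?thesis using *(3) by blast
 qed
 ultimately show ?thesis unfolding family_def using B tr unfolding tracking_def by blast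
qed

lemma stationary_family:
 assumes "profile V A N x v" "0 <= \<eta>" "0 <= V" shows "family 0 \<eta> V A T (%_. steps N x v)"
proof -
 have "moving 0 \<eta> V A ((%k. (x k, 0)) ` {1..N}) (%_. steps N x v) \<tau>" for \<tau>
  unfolding moving_def using assms by (intro exI[of _ 1] exI[of _ N] exI[of _ x] exI[of _ v]) auto
 moreover have "finite ((%k. (x k, 0::real)) ` {1..N})" by simp
 ultimately have "\<exists>B LS. finite B & finite LS & (\<forall>\<tau>\<in>{0..<T} - B. moving 0 \<eta> V A LS (%_. steps N x v) \<tau>)" using finite.emptyI by blast
 then show ?thesis unfolding family_def using assms by auto
qed

lemma fronts_shift: "fronts K p a (y - s) = fronts K (%k. p k + s) a y"
 unfolding fronts_def by (intro sum.cong) (auto simp: algebra_simps)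

lemma fronts_scale: "\<epsilon> * fronts K p a y = fronts K p (%k. \<epsilon> * a k) y" for a :: "_ => real"
 unfolding fronts_def sum_distrib_left by (intro sum.cong) auto

lemma fronts_variation:
 fixes a :: "'i => real"
 assumes "sorted xs"
 shows "(\<Sum>i<length xs - 1. \<bar>fronts K p a (xs ! Suc i) - fronts K p a (xs ! i)\<bar>) <= (\<Sum>k\<in>K. \<bar>a k\<bar>)"
proof -
 let ?H = "%k i. if p k <= xs ! i then 1 else 0 :: real"
 have mono: "xs ! i <= xs ! Suc i" if "i < length xs - 1" for i using assms that by (intro sorted_nth_mono) auto
 have "(\<Sum>i<length xs - 1. \<bar>fronts K p a (xs ! Suc i) - fronts K p a (xs ! i)\<bar>)
  <= (\<Sum>i<length xs - 1. \<Sum>k\<in>K. \<bar>a k\<bar> * (?H k (Suc i) - ?H k i))"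
 proof (intro sum_mono)
  fix i assume i: "i \<in> {..<length xs - 1}"
  show "\<bar>fronts K p a (xs ! Suc i) - fronts K p a (xs ! i)\<bar> <= (\<Sum>k\<in>K. \<bar>a k\<bar> * (?H k (Suc i) - ?H k i))"
   unfolding fronts_def sum_subtractf[symmetric] using mono[of i] i by (intro order_trans[OF sum_abs] sum_mono) auto
 qed
 also have "... = (\<Sum>k\<in>K. \<bar>a k\<bar> * (?H k (length xs - 1) - ?H k 0))"
 proof -
  have "(\<Sum>i<n. ?H k (Suc i) - ?H k i) = ?H k n - ?H k 0" for k n by (rule sum_lessThan_telescope)
  then show ?thesis by (subst sum.swap) (simp only: sum_distrib_left[symmetric])
 qed
 also have "... <= (\<Sum>k\<in>K. \<bar>a k\<bar> * 1)" by (intro sum_mono mult_left_mono) auto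
 finally show ?thesis by simp
qed

context hyperbolic_bounds begin

lemma L1_dist_le_sum:
 assumes uv: "integrable lborel (%y. u y - v y :: real ^ 'n)" and g: "!!j. j \<in> I ==> integrable lborel (g j)"
  and b: "!!j. j \<in> I ==> (LBINT y. \<bar>g j y\<bar>) <= b" and c: "0 <= c"
  and le: "!!y. norm (u y - v y) <= c * (\<Sum>j\<in>I. \<bar>g j y\<bar>)"
 shows "L1_dist u v <= ennreal (c * (nn * b))"
proof -
 have "(ndist1 u v) <= (LBINT y. c * (\<Sum>j\<in>I. \<bar>g j y\<bar>))"
  by (rule integral_mono[OF integrable_norm[OF uv] _ le]) (use g in \<open>auto intro!: integrable_mult_right\<close>)
 also have "... = c * (\<Sum>j\<in>I. \<integral>y. \<bar>g j y\<bar> \<partial>lborel)" using g by (simp add: Bochner_Integration.integral_sum)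
 also have "... <= c * (\<Sum>j\<in>I. b)" by (intro mult_left_mono sum_mono b c)
 finally show ?thesis unfolding L1_dist_eq[OF uv] by (simp add: nn_def ennreal_leI)
qed

lemma ansatz_measurable:
 assumes "!!j. j \<in> I ==> (%y. f y j) \<in> borel_measurable M" shows "(%y. ansatz (f y)) \<in> borel_measurable M" unfolding ansatz_def
proof (intro borel_measurable_add borel_measurable_scaleR borel_measurable_sum borel_measurable_const)
 fix j k assume jk: "j \<in> I" "k \<in> I"
 show "(%y. if lam j = lam k then f y j * f y k else 0) \<in> borel_measurable M" using assms[OF jk(1)] assms[OF jk(2)] by (cases "lam j = lam k") auto
qed (use assms in auto)

lemma ansatz_0: "ansatz (%_. 0) = U0" by (simp add: ansatz_def cong: if_cong)

lemma ansatz_integrable: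
 assumes f: "!!j. j \<in> I ==> integrable lborel (%y. f y j)" and b: "!!y j. j \<in> I ==> \<bar>f y j\<bar> <= 1"
 shows "integrable lborel (%y. ansatz (f y) - U0)"
proof (rule Bochner_Integration.integrable_bound)
 show "integrable lborel (%y. A0 * (\<Sum>j\<in>I. \<bar>f y j\<bar>))" using f by (intro integrable_mult_right Bochner_Integration.integrable_sum integrable_abs)
 show "(%y. ansatz (f y) - U0) \<in> borel_measurable lborel" by (intro borel_measurable_diff ansatz_measurable borel_measurable_const) (use f in auto)
 have "norm (ansatz (f y) - ansatz (%_. 0)) <= A0 * (\<Sum>j\<in>I. \<bar>f y j - 0\<bar>)" for y by (rule ansatz_lipschitz) (use b in auto)
 then have "norm (ansatz (f y) - U0) <= norm (A0 * (\<Sum>j\<in>I. \<bar>f y j\<bar>))" for y unfolding ansatz_0 using A0(1) by (simp add: abs_mult sum_nonneg)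
 then show "AE y in lborel. norm (ansatz (f y) - U0) <= norm (A0 * (\<Sum>j\<in>I. \<bar>f y j\<bar>))" by simp
qed

lemma ansatz_variation:
 fixes N :: "nat => nat"
 assumes amp: "!!j. j \<in> I ==> (\<Sum>i\<in>{1..N j}. \<bar>a j i\<bar>) <= Y" and Y: "0 <= Y" "Y <= 1"
 shows "pointwise_variation (%y. ansatz (%j. fronts {1..N j} (p j) (a j) y)) <= ennreal (A0 * (nn * Y))" unfolding pointwise_variation_def
proof (rule SUP_least)
 fix xs :: "real list" assume "xs \<in> {xs. sorted xs}"
 then have xs: "sorted xs" by simp
 let ?f = "%y j. fronts {1..N j} (p j) (a j) y"
 have b: "\<bar>?f y j\<bar> <= 1" if "j \<in> I" for y j using fronts_norm_le[of "{1..N j}" "p j" "a j" y] amp[OF that] Y by simp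
 have "(\<Sum>i<length xs - 1. ennreal (norm (ansatz (?f (xs ! Suc i)) - ansatz (?f (xs ! i)))))
   = ennreal (\<Sum>i<length xs - 1. norm (ansatz (?f (xs ! Suc i)) - ansatz (?f (xs ! i))))" by simp
 also have "... <= ennreal (\<Sum>i<length xs - 1. A0 * (\<Sum>j\<in>I. \<bar>?f (xs ! Suc i) j - ?f (xs ! i) j\<bar>))" by (intro ennreal_leI sum_mono ansatz_lipschitz b)
 also have "(\<Sum>i<length xs - 1. A0 * (\<Sum>j\<in>I. \<bar>?f (xs ! Suc i) j - ?f (xs ! i) j\<bar>))
   = A0 * (\<Sum>j\<in>I. \<Sum>i<length xs - 1. \<bar>?f (xs ! Suc i) j - ?f (xs ! i) j\<bar>)" unfolding sum_distrib_left[symmetric] by (subst sum.swap) simp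
 also have "ennreal (A0 * (\<Sum>j\<in>I. \<Sum>i<length xs - 1. \<bar>?f (xs ! Suc i) j - ?f (xs ! i) j\<bar>)) <= ennreal (A0 * (\<Sum>j\<in>I. Y))"
  using A0(1) by (intro ennreal_leI mult_left_mono sum_mono order_trans[OF fronts_variation[OF xs] amp]) auto
 finally show "(\<Sum>i<length xs - 1. ennreal (norm (ansatz (?f (xs ! Suc i)) - ansatz (?f (xs ! i))))) <= ennreal (A0 * (nn * Y))" by (simp add: nn_def)
qed

end

section \<open>The approximate solution in physical time\<close>

lemma total_variation_le: "total_variation u <= pointwise_variation u"
 unfolding total_variation_def by (rule INF_lower) simp

lemma integral_shift: "(LBINT y. f (y - s)) = (LBINT y. f y)" for f :: "real => real"
 using lborel_integral_real_affine[of 1 f "- s"] by simp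

lemma integrable_shift: "integrable lborel f ==> integrable lborel (%y. f (y - s))" for f :: "real => real"
 using lborel_integrable_real_affine[of f 1 "- s"] by simp

text \<open>The amplitudes live in the slow time \<epsilon> t. The smallness conditions keep all
  states where the Riemann solver is controlled, the perturbed speeds of distinct eigenvalues apart
  (\<open>small_gap\<close>), and the variation below the threshold of the domain
  \<open>D\<close>.\<close>

locale wave = riemann_semigroup F lam l r U0 I C D S R L1 L2 \<delta>0 \<rho> KR Lam
 for F :: "real ^ 'n => real ^ 'n" and lam l r U0 I C D S R L1 L2 \<delta>0 \<rho> KR Lam +
 fixes w :: "nat => real => real => real" and \<eta> V A T \<epsilon> :: real
 assumes fam_w: "!!j. j \<in> I ==> family (kap j) \<eta> V A T (w j)"
  and \<eta>: "0 <= \<eta>" and V: "0 <= V" and A: "0 <= A" and T: "0 < T" and \<epsilon>: "0 < \<epsilon>"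
  and small_\<rho>: "A0 * (\<epsilon> * V) < \<rho>" and small_1: "\<epsilon> * V < 1" and small_gap: "2 * (\<epsilon> * V) < 1 / C"
  and small_\<delta>: "A0 * (nn * (\<epsilon> * V)) < \<delta>0"
begin

abbreviation "Y \<equiv> \<epsilon> * V"
definition amp where "amp t y j = \<epsilon> * w j (\<epsilon> * t) (y - lam j U0 * t)"
definition W where "W t y = ansatz (amp t y)"

lemma Y0: "0 <= Y" using \<epsilon> V by simp

lemma snapshot:
 assumes t: "t \<in> {0..T / \<epsilon>}"
 shows "\<exists>N x v. \<forall>j\<in>I. profile V A (N j) (x j) (v j) & w j (\<epsilon> * t) = steps (N j) (x j) (v j)"
proof -
 have \<tau>: "\<epsilon> * t \<in> {0..T}" using t \<epsilon> by (auto simp: field_simps)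
 have "\<forall>j\<in>I. \<exists>N x v. profile V A N x v & w j (\<epsilon> * t) = steps N x v" using fam_w \<tau> unfolding family_def by blast
 then show ?thesis by metis
qed

lemma amp_fronts:
 "w j (\<epsilon> * t) = steps N x v ==> amp t y j = fronts {1..N} (%i. x i + lam j U0 * t) (%i. \<epsilon> * (v i - v (i - 1))) y"
 unfolding amp_def steps_def by (simp only: fronts_shift fronts_scale)

lemma profile_amp: "profile V A N x v ==> (\<Sum>i\<in>{1..N}. \<bar>\<epsilon> * (v i - v (i - 1))\<bar>) <= Y"
 unfolding profile_def admissible_def abs_mult sum_distrib_left[symmetric] using \<epsilon> by simp

lemma W_fronts:
 assumes "!!j. j \<in> I ==> w j (\<epsilon> * t) = steps (N j) (x j) (v j)"
 shows "W t = (%y. ansatz (%j. fronts {1..N j} (%i. x j i + lam j U0 * t) (%i. \<epsilon> * (v j i - v j (i - 1))) y))"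
 unfolding W_def fun_eq_iff by (intro allI ansatz_cong amp_fronts assms)

lemma amp_integrable: assumes t: "t \<in> {0..T / \<epsilon>}" and j: "j \<in> I" shows "integrable lborel (%y. amp t y j)"
proof -
 obtain N x v where N: "!!j. j \<in> I ==> profile V A (N j) (x j) (v j)" "!!j. j \<in> I ==> w j (\<epsilon> * t) = steps (N j) (x j) (v j)" using snapshot[OF t] by blast
 have "integrable lborel (w j (\<epsilon> * t))" unfolding N(2)[OF j] by (rule steps_integrable) (use N(1)[OF j] in \<open>auto simp: profile_def\<close>)
 then show ?thesis unfolding amp_def by (intro integrable_mult_right integrable_shift)
qed

lemma amp_bound: assumes t: "t \<in> {0..T / \<epsilon>}" and j: "j \<in> I" shows "\<bar>amp t y j\<bar> <= Y"
proof -
 obtain N x v where N: "!!j. j \<in> I ==> profile V A (N j) (x j) (v j)" "!!j. j \<in> I ==> w j (\<epsilon> * t) = steps (N j) (x j) (v j)" using snapshot[OF t] by blast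
 show ?thesis unfolding amp_fronts[OF N(2)[OF j]]
  using fronts_norm_le[of "{1..N j}" _ "%i. \<epsilon> * (v j i - v j (i - 1))"] profile_amp[OF N(1)[OF j]] by (fastforce intro: order_trans)
qed

lemma amp_bound_1: "t \<in> {0..T / \<epsilon>} ==> j \<in> I ==> \<bar>amp t y j\<bar> <= 1"
 using amp_bound small_1 by (meson less_imp_le order_trans)

lemma W_D: assumes t: "t \<in> {0..T / \<epsilon>}" shows "W t \<in> D"
proof (rule D_small)
 show "integrable lborel (%x. W t x - U0)" unfolding W_def by (rule ansatz_integrable) (use amp_integrable[OF t] amp_bound_1[OF t] in auto)
 obtain N x v where N: "!!j. j \<in> I ==> profile V A (N j) (x j) (v j)" "!!j. j \<in> I ==> w j (\<epsilon> * t) = steps (N j) (x j) (v j)" using snapshot[OF t] by blast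
 have eq: "W t = (%y. ansatz (%j. fronts {1..N j} (%i. x j i + lam j U0 * t) (%i. \<epsilon> * (v j i - v j (i - 1))) y))" by (rule W_fronts) (rule N(2))
 have "total_variation (W t) <= ennreal (A0 * (nn * Y))" unfolding eq
  by (rule order_trans[OF total_variation_le ansatz_variation]) (use profile_amp N(1) Y0 small_1 in auto)
 also have "... < ennreal \<delta>0" using small_\<delta> \<delta>0 by (simp add: ennreal_less_iff A0(1) order_trans[OF zero_le_one] nn1 Y0)
 finally show "total_variation (W t) < ennreal \<delta>0" .
qed

lemma W_lipschitz:
 assumes s: "s \<in> {0..T / \<epsilon>}" and t: "t \<in> {0..T / \<epsilon>}"
 shows "L1_dist (W s) (W t) <= ennreal (A0 * (nn * (\<epsilon> * (V * V * \<epsilon> + V * C))) * \<bar>s - t\<bar>)"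
proof -
 have \<tau>: "\<epsilon> * s \<in> {0..T}" "\<epsilon> * t \<in> {0..T}" using s t \<epsilon> by (auto simp: field_simps)
 have one: "(LBINT y. \<bar>amp s y j - amp t y j\<bar>) <= \<epsilon> * (V * V * \<epsilon> + V * C) * \<bar>s - t\<bar>" if j: "j \<in> I" for j
 proof -
  let ?a = "w j (\<epsilon> * s)" and ?b = "w j (\<epsilon> * t)" and ?c = "lam j U0"
  obtain N x v where pr: "profile V A N x v" and b: "?b = steps N x v" using fam_w[OF j] \<tau>(2) unfolding family_def by blast
  obtain N' x' v' where pr': "profile V A N' x' v'" and a: "?a = steps N' x' v'" using fam_w[OF j] \<tau>(1) unfolding family_def by blast
  have ia: "integrable lborel ?a" and ib: "integrable lborel ?b" unfolding a b by (rule steps_integrable; use pr pr' in \<open>auto simp: profile_def\<close>)+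
  note ints = integrable_shift[OF ia] integrable_shift[OF ib]
  have "(LBINT y. \<bar>amp s y j - amp t y j\<bar>) <= (LBINT y. \<epsilon> * (\<bar>?a (y - ?c * s) - ?b (y - ?c * s)\<bar> + \<bar>?b (y - ?c * s) - ?b (y - ?c * t)\<bar>))"
  proof (rule integral_mono)
   fix y
   have "\<bar>amp s y j - amp t y j\<bar> = \<epsilon> * \<bar>?a (y - ?c * s) - ?b (y - ?c * t)\<bar>" unfolding amp_def right_diff_distrib[symmetric] abs_mult using \<epsilon> by simp
   then show "\<bar>amp s y j - amp t y j\<bar> <= \<epsilon> * (\<bar>?a (y - ?c * s) - ?b (y - ?c * s)\<bar> + \<bar>?b (y - ?c * s) - ?b (y - ?c * t)\<bar>)" using \<epsilon> by simp
  qed (use amp_integrable s t j ints in \<open>auto intro!: integrable_mult_right Bochner_Integration.integrable_add integrable_abs\<close>)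
  also have "... = \<epsilon> * ((LBINT y. \<bar>?a (y - ?c * s) - ?b (y - ?c * s)\<bar>) + (LBINT y. \<bar>?b (y - ?c * s) - ?b (y - ?c * t)\<bar>))"
   using ints by (simp add: Bochner_Integration.integral_add)
  also have "... <= \<epsilon> * (V * V * \<bar>\<epsilon> * s - \<epsilon> * t\<bar> + V * (C * \<bar>s - t\<bar>))"
  proof (intro mult_left_mono add_mono)
   show "(LBINT y. \<bar>?a (y - ?c * s) - ?b (y - ?c * s)\<bar>) <= V * V * \<bar>\<epsilon> * s - \<epsilon> * t\<bar>"
    unfolding integral_shift[of "%y. \<bar>?a y - ?b y\<bar>"] using fam_w[OF j] \<tau> unfolding family_def by blast
   have "(LBINT y. \<bar>?b (y - ?c * s) - ?b (y - ?c * t)\<bar>) <= (\<Sum>k\<in>{1..N}. norm (v k - v (k - 1)) * \<bar>(x k + ?c * s) - (x k + ?c * t)\<bar>)"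
    unfolding b steps_def fronts_shift
    using fronts_move[of "{1..N}" "%k. v k - v (k - 1)" "%k. x k + ?c * s" "%k. x k + ?c * t"] pr admissible_sum[of V V N v]
    by (simp add: profile_def)
   also have "... <= (\<Sum>k\<in>{1..N}. \<bar>v k - v (k - 1)\<bar> * (C * \<bar>s - t\<bar>))"
   proof (intro sum_mono mult_mono)
    have "\<bar>(x k + ?c * s) - (x k + ?c * t)\<bar> = \<bar>?c\<bar> * \<bar>s - t\<bar>" for k by (simp add: right_diff_distrib[symmetric] abs_mult[symmetric])
    then show "\<bar>(x k + ?c * s) - (x k + ?c * t)\<bar> <= C * \<bar>s - t\<bar>" for k using bound_lam[OF j, of U0] by (simp add: mult_right_mono)
   qed auto
   also have "... = (\<Sum>k\<in>{1..N}. \<bar>v k - v (k - 1)\<bar>) * (C * \<bar>s - t\<bar>)" by (simp only: sum_distrib_right)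
   also have "... <= V * (C * \<bar>s - t\<bar>)" using pr C0 by (intro mult_right_mono) (auto simp: profile_def admissible_def)
   finally show "(LBINT y. \<bar>?b (y - ?c * s) - ?b (y - ?c * t)\<bar>) <= V * (C * \<bar>s - t\<bar>)" .
  qed (use \<epsilon> in simp)
  also have "\<bar>\<epsilon> * s - \<epsilon> * t\<bar> = \<epsilon> * \<bar>s - t\<bar>" unfolding right_diff_distrib[symmetric] abs_mult using \<epsilon> by simp
  finally show ?thesis by (simp add: algebra_simps)
 qed
 have "L1_dist (W s) (W t) <= ennreal (A0 * (nn * (\<epsilon> * (V * V * \<epsilon> + V * C) * \<bar>s - t\<bar>)))"
 proof (rule L1_dist_le_sum[OF diff_measurable(2)[OF W_D[OF s] W_D[OF t]], where g = "%j y. amp s y j - amp t y j"])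
  show "norm (W s y - W t y) <= A0 * (\<Sum>j\<in>I. \<bar>amp s y j - amp t y j\<bar>)" for y
   unfolding W_def by (rule ansatz_lipschitz) (use amp_bound_1[OF s] amp_bound_1[OF t] in auto)
 qed (use A0(1) one amp_integrable s t in auto)
 then show ?thesis by (simp only: mult.assoc)
qed

end

lemma moving_mono: "moving \<kappa> \<eta> V A LS w \<tau> ==> LS \<subseteq> LS' ==> moving \<kappa> \<eta> V A LS' w \<tau>"
 unfolding moving_def by (meson subsetD)

lemma increasing_chain:
 fixes x :: "nat => real"
 assumes "\<forall>k\<in>{1..<N}. x k < x (Suc k)" "1 <= i" "i < j" "j <= N" shows "x i < x j" using assms(3,4)
proof (induction j)
 case (Suc j)
 have "x j < x (Suc j)" using assms(1,2) Suc.prems by simp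
 moreover have "x i < x j" if "i ~= j" using Suc that by simp
 ultimately show ?case by (cases "i = j") auto
qed simp

lemma steps_at_front:
 fixes x v :: "nat => real"
 assumes inc: "\<forall>k\<in>{1..<N}. x k < x (Suc k)" and i: "i \<in> {1..N}" and v0: "v 0 = 0"
 shows "(\<Sum>k\<in>{1..N}. if x k + s < x i + s then \<epsilon> * (v k - v (k - 1)) else 0) = \<epsilon> * v (i - 1)"
  "(\<Sum>k\<in>{1..N}. if x k + s <= x i + s then \<epsilon> * (v k - v (k - 1)) else 0) = \<epsilon> * v i"
proof -
 have *: "x k < x i \<longleftrightarrow> k < i" "x k <= x i \<longleftrightarrow> k <= i" if "k \<in> {1..N}" for k
  using increasing_chain[OF inc, of k i] increasing_chain[OF inc, of i k] that i by (cases k i rule: linorder_cases; force)+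
 have "(\<Sum>k\<in>{1..N}. if x k + s < x i + s then \<epsilon> * (v k - v (k - 1)) else 0) = (\<Sum>k\<in>{1..N}. if k < i then \<epsilon> * (v k - v (k - 1)) else 0)"
  by (rule sum.cong) (use * in auto)
 also have "... = (\<Sum>k\<in>{1..i - 1}. \<epsilon> * (v k - v (k - 1)))" by (subst sum.inter_filter[symmetric]) (use i in \<open>auto intro!: sum.cong\<close>)
 also have "... = \<epsilon> * v (i - 1)" unfolding sum_distrib_left[symmetric] sum_telescope_1 v0 by simp
 finally show "(\<Sum>k\<in>{1..N}. if x k + s < x i + s then \<epsilon> * (v k - v (k - 1)) else 0) = \<epsilon> * v (i - 1)" .
 have "(\<Sum>k\<in>{1..N}. if x k + s <= x i + s then \<epsilon> * (v k - v (k - 1)) else 0) = (\<Sum>k\<in>{1..N}. if k <= i then \<epsilon> * (v k - v (k - 1)) else 0)"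
  by (rule sum.cong) (use * in auto)
 also have "... = (\<Sum>k\<in>{1..i}. \<epsilon> * (v k - v (k - 1)))" by (subst sum.inter_filter[symmetric]) (use i in \<open>auto intro!: sum.cong\<close>)
 also have "... = \<epsilon> * v i" unfolding sum_distrib_left[symmetric] sum_telescope_1 v0 by simp
 finally show "(\<Sum>k\<in>{1..N}. if x k + s <= x i + s then \<epsilon> * (v k - v (k - 1)) else 0) = \<epsilon> * v i" .
qed

context wave begin

text \<open>A line (p, s) in slow time becomes p + (lam i U0 + \<epsilon> s) t in physical time. Two
  lines of different slope meet once, so finitely many lines leave finitely many exceptional
  times.\<close>

definition crossings :: "(real \<times> real) set => real set" where
 "crossings LS = (\<Union>i\<in>I. \<Union>j\<in>I. \<Union>(p, s)\<in>LS. \<Union>(p', s')\<in>LS.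
   {t. lam i U0 + \<epsilon> * s ~= lam j U0 + \<epsilon> * s' & p + (lam i U0 + \<epsilon> * s) * t = p' + (lam j U0 + \<epsilon> * s') * t})"

lemma finite_crossings: assumes "finite LS" shows "finite (crossings LS)"
proof -
 have "finite {t::real. a ~= b & p + a * t = p' + b * t}" for a b p p' :: real
 proof (rule finite_subset)
  show "{t. a ~= b & p + a * t = p' + b * t} \<subseteq> {(p' - p) / (a - b)}" by (auto simp: field_simps)
 qed simp
 then show ?thesis unfolding crossings_def using assms by auto
qed

lemma breaks:
 "\<exists>B LS. finite B & finite LS & (\<forall>j\<in>I. \<forall>\<tau>\<in>{0..<T} - B. moving (kap j) \<eta> V A LS (w j) \<tau>)"
proof -
 have "\<forall>j\<in>I. \<exists>B LS. finite B & finite LS & (\<forall>\<tau>\<in>{0..<T} - B. moving (kap j) \<eta> V A LS (w j) \<tau>)" using fam_w unfolding family_def by blast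
 then obtain B LS where b: "\<forall>j\<in>I. finite (B j) & finite (LS j) & (\<forall>\<tau>\<in>{0..<T} - B j. moving (kap j) \<eta> V A (LS j) (w j) \<tau>)" by metis
 have "moving (kap j) \<eta> V A (\<Union>(LS ` I)) (w j) \<tau>" if "j \<in> I" "\<tau> \<in> {0..<T} - \<Union>(B ` I)" for j \<tau>
  by (rule moving_mono[of _ _ _ _ "LS j"]) (use b that in blast)+
 moreover have "finite (\<Union>(B ` I))" "finite (\<Union>(LS ` I))" using b by auto
 ultimately show ?thesis by blast
qed

text \<open>A genuinely nonlinear eigenvalue is simple, so two different families with a common
  eigenvalue both have coefficient 0.\<close>

lemma kap_zero: "j \<in> I ==> j' \<in> I ==> lam j = lam j' ==> kap j ~= 0 \<or> kap j' ~= 0 ==> j = j'"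
 using gnl_simple[of j j'] gnl_simple[of j' j] unfolding kap_def by (metis (full_types))

lemma profile_speed: "profile V A N x v ==> i \<in> {1..N} ==> \<bar>\<epsilon> * (kap j * speed v i)\<bar> <= Y"
proof -
 assume *: "profile V A N x v" "i \<in> {1..N}"
 have "\<bar>kap j * speed v i\<bar> <= 1 * V" unfolding abs_mult
  by (rule mult_mono) (use kap_range[of j] admissible_speed[of V V N v i] * in \<open>auto simp: profile_def\<close>)
 then show ?thesis using \<epsilon> by (simp add: abs_mult)
qed

text \<open>Off interaction and crossing times the approximation is a \<open>front_field\<close> for
  a short while. After the time 2 A C the amplitudes of all other groups vanish at each front, which
  admits the sharper estimate.\<close>

lemma rates:
 assumes "finite B" "finite LS" and mov: "!!j \<tau>. j \<in> I ==> \<tau> \<in> {0..<T} - B ==> moving (kap j) \<eta> V A LS (w j) \<tau>"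
  and t: "0 <= t" "t < T / \<epsilon>" "\<epsilon> * t \<notin> B" "t \<notin> crossings LS"
 shows "rate (W t) (%h. W (t + h)) (KR * (K1 * Y * (nn * Y)))"
  and "2 * A * C < t ==> rate (W t) (%h. W (t + h)) (KR * (K2 * (Y\<^sup>2 + \<epsilon> * \<eta>) * (nn * Y)))"
proof -
 have \<tau>: "\<epsilon> * t \<in> {0..<T} - B" using t \<epsilon> by (auto simp: field_simps)
 define good where "good j h N x v \<longleftrightarrow> 0 < h & profile V A N x v &
   (\<forall>k\<in>{1..N}. kap j * (v k - v (k - 1)) <= \<eta> & (x k - kap j * speed v k * (\<epsilon> * t), kap j * speed v k) \<in> LS) &
   (kap j ~= 0 --> (\<forall>k\<in>{1..<N}. x k < x (Suc k))) &
   (\<forall>\<tau>'\<in>{\<epsilon> * t..<\<epsilon> * t+h}. w j \<tau>' = steps N (%k. x k + kap j * speed v k * (\<tau>' - \<epsilon> * t)) v)" for j h N x v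
 have "\<forall>j\<in>I. \<exists>h N x v. good j h N x v" using mov[OF _ \<tau>] unfolding moving_def good_def by blast
 then obtain hh N x v where g: "\<forall>j\<in>I. good j (hh j) (N j) (x j) (v j)" by metis
 have hh: "0 < hh j" and pr: "profile V A (N j) (x j) (v j)" and inc: "kap j ~= 0 ==> \<forall>k\<in>{1..<N j}. x j k < x j (Suc k)"
  and wj: "!!\<tau>'. \<tau>' \<in> {\<epsilon> * t..<\<epsilon> * t + hh j} ==> w j \<tau>' = steps (N j) (%k. x j k + kap j * speed (v j) k * (\<tau>' - \<epsilon> * t)) (v j)"
  if "j \<in> I" for j using g that unfolding good_def by blast+
 have up: "kap j * (v j k - v j (k - 1)) <= \<eta>" and line: "(x j k - kap j * speed (v j) k * (\<epsilon> * t), kap j * speed (v j) k) \<in> LS"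
  if "j \<in> I" "k \<in> {1..N j}" for j k using g that unfolding good_def by blast+
 have ad: "admissible V V (N j) (v j)" and xA: "!!k. k \<in> {1..N j} ==> \<bar>x j k\<bar> <= A" if "j \<in> I" for j using pr[OF that] by (auto simp: profile_def)
 define p where "p j i = x j i + lam j U0 * t" for j i
 define c where "c j i = lam j U0 + \<epsilon> * (kap j * speed (v j) i)" for j i
 define a where "a j i = \<epsilon> * (v j i - v j (i - 1))" for j i
 have dist: "lam j = lam j' \<or> 1 / C <= \<bar>lam j U0 - lam j' U0\<bar>" if "j \<in> I" "j' \<in> I" for j j' using gap that by blast
 have cdiff: "\<bar>c j i - lam j U0\<bar> <= Y" if "j \<in> I" "i \<in> {1..N j}" for j i using profile_speed[OF pr[OF that(1)] that(2)] by (simp add: c_def)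
 interpret ff: front_field F lam l r U0 I C D S R L1 L2 \<delta>0 \<rho> KR Lam N p c a Y
 proof unfold_locales
  show "0 <= Y" "A0 * Y < \<rho>" "Y <= 1" using Y0 small_\<rho> small_1 by auto
  fix j assume j: "j \<in> I"
  show "(\<Sum>i = 1..N j. \<bar>a j i\<bar>) <= Y" unfolding a_def by (rule profile_amp[OF pr[OF j]])
  fix i assume i: "i \<in> {1..N j}"
  show "\<bar>c j i\<bar> < Lam" using cdiff[OF j i] bound_lam[OF j, of U0] Lam small_1 by simp
  fix j' i' assume j': "j' \<in> I" and i': "i' \<in> {1..N j'}" and eq: "p j i = p j' i'"
  \<comment> \<open>Fronts of different eigenvalues have different speeds by
    \<open>small_gap\<close>, so meeting at time t would put t among the crossings.\<close>
  have lj: "lam j = lam j'"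
  proof (rule ccontr)
   assume "lam j ~= lam j'"
   then have "1 / C <= \<bar>lam j U0 - lam j' U0\<bar>" using dist[OF j j'] by blast
   then have "c j i ~= c j' i'" using cdiff[OF j i] cdiff[OF j' i'] small_gap by linarith
   then have ne: "lam j U0 + \<epsilon> * (kap j * speed (v j) i) ~= lam j' U0 + \<epsilon> * (kap j' * speed (v j') i')" by (simp add: c_def)
   have "(x j i - kap j * speed (v j) i * (\<epsilon> * t)) + (lam j U0 + \<epsilon> * (kap j * speed (v j) i)) * t
    = (x j' i' - kap j' * speed (v j') i' * (\<epsilon> * t)) + (lam j' U0 + \<epsilon> * (kap j' * speed (v j') i')) * t"
    using eq unfolding p_def by (simp add: algebra_simps)
   then have "t \<in> crossings LS" unfolding crossings_def using j j' line[OF j i] line[OF j' i'] ne by blast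
   then show False using t(4) by simp
  qed
  show "lam j = lam j' & c j i = c j' i'"
  proof (cases "kap j = 0 & kap j' = 0")
   case True then show ?thesis using lj by (simp add: c_def)
  next
   case False
   then have jj: "j = j'" using kap_zero[OF j j' lj] by blast
   with False have "\<forall>k\<in>{1..<N j}. x j k < x j (Suc k)" using inc[OF j] by blast
   from increasing_chain[OF this, of i i'] increasing_chain[OF this, of i' i] have "i = i'"
    using eq i i' jj unfolding p_def by (cases i i' rule: linorder_cases) auto
   then show ?thesis using jj by simp
  qed
 qed
 \<comment> \<open>A slow duration \<open>hh j\<close> lasts hh j / \<epsilon> in physical time; the
   minimum over all families keeps every profile in straight motion.\<close>
 define hm where "hm = Min (insert 1 ((%j. hh j / \<epsilon>) ` I))"
 have hm: "0 < hm" unfolding hm_def using hh \<epsilon> by (subst Min_gr_iff) auto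
 have hmj: "hm <= hh j / \<epsilon>" if "j \<in> I" for j unfolding hm_def using that by (intro Min_le) auto
 have vals: "amp (t + h) y j = ff.val h y j" if h: "0 <= h" "h < hm" and j: "j \<in> I" for h y j
 proof -
  have "h < hh j / \<epsilon>" using h hmj[OF j] by linarith
  then have "\<epsilon> * h < hh j" using \<epsilon> by (simp add: field_simps)
  then have "\<epsilon> * (t + h) \<in> {\<epsilon> * t..<\<epsilon> * t + hh j}" using h \<epsilon> by (simp add: distrib_left)
  from amp_fronts[OF wj[OF j this]]
  have "amp (t + h) y j = fronts {1..N j} (%i. (x j i + kap j * speed (v j) i * (\<epsilon> * (t + h) - \<epsilon> * t)) + lam j U0 * (t + h)) (a j) y"
   unfolding a_def .
  also have "(%i. (x j i + kap j * speed (v j) i * (\<epsilon> * (t + h) - \<epsilon> * t)) + lam j U0 * (t + h)) = (%i. p j i + c j i * h)"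
   unfolding p_def c_def by (simp add: algebra_simps)
  finally show ?thesis unfolding ff.val_def .
 qed
 have Wv: "W (t + h) = (ff.field h)" if "0 <= h" "h < hm" for h unfolding W_def fun_eq_iff by (intro allI ansatz_cong vals that)
 have W0: "W t = (ff.field 0)" using Wv[of 0] hm by simp
 have D: "(ff.field 0) \<in> D" unfolding W0[symmetric] by (rule W_D) (use t in auto)
 have transfer: "rate (W t) (%h. W (t + h)) (E)"
  if asm: "rate (ff.field 0) ff.field (E)" for E
 proof -
  obtain h0 where h0: "0 < h0" "!!h. 0 < h & h < h0 ==> L1_dist (S h (ff.field 0)) (ff.field h) <= ennreal (E * h)" using asm by blast
  show ?thesis by (intro exI[of _ "min h0 hm"] conjI allI impI) (use h0 hm Wv W0 in auto)
 qed
 show "rate (W t) (%h. W (t + h)) (KR * (K1 * Y * (nn * Y)))" by (rule transfer[OF ff.crude_error[OF D cdiff]])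
 assume late: "2 * A * C < t"
 show "rate (W t) (%h. W (t + h)) (KR * (K2 * (Y\<^sup>2 + \<epsilon> * \<eta>) * (nn * Y)))"
 proof (rule transfer[OF ff.separated_error[OF D]])
  show "0 <= \<epsilon> * \<eta>" using \<epsilon> \<eta> by simp
 next
  fix j j' i :: nat assume j: "j \<in> I" "j' \<in> I" "lam j ~= lam j'" and i: "i \<in> {1..N j}"
  have "1 / C * t <= \<bar>lam j U0 - lam j' U0\<bar> * t" using dist[OF j(1,2)] j(3) t(1) by (intro mult_right_mono) auto
  moreover have "2 * A < 1 / C * t" using late C1 by (simp add: field_simps)
  ultimately have far: "2 * A < \<bar>lam j U0 * t - lam j' U0 * t\<bar>" using t(1) by (simp add: left_diff_distrib[symmetric] abs_mult)
  \<comment> \<open>All fronts of the other group lie on one side of this front, so the sum is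
    either empty or complete, and the complete sum vanishes because the profile returns to
    0.\<close>
  have "(\<Sum>i'\<in>{1..N j'}. if p j' i' < p j i then a j' i' else 0) = (if lam j' U0 * t < lam j U0 * t then \<Sum>i'\<in>{1..N j'}. a j' i' else 0)"
  proof -
   have "(p j' i' < p j i) = (lam j' U0 * t < lam j U0 * t)" if "i' \<in> {1..N j'}" for i'
    using far xA[OF j(1) i] xA[OF j(2) that] unfolding p_def by linarith
   then have "(\<Sum>i'\<in>{1..N j'}. if p j' i' < p j i then a j' i' else 0) = (\<Sum>i'\<in>{1..N j'}. if lam j' U0 * t < lam j U0 * t then a j' i' else 0)"
    by (intro sum.cong) auto
   then show ?thesis by simp
  qed
  also have "... = 0" unfolding a_def sum_distrib_left[symmetric] using admissible_sum[OF ad[OF j(2)]] by simp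
  finally show "ff.lval (p j i) j' = 0" unfolding ff.lval_def .
 next
  fix j i assume j: "j \<in> I" and i: "i \<in> {1..N j}"
  have v0: "v j 0 = 0" using ad[OF j] by (simp add: admissible_def)
  have at: "ff.lval (p j i) j = \<epsilon> * v j (i - 1)" "ff.val 0 (p j i) j = \<epsilon> * v j i" if "kap j ~= 0"
   using steps_at_front[where x = "x j" and v = "v j" and N = "N j" and i = i and s = "lam j U0 * t" and \<epsilon> = \<epsilon>] inc[OF j that] i v0 unfolding ff.lval_def ff.val_def fronts_def p_def a_def by simp_all
  show "c j i - lam j U0 = kap j * ((ff.lval (p j i) j + ff.val 0 (p j i) j) / 2)"
   by (cases "kap j = 0") (simp_all add: c_def at speed_def field_simps)
  have "\<epsilon> * (kap j * (v j i - v j (i - 1))) <= \<epsilon> * \<eta>" using up[OF j i] \<epsilon> by simp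
  then show "kap j * (ff.val 0 (p j i) j - ff.lval (p j i) j) <= \<epsilon> * \<eta>" by (cases "kap j = 0") (use \<epsilon> \<eta> in \<open>simp_all add: at algebra_simps\<close>)
 qed
qed

text \<open>The crude rate is paid only up to a time \<open>t0\<close> that does not depend on
  \<epsilon>, the separated rate afterwards. The factor 1 + L1 covers both the error at times before
  \<open>t0\<close> and its propagation by the semigroup later.\<close>

lemma total_error:
 assumes t: "t \<in> {0..T / \<epsilon>}"
 shows "L1_dist (S t (W 0)) (W t) <= ennreal (L1 * (1 + L1) * (KR * (K1 * Y * (nn * Y))) * (2 * A * C + 1)
   + L1 * (KR * (K2 * (Y\<^sup>2 + \<epsilon> * \<eta>) * (nn * Y))) * (T / \<epsilon>))"
proof -
 obtain B LS where B: "finite B" "finite LS" and mov: "!!j \<tau>. j \<in> I ==> \<tau> \<in> {0..<T} - B ==> moving (kap j) \<eta> V A LS (w j) \<tau>" using breaks by blast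
 define X where "X = (%\<tau>. \<tau> / \<epsilon>) ` B \<union> crossings LS"
 have finX: "finite X" using B finite_crossings by (simp add: X_def)
 have notX: "\<epsilon> * s \<notin> B & s \<notin> crossings LS" if "s \<notin> X" for s
 proof -
  have "s \<in> (%\<tau>. \<tau> / \<epsilon>) ` B" if "\<epsilon> * s \<in> B" by (rule image_eqI[OF _ that]) (use \<epsilon> in simp)
  then show ?thesis using that by (auto simp: X_def)
 qed
 define E1 where "E1 = KR * (K1 * Y * (nn * Y))"
 define E2 where "E2 = KR * (K2 * (Y\<^sup>2 + \<epsilon> * \<eta>) * (nn * Y))"
 have E: "0 <= E1" "0 <= E2" unfolding E1_def E2_def using KR K_nonneg Y0 nn1 \<epsilon> \<eta> by auto
 define M where "M = A0 * (nn * (\<epsilon> * (V * V * \<epsilon> + V * C)))"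
 have M: "0 <= M" unfolding M_def using A0(1) nn1 \<epsilon> V C0 by auto
 \<comment> \<open>The summand 1 makes the condition 2 A C < t of \<open>rates\<close> hold from
   \<open>t0\<close> on.\<close>
 define t0 where "t0 = 2 * A * C + 1"
 have t0: "0 <= t0" unfolding t0_def using A C0 by simp
 have first: "L1_dist (S s (W 0)) (W s) <= ennreal (L1 * E1 * s)" if s: "s \<in> {0..T / \<epsilon>}" for s
 proof -
  have "L1_dist (S (s - 0) (W 0)) (W s) <= ennreal (L1 * E1 * (s - 0))"
  proof (rule semigroup_error[OF _ _ M _ finX E(1)])
   fix u assume u: "u \<in> {0..<s} - X"
   then have "u < s" "s <= T / \<epsilon>" using s by auto
   then have "u < T / \<epsilon>" by linarith
   then show "\<exists>h0>0. \<forall>h. 0 < h & h < h0 & u + h <= s --> L1_dist (S h (W u)) (W (u + h)) <= ennreal (E1 * h)"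
    unfolding E1_def using rates(1)[OF B mov, of u] u notX[of u] by auto
  next
   fix u u' assume "u \<in> {0..s}" "u' \<in> {0..s}"
   then show "L1_dist (W u) (W u') <= ennreal (M * \<bar>u - u'\<bar>)" unfolding M_def by (intro W_lipschitz) (use s in auto)
  qed (use s W_D in auto)
  then show ?thesis by simp
 qed
 have goal: "L1_dist (S t (W 0)) (W t) <= ennreal (L1 * (1 + L1) * E1 * t0 + L1 * E2 * (T / \<epsilon>))"
 proof (cases "t <= t0")
  case True
  have "L1 * E1 * t <= L1 * E1 * t0" using True L1 E by (intro mult_left_mono) auto
  also have "... <= L1 * (1 + L1) * E1 * t0" using L1 E t0 by (intro mult_right_mono) (auto simp: distrib_left)
  also have "... <= L1 * (1 + L1) * E1 * t0 + L1 * E2 * (T / \<epsilon>)" using L1 E T \<epsilon> by simp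
  finally show ?thesis using first[OF t] by (meson ennreal_leI order_trans)
 next
  case False
  then have tt: "t0 \<in> {0..T / \<epsilon>}" "t0 <= t" using t t0 by auto
  have I0: "0 \<in> {0..T / \<epsilon>}" using T \<epsilon> by simp
  have a: "L1_dist (S (t - t0) (S t0 (W 0))) (S (t - t0) (W t0)) <= ennreal (L1 * (L1 * E1 * t0))"
   by (rule S_contract[OF _ _ _ first[OF tt(1)]]) (use S_D W_D tt I0 t0 L1 E in auto)
  have b: "L1_dist (S (t - t0) (S t0 (W 0))) (S (t - t0) (W t0)) = L1_dist (S t (W 0)) (S (t - t0) (W t0))"
   by (rule L1_dist_cong_AE) (use S_add[OF W_D[OF I0] t0, of "t - t0"] tt in auto)
  have c: "L1_dist (S (t - t0) (W t0)) (W t) <= ennreal (L1 * E2 * (t - t0))"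
  proof (rule semigroup_error[OF tt(2) _ M _ finX E(2)])
   fix u assume u: "u \<in> {t0..<t} - X"
   then have "t0 <= u" "u < t" "t <= T / \<epsilon>" using t by auto
   then have u': "0 <= u" "u < T / \<epsilon>" "2 * A * C < u" using t0 unfolding t0_def by linarith+
   then show "\<exists>h0>0. \<forall>h. 0 < h & h < h0 & u + h <= t --> L1_dist (S h (W u)) (W (u + h)) <= ennreal (E2 * h)"
    unfolding E2_def using rates(2)[OF B mov u'(1,2) _ _ u'(3)] u notX[of u] by auto
  next
   fix u u' assume "u \<in> {t0..t}" "u' \<in> {t0..t}"
   then show "L1_dist (W u) (W u') <= ennreal (M * \<bar>u - u'\<bar>)" unfolding M_def by (intro W_lipschitz) (use t t0 in auto)
  qed (use t t0 W_D in auto)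
  have "L1_dist (S t (W 0)) (W t) <= L1_dist (S t (W 0)) (S (t - t0) (W t0)) + L1_dist (S (t - t0) (W t0)) (W t)"
   by (rule D_triangle) (use S_D W_D t tt I0 in auto)
  also have "... <= ennreal (L1 * (L1 * E1 * t0)) + ennreal (L1 * E2 * (t - t0))" using add_mono[OF a[unfolded b] c] .
  also have "... = ennreal (L1 * (L1 * E1 * t0) + L1 * E2 * (t - t0))" using L1 E t0 tt by (subst ennreal_plus) auto
  also have "... <= ennreal (L1 * (1 + L1) * E1 * t0 + L1 * E2 * (T / \<epsilon>))"
  proof (intro ennreal_leI add_mono)
   show "L1 * (L1 * E1 * t0) <= L1 * (1 + L1) * E1 * t0" using L1 E t0 by (simp add: algebra_simps)
   show "L1 * E2 * (t - t0) <= L1 * E2 * (T / \<epsilon>)" using L1 E t t0 by (intro mult_left_mono) auto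
  qed
  finally show ?thesis .
 qed
 then show ?thesis unfolding E1_def E2_def t0_def .
qed

end

section \<open>Step data and the scalar equations\<close>

lemma lfronts_linear: "linear f ==> f (lfronts L y) = lfronts (map (%(p, d). (p, f d)) L) y"
 unfolding lfronts_def by (induction L) (auto simp: linear_0 linear_add)

lemma sum_list_linear: "linear f ==> sum_list (map snd (map (%(p, d). (p, f d)) L)) = f (sum_list (map snd L))"
 by (induction L) (auto simp: linear_0 linear_add)

text \<open>Every jump is divided by m and repeated m times at its position, which leaves the
  function unchanged but bounds each jump by V / m <= \<eta>. Sorting orders the fronts; those with
  equal positions fan out or merge in \<open>tracking_exists\<close>.\<close>

lemma scalar_data:
 fixes L :: "(real \<times> real) list"
 assumes zero: "sum_list (map snd L) = 0" and V: "(\<Sum>(p, d)\<leftarrow>L. \<bar>d\<bar>) <= V" and A: "!!z. z \<in> set L ==> \<bar>fst z\<bar> <= A" and \<eta>: "0 < \<eta>"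
 shows "\<exists>N x v. admissible \<eta> V N v & (\<forall>k\<in>{1..N}. \<bar>x k\<bar> <= A) & (\<forall>k\<in>{1..<N}. x k <= x (Suc k)) & steps N x v = lfronts L"
proof -
 have V0: "0 <= V" by (rule order_trans[OF _ V]) (auto intro!: sum_list_nonneg)
 define m where "m = Suc (nat \<lceil>V / \<eta>\<rceil>)"
 have "V / \<eta> <= real m" unfolding m_def using V0 \<eta> by simp linarith
 then have m: "V / real m <= \<eta>" "0 < m" using \<eta> by (auto simp: m_def field_simps)
 define L1 where "L1 = map (%(p, d). (p, d / m)) L"
 define L2 where "L2 = sort_key fst (concat (replicate m L1))"
 have sums: "(\<Sum>z\<leftarrow>L2. g z) = real m * (\<Sum>z\<leftarrow>L1. g z)" for g :: "_ => real"
 proof -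
  have "(\<Sum>z\<leftarrow>concat (replicate k L1). g z) = real k * (\<Sum>z\<leftarrow>L1. g z)" for k by (induction k) (auto simp: distrib_right)
  moreover have "(\<Sum>z\<leftarrow>L2. g z) = (\<Sum>z\<leftarrow>concat (replicate m L1). g z)" unfolding sum_mset_sum_list[symmetric] mset_map L2_def mset_sort ..
  ultimately show ?thesis by simp
 qed
 have sums': "(\<Sum>z\<leftarrow>L2. g z) = (\<Sum>z\<leftarrow>L. g' z)" if "!!p d. g' (p, d) = real m * g (p, d / real m)" for g g' :: "_ => real"
  unfolding sums L1_def using that by (induction L) (auto simp: distrib_left)
 define N where "N = length L2"
 define x where "x k = fst (L2 ! (k - 1))" for k
 define v where "v k = (\<Sum>i<k. snd (L2 ! i))" for k
 have jump: "v k - v (k - 1) = snd (L2 ! (k - 1))" if "k \<in> {1..N}" for k using that by (cases k) (auto simp: v_def)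
 have reindex: "(\<Sum>k\<in>{1..N}. g (k - 1)) = (\<Sum>i<N. g i)" for g :: "nat => real" by (rule sum.reindex_bij_witness[of _ Suc "%k. k - 1"]) auto
 have in_L2: "L2 ! (k - 1) \<in> set L2" if "k \<in> {1..N}" for k using that by (intro nth_mem) (auto simp: N_def)
 have set_L2: "set L2 = set L1" using m(2) by (simp add: L2_def)
 have st: "steps N x v = lfronts L"
 proof
  fix y
  have "steps N x v y = (\<Sum>k\<in>{1..N}. if fst (L2 ! (k - 1)) <= y then snd (L2 ! (k - 1)) else 0)"
   unfolding steps_def fronts_def by (rule sum.cong) (use jump in \<open>auto simp: x_def\<close>)
  also have "... = (\<Sum>z\<leftarrow>L2. if fst z <= y then snd z else 0)"
   unfolding reindex[of "%i. if fst (L2 ! i) <= y then snd (L2 ! i) else 0"] by (simp add: sum_list_sum_nth N_def atLeast0LessThan)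
  also have "... = (\<Sum>z\<leftarrow>L. if fst z <= y then snd z else 0)" by (rule sums') (use m in auto)
  finally show "steps N x v y = lfronts L y" by (simp add: lfronts_def case_prod_unfold)
 qed
 have "admissible \<eta> V N v" unfolding admissible_def
 proof (intro conjI ballI)
  show "v 0 = 0" by (simp add: v_def)
  have "v N = (\<Sum>z\<leftarrow>L2. snd z)" by (simp add: v_def N_def sum_list_sum_nth atLeast0LessThan)
  also have "... = (\<Sum>z\<leftarrow>L. snd z)" by (rule sums') (use m in auto)
  finally show "v N = 0" using zero by simp
  have "(\<Sum>k = 1..N. \<bar>v k - v (k - 1)\<bar>) = (\<Sum>k\<in>{1..N}. \<bar>snd (L2 ! (k - 1))\<bar>)" by (rule sum.cong) (use jump in auto)
  also have "... = (\<Sum>z\<leftarrow>L2. \<bar>snd z\<bar>)" unfolding reindex[of "%i. \<bar>snd (L2 ! i)\<bar>"] by (simp add: sum_list_sum_nth N_def atLeast0LessThan)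
  also have "... = (\<Sum>z\<leftarrow>L. \<bar>snd z\<bar>)" by (rule sums') (use m in auto)
  also have "... <= V" using V by (simp add: case_prod_unfold)
  finally show "(\<Sum>k = 1..N. \<bar>v k - v (k - 1)\<bar>) <= V" .
  fix k assume k: "k \<in> {1..N}"
  obtain p d where pd: "(p, d) \<in> set L" "L2 ! (k - 1) = (p, d / m)" using in_L2[OF k] unfolding set_L2 L1_def by auto
  have "\<bar>d\<bar> \<in> set (map (%(p, d). \<bar>d\<bar>) L)" using pd(1) by force
  then have "\<bar>d\<bar> <= (\<Sum>(p, d)\<leftarrow>L. \<bar>d\<bar>)" by (rule member_le_sum_list) auto
  then have "\<bar>d\<bar> <= V" using V by linarith
  then have "d / m <= V / m" by (intro divide_right_mono) auto
  then show "v k - v (k - 1) <= \<eta>" unfolding jump[OF k] pd(2) using m(1) by simp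
 qed
 moreover have "\<bar>x k\<bar> <= A" if "k \<in> {1..N}" for k using in_L2[OF that] A unfolding set_L2 L1_def x_def by force
 moreover have "x k <= x (Suc k)" if k: "k \<in> {1..<N}" for k
 proof -
  have "sorted (map fst L2)" by (simp add: L2_def)
  then have "map fst L2 ! (k - 1) <= map fst L2 ! k" by (rule sorted_nth_mono) (use k in \<open>auto simp: N_def\<close>)
  then show ?thesis using k by (auto simp: x_def N_def)
 qed
 ultimately show ?thesis using st by blast
qed

lemma integral_steps_le:
 assumes pr: "profile V A N x v" and A: "0 <= A"
 shows "(LBINT y. \<bar>steps N x v y\<bar>) <= 2 * A * V"
proof -
 have ad: "admissible V V N v" using pr by (simp add: profile_def)
 have V: "0 <= V" by (rule admissible_V_nonneg[OF ad])
 have "\<bar>steps N x v y\<bar> <= V * indicator {- A..A} y" for y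
 proof (cases "y \<in> {- A..A}")
  case True
  have "\<bar>steps N x v y\<bar> <= (\<Sum>k\<in>{1..N}. norm (v k - v (k - 1)))" unfolding steps_def real_norm_def[symmetric] by (rule fronts_norm_le)
  then show ?thesis using True ad by (simp add: admissible_def)
 next
  case False
  have "x k \<in> {- A..A}" if "k \<in> {1..N}" for k
  proof -
   have "\<bar>x k\<bar> <= A" using pr that unfolding profile_def by blast
   then show ?thesis by auto
  qed
  then have "steps N x v y = 0" by (rule steps_outside[OF ad _ False])
  then show ?thesis using V by simp
 qed
 moreover have "integrable lborel (%y. V * indicator {- A..A} y)"
  by (intro integrable_mult_right integrable_real_indicator) (auto simp: emeasure_lborel_Icc_eq)
 ultimately have "(LBINT y. \<bar>steps N x v y\<bar>) <= (LBINT y. V * indicator {- A..A} y)"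
  by (intro integral_mono) (auto intro!: integrable_abs steps_integrable[OF ad])
 then show ?thesis using A by (simp add: mult.commute)
qed

lemma pointwise_variation_affine:
 "0 <= \<epsilon> ==> pointwise_variation (%x. a + \<epsilon> *\<^sub>R v x) <= ennreal \<epsilon> * pointwise_variation v" unfolding pointwise_variation_def
proof (rule SUP_least)
 fix xs :: "real list" assume \<epsilon>: "0 <= \<epsilon>" and xs: "xs \<in> {xs. sorted xs}"
 have "(\<Sum>i<length xs - 1. ennreal (norm (a + \<epsilon> *\<^sub>R v (xs ! Suc i) - (a + \<epsilon> *\<^sub>R v (xs ! i)))))
   = (\<Sum>i<length xs - 1. ennreal \<epsilon> * ennreal (norm (v (xs ! Suc i) - v (xs ! i))))"
 proof (rule sum.cong[OF refl])
  fix i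
  have "a + \<epsilon> *\<^sub>R v (xs ! Suc i) - (a + \<epsilon> *\<^sub>R v (xs ! i)) = \<epsilon> *\<^sub>R (v (xs ! Suc i) - v (xs ! i))" by (simp add: scaleR_diff_right)
  then show "ennreal (norm (a + \<epsilon> *\<^sub>R v (xs ! Suc i) - (a + \<epsilon> *\<^sub>R v (xs ! i)))) = ennreal \<epsilon> * ennreal (norm (v (xs ! Suc i) - v (xs ! i)))"
   using \<epsilon> by (simp add: ennreal_mult)
 qed
 also have "... = ennreal \<epsilon> * (\<Sum>i<length xs - 1. ennreal (norm (v (xs ! Suc i) - v (xs ! i))))" by (simp only: sum_distrib_left)
 also have "... <= ennreal \<epsilon> * (SUP xs \<in> {xs. sorted xs}. \<Sum>i<length xs - 1. ennreal (norm (v (xs ! Suc i) - v (xs ! i))))"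
  by (intro mult_left_mono SUP_upper xs) simp
 finally show "(\<Sum>i<length xs - 1. ennreal (norm (a + \<epsilon> *\<^sub>R v (xs ! Suc i) - (a + \<epsilon> *\<^sub>R v (xs ! i)))))
   <= ennreal \<epsilon> * (SUP xs \<in> {xs. sorted xs}. \<Sum>i<length xs - 1. ennreal (norm (v (xs ! Suc i) - v (xs ! i))))" .
qed

context riemann_semigroup begin

lemma data_in_D:
 assumes U1: "integrable lborel U1" "total_variation U1 < \<infinity>"
 shows "eventually (%\<epsilon>. (%x. U0 + \<epsilon> *\<^sub>R U1 x) \<in> D) (at_right 0)"
proof -
 obtain v where v: "AE x in lborel. v x = U1 x" "pointwise_variation v < \<infinity>" using U1(2) unfolding total_variation_def INF_less_iff by auto
 define B where "B = enn2real (pointwise_variation v)"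
 have B: "pointwise_variation v = ennreal B" using v(2) by (simp add: B_def)
 have "eventually (%\<epsilon>. B * \<epsilon> < \<delta>0) (at_right 0)" by (rule eventually_small[OF \<delta>0])
 moreover have "eventually (%\<epsilon>. 0 < \<epsilon>) (at_right (0::real))" by (simp add: eventually_at_right_less)
 ultimately show ?thesis
 proof eventually_elim
  case (elim \<epsilon>)
  show ?case
  proof (rule D_small)
   show "integrable lborel (%x. U0 + \<epsilon> *\<^sub>R U1 x - U0)" using U1 by simp
   have "total_variation (%x. U0 + \<epsilon> *\<^sub>R U1 x) <= pointwise_variation (%x. U0 + \<epsilon> *\<^sub>R v x)"
    unfolding total_variation_def by (rule INF_lower) (use v(1) in auto)
   also have "... <= ennreal \<epsilon> * pointwise_variation v" by (rule pointwise_variation_affine) (use elim in simp)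
   also have "... = ennreal (\<epsilon> * B)" unfolding B using elim by (subst ennreal_mult') auto
   also have "... < ennreal \<delta>0" using elim \<delta>0 by (simp add: ennreal_less_iff mult.commute ennreal_lessI)
   finally show "total_variation (%x. U0 + \<epsilon> *\<^sub>R U1 x) < ennreal \<delta>0" .
  qed
 qed
qed

text \<open>\<open>CQ\<close> bounds the quadratic part of the ansatz in L1, in units of
  \<epsilon>^2. \<open>Cfin\<close> collects everything of total order \<epsilon>^2: that part at
  both ends of the time interval, the crude phase, and the cubic errors.\<close>

definition CQ where "CQ A V = A0 * (nn * V) * (nn * (2 * A * V))"

definition Cfin where
 "Cfin A V T = (L1 + 1) * CQ A V + L1 * (1 + L1) * (KR * (K1 * V * (nn * V))) * (2 * A * C + 1) + L1 * (KR * (K2 * V\<^sup>2 * (nn * V))) * T"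

text \<open>C e bounds the error of the step data seen through \<open>l j U0\<close>, and tracking
  adds \<eta> V / 4 per unit of slow time. Linearly degenerate amplitudes and their step profiles
  both stay at rest.\<close>

lemma families:
 assumes U1: "integrable lborel U1" and T: "0 < T"
  and gnl: "!!j. j \<in> I ==> genuinely_nonlinear lam r j ==> entropy_solution (%s. s\<^sup>2 / 2) (%y. l j U0 \<bullet> U1 y) (\<sigma> j)"
  and ld: "!!j. j \<in> I ==> linearly_degenerate lam r j ==> weak_solution (%_. 0) (%y. l j U0 \<bullet> U1 y) (\<sigma> j)"
  and L: "sum_list (map snd L) = 0" and e: "(ndist1 U1 (lfronts L)) < e"
  and V: "C * (\<Sum>(p, d)\<leftarrow>L. norm d) <= V" and A: "!!z. z \<in> set L ==> \<bar>fst z\<bar> <= A" "0 <= A" and \<eta>: "0 < \<eta>" and j: "j \<in> I"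
 shows "\<exists>w. family (kap j) \<eta> V (A + V * T) T w & w 0 = (%y. l j U0 \<bullet> lfronts L y) &
   (\<forall>\<tau>\<in>{0..T}. (dist1 (\<sigma> j \<tau>) (w \<tau>)) <= C * e + \<eta> * V / 4 * T)"
proof -
 let ?f = "%d. l j U0 \<bullet> d"
 define Lj where "Lj = map (%(p, d). (p, ?f d)) L"
 have lin: "linear ?f" by (rule bounded_linear.linear[OF bounded_linear_inner_right])
 have lb: "\<bar>?f d\<bar> <= C * norm d" for d using Cauchy_Schwarz_ineq2[of "l j U0" d] mult_right_mono[OF bound_l[OF j, of U0], of "norm d"] by simp
 have Lj: "lfronts Lj = (%y. ?f (lfronts L y))" unfolding Lj_def using lfronts_linear[OF lin] by metis
 have V': "(\<Sum>(p, d)\<leftarrow>Lj. \<bar>d\<bar>) <= V"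
 proof -
  have "(\<Sum>(p, d)\<leftarrow>Lj. \<bar>d\<bar>) <= (\<Sum>(p, d)\<leftarrow>L. C * norm d)" unfolding Lj_def by (simp add: o_def case_prod_unfold) (rule sum_list_mono, rule lb)
  also have "... = C * (\<Sum>(p, d)\<leftarrow>L. norm d)" by (simp add: sum_list_const_mult case_prod_unfold)
  finally show ?thesis using V by simp
 qed
 have V0: "0 <= V" by (rule order_trans[OF _ V']) (auto intro!: sum_list_nonneg)
 have sum0: "sum_list (map snd Lj) = 0" unfolding Lj_def sum_list_linear[OF lin] L by simp
 have A': "\<bar>fst z\<bar> <= A" if "z \<in> set Lj" for z using that A(1) unfolding Lj_def by force
 obtain N x v where ad: "admissible \<eta> V N v" and xA: "\<forall>k\<in>{1..N}. \<bar>x k\<bar> <= A" and mono: "\<forall>k\<in>{1..<N}. x k <= x (Suc k)"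
  and st: "steps N x v = lfronts Lj" using scalar_data[OF sum0 V' A' \<eta>] by blast
 have pr: "profile V (A + V * T) N x v" unfolding profile_def
 proof (intro conjI ballI admissible_weaken[OF ad])
  fix k assume "k \<in> {1..N}"
  with xA have "\<bar>x k\<bar> <= A" by blast
  moreover have "0 <= V * T" using V0 T by simp
  ultimately show "\<bar>x k\<bar> <= A + V * T" by linarith
 qed
 have iL: "integrable lborel (lfronts L)" by (rule lfronts_integrable[OF L])
 have init: "(dist1 (\<sigma> j 0) (lfronts Lj)) <= C * e" if ev: "bounded_L1_evolution (%y. ?f (U1 y)) (\<sigma> j)"
 proof -
  have m: "\<sigma> j 0 \<in> borel_measurable lborel" using L1_evolution_integrable[OF ev, of 0] by auto
  have ae: "AE y in lborel. \<sigma> j 0 y = ?f (U1 y)" using ev unfolding bounded_L1_evolution_def by auto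
  have "(dist1 (\<sigma> j 0) (lfronts Lj)) <= (LBINT y. C * norm (U1 y - lfronts L y))"
  proof (rule integral_mono_AE)
   show "AE y in lborel. \<bar>\<sigma> j 0 y - lfronts Lj y\<bar> <= C * norm (U1 y - lfronts L y)" using ae
   proof eventually_elim
    case (elim y)
    then have "\<sigma> j 0 y - lfronts Lj y = ?f (U1 y - lfronts L y)" unfolding Lj by (simp add: inner_diff_right)
    then show ?case using lb by simp
   qed
   show "integrable lborel (%y. \<bar>\<sigma> j 0 y - lfronts Lj y\<bar>)" using L1_evolution_integrable[OF ev, of 0] lfronts_integrable[OF sum0] by simp
   show "integrable lborel (%y. C * norm (U1 y - lfronts L y))" using U1 iL by simp
  qed
  also have "... = C * (ndist1 U1 (lfronts L))" by simp
  also have "... <= C * e" using e C0 by (intro mult_left_mono) auto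
  finally show ?thesis .
 qed
 show ?thesis
 proof (cases "genuinely_nonlinear lam r j")
  case True
  have ent: "entropy_solution (%s. s\<^sup>2 / 2) (%y. ?f (U1 y)) (\<sigma> j)" by (rule gnl[OF j True])
  then have ev: "bounded_L1_evolution (%y. ?f (U1 y)) (\<sigma> j)" by (simp add: entropy_solution_def)
  obtain w where w: "tracking \<eta> V A 0 T w" "w 0 = steps N x v" using tracking_exists[of 0 T \<eta> V N v x A] T \<eta> ad xA mono by (auto simp: less_imp_le)
  have "(dist1 (\<sigma> j \<tau>) (w \<tau>)) <= C * e + \<eta> * V / 4 * T" if \<tau>: "\<tau> \<in> {0..T}" for \<tau>
  proof -
   have "(dist1 (\<sigma> j \<tau>) (w \<tau>)) <= (dist1 (\<sigma> j 0) (w 0)) + \<eta> * V / 4 * \<tau>" by (rule entropy_tracking[OF ent w(1) _ A(2) \<tau>]) (use \<eta> in simp)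
   moreover have "\<eta> * V / 4 * \<tau> <= \<eta> * V / 4 * T" using \<tau> \<eta> V0 by (intro mult_left_mono) auto
   ultimately show ?thesis using init[OF ev] unfolding w(2) st by linarith
  qed
  moreover have "family (kap j) \<eta> V (A + V * T) T w" using tracking_family[OF w(1) V0] True by (simp add: kap_def)
  ultimately show ?thesis using w(2) st Lj by auto
 next
  case False
  then have "linearly_degenerate lam r j" using fields[OF j] by blast
  then have ws: "weak_solution (%_. 0) (%y. ?f (U1 y)) (\<sigma> j)" by (rule ld[OF j])
  then have ev: "bounded_L1_evolution (%y. ?f (U1 y)) (\<sigma> j)" by (simp add: weak_solution_def)
  have "(dist1 (\<sigma> j \<tau>) (steps N x v)) <= C * e + \<eta> * V / 4 * T" if \<tau>: "\<tau> \<in> {0..T}" for \<tau>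
  proof -
   have i: "integrable lborel (\<sigma> j \<tau>)" "integrable lborel (\<sigma> j 0)" using L1_evolution_integrable[OF ev] \<tau> by auto
   have "AE y in lborel. \<sigma> j \<tau> y = \<sigma> j 0 y" by (rule weak_solution_stationary[OF ws]) (use \<tau> in simp)
   then have "(dist1 (\<sigma> j \<tau>) (steps N x v)) = (dist1 (\<sigma> j 0) (steps N x v))" by (intro integral_cong_AE) (use i steps_integrable[OF ad, of x] in auto)
   moreover have "0 <= \<eta> * V / 4 * T" using \<eta> V0 T by simp
   ultimately show ?thesis using init[OF ev] unfolding st by linarith
  qed
  moreover have "family (kap j) \<eta> V (A + V * T) T (%_. steps N x v)" using stationary_family[OF pr, of \<eta> T] \<eta> V0 False by (simp add: kap_def)
  ultimately show ?thesis using st Lj by (intro exI[of _ "%_. steps N x v"]) auto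
 qed
qed

end

section \<open>Comparison with the weakly nonlinear approximation\<close>

context wave begin

text \<open>The ansatz without its quadratic part, which has the form of \<open>U_w\<close>.\<close>

definition lin where "lin t y = U0 + (\<Sum>j\<in>I. amp t y j *\<^sub>R r j U0)"

lemma lin_integrable: "t \<in> {0..T / \<epsilon>} ==> integrable lborel (%y. lin t y - U0)"
 unfolding lin_def using amp_integrable by (simp add: integrable_scaleR_left Bochner_Integration.integrable_sum)


lemma W_lin:
 assumes t: "t \<in> {0..T / \<epsilon>}" shows "L1_dist (W t) (lin t) <= ennreal (\<epsilon>\<^sup>2 * CQ A V)"
proof -
 have eq: "W t y - lin t y = (W t y - U0) - (lin t y - U0)" for y by simp
 have int: "integrable lborel (%y. W t y - lin t y)" unfolding eq by (intro Bochner_Integration.integrable_diff D_integrable W_D lin_integrable t)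
 have 1: "norm (W t y - lin t y) <= A0 * (nn * Y) * (\<Sum>j\<in>I. \<bar>amp t y j\<bar>)" for y
 proof -
  let ?X = "\<Sum>j\<in>I. \<bar>amp t y j\<bar>"
  have "\<bar>amp t y j\<bar> <= ?X" if "j \<in> I" for j using that by (intro member_le_sum) auto
  from quad_bound[OF this] have "norm (W t y - lin t y) <= nn\<^sup>2 * (C * C) * ?X\<^sup>2" unfolding W_def lin_def by (simp add: algebra_simps)
  also have "... <= A0 * ?X\<^sup>2" using A0(2) by (intro mult_right_mono) auto
  also have "... = A0 * ?X * ?X" by (simp add: power2_eq_square)
  also have "... <= A0 * (nn * Y) * ?X"
  proof (intro mult_right_mono mult_left_mono sum_nonneg)
   have "?X <= (\<Sum>j\<in>I. Y)" by (intro sum_mono amp_bound t)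
   then show "?X <= nn * Y" by (simp add: nn_def)
  qed (use A0(1) in auto)
  finally show ?thesis .
 qed
 have 2: "(LBINT y. \<bar>amp t y j\<bar>) <= \<epsilon> * (2 * A * V)" if j: "j \<in> I" for j
 proof -
  obtain N x v where N: "!!j. j \<in> I ==> profile V A (N j) (x j) (v j)" "!!j. j \<in> I ==> w j (\<epsilon> * t) = steps (N j) (x j) (v j)" using snapshot[OF t] by blast
  have "(LBINT y. \<bar>amp t y j\<bar>) = \<epsilon> * (LBINT y. \<bar>w j (\<epsilon> * t) (y - lam j U0 * t)\<bar>)" unfolding amp_def abs_mult using \<epsilon> by simp
  also have "(LBINT y. \<bar>w j (\<epsilon> * t) (y - lam j U0 * t)\<bar>) = (LBINT y. \<bar>w j (\<epsilon> * t) y\<bar>)" by (rule integral_shift[of "%y. \<bar>w j (\<epsilon> * t) y\<bar>"])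
  also have "... <= 2 * A * V" unfolding N(2)[OF j] by (rule integral_steps_le[OF N(1)[OF j] A])
  finally show ?thesis using \<epsilon> by simp
 qed
 have "L1_dist (W t) (lin t) <= ennreal (A0 * (nn * Y) * (nn * (\<epsilon> * (2 * A * V))))"
  by (rule L1_dist_le_sum[OF int amp_integrable[OF t] 2 _ 1]) (use A0(1) nn1 Y0 in auto)
 then show ?thesis by (simp add: CQ_def power2_eq_square mult_ac)
qed

lemma lin_U_w:
 assumes t: "t \<in> {0..T / \<epsilon>}"
  and \<sigma>: "!!j. j \<in> I ==> integrable lborel (\<sigma> j (\<epsilon> * t))"
  and e: "!!j. j \<in> I ==> (dist1 (\<sigma> j (\<epsilon> * t)) (w j (\<epsilon> * t))) <= e"
 shows "integrable lborel (%x. U_w lam r U0 \<sigma> \<epsilon> t x - U0)" "L1_dist (lin t) (U_w lam r U0 \<sigma> \<epsilon> t) <= ennreal (\<epsilon> * (nn * C * e))"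
proof -
 let ?s = "%j y. \<sigma> j (\<epsilon> * t) (y - lam j U0 * t)" and ?w = "%j y. w j (\<epsilon> * t) (y - lam j U0 * t)"
 have Uw: "U_w lam r U0 \<sigma> \<epsilon> t y = U0 + \<epsilon> *\<^sub>R (\<Sum>j\<in>I. ?s j y *\<^sub>R r j U0)" for y by (simp add: U_w_def I_eq)
 have is': "integrable lborel (?s j)" if "j \<in> I" for j by (rule integrable_shift[OF \<sigma>[OF that]])
 have iw: "integrable lborel (?w j)" if j: "j \<in> I" for j using integrable_mult_right[OF amp_integrable[OF t j], of "1 / \<epsilon>"] \<epsilon> by (simp add: amp_def)
 show iU: "integrable lborel (%x. U_w lam r U0 \<sigma> \<epsilon> t x - U0)" unfolding Uw using is' by simp
 have eq: "lin t y - U_w lam r U0 \<sigma> \<epsilon> t y = (lin t y - U0) - (U_w lam r U0 \<sigma> \<epsilon> t y - U0)" for y by simp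
 have int: "integrable lborel (%y. lin t y - U_w lam r U0 \<sigma> \<epsilon> t y)" unfolding eq by (intro Bochner_Integration.integrable_diff lin_integrable iU t)
 have 1: "norm (lin t y - U_w lam r U0 \<sigma> \<epsilon> t y) <= \<epsilon> * C * (\<Sum>j\<in>I. \<bar>?s j y - ?w j y\<bar>)" for y
 proof -
  have "lin t y - U_w lam r U0 \<sigma> \<epsilon> t y = \<epsilon> *\<^sub>R (\<Sum>j\<in>I. (?w j y - ?s j y) *\<^sub>R r j U0)"
   unfolding lin_def Uw amp_def by (simp add: scaleR_sum_right scaleR_left_diff_distrib sum_subtractf scaleR_diff_right)
  moreover have "norm (\<Sum>j\<in>I. (?w j y - ?s j y) *\<^sub>R r j U0) <= (\<Sum>j\<in>I. C * \<bar>?s j y - ?w j y\<bar>)"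
   by (rule sum_norm_le) (use bound_r[of _ U0] in \<open>auto simp: abs_minus_commute mult.commute[of C] intro!: mult_left_mono\<close>)
  ultimately show ?thesis using \<epsilon> by (simp add: sum_distrib_left[symmetric])
 qed
 have "L1_dist (lin t) (U_w lam r U0 \<sigma> \<epsilon> t) <= ennreal (\<epsilon> * C * (nn * e))"
 proof (rule L1_dist_le_sum[OF int _ _ _ 1])
  fix j assume j: "j \<in> I"
  show "integrable lborel (%y. ?s j y - ?w j y)" using is'[OF j] iw[OF j] by simp
  show "(dist1 (?s j) (?w j)) <= e" using e[OF j] integral_shift[of "%y. \<bar>\<sigma> j (\<epsilon> * t) y - w j (\<epsilon> * t) y\<bar>" "lam j U0 * t"] by simp
 qed (use \<epsilon> C0 in simp)
 then show "L1_dist (lin t) (U_w lam r U0 \<sigma> \<epsilon> t) <= ennreal (\<epsilon> * (nn * C * e))" by (simp add: mult_ac)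
qed

text \<open>The distance is split at S t (W 0), W t and lin t. Expansion in the eigenvectors at
  \<open>U0\<close> shows that lin 0 is exactly U0 + \<epsilon> V1, so initially only the error of
  the step data and the quadratic part of the ansatz occur.\<close>

lemma final_error:
 assumes t: "t \<in> {0..T / \<epsilon>}"
  and U1: "integrable lborel U1" and D: "(%x. U0 + \<epsilon> *\<^sub>R U1 x) \<in> D"
  and V1: "integrable lborel V1" and w0: "!!j. j \<in> I ==> w j 0 = (%y. l j U0 \<bullet> V1 y)"
  and e1: "(ndist1 U1 V1) <= e1"
  and \<sigma>: "!!j. j \<in> I ==> integrable lborel (\<sigma> j (\<epsilon> * t))"
  and e: "!!j. j \<in> I ==> (dist1 (\<sigma> j (\<epsilon> * t)) (w j (\<epsilon> * t))) <= e"
 shows "L1_dist (S t (%x. U0 + \<epsilon> *\<^sub>R U1 x)) (U_w lam r U0 \<sigma> \<epsilon> t)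
   <= ennreal (\<epsilon> * (L1 * e1 + nn * C * e + L1 * KR * K2 * nn * V * T * \<eta> + Cfin A V T * \<epsilon>))"
proof -
 let ?u = "%x. U0 + \<epsilon> *\<^sub>R U1 x" and ?Uw = "U_w lam r U0 \<sigma> \<epsilon> t"
 have I0: "0 \<in> {0..T / \<epsilon>}" using T \<epsilon> by simp
 have t0: "0 <= t" using t by simp
 obtain j where "j \<in> I" using card_I by (metis card.empty ex_in_conv zero_less_card_finite less_irrefl)
 from e[OF this] have e0: "0 <= e" by (rule order_trans[rotated]) simp
 have e10: "0 <= e1" by (rule order_trans[OF _ e1]) simp
 have CQ0: "0 <= CQ A V" unfolding CQ_def using A0(1) nn1 V A by auto
 have lin0: "lin 0 y = U0 + \<epsilon> *\<^sub>R V1 y" for y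
 proof -
  have "(\<Sum>j\<in>I. amp 0 y j *\<^sub>R r j U0) = (\<Sum>j\<in>I. \<epsilon> *\<^sub>R ((l j U0 \<bullet> V1 y) *\<^sub>R r j U0))" by (rule sum.cong) (use w0 in \<open>auto simp: amp_def\<close>)
  also have "... = \<epsilon> *\<^sub>R V1 y" unfolding scaleR_sum_right[symmetric] expand_r[of "V1 y" U0, symmetric] ..
  finally show ?thesis by (simp add: lin_def)
 qed
 have a: "L1_dist ?u (lin 0) <= ennreal (\<epsilon> * e1)"
 proof -
  have d: "?u y - lin 0 y = \<epsilon> *\<^sub>R (U1 y - V1 y)" for y unfolding lin0 by (simp add: scaleR_diff_right)
  have "integrable lborel (%y. ?u y - lin 0 y)" unfolding d using U1 V1 by simp
  then have "L1_dist ?u (lin 0) = ennreal (ndist1 ?u (lin 0))" by (rule L1_dist_eq)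
  also have "(ndist1 ?u (lin 0)) = \<epsilon> * (ndist1 U1 V1)" unfolding d using \<epsilon> by simp
  finally show ?thesis using e1 \<epsilon> by (simp add: ennreal_leI)
 qed
 have m: "(%x. f x - g x) \<in> borel_measurable lborel"
  if "integrable lborel (%x. f x - U0)" "integrable lborel (%x. g x - U0)" for f g :: "real => real ^ 'n"
  using Bochner_Integration.integrable_diff[OF that] by (simp add: borel_measurable_integrable)
 note iW = D_integrable[OF W_D]
 have "L1_dist ?u (W 0) <= L1_dist ?u (lin 0) + L1_dist (lin 0) (W 0)" by (rule L1_dist_triangle) (intro m D_integrable[OF D] lin_integrable I0 iW)+
 also have "... <= ennreal (\<epsilon> * e1) + ennreal (\<epsilon>\<^sup>2 * CQ A V)" using a W_lin[OF I0] by (intro add_mono) (simp_all add: L1_dist_commute)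
 also have "... = ennreal (\<epsilon> * e1 + \<epsilon>\<^sup>2 * CQ A V)" using \<epsilon> e10 CQ0 by simp
 finally have "L1_dist (S t ?u) (S t (W 0)) <= ennreal (L1 * (\<epsilon> * e1 + \<epsilon>\<^sup>2 * CQ A V))" by (rule S_contract[OF D W_D[OF I0] t0]) (use \<epsilon> e10 CQ0 in auto)
 note b = this and c = total_error[OF t] and d = W_lin[OF t] and f = lin_U_w(2)[where \<sigma> = \<sigma> and e = e, OF t \<sigma> e]
 define E where "E = L1 * (1 + L1) * (KR * (K1 * Y * (nn * Y))) * (2 * A * C + 1) + L1 * (KR * (K2 * (Y\<^sup>2 + \<epsilon> * \<eta>) * (nn * Y))) * (T / \<epsilon>)"
 have E0: "0 <= E" unfolding E_def by (intro add_nonneg_nonneg mult_nonneg_nonneg) (use L1 KR K_nonneg nn1 Y0 A C0 \<epsilon> \<eta> T V in auto)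
 have SD: "S t ?u \<in> D" "S t (W 0) \<in> D" "W t \<in> D" using S_D[OF D t0] S_D[OF W_D[OF I0] t0] W_D[OF t] by auto
 have iUw: "integrable lborel (%x. ?Uw x - U0)" by (rule lin_U_w(1)[where \<sigma> = \<sigma> and e = e, OF t \<sigma> e])
 have "L1_dist (S t ?u) ?Uw <= L1_dist (S t ?u) (S t (W 0)) + L1_dist (S t (W 0)) ?Uw" by (rule L1_dist_triangle) (intro m D_integrable SD iUw)+
 also have "L1_dist (S t (W 0)) ?Uw <= L1_dist (S t (W 0)) (W t) + L1_dist (W t) ?Uw" by (rule L1_dist_triangle) (intro m D_integrable SD iUw)+
 also have "L1_dist (W t) ?Uw <= L1_dist (W t) (lin t) + L1_dist (lin t) ?Uw"
  by (rule L1_dist_triangle) (intro m D_integrable SD iUw lin_integrable t)+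
 finally have "L1_dist (S t ?u) ?Uw <= L1_dist (S t ?u) (S t (W 0)) + (L1_dist (S t (W 0)) (W t) + (L1_dist (W t) (lin t) + L1_dist (lin t) ?Uw))"
  by (simp add: add_left_mono)
 also have "... <= ennreal (L1 * (\<epsilon> * e1 + \<epsilon>\<^sup>2 * CQ A V)) + (ennreal E + (ennreal (\<epsilon>\<^sup>2 * CQ A V) + ennreal (\<epsilon> * (nn * C * e))))"
  unfolding E_def by (intro add_mono b c d f)
 also have "... = ennreal (L1 * (\<epsilon> * e1 + \<epsilon>\<^sup>2 * CQ A V) + (E + (\<epsilon>\<^sup>2 * CQ A V + \<epsilon> * (nn * C * e))))"
  using L1 \<epsilon> e10 CQ0 E0 nn1 C0 e0 by (simp add: ennreal_plus[symmetric] del: ennreal_plus)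
 also have "L1 * (\<epsilon> * e1 + \<epsilon>\<^sup>2 * CQ A V) + (E + (\<epsilon>\<^sup>2 * CQ A V + \<epsilon> * (nn * C * e)))
   = \<epsilon> * (L1 * e1 + nn * C * e + L1 * KR * K2 * nn * V * T * \<eta> + Cfin A V T * \<epsilon>)"
  unfolding E_def Cfin_def using \<epsilon> by (simp add: field_simps power2_eq_square)
 finally show ?thesis .
qed

end

section \<open>Choice of the parameters\<close>

context riemann_semigroup begin

theorem weakly_nonlinear_limit:
 assumes U1: "integrable lborel U1" "total_variation U1 < \<infinity>" and T: "0 < T"
  and gnl: "!!j. j \<in> I ==> genuinely_nonlinear lam r j ==> entropy_solution (%s. s\<^sup>2 / 2) (%y. l j U0 \<bullet> U1 y) (\<sigma> j)"
  and ld: "!!j. j \<in> I ==> linearly_degenerate lam r j ==> weak_solution (%_. 0) (%y. l j U0 \<bullet> U1 y) (\<sigma> j)"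
 shows "((%\<epsilon>. (SUP t\<in>{0..T / \<epsilon>}. L1_dist (S t (%x. U0 + \<epsilon> *\<^sub>R U1 x)) (U_w lam r U0 \<sigma> \<epsilon> t)) / ennreal \<epsilon>)
   \<longlongrightarrow> 0) (at_right 0)"
proof (rule order_tendstoI)
 fix a :: ennreal assume "0 < a"
 then obtain b where b: "0 < b" "b < a" using dense by blast
 then obtain e where e: "b = ennreal e" "0 < e" by (cases b) auto
 \<comment> \<open>Three quarters of \<open>e\<close> are spent, on the step data, on \<eta> and on
   \<epsilon>, one after the other, because each choice fixes the constants of the next.\<close>
 obtain e1 where "0 < e1" "(L1 + nn * C * C) * e1 < e / 4" using small_multiples[of "{(L1 + nn * C * C, e / 4)}"] e by auto
 then have e1: "0 < e1" and e1e: "(L1 + nn * C * C) * e1 <= e / 4" by auto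
 obtain L where L: "sum_list (map snd L) = 0" "(ndist1 U1 (lfronts L)) < e1"
  using step_functions_dense[OF U1(1)] e1 unfolding step_approximable_def by blast
 define V where "V = C * (\<Sum>(p, d)\<leftarrow>L. norm d)"
 have V: "0 <= V" unfolding V_def using C0 by (auto intro!: mult_nonneg_nonneg sum_list_nonneg)
 define A' where "A' = (\<Sum>z\<leftarrow>L. \<bar>fst z\<bar>)"
 have A': "\<bar>fst z\<bar> <= A'" if "z \<in> set L" for z unfolding A'_def by (rule member_le_sum_list) (use that in auto)
 have A'0: "0 <= A'" unfolding A'_def by (auto intro!: sum_list_nonneg)
 \<comment> \<open>Fronts move with speed at most \<open>V\<close> in slow time, so all profiles
   stay within this radius up to time \<open>T\<close>.\<close>
 define A where "A = A' + V * T"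
 have A: "0 <= A" using A'0 V T by (simp add: A_def)
 \<comment> \<open>The coefficient of \<eta> in the final error: the first summand comes from
   comparing scalar solutions with tracked fronts, the second from the separated rate over the time
   T / \<epsilon>.\<close>
 define K where "K = nn * C * V * T / 4 + L1 * KR * K2 * nn * V * T"
 have K: "0 <= K" unfolding K_def using nn1 C0 V T L1 KR K_nonneg by auto
 obtain \<eta> where "0 < \<eta>" "K * \<eta> < e / 4" using small_multiples[of "{(K, e / 4)}"] e by auto
 then have \<eta>: "0 < \<eta>" and K\<eta>: "K * \<eta> <= e / 4" by auto
 have "\<forall>j\<in>I. \<exists>w. family (kap j) \<eta> V (A' + V * T) T w & w 0 = (%y. l j U0 \<bullet> lfronts L y) &
   (\<forall>\<tau>\<in>{0..T}. (dist1 (\<sigma> j \<tau>) (w \<tau>)) <= C * e1 + \<eta> * V / 4 * T)"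
 proof
  fix j assume j: "j \<in> I"
  have V': "C * (\<Sum>(p, d)\<leftarrow>L. norm d) <= V" by (simp add: V_def)
  show "\<exists>w. family (kap j) \<eta> V (A' + V * T) T w & w 0 = (%y. l j U0 \<bullet> lfronts L y) &
   (\<forall>\<tau>\<in>{0..T}. (dist1 (\<sigma> j \<tau>) (w \<tau>)) <= C * e1 + \<eta> * V / 4 * T)" by (rule families[of U1 T \<sigma> L e1 V A' \<eta> j])
    (rule U1(1) T L V' A'0 \<eta> j | erule (1) gnl | erule (1) ld | erule A')+
 qed
 from bchoice[OF this[folded A_def]] obtain w where "\<forall>j\<in>I. family (kap j) \<eta> V A T (w j) & w j 0 = (%y. l j U0 \<bullet> lfronts L y) &
   (\<forall>\<tau>\<in>{0..T}. (dist1 (\<sigma> j \<tau>) (w j \<tau>)) <= C * e1 + \<eta> * V / 4 * T)" by (elim exE) (rule that)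
 then have w: "family (kap j) \<eta> V A T (w j)" "w j 0 = (%y. l j U0 \<bullet> lfronts L y)"
   "\<tau> \<in> {0..T} ==> (dist1 (\<sigma> j \<tau>) (w j \<tau>)) <= C * e1 + \<eta> * V / 4 * T" if "j \<in> I" for j \<tau> using that by blast+
 have \<sigma>: "integrable lborel (\<sigma> j \<tau>)" if j: "j \<in> I" and \<tau>: "0 <= \<tau>" for j \<tau>
 proof -
  have "bounded_L1_evolution (%y. l j U0 \<bullet> U1 y) (\<sigma> j)"
   using fields[OF j] gnl[OF j] ld[OF j] unfolding entropy_solution_def weak_solution_def by blast
  then show ?thesis using \<tau> by (rule L1_evolution_integrable)
 qed
 have "eventually (%\<epsilon>. (%x. U0 + \<epsilon> *\<^sub>R U1 x) \<in> D) (at_right 0)" by (rule data_in_D[OF U1])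
 moreover have "eventually (%\<epsilon>. 0 < \<epsilon>) (at_right (0::real))" by (simp add: eventually_at_right_less)
 moreover have "eventually (%\<epsilon>. (A0 * V) * \<epsilon> < \<rho>) (at_right 0)" by (rule eventually_small[OF \<rho>(1)])
 moreover have "eventually (%\<epsilon>. V * \<epsilon> < 1) (at_right 0)" by (rule eventually_small) simp
 moreover have "eventually (%\<epsilon>. (2 * V) * \<epsilon> < 1 / C) (at_right 0)" by (rule eventually_small) (use C1 in simp)
 moreover have "eventually (%\<epsilon>. (A0 * nn * V) * \<epsilon> < \<delta>0) (at_right 0)" by (rule eventually_small[OF \<delta>0])
 moreover have "eventually (%\<epsilon>. Cfin A V T * \<epsilon> < e / 4) (at_right 0)" by (rule eventually_small) (use e in simp)
 ultimately show "eventually (%\<epsilon>. (SUP t\<in>{0..T / \<epsilon>}. L1_dist (S t (%x. U0 + \<epsilon> *\<^sub>R U1 x)) (U_w lam r U0 \<sigma> \<epsilon> t)) / ennreal \<epsilon> < a) (at_right 0)"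
 proof eventually_elim
  case (elim \<epsilon>)
  interpret wave F lam l r U0 I C D S R L1 L2 \<delta>0 \<rho> KR Lam w \<eta> V A T \<epsilon> by unfold_locales (use w(1) \<eta> V A T elim in \<open>simp_all add: mult_ac\<close>)
  have "L1_dist (S t (%x. U0 + \<epsilon> *\<^sub>R U1 x)) (U_w lam r U0 \<sigma> \<epsilon> t) <= ennreal (\<epsilon> * e)" if t: "t \<in> {0..T / \<epsilon>}" for t
  proof -
   have \<tau>: "\<epsilon> * t \<in> {0..T}" using t elim(2) by (auto simp: field_simps)
   have "L1_dist (S t (%x. U0 + \<epsilon> *\<^sub>R U1 x)) (U_w lam r U0 \<sigma> \<epsilon> t)
    <= ennreal (\<epsilon> * (L1 * e1 + nn * C * (C * e1 + \<eta> * V / 4 * T) + L1 * KR * K2 * nn * V * T * \<eta> + Cfin A V T * \<epsilon>))"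
    by (rule final_error[where ?V1.0 = "lfronts L"]) (use t U1 elim L lfronts_integrable[OF L(1)] w(2) w(3)[OF _ \<tau>] \<sigma> \<tau> in auto)
   also have "L1 * e1 + nn * C * (C * e1 + \<eta> * V / 4 * T) + L1 * KR * K2 * nn * V * T * \<eta> + Cfin A V T * \<epsilon>
    = (L1 + nn * C * C) * e1 + K * \<eta> + Cfin A V T * \<epsilon>" unfolding K_def by (simp add: algebra_simps)
   also have "ennreal (\<epsilon> * ((L1 + nn * C * C) * e1 + K * \<eta> + Cfin A V T * \<epsilon>)) <= ennreal (\<epsilon> * e)"
    using e1e K\<eta> elim(7) e(2) elim(2) by (intro ennreal_leI mult_left_mono) auto
   finally show ?thesis .
  qed
  then have "(SUP t\<in>{0..T / \<epsilon>}. L1_dist (S t (%x. U0 + \<epsilon> *\<^sub>R U1 x)) (U_w lam r U0 \<sigma> \<epsilon> t)) <= ennreal (\<epsilon> * e)" by (rule SUP_least)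
  then have "(SUP t\<in>{0..T / \<epsilon>}. L1_dist (S t (%x. U0 + \<epsilon> *\<^sub>R U1 x)) (U_w lam r U0 \<sigma> \<epsilon> t)) / ennreal \<epsilon> <= ennreal (\<epsilon> * e) / ennreal \<epsilon>"
   by (rule divide_right_mono_ennreal)
  also have "... = ennreal e" using elim(2) e(2) by (simp add: divide_ennreal)
  also have "... < a" using b e by simp
  finally show ?case .
 qed
qed simp

end

theorem theorem1p2:
  fixes F :: "real ^ 'n \<Rightarrow> real ^ 'n"
    and U0 :: "real ^ 'n"
    and U1 :: "real \<Rightarrow> real ^ 'n"
    and lam :: "nat \<Rightarrow> real ^ 'n \<Rightarrow> real"
    and l r :: "nat \<Rightarrow> real ^ 'n \<Rightarrow> real ^ 'n"
    and D :: "(real \<Rightarrow> real ^ 'n) set"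
    and S :: "real \<Rightarrow> (real \<Rightarrow> real ^ 'n) \<Rightarrow> (real \<Rightarrow> real ^ 'n)"
    and \<sigma> :: "nat \<Rightarrow> real \<Rightarrow> real \<Rightarrow> real"
    and T0 :: real
  assumes "smooth F"
    and "\<And>U. real_diagonalizable (jacobian F (at U))"
    and "\<And>U. ordered_eigenvalues (jacobian F (at U)) (\<lambda>j. lam j U)"
    and "constant_multiplicity lam"
    and "dual_eigenvectors F lam l r"
    and "\<And>j. j \<in> {1..CARD('n)} \<Longrightarrow> genuinely_nonlinear lam r j \<or> linearly_degenerate lam r j"
    and "integrable lborel U1"
    and "total_variation U1 < \<infinity>"
    and "standard_riemann_semigroup F lam r U0 D S"
    and "\<And>j. j \<in> {1..CARD('n)} \<Longrightarrow> genuinely_nonlinear lam r j \<Longrightarrow>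
           entropy_solution (\<lambda>s. s\<^sup>2 / 2) (\<lambda>y. l j U0 \<bullet> U1 y) (\<sigma> j)"
    and "\<And>j. j \<in> {1..CARD('n)} \<Longrightarrow> linearly_degenerate lam r j \<Longrightarrow>
           weak_solution (\<lambda>_. 0) (\<lambda>y. l j U0 \<bullet> U1 y) (\<sigma> j)"
    and "T0 > 0"
  shows "((\<lambda>\<epsilon>. (SUP t\<in>{0..T0 / \<epsilon>}.
             L1_dist (S t (\<lambda>x. U0 + \<epsilon> *\<^sub>R U1 x)) (U_w lam r U0 \<sigma> \<epsilon> t)) / ennreal \<epsilon>)
           \<longlongrightarrow> 0) (at_right 0)"
proof -
 have "hyperbolic F lam l r {1..CARD('n)}" using assms(1,3-6) by unfold_locales auto
 then interpret hyperbolic F lam l r U0 "{1..CARD('n)}" .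
 obtain C where "hyperbolic_bounds F lam l r U0 {1..CARD('n)} C" using bounds_exist by blast
 then interpret hyperbolic_bounds F lam l r U0 "{1..CARD('n)}" C .
 note srs = assms(9)[unfolded standard_riemann_semigroup_def]
 note c3 = srs[THEN conjunct2, THEN conjunct2]
 note c4 = c3[THEN conjunct2]
 note c7 = c4[THEN conjunct2, THEN conjunct2, THEN conjunct2]
 obtain \<delta>0 where \<delta>0: "0 < \<delta>0" and small: "\<forall>u. integrable lborel (%x. u x - U0) & total_variation u < ennreal \<delta>0 --> u \<in> D"
  using c3[THEN conjunct1] by blast
 obtain L1 L2 where L: "0 <= L1" "0 <= L2" and lip: "\<forall>u\<in>D. \<forall>v\<in>D. \<forall>s\<ge>0. \<forall>t\<ge>0.
    L1_dist (S t u) (S s v) <= ennreal L1 * L1_dist u v + ennreal (L2 * \<bar>t - s\<bar>)" using c7[THEN conjunct1] by blast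
 obtain R where R: "standard_riemann_solver F lam r U0 R & (\<forall>u\<in>D. \<forall>N x v. piecewise_constant N x v u -->
    (\<forall>k\<in>{1..N}. \<exists>om. lax_solution F lam r (v (k - 1)) (v k) om (R (v (k - 1)) (v k))) &
    (\<exists>\<delta>>0. \<exists>d>0. (\<forall>k\<in>{1..<N}. x k + 2 * d <= x (Suc k)) &
    (\<forall>t\<in>{0<..\<delta>}. AE y in lborel.
    (\<forall>k\<in>{1..N}. \<bar>y - x k\<bar> < d -->
    S t u y = R (v (k - 1)) (v k) ((y - x k) / t)) &
    ((\<forall>k\<in>{1..N}. d <= \<bar>y - x k\<bar>) --> S t u y = u y))))" using c7[THEN conjunct2] by (rule exE)
 obtain \<rho> K Lam where \<rho>: "0 < \<rho>" "\<rho> <= 1" "0 <= K" "C + 1 <= Lam" and Rie: "!!um up. um \<in> ball U0 \<rho> ==> up \<in> ball U0 \<rho> ==>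
   (\<forall>\<xi>. \<xi> < - Lam --> R um up \<xi> = um) & (\<forall>\<xi>. Lam < \<xi> --> R um up \<xi> = up) &
   (\<forall>j\<in>{1..CARD('n)}. \<forall>c. \<bar>c\<bar> <= Lam --> L1_dominated (R um up) (%\<xi>. if \<xi> < c then um else up) (K * wave_error j c um up))"
  using riemann_error[OF R[THEN conjunct1]] by (elim exE conjE) blast
 interpret riemann_semigroup F lam l r U0 "{1..CARD('n)}" C D S R L1 L2 \<delta>0 \<rho> K Lam
 proof unfold_locales
  show "L1_dist (S t u) (S s v) <= ennreal L1 * L1_dist u v + ennreal (L2 * \<bar>t - s\<bar>)"
   if "u \<in> D" "v \<in> D" "0 <= s" "0 <= t" for u v s t using lip that by simp
  show "\<exists>\<delta>>0. \<exists>d>0. (\<forall>k\<in>{1..<N}. x k + 2 * d <= x (Suc k)) &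
    (\<forall>t\<in>{0<..\<delta>}. AE y in lborel.
    (\<forall>k\<in>{1..N}. \<bar>y - x k\<bar> < d --> S t u y = R (v (k - 1)) (v k) ((y - x k) / t)) &
    ((\<forall>k\<in>{1..N}. d <= \<bar>y - x k\<bar>) --> S t u y = u y))"
   if "u \<in> D" "piecewise_constant N x v u" for u N x v
   by (rule R[THEN conjunct2, THEN bspec, OF that(1), THEN spec, THEN spec, THEN spec, THEN mp, OF that(2), THEN conjunct2])
  show "integrable lborel (%x. u x - U0)" if "u \<in> D" for u using srs[THEN conjunct1] that by simp
  show "S t u \<in> D" if "u \<in> D" "0 <= t" for u t using c4[THEN conjunct1] that by simp
  show "AE x in lborel. S 0 u x = u x" if "u \<in> D" for u using c4[THEN conjunct2, THEN conjunct1] that by simp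
  show "AE x in lborel. S t (S s u) x = S (t + s) u x" if "u \<in> D" "0 <= s" "0 <= t" for u s t
   using c4[THEN conjunct2, THEN conjunct2, THEN conjunct1] that by simp
  show "L1_dominated (R um up) (%\<xi>. if \<xi> < c then um else up) (K * wave_error j c um up)"
   if "um \<in> ball U0 \<rho>" "up \<in> ball U0 \<rho>" "j \<in> {1..CARD('n)}" "\<bar>c\<bar> <= Lam" for um up j c using Rie[OF that(1,2)] that(3,4) by blast
 qed (use \<delta>0 small L \<rho> in \<open>simp_all add: Rie del: atLeastAtMost_iff\<close>)
 show ?thesis by (rule weakly_nonlinear_limit) (use assms in auto)
qed

end
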